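(* Let $N\geq 3$, $q>2N$ and $m \in [1,2_*]$, where $2_*:=\frac{2N}{N+2}$. There exists a constant $c=c(N,q,m)>0$ such that if $\rho\in L^q(\mathbb{R}^N)\cap L^{m}(\mathbb{R}^N)$ satisfies $|\rho|_{q}+|\rho|_{m} \leq c$, then the minimizer $u_\rho$ is a weak solution of $$-\operatorname{div}\left(\frac{\nabla u}{\sqrt{1-|\nabla u|^2}}\right)= \rho \ \text{ in }\mathbb{R}^N,\qquad \lim_{|x|\to\infty}u(x)=0,$$ it is strictly spacelike (i.e. $|\nabla u_\rho|<1$ in $\mathbb{R}^N$) and $u_\rho \in C^{1,\alpha}_{\rm loc}(\mathbb{R}^N)$ for some $\alpha \in (0,1)$.
   Context: Let $N\geq 3$ and let $\mathcal{X}=D^{1,2}(\mathbb{R}^N)\cap \{u\in C^{0,1}(\mathbb{R}^N):\ |\nabla u|_\infty \le 1\}$ with norm $\|u\|_{\mathcal{X}}=(\int_{\mathbb{R}^N}|\nabla u|^2dx)^{1/2}$, where $D^{1,2}(\mathbb{R}^N)$ is the completion of $C_c^\infty(\mathbb{R}^N)$ for this norm. For $\rho$ in the dual $\mathcal{X}^*$ (with duality pairing $\langle\cdot,\cdot\rangle$), the Born-Infeld energy is $I_\rho(u)=\int_{\mathbb{R}^N}(1-\sqrt{1-|\nabla u|^2})\,dx-\int_{\mathbb{R}^N}\rho u\,dx$ on $\mathcal{X}$, and $u_\rho$ denotes its unique minimizer in $\mathcal{X}$. $|\cdot|_r$ is the standard $L^r(\mathbb{R}^N)$ norm. A function $u_\rho\in\mathcal{X}$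 is a weak solution of the equation if $\int_{\mathbb{R}^N}\frac{\nabla u_\rho\cdot\nabla\psi}{\sqrt{1-|\nabla u_\rho|^2}}dx=\langle\rho,\psi\rangle$ for all $\psi\in\mathcal{X}$. A function $u$ is strictly spacelike if $|u(x)-u(y)|<|x-y|$ for $x\neq y$, $u\in C^1$ and $|\nabla u|<1$. *)

theory Defs
  imports "HOL-Analysis.Analysis"
begin

definition grad :: "('a::euclidean_space \<Rightarrow> real) \<Rightarrow> 'a \<Rightarrow> 'a" where
  "grad u x = (if u differentiable (at x)
               then (\<Sum>i\<in>Basis. frechet_derivative u (at x) i *\<^sub>R i) else 0)"

fun Ck :: "nat \<Rightarrow> ('a::euclidean_space \<Rightarrow> real) \<Rightarrow> bool" where
  "Ck 0 f = continuous_on UNIV f"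
| "Ck (Suc k) f = (continuous_on UNIV f \<and> (\<forall>x. f differentiable (at x)) \<and>
      (\<forall>i\<in>Basis. Ck k (\<lambda>x. frechet_derivative f (at x) i)))"

definition smooth_Cc :: "('a::euclidean_space \<Rightarrow> real) \<Rightarrow> bool" where
  "smooth_Cc f = ((\<forall>k. Ck k f) \<and> compact (closure {x. f x \<noteq> 0}))"

definition in_Lp :: "real \<Rightarrow> ('a::euclidean_space \<Rightarrow> real) \<Rightarrow> bool" where
  "in_Lp r f = (f \<in> borel_measurable lebesgue \<and> integrable lebesgue (\<lambda>x. \<bar>f x\<bar> powr r))"

definition Lnorm :: "real \<Rightarrow> ('a::euclidean_space \<Rightarrow> real) \<Rightarrow> real" where
  "Lnorm r f = (\<integral>x. \<bar>f x\<bar> powr r \<partial>lebesgue) powr (1 / r)"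

definition two_star :: "nat \<Rightarrow> real" where "two_star N = 2 * N / (N - 2)"
definition two_lstar :: "nat \<Rightarrow> real" where "two_lstar N = 2 * N / (N + 2)"

text \<open>D^{1,2}: completion of C_c^\<infinity> in the norm |\<nabla>u|_2, realised (via Sobolev)
  as functions in L^{2^*} that are limits of C_c^\<infinity> functions in L^{2^*}
  whose gradients converge in L^2 to the (a.e.) gradient of u.\<close>
definition D12 :: "('a::euclidean_space \<Rightarrow> real) set" where
  "D12 = {u. in_Lp (two_star DIM('a)) u \<and>
     (grad u) \<in> borel_measurable lebesgue \<and>
     integrable lebesgue (\<lambda>x. (norm (grad u x))\<^sup>2) \<and>
     (\<exists>\<phi>::nat \<Rightarrow> 'a \<Rightarrow> real. (\<forall>k. smooth_Cc (\<phi> k)) \<and>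
        (\<forall>k. integrable lebesgue (\<lambda>x. \<bar>\<phi> k x - u x\<bar> powr two_star DIM('a))) \<and>
        (\<forall>k. integrable lebesgue (\<lambda>x. (norm (grad (\<phi> k) x - grad u x))\<^sup>2)) \<and>
        (\<lambda>k. \<integral>x. \<bar>\<phi> k x - u x\<bar> powr two_star DIM('a) \<partial>lebesgue) \<longlonglongrightarrow> 0 \<and>
        (\<lambda>k. \<integral>x. (norm (grad (\<phi> k) x - grad u x))\<^sup>2 \<partial>lebesgue) \<longlonglongrightarrow> 0)}"

definition Xsp :: "('a::euclidean_space \<Rightarrow> real) set" where
  "Xsp = {u. u \<in> D12 \<and> (\<exists>L. L-lipschitz_on UNIV u) \<and>
             (AE x in lebesgue. norm (grad u x) \<le> 1)}"

definition BI_energy :: "('a::euclidean_space \<Rightarrow> real) \<Rightarrow> ('a \<Rightarrow> real) \<Rightarrow> real" where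
  "BI_energy \<rho> u = (\<integral>x. 1 - sqrt (1 - (norm (grad u x))\<^sup>2) \<partial>lebesgue)
                    - (\<integral>x. \<rho> x * u x \<partial>lebesgue)"

definition is_minimizer :: "('a::euclidean_space \<Rightarrow> real) \<Rightarrow> ('a \<Rightarrow> real) \<Rightarrow> bool" where
  "is_minimizer \<rho> u = (u \<in> Xsp \<and> (\<forall>v\<in>Xsp. BI_energy \<rho> u \<le> BI_energy \<rho> v))"

definition weak_solution :: "('a::euclidean_space \<Rightarrow> real) \<Rightarrow> ('a \<Rightarrow> real) \<Rightarrow> bool" where
  "weak_solution \<rho> u = (u \<in> Xsp \<and> (\<forall>\<psi>\<in>Xsp.
      (\<integral>x. (grad u x \<bullet> grad \<psi> x) / sqrt (1 - (norm (grad u x))\<^sup>2) \<partial>lebesgue)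
      = (\<integral>x. \<rho> x * \<psi> x \<partial>lebesgue)))"

definition strictly_spacelike :: "('a::euclidean_space \<Rightarrow> real) \<Rightarrow> bool" where
  "strictly_spacelike u = ((\<forall>x y. x \<noteq> y \<longrightarrow> \<bar>u x - u y\<bar> < dist x y) \<and>
      Ck 1 u \<and> (\<forall>x. norm (grad u x) < 1))"

definition C1alpha_loc :: "real \<Rightarrow> ('a::euclidean_space \<Rightarrow> real) \<Rightarrow> bool" where
  "C1alpha_loc \<alpha> u = (Ck 1 u \<and> (\<forall>K. compact K \<longrightarrow>
      (\<exists>C. \<forall>x\<in>K. \<forall>y\<in>K. norm (grad u x - grad u y) \<le> C * dist x y powr \<alpha>)))"

end

(* For small data the equation is a perturbation of the Poisson equation, so no quasilinear regularity
   theory is needed. Writing p / sqrt(1 - |p|^2) = p + excess p, where excess is cubic at 0, one solves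
   -div G' = \<rho> + div (excess G) for a gradient field G' and iterates. Minimizing a quadratic functional over
   test functions shows that G |-> G' contracts in L^2 on small fields. The iteration also preserves a small
   Hoelder ball: if \<eta> is a radial bump with dilates \<eta>_s, then d/ds \<eta>_s is the Laplacian of a compactly
   supported function, so the equation turns d/ds (\<eta>_s * G') into a convolution of \<rho> and of the oscillation
   of excess G with compactly supported kernels, of size s^(\<alpha>-1) with \<alpha> = 1 - N/q. Integrating
   in s replaces Calderon-Zygmund theory. The fixed point is the gradient of a weak solution with |G| <= 1/2, and
   strict convexity of the energy identifies this solution with the minimizer. The Sobolev inequality, needed to
   have potentials in L^{2*}, comes from truncation at dyadic levels and \<parallel>\<eta>_s * u - u\<parallel>_2 <= s \<parallel>\<nabla>u\<parallel>_2. *)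
theory Submission
  imports Defs
begin

section \<open>Gradients, compactly supported functions and Lebesgue spaces\<close>

text \<open>Smallness enters through two norms at once. A field in the iteration is bounded by R
  both in the Hoelder seminorm and in L^2; together these bound its supremum by a multiple r of R,
  and on the ball of radius r \<le> 1/2 the excess, being cubic, has Lipschitz constant 3 r^2. For
  small R this beats the constant of the linear Hoelder estimate, which depends on N and q only. The
  exponent 1 - N/q is the one at which a datum in L^q and a Hoelder field contribute the same power
  of the scale.

  The obstacle is that no complete space of potentials is at hand: the linear problem is solved by
  near-minimizers that are test functions, with a residual of size 1/(k+1) in the dual norm. All
  estimates are proved for them, up to errors that vanish with k. At a fixed scale, L^2 convergence
  of gradients is pointwise convergence of their mollifications; letting the scale tend to 0
  afterwards yields a continuous representative rather than a class of functions.

  The datum acts on D^{1,2} because L^m and L^q interpolate to L^{2_*}, whose dual is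
  L^{2^*}.\<close>

lemma grad_has_derivative:
  fixes f :: "'a::euclidean_space \<Rightarrow> real"
  assumes "f differentiable (at x)"
  shows "(f has_derivative (\<lambda>h. grad f x \<bullet> h)) (at x)"
proof -
  have D: "(f has_derivative frechet_derivative f (at x)) (at x)"
    using assms frechet_derivative_works by blast
  then interpret bounded_linear "frechet_derivative f (at x)"
    by (rule has_derivative_bounded_linear)
  have "frechet_derivative f (at x) h = grad f x \<bullet> h" for h
  proof -
    have "frechet_derivative f (at x) h = frechet_derivative f (at x) (\<Sum>i\<in>Basis. (h \<bullet> i) *\<^sub>R i)"
      by (simp add: euclidean_representation)
    also have "\<dots> = (\<Sum>i\<in>Basis. (h \<bullet> i) * frechet_derivative f (at x) i)"
      by (simp add: sum scaleR)
    also have "\<dots> = grad f x \<bullet> h"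
      using assms by (simp add: grad_def inner_sum_left mult.commute) (simp add: inner_commute)
    finally show ?thesis .
  qed
  then have "frechet_derivative f (at x) = (\<lambda>h. grad f x \<bullet> h)" by auto
  with D show ?thesis by simp
qed

lemma grad_unique:
  fixes f :: "'a::euclidean_space \<Rightarrow> real"
  assumes "(f has_derivative (\<lambda>h. g \<bullet> h)) (at x)"
  shows "grad f x = g"
proof -
  have "f differentiable (at x)" using assms differentiable_def by blast
  then have "(\<lambda>h. grad f x \<bullet> h) = (\<lambda>h. g \<bullet> h)"
    using has_derivative_unique[OF grad_has_derivative assms] by blast
  then have "(grad f x - g) \<bullet> (grad f x - g) = 0"
    by (metis inner_diff_left right_minus_eq)
  then show ?thesis by simp
qed

lemma grad_inner_Basis:
  fixes f :: "'a::euclidean_space \<Rightarrow> real"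
  assumes "f differentiable (at x)"
  shows "grad f x \<bullet> i = frechet_derivative f (at x) i"
  using fun_cong[OF frechet_derivative_at[OF grad_has_derivative[OF assms]], of i] .

text \<open>Compact support is expressed as vanishing outside some ball, and the codomain is any
  normed space, so that functions and their gradients fall under the same closure rules.\<close>

definition Cc :: "('a::euclidean_space \<Rightarrow> 'b::real_normed_vector) \<Rightarrow> bool" where
  "Cc f \<longleftrightarrow> continuous_on UNIV f \<and> (\<exists>R. \<forall>x. R < norm x \<longrightarrow> f x = 0)"

text \<open>\<open>grad\<close> is 0 by convention wherever f is not differentiable, so continuity
  of \<open>grad f\<close> alone would not express that f is of class C^1.\<close>

definition C1c :: "('a::euclidean_space \<Rightarrow> real) \<Rightarrow> bool" where
  "C1c f \<longleftrightarrow> (\<forall>x. f differentiable (at x)) \<and> continuous_on UNIV (grad f) \<and>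
     (\<exists>R. \<forall>x. R < norm x \<longrightarrow> f x = 0)"

lemma C1c_deriv: "C1c f \<Longrightarrow> (f has_derivative (\<lambda>h. grad f x \<bullet> h)) (at x)"
  by (simp add: C1c_def grad_has_derivative)

lemma grad_eq_0_outside:
  fixes f :: "'a::euclidean_space \<Rightarrow> real"
  assumes "\<And>x. R < norm x \<Longrightarrow> f x = 0" "R < norm x"
  shows "grad f x = 0"
proof -
  have "((\<lambda>x. 0) has_derivative (\<lambda>h. 0)) (at x)" by simp
  then have "(f has_derivative (\<lambda>h. 0)) (at x)"
  proof (rule has_derivative_transform_within_open[where s="{x. R < norm x}"])
    show "open {x::'a. R < norm x}"
      by (intro open_Collect_less continuous_intros)
  qed (use assms in auto)
  then show ?thesis using grad_unique[of f 0 x] by simp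
qed

lemma Cc_grad: assumes "C1c f" shows "Cc (grad f)"
proof -
  obtain R where "\<forall>x. R < norm x \<longrightarrow> f x = 0" using assms C1c_def by blast
  then have "\<forall>x. R < norm x \<longrightarrow> grad f x = 0" using grad_eq_0_outside by blast
  then show ?thesis using assms by (auto simp: Cc_def C1c_def)
qed

lemma C1c_Cc: assumes "C1c f" shows "Cc f"
proof -
  have "continuous_on UNIV f"
    using assms by (intro continuous_at_imp_continuous_on ballI differentiable_imp_continuous_within)
      (auto simp: C1c_def)
  then show ?thesis using assms by (auto simp: C1c_def Cc_def)
qed

lemma Cc_cont: "Cc f \<Longrightarrow> continuous_on UNIV f" by (simp add: Cc_def)

lemma Cc_mult_left:
  fixes f :: "'a::euclidean_space \<Rightarrow> real" and g :: "'a \<Rightarrow> 'b::real_normed_vector"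
  assumes "Cc f" "continuous_on UNIV g" shows "Cc (\<lambda>x. f x *\<^sub>R g x)"
proof -
  obtain R where "\<forall>x. R < norm x \<longrightarrow> f x = 0" using assms Cc_def by metis
  then have "\<forall>x. R < norm x \<longrightarrow> f x *\<^sub>R g x = 0" by simp
  moreover have "continuous_on UNIV (\<lambda>x. f x *\<^sub>R g x)"
    by (intro continuous_intros Cc_cont[OF assms(1)] assms(2))
  ultimately show ?thesis unfolding Cc_def by blast
qed

lemma Cc_times:
  fixes f :: "'a::euclidean_space \<Rightarrow> real"
  assumes "Cc f" "continuous_on UNIV g" shows "Cc (\<lambda>x. f x * g x)"
  using Cc_mult_left[OF assms] by simp

lemma Cc_times2:
  fixes f :: "'a::euclidean_space \<Rightarrow> real"
  assumes "Cc f" "continuous_on UNIV g" shows "Cc (\<lambda>x. g x * f x)"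
  using Cc_times[OF assms] by (simp add: mult.commute)

lemma Cc_inner:
  fixes f :: "'a::euclidean_space \<Rightarrow> 'b::real_inner"
  assumes "Cc f" "continuous_on UNIV g" shows "Cc (\<lambda>x. f x \<bullet> g x)"
proof -
  obtain R where "\<forall>x. R < norm x \<longrightarrow> f x = 0" using assms Cc_def by metis
  then have "\<forall>x. R < norm x \<longrightarrow> f x \<bullet> g x = 0" by simp
  moreover have "continuous_on UNIV (\<lambda>x. f x \<bullet> g x)"
    by (intro continuous_intros Cc_cont[OF assms(1)] assms(2))
  ultimately show ?thesis unfolding Cc_def by blast
qed

lemma Cc_comp:
  assumes "Cc f" "continuous_on UNIV h" "h 0 = 0" shows "Cc (\<lambda>x. h (f x))"
proof -
  obtain R where "\<forall>x. R < norm x \<longrightarrow> f x = 0" using assms Cc_def by metis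
  then have "\<forall>x. R < norm x \<longrightarrow> h (f x) = 0" using assms(3) by simp
  moreover have "continuous_on UNIV (\<lambda>x. h (f x))"
    by (rule continuous_on_compose2[OF assms(2) Cc_cont[OF assms(1)]]) simp
  ultimately show ?thesis by (auto simp: Cc_def)
qed

lemma Cc_add: assumes "Cc f" "Cc g" shows "Cc (\<lambda>x. f x + g x)"
proof -
  obtain R S where "\<forall>x. R < norm x \<longrightarrow> f x = 0" "\<forall>x. S < norm x \<longrightarrow> g x = 0"
    using assms Cc_def by metis
  then have "\<forall>x. max R S < norm x \<longrightarrow> f x + g x = 0" by auto
  moreover have "continuous_on UNIV (\<lambda>x. f x + g x)"
    using assms by (intro continuous_intros Cc_cont)
  ultimately show ?thesis unfolding Cc_def by blast
qed

lemma Cc_scaleR: "Cc f \<Longrightarrow> Cc (\<lambda>x. c *\<^sub>R f x)"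
  unfolding Cc_def by (auto intro!: continuous_intros)

lemma Cc_cmult: fixes f :: "'a::euclidean_space \<Rightarrow> real" shows "Cc f \<Longrightarrow> Cc (\<lambda>x. c * f x)"
  using Cc_scaleR[of f c] by simp

lemma Cc_diff: assumes "Cc f" "Cc g" shows "Cc (\<lambda>x. f x - g x)"
  using Cc_add[OF assms(1) Cc_scaleR[OF assms(2), of "-1"]] by simp

lemma Cc_powr:
  fixes f :: "'a::euclidean_space \<Rightarrow> 'b::real_normed_vector"
  assumes "Cc f" "p > 0" shows "Cc (\<lambda>x. norm (f x) powr p)"
proof -
  have "continuous_on UNIV (\<lambda>y::'b. norm y powr p)"
    using assms(2) by (intro continuous_on_powr' continuous_intros) auto
  from Cc_comp[OF assms(1) this] show ?thesis by simp
qed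

lemma Cc_norm_power2:
  fixes f :: "'a::euclidean_space \<Rightarrow> 'b::real_normed_vector"
  assumes "Cc f" shows "Cc (\<lambda>x. (norm (f x))\<^sup>2)"
  using Cc_comp[OF assms, of "\<lambda>y. (norm y)\<^sup>2"] by (auto intro!: continuous_intros)

lemma Cc_translate: assumes "Cc f" shows "Cc (\<lambda>x. f (x + a))"
proof -
  obtain R where R: "\<forall>x. R < norm x \<longrightarrow> f x = 0" using assms Cc_def by metis
  have "f (x + a) = 0" if "R + norm a < norm x" for x
    using R that norm_triangle_ineq[of "x + a" "-a"] by (auto simp: algebra_simps)
  then have "\<forall>x. R + norm a < norm x \<longrightarrow> f (x + a) = 0" by blast
  moreover have "continuous_on UNIV (\<lambda>x. f (x + a))"
    by (rule continuous_on_compose2[OF Cc_cont[OF assms], of UNIV "\<lambda>x. x + a"]) (auto intro!: continuous_intros)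
  ultimately show ?thesis unfolding Cc_def by blast
qed

lemma Cc_bounded:
  fixes f :: "'a::euclidean_space \<Rightarrow> 'b::real_normed_vector"
  assumes "Cc f" obtains B where "B > 0" "\<And>x. norm (f x) \<le> B"
proof -
  obtain R where R: "\<forall>x. R < norm x \<longrightarrow> f x = 0" using assms Cc_def by metis
  have "compact (f ` cball 0 R)"
    using assms by (intro compact_continuous_image) (auto simp: Cc_def intro: continuous_on_subset)
  then obtain B where B: "\<forall>x\<in>cball 0 R. norm (f x) \<le> B"
    using bounded_iff[of "f ` cball 0 R"] compact_imp_bounded by auto
  have "norm (f x) \<le> max B 1" for x
    using R B by (cases "norm x \<le> R") (auto simp: max.coboundedI1)
  then show ?thesis by (intro that[of "max B 1"]) auto
qed

section \<open>Integrals of continuous functions and affine substitutions\<close>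

lemma borel_cont: "continuous_on UNIV f \<Longrightarrow> f \<in> borel_measurable borel"
  by (rule borel_measurable_continuous_onI)

lemma lebesgue_cont:
  fixes f :: "'a::euclidean_space \<Rightarrow> 'b::topological_space"
  assumes "continuous_on UNIV f" shows "f \<in> borel_measurable lebesgue"
proof -
  have "f \<in> borel_measurable lborel" using borel_cont[OF assms] by simp
  then show ?thesis by (rule measurable_completion)
qed

lemma Cc_integrable_lborel:
  fixes f :: "'a::euclidean_space \<Rightarrow> 'b::{banach, second_countable_topology}"
  assumes "Cc f" shows "integrable lborel f"
proof -
  obtain R where R: "\<forall>x. R < norm x \<longrightarrow> f x = 0" using assms Cc_def by metis
  have "integrable lborel (\<lambda>x. indicator (cball 0 R) x *\<^sub>R f x)"
    using assms by (intro borel_integrable_compact) (auto simp: Cc_def intro: continuous_on_subset)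
  moreover have "(\<lambda>x. indicator (cball 0 R) x *\<^sub>R f x) = f"
    using R by (auto simp: indicator_def fun_eq_iff)
  ultimately show ?thesis by simp
qed

lemma integral_lebesgue_cont:
  fixes f :: "'a::euclidean_space \<Rightarrow> 'b::{banach, second_countable_topology}"
  assumes "continuous_on UNIV f" shows "integral\<^sup>L lebesgue f = integral\<^sup>L lborel f"
  using borel_cont[OF assms] by (intro integral_completion) simp

lemma Cc_integrable:
  fixes f :: "'a::euclidean_space \<Rightarrow> 'b::{banach, second_countable_topology}"
  assumes "Cc f" shows "integrable lebesgue f"
  using integrable_completion[of f lborel] Cc_integrable_lborel[OF assms] borel_cont[OF Cc_cont[OF assms]]
  by simp

text \<open>The substitution is carried out in \<open>lborel\<close>; continuity gives Borel
  measurability, so passing to the completion changes neither integral.\<close>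

lemma integral_affine:
  fixes f :: "'a::euclidean_space \<Rightarrow> real"
  assumes "continuous_on UNIV f" "c \<noteq> 0"
  shows "(\<integral>x. f x \<partial>lebesgue) = \<bar>c\<bar> ^ DIM('a) * (\<integral>x. f (t + c *\<^sub>R x) \<partial>lebesgue)"
proof -
  have m: "f \<in> borel_measurable borel" using assms borel_cont by blast
  have "(\<integral>x. f x \<partial>lborel) = (\<integral>x. \<bar>c\<bar> ^ DIM('a) * f x \<partial>(distr lborel borel (\<lambda>x. t + c *\<^sub>R x)))"
    by (subst lborel_affine[OF assms(2), of t], subst integral_density) (use m in auto)
  also have "\<dots> = \<bar>c\<bar> ^ DIM('a) * (\<integral>x. f (t + c *\<^sub>R x) \<partial>lborel)"
    by (subst integral_distr) (use m in auto)
  moreover have "continuous_on UNIV (\<lambda>x. f (t + c *\<^sub>R x))"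
    by (rule continuous_on_compose2[OF assms(1), of UNIV "\<lambda>x. t + c *\<^sub>R x"]) (auto intro!: continuous_intros)
  ultimately show ?thesis
    using assms by (simp add: integral_lebesgue_cont)
qed

lemma integral_translate:
  fixes f :: "'a::euclidean_space \<Rightarrow> real"
  assumes "continuous_on UNIV f"
  shows "(\<integral>x. f (x + a) \<partial>lebesgue) = (\<integral>x. f x \<partial>lebesgue)"
  using integral_affine[OF assms, of 1 a] by (simp add: add.commute)

lemma integral_reflect:
  fixes f :: "'a::euclidean_space \<Rightarrow> real"
  assumes "continuous_on UNIV f"
  shows "(\<integral>x. f (a - x) \<partial>lebesgue) = (\<integral>x. f x \<partial>lebesgue)"
  using integral_affine[OF assms, of "-1" a] by simp

section \<open>Hoelder's inequality and the space L^2\<close>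

lemma holder_ineq:
  fixes f g :: "'b \<Rightarrow> real"
  assumes pq: "p > 1" "q > 1" "1/p + 1/q = 1"
    and m: "f \<in> borel_measurable M" "g \<in> borel_measurable M"
    and i: "integrable M (\<lambda>x. \<bar>f x\<bar> powr p)" "integrable M (\<lambda>x. \<bar>g x\<bar> powr q)"
  shows "integrable M (\<lambda>x. f x * g x)"
    and "(\<integral>x. \<bar>f x * g x\<bar> \<partial>M) \<le> (\<integral>x. \<bar>f x\<bar> powr p \<partial>M) powr (1/p) * (\<integral>x. \<bar>g x\<bar> powr q \<partial>M) powr (1/q)"
proof -
  note [measurable] = m
  have Y: "\<bar>f x * g x\<bar> \<le> \<bar>f x\<bar> powr p / p + \<bar>g x\<bar> powr q / q" for x
    using Youngs_inequality[OF pq, of "\<bar>f x\<bar>" "\<bar>g x\<bar>"] by (simp add: abs_mult)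
  show I: "integrable M (\<lambda>x. f x * g x)"
    by (rule Bochner_Integration.integrable_bound[of M "\<lambda>x. \<bar>f x\<bar> powr p / p + \<bar>g x\<bar> powr q / q"])
      (use i Y in \<open>auto intro!: AE_I2 order_trans[OF Y abs_ge_self]\<close>)
  define A B where "A = (\<integral>x. \<bar>f x\<bar> powr p \<partial>M)" and "B = (\<integral>x. \<bar>g x\<bar> powr q \<partial>M)"
  have AB: "A \<ge> 0" "B \<ge> 0" unfolding A_def B_def by (auto intro!: integral_nonneg_AE)
  have "(\<integral>x. \<bar>f x * g x\<bar> \<partial>M) \<le> A powr (1/p) * B powr (1/q)"
  \<comment> \<open>If one of the integrals vanishes, the product is 0 almost everywhere; otherwise
    Young's inequality is applied to the functions normalised by a and b.\<close>
  proof (cases "A = 0 \<or> B = 0")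
    case True
    then have "AE x in M. f x * g x = 0"
    proof
      assume "A = 0"
      then have "AE x in M. \<bar>f x\<bar> powr p = 0"
        unfolding A_def using integral_nonneg_eq_0_iff_AE[OF i(1)] by auto
      then show ?thesis by eventually_elim auto
    next
      assume "B = 0"
      then have "AE x in M. \<bar>g x\<bar> powr q = 0"
        unfolding B_def using integral_nonneg_eq_0_iff_AE[OF i(2)] by auto
      then show ?thesis by eventually_elim auto
    qed
    then have "(\<integral>x. \<bar>f x * g x\<bar> \<partial>M) = 0"
      by (intro integral_eq_zero_AE) auto
    then show ?thesis by simp
  next
    case False
    define a b where "a = A powr (1/p)" and "b = B powr (1/q)"
    have ab: "a > 0" "b > 0" "a powr p = A" "b powr q = B"
      using False AB pq by (auto simp: a_def b_def powr_powr)
    have "\<bar>f x * g x\<bar> \<le> a * b * (\<bar>f x\<bar> powr p / A / p + \<bar>g x\<bar> powr q / B / q)" for x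
    proof -
      have "\<bar>f x\<bar> / a * (\<bar>g x\<bar> / b) \<le> (\<bar>f x\<bar> / a) powr p / p + (\<bar>g x\<bar> / b) powr q / q"
        using ab by (intro Youngs_inequality pq) auto
      then show ?thesis using ab by (simp add: powr_divide field_simps abs_mult)
    qed
    then have "(\<integral>x. \<bar>f x * g x\<bar> \<partial>M) \<le> (\<integral>x. a * b * (\<bar>f x\<bar> powr p / A / p + \<bar>g x\<bar> powr q / B / q) \<partial>M)"
      using I i by (intro integral_mono) auto
    also have "\<dots> = a * b * (A / A / p + B / B / q)"
      using i by (simp add: A_def B_def)
    also have "\<dots> = a * b" using False pq by simp
    finally show ?thesis by (simp add: a_def b_def)
  qed
  then show "(\<integral>x. \<bar>f x * g x\<bar> \<partial>M) \<le> (\<integral>x. \<bar>f x\<bar> powr p \<partial>M) powr (1/p) * (\<integral>x. \<bar>g x\<bar> powr q \<partial>M) powr (1/q)"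
    by (simp add: A_def B_def)
qed

definition L2 :: "('a::euclidean_space \<Rightarrow> 'b::euclidean_space) \<Rightarrow> bool" where
  "L2 F \<longleftrightarrow> F \<in> borel_measurable lebesgue \<and> integrable lebesgue (\<lambda>x. (norm (F x))\<^sup>2)"

definition n2 :: "('a::euclidean_space \<Rightarrow> 'b::euclidean_space) \<Rightarrow> real" where
  "n2 F = sqrt (\<integral>x. (norm (F x))\<^sup>2 \<partial>lebesgue)"

definition ip :: "('a::euclidean_space \<Rightarrow> 'b::euclidean_space) \<Rightarrow> ('a \<Rightarrow> 'b) \<Rightarrow> real" where
  "ip F G = (\<integral>x. F x \<bullet> G x \<partial>lebesgue)"

lemma L2_Cc: "Cc F \<Longrightarrow> L2 F"
  unfolding L2_def by (auto intro: lebesgue_cont Cc_cont Cc_integrable Cc_norm_power2)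

lemma n2_nonneg [simp]: "n2 F \<ge> 0"
  by (simp add: n2_def)

lemma n2_square: "(n2 F)\<^sup>2 = (\<integral>x. (norm (F x))\<^sup>2 \<partial>lebesgue)"
  by (simp add: n2_def)

lemma ip_self: "ip F F = (n2 F)\<^sup>2"
  by (simp add: n2_square ip_def power2_norm_eq_inner)

lemma ip_commute: "ip F G = ip G F"
  by (simp add: ip_def inner_commute)

lemma L2_integrable_norm_mult:
  assumes "L2 F" "L2 G"
  shows "integrable lebesgue (\<lambda>x. norm (F x) * norm (G x))"
proof (rule Bochner_Integration.integrable_bound)
  show "integrable lebesgue (\<lambda>x. (norm (F x))\<^sup>2 + (norm (G x))\<^sup>2)"
    using assms by (auto simp: L2_def)
  show "(\<lambda>x. norm (F x) * norm (G x)) \<in> borel_measurable lebesgue"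
    using assms by (auto simp: L2_def)
  show "AE x in lebesgue. norm (norm (F x) * norm (G x)) \<le> norm ((norm (F x))\<^sup>2 + (norm (G x))\<^sup>2)"
  proof (rule AE_I2)
    fix x
    have "2 * (norm (F x) * norm (G x)) \<le> (norm (F x))\<^sup>2 + (norm (G x))\<^sup>2"
      using sum_squares_bound[of "norm (F x)" "norm (G x)"] by simp
    moreover have "norm (F x) * norm (G x) \<ge> 0" by simp
    ultimately have "norm (F x) * norm (G x) \<le> (norm (F x))\<^sup>2 + (norm (G x))\<^sup>2" by linarith
    then show "norm (norm (F x) * norm (G x)) \<le> norm ((norm (F x))\<^sup>2 + (norm (G x))\<^sup>2)" by simp
  qed
qed

lemma L2_integrable_inner:
  assumes "L2 F" "L2 G"
  shows "integrable lebesgue (\<lambda>x. F x \<bullet> G x)"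
proof (rule Bochner_Integration.integrable_bound[OF L2_integrable_norm_mult[OF assms]])
  show "(\<lambda>x. F x \<bullet> G x) \<in> borel_measurable lebesgue"
    using assms by (auto simp: L2_def)
qed (auto simp: Cauchy_Schwarz_ineq2)

lemma L2_cauchy_schwarz_norm:
  assumes "L2 F" "L2 G"
  shows "(\<integral>x. norm (F x) * norm (G x) \<partial>lebesgue) \<le> n2 F * n2 G"
proof -
  have m: "(\<lambda>x. norm (F x)) \<in> borel_measurable lebesgue" "(\<lambda>x. norm (G x)) \<in> borel_measurable lebesgue"
    using assms by (auto simp: L2_def)
  show ?thesis
    using holder_ineq(2)[of 2 2 "\<lambda>x. norm (F x)" lebesgue "\<lambda>x. norm (G x)", OF _ _ _ m] assms
    by (simp add: L2_def n2_def powr_half_sqrt)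
qed

lemma ip_bound:
  assumes "L2 F" "L2 G" shows "\<bar>ip F G\<bar> \<le> n2 F * n2 G"
proof -
  have "\<bar>ip F G\<bar> \<le> (\<integral>x. \<bar>F x \<bullet> G x\<bar> \<partial>lebesgue)"
    unfolding ip_def by (rule integral_abs_bound)
  also have "\<dots> \<le> (\<integral>x. norm (F x) * norm (G x) \<partial>lebesgue)"
    using assms by (intro integral_mono L2_integrable_norm_mult integrable_abs L2_integrable_inner)
      (auto simp: Cauchy_Schwarz_ineq2)
  finally show ?thesis using L2_cauchy_schwarz_norm[OF assms] by simp
qed

lemma L2_scaleR: assumes "L2 F" shows "L2 (\<lambda>x. c *\<^sub>R F x)"
  using assms by (auto simp: L2_def power_mult_distrib)

lemma L2_add: assumes "L2 F" "L2 G" shows "L2 (\<lambda>x. F x + G x)"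
proof -
  have "(norm (F x + G x))\<^sup>2 = (norm (F x))\<^sup>2 + 2 * (F x \<bullet> G x) + (norm (G x))\<^sup>2" for x
    by (simp add: power2_norm_eq_inner inner_add inner_commute)
  then show ?thesis using assms L2_integrable_inner[OF assms] by (auto simp: L2_def)
qed

lemma L2_diff: assumes "L2 F" "L2 G" shows "L2 (\<lambda>x. F x - G x)"
  using L2_add[OF assms(1) L2_scaleR[OF assms(2), of "-1"]] by simp

lemma ip_add_left: "L2 F \<Longrightarrow> L2 G \<Longrightarrow> L2 H \<Longrightarrow> ip (\<lambda>x. F x + G x) H = ip F H + ip G H"
  by (simp add: ip_def inner_add_left L2_integrable_inner)

lemma ip_diff_left: "L2 F \<Longrightarrow> L2 G \<Longrightarrow> L2 H \<Longrightarrow> ip (\<lambda>x. F x - G x) H = ip F H - ip G H"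
  by (simp add: ip_def inner_diff_left L2_integrable_inner)

lemma ip_scaleR_left: "ip (\<lambda>x. c *\<^sub>R F x) H = c * ip F H"
  by (simp add: ip_def)

lemma n2_scaleR: "n2 (\<lambda>x. c *\<^sub>R F x) = \<bar>c\<bar> * n2 F"
  by (simp add: n2_def power_mult_distrib real_sqrt_mult)

lemma n2_triangle:
  assumes "L2 F" "L2 G" shows "n2 (\<lambda>x. F x + G x) \<le> n2 F + n2 G"
proof (rule power2_le_imp_le)
  have "(n2 (\<lambda>x. F x + G x))\<^sup>2 = (n2 F)\<^sup>2 + 2 * ip F G + (n2 G)\<^sup>2"
    using assms unfolding ip_self[symmetric]
    by (simp add: ip_add_left L2_add ip_commute[of F "\<lambda>x. F x + G x"] ip_commute[of G "\<lambda>x. F x + G x"]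
        ip_commute[of G F])
  also have "\<dots> \<le> (n2 F + n2 G)\<^sup>2"
    using ip_bound[OF assms] by (simp add: power2_sum)
  finally show "(n2 (\<lambda>x. F x + G x))\<^sup>2 \<le> (n2 F + n2 G)\<^sup>2" .
qed simp

lemma n2_diff_triangle:
  assumes "L2 F" "L2 G" "L2 H" shows "n2 (\<lambda>x. F x - H x) \<le> n2 (\<lambda>x. F x - G x) + n2 (\<lambda>x. G x - H x)"
  using n2_triangle[OF L2_diff[OF assms(1,2)] L2_diff[OF assms(2,3)]] by simp

lemma n2_commute: "n2 (\<lambda>x. F x - G x) = n2 (\<lambda>x. G x - F x)"
  by (simp add: n2_def norm_minus_commute)

lemma n2_mono:
  assumes "L2 F" "L2 G" "\<And>x. norm (F x) \<le> norm (G x)" shows "n2 F \<le> n2 G"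
  unfolding n2_def using assms by (auto simp: L2_def intro!: integral_mono power_mono)

text \<open>Fatou's lemma with a convergent majorant for the integrals. Integrability of the limit
  is part of the conclusion; this is how pointwise limits are placed in Lebesgue spaces later
  on.\<close>

lemma fatou_bound:
  fixes f :: "nat \<Rightarrow> 'b \<Rightarrow> real"
  assumes m: "\<And>n. integrable M (f n)" and nn: "\<And>n x. f n x \<ge> 0"
    and lim: "AE x in M. (\<lambda>n. f n x) \<longlonglongrightarrow> g x" and g: "g \<in> borel_measurable M"
    and b: "\<And>n. (\<integral>x. f n x \<partial>M) \<le> b n" "b \<longlonglongrightarrow> B"
  shows "integrable M g" "(\<integral>x. g x \<partial>M) \<le> B" "AE x in M. g x \<ge> 0"
proof -
  show g0: "AE x in M. g x \<ge> 0" using lim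
  proof eventually_elim
    case (elim x) then show ?case using nn by (intro LIMSEQ_le_const) auto
  qed
  have "AE x in M. ennreal (g x) = liminf (\<lambda>n. ennreal (f n x))" using lim
  proof eventually_elim
    case (elim x)
    then have "(\<lambda>n. ennreal (f n x)) \<longlonglongrightarrow> ennreal (g x)" by (intro tendsto_ennrealI)
    from lim_imp_Liminf[OF sequentially_bot this] show ?case by simp
  qed
  then have "(\<integral>\<^sup>+x. ennreal (g x) \<partial>M) = (\<integral>\<^sup>+x. liminf (\<lambda>n. ennreal (f n x)) \<partial>M)"
    by (rule nn_integral_cong_AE)
  also have "\<dots> \<le> liminf (\<lambda>n. \<integral>\<^sup>+x. ennreal (f n x) \<partial>M)"
    using m by (intro nn_integral_liminf) auto
  also have "(\<lambda>n. \<integral>\<^sup>+x. ennreal (f n x) \<partial>M) = (\<lambda>n. ennreal (\<integral>x. f n x \<partial>M))"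
    using m nn by (simp add: nn_integral_eq_integral)
  also have "liminf (\<lambda>n. ennreal (\<integral>x. f n x \<partial>M)) \<le> liminf (\<lambda>n. ennreal (b n))"
    using b by (intro Liminf_mono always_eventually) (auto intro: ennreal_leI)
  also have "\<dots> = ennreal B"
    by (rule lim_imp_Liminf[OF sequentially_bot tendsto_ennrealI[OF b(2)]])
  finally have le: "(\<integral>\<^sup>+x. ennreal (g x) \<partial>M) \<le> ennreal B" .
  then show I: "integrable M g"
    using g g0 by (intro integrableI_nonneg) (auto simp: less_top[symmetric] top_unique)
  have B: "B \<ge> 0"
  proof (rule LIMSEQ_le_const[OF b(2)], intro exI allI impI)
    fix n
    have "0 \<le> (\<integral>x. f n x \<partial>M)" using nn by (intro integral_nonneg_AE) auto
    then show "0 \<le> b n" using b(1)[of n] by linarith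
  qed
  show "(\<integral>x. g x \<partial>M) \<le> B"
    using le g0 I B by (simp add: nn_integral_eq_integral)
qed

section \<open>Integration by parts and translation estimates\<close>

text \<open>The mean value inequality turns the bound on the derivative into one on the difference
  quotients, and dominated convergence does the rest. The hypotheses are confined to an interval
  around s0, because dilated kernels degenerate as the scale tends to 0.\<close>

lemma deriv_under_integral:
  fixes f f' :: "real \<Rightarrow> 'b \<Rightarrow> real"
  assumes ab: "a < s0" "s0 < b"
    and i: "\<And>s. a < s \<Longrightarrow> s < b \<Longrightarrow> integrable M (f s)"
    and d: "\<And>s y. a < s \<Longrightarrow> s < b \<Longrightarrow> ((\<lambda>s. f s y) has_real_derivative f' s y) (at s)"
    and bd: "\<And>s y. a < s \<Longrightarrow> s < b \<Longrightarrow> \<bar>f' s y\<bar> \<le> w y"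
    and w: "integrable M w"
  shows "((\<lambda>s. \<integral>y. f s y \<partial>M) has_real_derivative (\<integral>y. f' s0 y \<partial>M)) (at s0)"
proof -
  have lip: "\<bar>(f s y - f s0 y) / (s - s0)\<bar> \<le> w y" if "a < s" "s < b" "s \<noteq> s0" for s y
  proof -
    have "norm (f s y - f s0 y) \<le> w y * norm (s - s0)"
    proof (rule field_differentiable_bound[where S="{a<..<b}" and f'="\<lambda>s. f' s y"])
      show "((\<lambda>s. f s y) has_field_derivative f' z y) (at z within {a<..<b})" if "z \<in> {a<..<b}" for z
        using has_field_derivative_at_within[OF d] that by auto
      show "norm (f' z y) \<le> w y" if "z \<in> {a<..<b}" for z
        using that bd by auto
      show "convex {a<..<b}" "s \<in> {a<..<b}" "s0 \<in> {a<..<b}" using that ab \<open>a < s\<close> \<open>s < b\<close> by auto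
    qed
    then show ?thesis using that by (simp add: abs_divide divide_le_eq)
  qed
  have "((\<lambda>s. ((\<integral>y. f s y \<partial>M) - (\<integral>y. f s0 y \<partial>M)) / (s - s0)) \<longlongrightarrow> (\<integral>y. f' s0 y \<partial>M)) (at s0)"
    unfolding tendsto_at_iff_sequentially comp_def
  proof (intro allI impI)
    fix X :: "nat \<Rightarrow> real" assume X: "\<forall>i. X i \<in> UNIV - {s0}" "X \<longlonglongrightarrow> s0"
    have "\<forall>\<^sub>F n in sequentially. X n \<in> {a<..<b}"
      using X(2) ab by (intro topological_tendstoD[OF X(2)]) auto
    then obtain N where N: "\<And>n. n \<ge> N \<Longrightarrow> a < X n \<and> X n < b"
      unfolding eventually_sequentially by auto
    \<comment> \<open>Dropping the first N terms places the whole sequence inside the interval,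
      where the bounds are available.\<close>
    define Y where "Y n = X (n + N)" for n
    have Y: "a < Y n" "Y n < b" "Y n \<noteq> s0" for n using N X by (auto simp: Y_def)
    have YL: "Y \<longlonglongrightarrow> s0" unfolding Y_def using X(2) by (rule LIMSEQ_ignore_initial_segment)
    have lim: "(\<lambda>n. (f (Y n) y - f s0 y) / (Y n - s0)) \<longlonglongrightarrow> f' s0 y" for y
    proof -
      have "((\<lambda>s. (f s y - f s0 y) / (s - s0)) \<longlongrightarrow> f' s0 y) (at s0)"
        using d[OF ab] by (simp add: has_field_derivative_iff)
      then show ?thesis using YL Y(3) unfolding tendsto_at_iff_sequentially comp_def by auto
    qed
    have m: "(\<lambda>y. (f (Y n) y - f s0 y) / (Y n - s0)) \<in> borel_measurable M" for n
      using i[OF Y(1,2)] i[OF ab] by (intro borel_measurable_divide borel_measurable_diff) auto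
    have "f' s0 \<in> borel_measurable M"
      by (rule borel_measurable_LIMSEQ_real[OF _ m]) (rule lim)
    then have "(\<lambda>n. \<integral>y. (f (Y n) y - f s0 y) / (Y n - s0) \<partial>M) \<longlonglongrightarrow> (\<integral>y. f' s0 y \<partial>M)"
      using m w lim lip Y by (intro integral_dominated_convergence[where w=w]) auto
    moreover have "(\<integral>y. (f (Y n) y - f s0 y) / (Y n - s0) \<partial>M)
        = ((\<integral>y. f (Y n) y \<partial>M) - (\<integral>y. f s0 y \<partial>M)) / (Y n - s0)" for n
      using i[OF Y(1,2)] i[OF ab] by simp
    ultimately have "(\<lambda>n. ((\<integral>y. f (X (n + N)) y \<partial>M) - (\<integral>y. f s0 y \<partial>M)) / (X (n + N) - s0)) \<longlonglongrightarrow> (\<integral>y. f' s0 y \<partial>M)"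
      unfolding Y_def by (simp only:)
    then show "(\<lambda>n. ((\<integral>y. f (X n) y \<partial>M) - (\<integral>y. f s0 y \<partial>M)) / (X n - s0)) \<longlonglongrightarrow> (\<integral>y. f' s0 y \<partial>M)"
      by (rule LIMSEQ_offset)
  qed
  then show ?thesis by (simp add: has_field_derivative_iff)
qed

text \<open>Both c - h and c + h are nondecreasing. This takes the place of integration in the scale
  variable: a bound on h' is never integrated, only compared with a primitive c of the
  bound.\<close>

lemma deriv_bound_diff:
  fixes h c :: "real \<Rightarrow> real"
  assumes "a \<le> b"
    and "\<And>t. a \<le> t \<Longrightarrow> t \<le> b \<Longrightarrow> (h has_real_derivative h' t) (at t)"
    and "\<And>t. a \<le> t \<Longrightarrow> t \<le> b \<Longrightarrow> (c has_real_derivative c' t) (at t)"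
    and "\<And>t. a \<le> t \<Longrightarrow> t \<le> b \<Longrightarrow> \<bar>h' t\<bar> \<le> c' t"
  shows "\<bar>h b - h a\<bar> \<le> c b - c a"
proof -
  have "c a - h a \<le> c b - h b"
  proof (rule DERIV_nonneg_imp_nondecreasing[OF assms(1)])
    fix t assume "a \<le> t" "t \<le> b"
    with assms have "((\<lambda>t. c t - h t) has_real_derivative c' t - h' t) (at t)" "0 \<le> c' t - h' t"
      by (auto intro!: derivative_intros simp: abs_le_iff)
    then show "\<exists>y. ((\<lambda>t. c t - h t) has_real_derivative y) (at t) \<and> 0 \<le> y" by blast
  qed
  moreover have "c a + h a \<le> c b + h b"
  proof (rule DERIV_nonneg_imp_nondecreasing[OF assms(1)])
    fix t assume t: "a \<le> t" "t \<le> b"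
    then have "((\<lambda>t. c t + h t) has_real_derivative c' t + h' t) (at t)"
      using assms by (auto intro!: derivative_intros)
    moreover have "0 \<le> c' t + h' t" using assms(4)[OF t] by linarith
    ultimately show "\<exists>y. ((\<lambda>t. c t + h t) has_real_derivative y) (at t) \<and> 0 \<le> y" by blast
  qed
  ultimately show ?thesis by linarith
qed

lemma C1c_line_deriv:
  assumes "C1c f"
  shows "((\<lambda>t. f (x + t *\<^sub>R e)) has_real_derivative grad f (x + t *\<^sub>R e) \<bullet> e) (at t)"
proof -
  have "((\<lambda>t. x + t *\<^sub>R e) has_derivative (\<lambda>h. h *\<^sub>R e)) (at t)"
    by (auto intro!: derivative_eq_intros)
  from has_derivative_compose[OF this C1c_deriv[OF assms]]
  have "((\<lambda>t. f (x + t *\<^sub>R e)) has_derivative (\<lambda>h. grad f (x + t *\<^sub>R e) \<bullet> (h *\<^sub>R e))) (at t)" .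
  then show ?thesis by (simp add: has_field_derivative_def mult.commute[of _ "grad f (x + t *\<^sub>R e) \<bullet> e"])
qed

lemma lipschitz_of_grad_bound:
  fixes f :: "'a::euclidean_space \<Rightarrow> real"
  assumes "\<And>x. (f has_derivative (\<lambda>h. G x \<bullet> h)) (at x)" "\<And>x. norm (G x) \<le> B"
  shows "\<bar>f x - f y\<bar> \<le> B * norm (x - y)"
proof -
  have "norm (f x - f y) \<le> B * norm (x - y)"
  proof (rule differentiable_bound[where S=UNIV and f'="\<lambda>x h. G x \<bullet> h"])
    fix z
    show "onorm ((\<bullet>) (G z)) \<le> B"
    proof (rule onorm_le)
      fix h
      have "norm (G z \<bullet> h) \<le> norm (G z) * norm h" using Cauchy_Schwarz_ineq2 by auto
      also have "\<dots> \<le> B * norm h" using assms(2) by (intro mult_right_mono) auto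
      finally show "norm (G z \<bullet> h) \<le> B * norm h" .
    qed
  qed (use assms in auto)
  then show ?thesis by simp
qed

lemma C1c_lipschitz:
  assumes "C1c f" obtains B where "B > 0" "\<And>x y. \<bar>f x - f y\<bar> \<le> B * norm (x - y)" "\<And>x. norm (grad f x) \<le> B"
proof -
  obtain B where "B > 0" "\<And>x. norm (grad f x) \<le> B"
    using Cc_bounded[OF Cc_grad[OF assms]] by blast
  with lipschitz_of_grad_bound[OF C1c_deriv[OF assms]] that show ?thesis by blast
qed

lemma integrable_indicator_cball: "integrable lebesgue (\<lambda>x. c * indicator (cball (a::'a::euclidean_space) r) x :: real)"
  by (intro integrable_mult_right integrable_real_indicator)
    (use emeasure_lborel_cball_finite[of a r] in auto)

text \<open>A single integrable majorant for all translates by vectors of length at most r, as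
  required for differentiating under the integral along a line.\<close>

lemma Cc_dom:
  fixes F :: "'a::euclidean_space \<Rightarrow> 'b::real_normed_vector"
  assumes "Cc F"
  obtains w where "integrable lebesgue w" "\<And>h x. norm h \<le> r \<Longrightarrow> norm (F (x + h)) \<le> w x" "\<And>x. (w x::real) \<ge> 0"
proof -
  obtain R where R: "\<And>x. R < norm x \<Longrightarrow> F x = 0" using assms Cc_def by metis
  obtain B where B: "B > 0" "\<And>x. norm (F x) \<le> B" using Cc_bounded[OF assms] by blast
  show ?thesis
  proof (rule that)
    show "integrable lebesgue (\<lambda>x. B * indicator (cball 0 (R + r)) x :: real)"
      by (rule integrable_indicator_cball)
    fix h x :: 'a assume "norm h \<le> r"
    then have "F (x + h) = 0" if "R + r < norm x"
      using R[of "x + h"] that norm_triangle_ineq[of "x + h" "- h"] by auto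
    then show "norm (F (x + h)) \<le> B * indicator (cball 0 (R + r)) x"
      using B by (auto simp: indicator_def)
  qed (use B in \<open>auto simp: indicator_def\<close>)
qed

text \<open>By translation invariance the integral of f(x + t e) does not depend on t, and its
  derivative at t = 0 is the integral in question.\<close>

lemma integral_grad:
  assumes "C1c f" shows "(\<integral>x. grad f x \<bullet> e \<partial>lebesgue) = 0"
proof -
  obtain w where w: "integrable lebesgue w" "\<And>h x. norm h \<le> norm e \<Longrightarrow> norm (grad f (x + h)) \<le> w x" "\<And>x. w x \<ge> 0"
    using Cc_dom[OF Cc_grad[OF assms], of "norm e"] by blast
  have "((\<lambda>t. \<integral>x. f (x + t *\<^sub>R e) \<partial>lebesgue) has_real_derivative (\<integral>x. grad f (x + 0 *\<^sub>R e) \<bullet> e \<partial>lebesgue)) (at 0)"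
  proof (rule deriv_under_integral[where a="-1" and b=1 and w="\<lambda>x. w x * norm e"])
    fix s :: real and y assume "- 1 < s" "s < 1"
    then have "norm (s *\<^sub>R e) \<le> norm e" by (simp add: mult_left_le_one_le)
    then have "norm (grad f (y + s *\<^sub>R e)) \<le> w y" using w by blast
    then have "norm (grad f (y + s *\<^sub>R e)) * norm e \<le> w y * norm e" by (intro mult_right_mono) auto
    then show "\<bar>grad f (y + s *\<^sub>R e) \<bullet> e\<bar> \<le> w y * norm e"
      using Cauchy_Schwarz_ineq2[of "grad f (y + s *\<^sub>R e)" e] by linarith
  qed (use w assms in \<open>auto intro: C1c_line_deriv Cc_integrable Cc_translate C1c_Cc\<close>)
  moreover have "(\<integral>x. f (x + t *\<^sub>R e) \<partial>lebesgue) = (\<integral>x. f x \<partial>lebesgue)" for t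
    using assms by (intro integral_translate Cc_cont C1c_Cc)
  ultimately show ?thesis using DERIV_unique[OF _ DERIV_const] by fastforce
qed

section \<open>Gradient rules, integration by parts and symmetry of mixed derivatives\<close>

lemma grad_mult:
  fixes f g :: "'a::euclidean_space \<Rightarrow> real"
  assumes "f differentiable (at x)" "g differentiable (at x)"
  shows "((\<lambda>x. f x * g x) has_derivative (\<lambda>h. (f x *\<^sub>R grad g x + g x *\<^sub>R grad f x) \<bullet> h)) (at x)"
    and "grad (\<lambda>x. f x * g x) x = f x *\<^sub>R grad g x + g x *\<^sub>R grad f x"
proof -
  show "((\<lambda>x. f x * g x) has_derivative (\<lambda>h. (f x *\<^sub>R grad g x + g x *\<^sub>R grad f x) \<bullet> h)) (at x)"
    by (rule derivative_eq_intros grad_has_derivative assms)+ (auto simp: inner_add_left algebra_simps)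
  then show "grad (\<lambda>x. f x * g x) x = f x *\<^sub>R grad g x + g x *\<^sub>R grad f x" by (rule grad_unique)
qed

lemma grad_add:
  fixes f g :: "'a::euclidean_space \<Rightarrow> real"
  assumes "f differentiable (at x)" "g differentiable (at x)"
  shows "((\<lambda>x. f x + g x) has_derivative (\<lambda>h. (grad f x + grad g x) \<bullet> h)) (at x)"
    and "grad (\<lambda>x. f x + g x) x = grad f x + grad g x"
proof -
  show "((\<lambda>x. f x + g x) has_derivative (\<lambda>h. (grad f x + grad g x) \<bullet> h)) (at x)"
    by (rule derivative_eq_intros grad_has_derivative assms)+ (auto simp: inner_add_left algebra_simps)
  then show "grad (\<lambda>x. f x + g x) x = grad f x + grad g x" by (rule grad_unique)
qed

lemma grad_cmult:
  fixes f :: "'a::euclidean_space \<Rightarrow> real"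
  assumes "f differentiable (at x)"
  shows "((\<lambda>x. c * f x) has_derivative (\<lambda>h. (c *\<^sub>R grad f x) \<bullet> h)) (at x)"
    and "grad (\<lambda>x. c * f x) x = c *\<^sub>R grad f x"
proof -
  show "((\<lambda>x. c * f x) has_derivative (\<lambda>h. (c *\<^sub>R grad f x) \<bullet> h)) (at x)"
    by (rule derivative_eq_intros grad_has_derivative assms)+ auto
  then show "grad (\<lambda>x. c * f x) x = c *\<^sub>R grad f x" by (rule grad_unique)
qed

lemma C1c_mult:
  assumes "C1c f" "C1c g" shows "C1c (\<lambda>x. f x * g x)"
    and "grad (\<lambda>x. f x * g x) x = f x *\<^sub>R grad g x + g x *\<^sub>R grad f x"
proof -
  have d: "f differentiable (at x)" "g differentiable (at x)" for x using assms by (auto simp: C1c_def)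
  show "grad (\<lambda>x. f x * g x) x = f x *\<^sub>R grad g x + g x *\<^sub>R grad f x" for x
    by (rule grad_mult(2)[OF d])
  then have G: "grad (\<lambda>x. f x * g x) = (\<lambda>x. f x *\<^sub>R grad g x + g x *\<^sub>R grad f x)" by auto
  have "continuous_on UNIV (\<lambda>x. f x *\<^sub>R grad g x + g x *\<^sub>R grad f x)"
    by (intro continuous_intros Cc_cont C1c_Cc Cc_grad assms)
  moreover have "(\<lambda>x. f x * g x) differentiable (at x)" for x
    using d by simp
  moreover obtain R where "\<forall>x. R < norm x \<longrightarrow> f x = 0" using assms C1c_def by metis
  ultimately show "C1c (\<lambda>x. f x * g x)" unfolding C1c_def G by (metis mult_zero_left)
qed

lemma integration_by_parts:
  assumes "C1c f" "C1c g"
  shows "(\<integral>x. f x * (grad g x \<bullet> e) \<partial>lebesgue) = - (\<integral>x. g x * (grad f x \<bullet> e) \<partial>lebesgue)"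
proof -
  have i: "integrable lebesgue (\<lambda>x. f x * (grad g x \<bullet> e))" "integrable lebesgue (\<lambda>x. g x * (grad f x \<bullet> e))"
    by (intro Cc_integrable Cc_times C1c_Cc continuous_intros Cc_cont[OF Cc_grad] assms)+
  have "0 = (\<integral>x. f x * (grad g x \<bullet> e) + g x * (grad f x \<bullet> e) \<partial>lebesgue)"
    using integral_grad[OF C1c_mult(1)[OF assms], of e] by (simp add: C1c_mult(2)[OF assms] inner_add_left)
  then show ?thesis using i by simp
qed

text \<open>The increments t n may have either sign: \<open>weak_schwarz\<close> applies this to a
  sequence and to its negative.\<close>

lemma diff_quotient_limit:
  assumes "C1c f" "C1c g" "t \<longlonglongrightarrow> 0" "\<And>n. t n \<noteq> 0" "\<And>n. \<bar>t n\<bar> \<le> 1"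
  shows "(\<lambda>n. \<integral>x. (f (x + t n *\<^sub>R a) - f x) / t n * ((g (x + t n *\<^sub>R b) - g x) / t n) \<partial>lebesgue)
     \<longlonglongrightarrow> (\<integral>x. (grad f x \<bullet> a) * (grad g x \<bullet> b) \<partial>lebesgue)"
proof -
  obtain L where L: "L > 0" "\<And>x y. \<bar>g x - g y\<bar> \<le> L * norm (x - y)" using C1c_lipschitz[OF assms(2)] by metis
  obtain K where K: "K > 0" "\<And>x y. \<bar>f x - f y\<bar> \<le> K * norm (x - y)" using C1c_lipschitz[OF assms(1)] by metis
  obtain R where R: "\<And>x. R < norm x \<Longrightarrow> f x = 0" using assms(1) C1c_def by metis
  have dq: "(\<lambda>n. (h (x + t n *\<^sub>R e) - h x) / t n) \<longlonglongrightarrow> grad h x \<bullet> e" if "C1c h" for h x e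
  proof -
    have "((\<lambda>s. (h (x + s *\<^sub>R e) - h x) / s) \<longlongrightarrow> grad h x \<bullet> e) (at 0)"
      using C1c_line_deriv[OF that, of x e 0] by (simp add: has_field_derivative_iff)
    then show ?thesis using assms(3,4) unfolding tendsto_at_iff_sequentially comp_def by auto
  qed
  have cf: "continuous_on UNIV f" "continuous_on UNIV g" using assms by (auto intro: Cc_cont C1c_Cc)
  have ct: "continuous_on UNIV (\<lambda>x. h (x + c))" if "continuous_on UNIV h" for h :: "'a \<Rightarrow> real" and c
    by (rule continuous_on_compose2[OF that, of UNIV "\<lambda>x. x + c"]) (auto intro!: continuous_intros)
  show ?thesis
  \<comment> \<open>Lipschitz constants bound both quotients, and since |t n| \<le> 1 the first
    quotient vanishes outside the ball of radius \<open>R + norm a\<close>.\<close>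
  proof (rule integral_dominated_convergence[where w="\<lambda>x. (K * norm a) * (L * norm b) * indicator (cball 0 (R + norm a)) x"])
    show "(\<lambda>x. (grad f x \<bullet> a) * (grad g x \<bullet> b)) \<in> borel_measurable lebesgue"
      using assms by (intro lebesgue_cont continuous_intros Cc_cont Cc_grad)
    show "(\<lambda>x. (f (x + t n *\<^sub>R a) - f x) / t n * ((g (x + t n *\<^sub>R b) - g x) / t n)) \<in> borel_measurable lebesgue" for n
      using assms(4) by (intro lebesgue_cont continuous_intros ct cf) auto
    show "AE x in lebesgue. (\<lambda>n. (f (x + t n *\<^sub>R a) - f x) / t n * ((g (x + t n *\<^sub>R b) - g x) / t n))
        \<longlonglongrightarrow> (grad f x \<bullet> a) * (grad g x \<bullet> b)"
      using assms by (intro AE_I2 tendsto_mult dq)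
    show "AE x in lebesgue. norm ((f (x + t n *\<^sub>R a) - f x) / t n * ((g (x + t n *\<^sub>R b) - g x) / t n))
        \<le> (K * norm a) * (L * norm b) * indicator (cball 0 (R + norm a)) x" for n
    proof (rule AE_I2)
      fix x
      have q: "\<bar>(f (x + t n *\<^sub>R a) - f x) / t n\<bar> \<le> K * norm a" "\<bar>(g (x + t n *\<^sub>R b) - g x) / t n\<bar> \<le> L * norm b"
        using K(2)[of "x + t n *\<^sub>R a" x] L(2)[of "x + t n *\<^sub>R b" x] assms(4)[of n]
        by (auto simp: abs_divide divide_le_eq algebra_simps)
      have "f x = 0 \<and> f (x + t n *\<^sub>R a) = 0" if "R + norm a < norm x"
      proof -
        have "norm (t n *\<^sub>R a) \<le> norm a" using assms(5) by (simp add: mult_left_le_one_le)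
        then have "R < norm (x + t n *\<^sub>R a)" using that norm_triangle_ineq[of "x + t n *\<^sub>R a" "- (t n *\<^sub>R a)"] by simp
        moreover have "R < norm x" using that norm_ge_zero[of a] by linarith
        ultimately show ?thesis using R by blast
      qed
      then show "norm ((f (x + t n *\<^sub>R a) - f x) / t n * ((g (x + t n *\<^sub>R b) - g x) / t n))
        \<le> (K * norm a) * (L * norm b) * indicator (cball 0 (R + norm a)) x"
        using mult_mono[OF q] K L by (auto simp: indicator_def abs_mult)
    qed
  qed (rule integrable_indicator_cball)
qed

text \<open>Difference quotients commute with translations, so no second derivatives are needed here.\<close>

lemma weak_schwarz:
  assumes "C1c f" "C1c g"
  shows "(\<integral>x. (grad f x \<bullet> a) * (grad g x \<bullet> b) \<partial>lebesgue) = (\<integral>x. (grad f x \<bullet> b) * (grad g x \<bullet> a) \<partial>lebesgue)"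
proof -
  define t :: "nat \<Rightarrow> real" where "t n = 1 / (real n + 1)" for n
  have t: "t \<longlonglongrightarrow> 0" "t n \<noteq> 0" "\<bar>t n\<bar> \<le> 1" for n
    unfolding t_def using LIMSEQ_inverse_real_of_nat by (auto simp: inverse_eq_divide add.commute)
  have ct: "continuous_on UNIV (\<lambda>x. h (x + c))" if "continuous_on UNIV h" for h :: "'a \<Rightarrow> real" and c
    by (rule continuous_on_compose2[OF that, of UNIV "\<lambda>x. x + c"]) (auto intro!: continuous_intros)
  have cf: "Cc f" "continuous_on UNIV g" using assms by (auto intro: Cc_cont C1c_Cc)
  have i: "integrable lebesgue (\<lambda>x. f (x + c) * g (x + d))" for c d
    by (intro Cc_integrable Cc_times Cc_translate ct cf)
  have i': "integrable lebesgue (\<lambda>x. f (x + c) * g x)" "integrable lebesgue (\<lambda>x. f x * g (x + c))"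
     "integrable lebesgue (\<lambda>x. f x * g x)" for c
    using i[of c 0] i[of 0 c] i[of 0 0] by simp_all
  define J where "J c = (\<integral>x. f x * g (x + c) \<partial>lebesgue)" for c
  have sh: "(\<integral>x. f (x + c) * g (x + d) \<partial>lebesgue) = J (d - c)" for c d
  proof -
    have "continuous_on UNIV (\<lambda>x. f x * g (x + (d - c)))"
      using cf by (intro continuous_intros ct Cc_cont[OF cf(1)] cf(2))
    from integral_translate[OF this, of c] show ?thesis by (simp add: J_def add.assoc)
  qed
  \<comment> \<open>By translation invariance only the correlation J at d - c, - c, d and 0
    survives. Exchanging the directions a and b and reversing the sign of the increment permutes
    these values, so the two double difference quotients agree before any limit is taken.\<close>
  have exp: "(\<integral>x. (f (x + c) - f x) * (g (x + d) - g x) \<partial>lebesgue) = J (d - c) - J (- c) - J d + J 0" for c d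
  proof -
    have "(\<lambda>x. (f (x + c) - f x) * (g (x + d) - g x)) =
      (\<lambda>x. f (x + c) * g (x + d) - f (x + c) * g x - f x * g (x + d) + f x * g x)"
      by (auto simp: algebra_simps)
    then show ?thesis
      using i i' sh[of c d] sh[of c 0] sh[of 0 d] sh[of 0 0] by simp
  qed
  have dq: "(\<integral>x. (f (x + s *\<^sub>R a) - f x) / s * ((g (x + s *\<^sub>R b) - g x) / s) \<partial>lebesgue)
    = (J (s *\<^sub>R b - s *\<^sub>R a) - J (- (s *\<^sub>R a)) - J (s *\<^sub>R b) + J 0) / (s * s)" for a b s
    unfolding exp[symmetric] by (subst integral_divide_zero[symmetric]) (simp add: field_simps)
  have "(\<integral>x. (f (x + t n *\<^sub>R a) - f x) / t n * ((g (x + t n *\<^sub>R b) - g x) / t n) \<partial>lebesgue)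
     = (\<integral>x. (f (x + (- t n) *\<^sub>R b) - f x) / (- t n) * ((g (x + (- t n) *\<^sub>R a) - g x) / (- t n)) \<partial>lebesgue)" for n
    unfolding dq by (simp add: algebra_simps)
  moreover have "(\<lambda>n. \<integral>x. (f (x + (- t n) *\<^sub>R b) - f x) / (- t n) * ((g (x + (- t n) *\<^sub>R a) - g x) / (- t n)) \<partial>lebesgue)
     \<longlonglongrightarrow> (\<integral>x. (grad f x \<bullet> b) * (grad g x \<bullet> a) \<partial>lebesgue)"
    using t by (intro diff_quotient_limit assms) (auto intro: tendsto_minus_cancel_left[THEN iffD1] simp: tendsto_minus_cancel_left)
  ultimately show ?thesis
    using LIMSEQ_unique[OF diff_quotient_limit[OF assms t, of a b]] by (simp only:)
qed

text \<open>With D t the squared L^2 norm of the increment by t h, the Cauchy-Schwarz inequality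
  gives |D'| \<le> 2 sqrt D |h| |grad f|_2, so sqrt D grows at most at the rate |h| |grad f|_2 and
  starts from 0.\<close>

lemma translation_estimate:
  assumes "C1c f" shows "n2 (\<lambda>x. f (x + h) - f x) \<le> norm h * n2 (grad f)"
proof -
  have cf: "Cc f" using assms by (rule C1c_Cc)
  define D where "D t = (\<integral>x. (f (x + t *\<^sub>R h) - f x)\<^sup>2 \<partial>lebesgue)" for t
  have L2t: "L2 (\<lambda>x. f (x + c) - f x)" "L2 (\<lambda>x. grad f (x + c))" for c
    using assms by (auto intro!: L2_Cc Cc_diff Cc_translate cf Cc_grad)
  have n2t: "n2 (\<lambda>x. grad f (x + c)) = n2 (grad f)" for c
    unfolding n2_def using Cc_norm_power2[OF Cc_grad[OF assms]]
    by (subst integral_translate[of "\<lambda>x. (norm (grad f x))\<^sup>2"]) (auto intro: Cc_cont)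
  have Dn: "D t = (n2 (\<lambda>x. f (x + t *\<^sub>R h) - f x))\<^sup>2" for t
    by (simp add: D_def n2_square)
  have dD: "(D has_real_derivative (\<integral>x. 2 * (f (x + t *\<^sub>R h) - f x) * (grad f (x + t *\<^sub>R h) \<bullet> h) \<partial>lebesgue)) (at t)" for t
  proof -
    obtain w where w: "integrable lebesgue w" "\<And>k x. norm k \<le> (\<bar>t\<bar> + 1) * norm h \<Longrightarrow> norm (grad f (x + k)) \<le> w x" "\<And>x. w x \<ge> 0"
      using Cc_dom[OF Cc_grad[OF assms], of "(\<bar>t\<bar> + 1) * norm h"] by blast
    obtain B where B: "B > 0" "\<And>x. norm (f x) \<le> B" using Cc_bounded[OF cf] by blast
    show ?thesis unfolding D_def
    proof (rule deriv_under_integral[where a="t-1" and b="t+1" and w="\<lambda>x. 4 * B * (w x * norm h)"])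
      fix s assume s: "t - 1 < s" "s < t + 1"
      show "integrable lebesgue (\<lambda>y. (f (y + s *\<^sub>R h) - f y)\<^sup>2)"
        using L2t(1)[of "s *\<^sub>R h"] by (simp add: L2_def)
      fix y
      show "((\<lambda>s. (f (y + s *\<^sub>R h) - f y)\<^sup>2) has_real_derivative
             2 * (f (y + s *\<^sub>R h) - f y) * (grad f (y + s *\<^sub>R h) \<bullet> h)) (at s)"
        using DERIV_power[OF DERIV_diff[OF C1c_line_deriv[OF assms] DERIV_const], where n=2, of y h "f y" s]
        by (simp add: mult.assoc mult.commute[of "grad f (y + s *\<^sub>R h) \<bullet> h"] del: right_diff_distrib_numeral)
      have "norm (s *\<^sub>R h) \<le> (\<bar>t\<bar> + 1) * norm h" using s by (auto intro!: mult_right_mono)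
      then have "norm (grad f (y + s *\<^sub>R h)) * norm h \<le> w y * norm h" using w by (intro mult_right_mono) auto
      then have "\<bar>grad f (y + s *\<^sub>R h) \<bullet> h\<bar> \<le> w y * norm h"
        using Cauchy_Schwarz_ineq2[of "grad f (y + s *\<^sub>R h)" h] by linarith
      moreover have "\<bar>2 * (f (y + s *\<^sub>R h) - f y)\<bar> \<le> 4 * B"
        using B(2)[of "y + s *\<^sub>R h"] B(2)[of y] by auto
      ultimately show "\<bar>2 * (f (y + s *\<^sub>R h) - f y) * (grad f (y + s *\<^sub>R h) \<bullet> h)\<bar> \<le> 4 * B * (w y * norm h)"
        unfolding abs_mult[of "2 * (f (y + s *\<^sub>R h) - f y)"] using w B by (intro mult_mono) auto
    qed (use w in auto)
  qed
  have dD_bound: "\<bar>\<integral>x. 2 * (f (x + t *\<^sub>R h) - f x) * (grad f (x + t *\<^sub>R h) \<bullet> h) \<partial>lebesgue\<bar>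
      \<le> 2 * n2 (\<lambda>x. f (x + t *\<^sub>R h) - f x) * (norm h * n2 (grad f))" for t
  proof -
    have "(\<integral>x. 2 * (f (x + t *\<^sub>R h) - f x) * (grad f (x + t *\<^sub>R h) \<bullet> h) \<partial>lebesgue)
      = 2 * ip (\<lambda>x. (f (x + t *\<^sub>R h) - f x) *\<^sub>R h) (\<lambda>x. grad f (x + t *\<^sub>R h))"
      unfolding ip_def by (subst integral_mult_right_zero[symmetric]) (simp add: mult.assoc inner_commute del: right_diff_distrib_numeral)
    also have "\<bar>\<dots>\<bar> \<le> 2 * (n2 (\<lambda>x. (f (x + t *\<^sub>R h) - f x) *\<^sub>R h) * n2 (grad f))"
    proof -
      have "L2 (\<lambda>x. (f (x + t *\<^sub>R h) - f x) *\<^sub>R h)"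
        by (intro L2_Cc Cc_mult_left Cc_diff Cc_translate cf continuous_intros)
      from ip_bound[OF this L2t(2), of "t *\<^sub>R h"] show ?thesis by (simp add: n2t abs_mult)
    qed
    also have "n2 (\<lambda>x. (f (x + t *\<^sub>R h) - f x) *\<^sub>R h) = n2 (\<lambda>x. f (x + t *\<^sub>R h) - f x) * norm h"
      unfolding n2_def by (simp add: power_mult_distrib real_sqrt_mult)
    finally show ?thesis by (simp add: mult_ac)
  qed
  \<comment> \<open>The square root is not differentiable at 0, the value of D at t = 0; the shift
    by e repairs this and is removed at the end.\<close>
  have key: "sqrt (D 1 + e) \<le> sqrt e + norm h * n2 (grad f)" if "e > 0" for e
  proof -
    have D0: "D t \<ge> 0" for t by (simp add: Dn)
    have "\<bar>sqrt (D 1 + e) - sqrt (D 0 + e)\<bar> \<le> (norm h * n2 (grad f)) * 1 - (norm h * n2 (grad f)) * 0"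
    proof (rule deriv_bound_diff[where c'="\<lambda>t. norm h * n2 (grad f)"])
      fix t :: real
      show "((\<lambda>t. sqrt (D t + e)) has_real_derivative
        (\<integral>x. 2 * (f (x + t *\<^sub>R h) - f x) * (grad f (x + t *\<^sub>R h) \<bullet> h) \<partial>lebesgue) * (inverse (sqrt (D t + e)) / 2)) (at t)"
        using D0[of t] that by (auto intro!: derivative_eq_intros dD)
      have "n2 (\<lambda>x. f (x + t *\<^sub>R h) - f x) \<le> sqrt (D t + e)"
        using that by (simp add: Dn real_le_rsqrt)
      then have "2 * n2 (\<lambda>x. f (x + t *\<^sub>R h) - f x) * (norm h * n2 (grad f)) \<le> 2 * sqrt (D t + e) * (norm h * n2 (grad f))"
        by (intro mult_right_mono) auto
      with dD_bound[of t] have "\<bar>\<integral>x. 2 * (f (x + t *\<^sub>R h) - f x) * (grad f (x + t *\<^sub>R h) \<bullet> h) \<partial>lebesgue\<bar>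
          \<le> 2 * sqrt (D t + e) * (norm h * n2 (grad f))" by linarith
      moreover have "sqrt (D t + e) > 0" using D0[of t] that by simp
      ultimately show "\<bar>(\<integral>x. 2 * (f (x + t *\<^sub>R h) - f x) * (grad f (x + t *\<^sub>R h) \<bullet> h) \<partial>lebesgue) * (inverse (sqrt (D t + e)) / 2)\<bar>
          \<le> norm h * n2 (grad f)"
        by (simp add: abs_mult field_simps)
    qed (auto intro!: derivative_eq_intros)
    moreover have "D 0 = 0" by (simp add: D_def)
    ultimately show ?thesis by simp
  qed
  have "n2 (\<lambda>x. f (x + h) - f x) \<le> norm h * n2 (grad f) + e" if "e > 0" for e
  proof -
    have "n2 (\<lambda>x. f (x + h) - f x) \<le> sqrt (D 1 + e\<^sup>2)" by (simp add: Dn real_le_rsqrt)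
    also have "\<dots> \<le> sqrt (e\<^sup>2) + norm h * n2 (grad f)" using that by (intro key) auto
    finally show ?thesis using that by simp
  qed
  then show ?thesis by (rule field_le_epsilon)
qed

section \<open>Smooth kernels\<close>

text \<open>Any field G representing the derivative may be used, so the closure rules below run by
  induction on k without reference to \<open>frechet_derivative\<close>.\<close>

lemma Ck_SucI:
  fixes f :: "'a::euclidean_space \<Rightarrow> real"
  assumes "\<And>x. (f has_derivative (\<lambda>h. G x \<bullet> h)) (at x)" "\<And>i. i \<in> Basis \<Longrightarrow> Ck k (\<lambda>x. G x \<bullet> i)"
  shows "Ck (Suc k) f"
proof -
  have d: "\<forall>x. f differentiable (at x)" using assms(1) differentiable_def by blast
  have "(\<lambda>x. frechet_derivative f (at x) i) = (\<lambda>x. G x \<bullet> i)" for i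
    using fun_cong[OF frechet_derivative_at[OF assms(1)], of _ i] by (simp add: fun_eq_iff)
  moreover have "continuous_on UNIV f"
    using d by (intro continuous_at_imp_continuous_on ballI differentiable_imp_continuous_within) auto
  ultimately show ?thesis using assms(2) d by simp
qed

lemma Ck_SucD:
  fixes f :: "'a::euclidean_space \<Rightarrow> real"
  assumes "Ck (Suc k) f"
  shows "f differentiable (at x)" "i \<in> Basis \<Longrightarrow> Ck k (\<lambda>x. grad f x \<bullet> i)"
  using assms by (auto simp: grad_inner_Basis)

lemma Ck_Suc_imp: "Ck (Suc k) f \<Longrightarrow> Ck k f"
  by (induction k arbitrary: f) auto

lemma Ck_const: "Ck k (\<lambda>x::'a::euclidean_space. c)"
proof (induction k arbitrary: c)
  case (Suc k)
  show ?case by (rule Ck_SucI[of _ "\<lambda>x. 0"]) (use Suc in auto)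
qed simp

lemma Ck_add: "Ck k f \<Longrightarrow> Ck k g \<Longrightarrow> Ck k (\<lambda>x. f x + g x)"
proof (induction k arbitrary: f g)
  case (Suc k)
  note d = Ck_SucD(1)[OF Suc.prems(1)] Ck_SucD(1)[OF Suc.prems(2)]
  show ?case
    by (rule Ck_SucI[OF grad_add(1)[OF d]])
      (use Suc.IH Ck_SucD(2)[OF Suc.prems(1)] Ck_SucD(2)[OF Suc.prems(2)] in \<open>simp add: inner_add_left\<close>)
qed (simp add: continuous_on_add)

lemma Ck_cmult: "Ck k f \<Longrightarrow> Ck k (\<lambda>x. c * f x)"
proof (induction k arbitrary: f)
  case (Suc k)
  show ?case
    by (rule Ck_SucI[OF grad_cmult(1)[OF Ck_SucD(1)[OF Suc.prems]]])
      (use Suc.IH Ck_SucD(2)[OF Suc.prems] in simp)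
qed (simp add: continuous_on_mult_left)

lemma Ck_mult: "Ck k f \<Longrightarrow> Ck k g \<Longrightarrow> Ck k (\<lambda>x. f x * g x)"
proof (induction k arbitrary: f g)
  case (Suc k)
  note d = Ck_SucD(1)[OF Suc.prems(1)] Ck_SucD(1)[OF Suc.prems(2)]
  note c = Ck_Suc_imp[OF Suc.prems(1)] Ck_Suc_imp[OF Suc.prems(2)]
  show ?case
    by (rule Ck_SucI[OF grad_mult(1)[OF d]])
      (use Suc.IH c Ck_SucD(2)[OF Suc.prems(1)] Ck_SucD(2)[OF Suc.prems(2)] in
        \<open>simp add: inner_add_left Ck_add\<close>)
qed (simp add: continuous_on_mult)

lemma Ck_inner: "Ck k (\<lambda>x::'a::euclidean_space. x \<bullet> a)"
proof (cases k)
  case (Suc n)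
  show ?thesis unfolding Suc
    by (rule Ck_SucI[of _ "\<lambda>x. a"]) (auto intro!: derivative_eq_intros Ck_const simp: inner_commute)
qed (auto intro!: continuous_intros)

lemma has_derivative_affine_comp:
  fixes f :: "'a::euclidean_space \<Rightarrow> real"
  assumes "f differentiable (at (a + c *\<^sub>R x))"
  shows "((\<lambda>x. f (a + c *\<^sub>R x)) has_derivative (\<lambda>h. (c *\<^sub>R grad f (a + c *\<^sub>R x)) \<bullet> h)) (at x)"
proof -
  have "((\<lambda>x. a + c *\<^sub>R x) has_derivative (\<lambda>h. c *\<^sub>R h)) (at x)"
    by (auto intro!: derivative_eq_intros)
  from has_derivative_compose[OF this grad_has_derivative[OF assms]]
  show ?thesis by simp
qed

lemma Ck_affine: "Ck k f \<Longrightarrow> Ck k (\<lambda>x. f (a + c *\<^sub>R x))"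
proof (induction k arbitrary: f)
  case 0
  then have "continuous_on UNIV f" by simp
  then have "continuous_on UNIV (\<lambda>x. f (a + c *\<^sub>R x))"
    by (rule continuous_on_compose2[of UNIV f UNIV "\<lambda>x. a + c *\<^sub>R x"]) (auto intro!: continuous_intros)
  then show ?case by simp
next
  case (Suc k)
  show ?case
    by (rule Ck_SucI[OF has_derivative_affine_comp[OF Ck_SucD(1)[OF Suc.prems]]])
      (use Suc.IH[OF Ck_SucD(2)[OF Suc.prems]] in \<open>simp add: Ck_cmult\<close>)
qed

lemma smooth_Cc_iff:
  fixes f :: "'a::euclidean_space \<Rightarrow> real"
  shows "smooth_Cc f \<longleftrightarrow> (\<forall>k. Ck k f) \<and> (\<exists>R. \<forall>x. R < norm x \<longrightarrow> f x = 0)"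
proof -
  have "compact (closure {x. f x \<noteq> 0}) \<longleftrightarrow> bounded {x. f x \<noteq> 0}" by simp
  also have "\<dots> \<longleftrightarrow> (\<exists>R. \<forall>x. R < norm x \<longrightarrow> f x = 0)"
    unfolding bounded_iff by (auto simp: not_less[symmetric])
  finally show ?thesis by (simp add: smooth_Cc_def)
qed

lemma Ck1_continuous_grad:
  fixes f :: "'a::euclidean_space \<Rightarrow> real"
  assumes "Ck (Suc 0) f" shows "continuous_on UNIV (grad f)"
proof -
  have "continuous_on UNIV (\<lambda>x. \<Sum>i\<in>Basis. (grad f x \<bullet> i) *\<^sub>R i)"
    using Ck_SucD(2)[OF assms] by (intro continuous_on_sum continuous_on_scaleR continuous_on_const) simp
  then show ?thesis by (simp add: euclidean_representation)
qed

lemma smooth_Cc_C1c: assumes "smooth_Cc f" shows "C1c f"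
  using assms Ck1_continuous_grad Ck_SucD(1)[of 0 f] unfolding smooth_Cc_iff C1c_def by blast

lemma smooth_Cc_add: assumes "smooth_Cc f" "smooth_Cc g" shows "smooth_Cc (\<lambda>x. f x + g x)"
proof -
  have "Cc (\<lambda>x. f x + g x)" using assms by (intro Cc_add C1c_Cc smooth_Cc_C1c)
  then show ?thesis using assms unfolding smooth_Cc_iff Cc_def by (auto intro: Ck_add)
qed

lemma smooth_Cc_cmult: assumes "smooth_Cc f" shows "smooth_Cc (\<lambda>x. c * f x)"
proof -
  have "Cc (\<lambda>x. c * f x)" using assms by (intro Cc_cmult C1c_Cc smooth_Cc_C1c)
  then show ?thesis using assms unfolding smooth_Cc_iff Cc_def by (auto intro: Ck_cmult)
qed

lemma smooth_Cc_diff: assumes "smooth_Cc f" "smooth_Cc g" shows "smooth_Cc (\<lambda>x. f x - g x)"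
  using smooth_Cc_add[OF assms(1) smooth_Cc_cmult[OF assms(2), of "-1"]] by simp

lemma grad_lincomb:
  assumes "C1c f" "C1c g"
  shows "grad (\<lambda>x. f x + c * g x) x = grad f x + c *\<^sub>R grad g x"
    and "grad (\<lambda>x. f x - g x) x = grad f x - grad g x"
proof -
  have d: "f differentiable (at x)" "g differentiable (at x)" "(\<lambda>x. c * g x) differentiable (at x)" for c
    using assms by (auto simp: C1c_def)
  show "grad (\<lambda>x. f x + c * g x) x = grad f x + c *\<^sub>R grad g x" for c
    using d grad_add(2)[OF d(1) d(3)] grad_cmult(2)[OF d(2)] by simp
  from this[of "-1"] show "grad (\<lambda>x. f x - g x) x = grad f x - grad g x" by simp
qed

lemma smooth_Cc_zero: "smooth_Cc (\<lambda>x. 0)"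
  by (auto simp: smooth_Cc_iff intro: Ck_const)

section \<open>The bump function and the kernels derived from it\<close>

definition expinv :: "nat \<Rightarrow> real \<Rightarrow> real" where
  "expinv n t = (if t > 0 then exp (- 1 / t) / t ^ n else 0)"

lemma expinv_tendsto_0: "(expinv n \<longlongrightarrow> 0) (at 0)"
proof (rule filterlim_split_at)
  have "((\<lambda>t. (inverse t) ^ n / exp (inverse t)) \<longlongrightarrow> 0) (at_right (0::real))"
    by (rule filterlim_compose[OF tendsto_power_div_exp_0 filterlim_inverse_at_top_right])
  then show "(expinv n \<longlongrightarrow> 0) (at_right 0)"
  proof (rule Lim_transform_eventually)
    show "\<forall>\<^sub>F t in at_right 0. (inverse t) ^ n / exp (inverse t) = expinv n t"
      using eventually_at_right_less[of 0]
      by eventually_elim (simp add: expinv_def exp_minus field_simps)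
  qed
  show "(expinv n \<longlongrightarrow> 0) (at_left 0)"
    by (rule Lim_transform_eventually[OF tendsto_const])
      (auto simp: expinv_def eventually_at_left_field intro!: exI[of _ "-1"])
qed

text \<open>The derivative stays in the span of the family, which is the reason for carrying the
  power t^n in the denominator: smoothness then follows by induction for all n
  simultaneously.\<close>

lemma expinv_deriv: "(expinv n has_real_derivative (expinv (n+2) t - real n * expinv (n+1) t)) (at t)"
proof -
  consider "t > 0" | "t < 0" | "t = 0" by linarith
  then show ?thesis
  proof cases
    case 1
    have "((\<lambda>t. exp (- 1 / t) / t ^ n) has_real_derivative (expinv (n+2) t - real n * expinv (n+1) t)) (at t)"
    proof -
      have "((\<lambda>t. exp (- 1 / t) / t ^ n) has_real_derivative
        (exp (- 1 / t) * (1 / t\<^sup>2) * t ^ n - exp (- 1 / t) * (real n * t ^ (n - 1))) / (t ^ n * t ^ n)) (at t)"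
        using 1 by (auto intro!: derivative_eq_intros simp: power2_eq_square)
      moreover have "(exp (- 1 / t) * (1 / t\<^sup>2) * t ^ n - exp (- 1 / t) * (real n * t ^ (n - 1))) / (t ^ n * t ^ n)
          = expinv (n+2) t - real n * expinv (n+1) t"
      proof (cases n)
        case 0 then show ?thesis using 1 by (simp add: expinv_def power2_eq_square)
      next
        case (Suc m)
        show ?thesis using 1 Suc by (simp add: expinv_def field_simps power2_eq_square)
      qed
      ultimately show ?thesis by simp
    qed
    then show ?thesis
      using 1 by (elim has_field_derivative_transform_within_open[where S="{0<..}"]) (auto simp: expinv_def)
  next
    case 2
    have "((\<lambda>t. 0) has_real_derivative (expinv (n+2) t - real n * expinv (n+1) t)) (at t)"
      using 2 by (simp add: expinv_def)
    then show ?thesis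
      using 2 by (elim has_field_derivative_transform_within_open[where S="{..<0}"]) (auto simp: expinv_def)
  next
    case 3
    \<comment> \<open>At 0 the difference quotient of \<open>expinv n\<close> is
      \<open>expinv (Suc n)\<close>, which tends to 0.\<close>
    have "((\<lambda>h. (expinv n h - expinv n 0) / (h - 0)) \<longlongrightarrow> 0) (at 0)"
      by (rule Lim_transform_eventually[OF expinv_tendsto_0[of "Suc n"]])
        (auto simp: expinv_def eventually_at_filter)
    then show ?thesis using 3 by (simp add: has_field_derivative_iff expinv_def)
  qed
qed

text \<open>The standard mollifier exp(-1/(1 - |z|^2)) on the unit ball, left unnormalised; its
  integral \<open>mass\<close> is carried through all later constants.\<close>

definition bump :: "'a::euclidean_space \<Rightarrow> real" where "bump z = expinv 0 (1 - z \<bullet> z)"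

lemma expinv_radial_deriv:
  fixes z :: "'a::euclidean_space"
  shows "((\<lambda>z. expinv n (1 - z \<bullet> z)) has_derivative
    (\<lambda>h. ((- 2 * (expinv (n+2) (1 - z \<bullet> z) - real n * expinv (n+1) (1 - z \<bullet> z))) *\<^sub>R z) \<bullet> h)) (at z)"
proof -
  have "((\<lambda>z. 1 - z \<bullet> z) has_derivative (\<lambda>h. - 2 * (z \<bullet> h))) (at z)"
    by (auto intro!: derivative_eq_intros simp: inner_commute)
  from has_derivative_compose[OF this expinv_deriv[unfolded has_field_derivative_def]]
  show ?thesis
    by (rule has_derivative_eq_rhs) (auto simp: fun_eq_iff algebra_simps)
qed

text \<open>Each derivative is a combination of functions of the same form with larger n, times a
  coordinate; hence the induction on k with n arbitrary.\<close>

lemma Ck_expinv_radial: "Ck k (\<lambda>z::'a::euclidean_space. expinv n (1 - z \<bullet> z))"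
proof (induction k arbitrary: n)
  case 0
  have "(\<lambda>z::'a. expinv n (1 - z \<bullet> z)) differentiable (at x)" for x
    using expinv_radial_deriv differentiable_def by blast
  then have "continuous_on UNIV (\<lambda>z::'a. expinv n (1 - z \<bullet> z))"
    by (intro continuous_at_imp_continuous_on ballI differentiable_imp_continuous_within) auto
  then show ?case by simp
next
  case (Suc k)
  have "Ck k (\<lambda>z::'a. (- 2 * expinv (n+2) (1 - z \<bullet> z) + 2 * real n * expinv (n+1) (1 - z \<bullet> z)) * (z \<bullet> i))" for i
    by (intro Ck_mult Ck_add Ck_cmult Suc Ck_inner)
  then show ?case
    by (intro Ck_SucI[OF expinv_radial_deriv]) (simp add: algebra_simps)
qed

lemma Ck_bump: "Ck k (bump :: 'a::euclidean_space \<Rightarrow> real)"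
  using Ck_expinv_radial[of k 0] by (simp add: bump_def[abs_def])

lemma bump_zero: "1 \<le> norm z \<Longrightarrow> bump z = 0"
  by (simp add: bump_def expinv_def dot_square_norm abs_square_le_1 not_less one_le_power)

lemma bump_nonneg: "bump z \<ge> 0"
  by (simp add: bump_def expinv_def)

lemma bump_le_1: "bump z \<le> 1"
  by (simp add: bump_def expinv_def)

lemma smooth_Cc_bump: "smooth_Cc bump"
  unfolding smooth_Cc_iff using Ck_bump bump_zero[OF less_imp_le] by (auto intro!: exI[of _ 1])

lemma grad_bump: "grad bump z = (- 2 * expinv 2 (1 - z \<bullet> z)) *\<^sub>R z"
  using expinv_radial_deriv[of 0 z] by (intro grad_unique) (simp add: bump_def[abs_def] numeral_2_eq_2)

text \<open>The gradients of these kernels form a symmetric matrix because they are, up to sign, the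
  components of the gradient of a compactly supported radial function.\<close>

definition bump1 :: "'a \<Rightarrow> 'a::euclidean_space \<Rightarrow> real" where "bump1 i z = (z \<bullet> i) * bump z"

definition bump2 :: "'a \<Rightarrow> 'a \<Rightarrow> 'a::euclidean_space \<Rightarrow> real" where "bump2 i j z = grad (bump1 i) z \<bullet> j"

lemma smooth_Cc_bump1: "smooth_Cc (bump1 i)"
  unfolding smooth_Cc_iff bump1_def[abs_def] using bump_zero[OF less_imp_le]
  by (auto intro!: exI[of _ 1] Ck_mult Ck_inner Ck_bump)

lemma bump2_eq: "bump2 i j z = (i \<bullet> j) * bump z + (z \<bullet> i) * (grad bump z \<bullet> j)"
proof -
  have "(\<lambda>z. z \<bullet> i) differentiable (at z)" "bump differentiable (at z)"
    using Ck_SucD(1)[of 0] Ck_inner Ck_bump by blast+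
  moreover have "grad (\<lambda>z. z \<bullet> i) z = i"
    by (rule grad_unique) (auto intro!: derivative_eq_intros simp: inner_commute)
  ultimately show ?thesis
    using grad_mult(2)[of "\<lambda>z. z \<bullet> i" z bump] by (simp add: bump2_def bump1_def[abs_def] inner_add_left)
qed

text \<open>Since \<open>bump\<close> is radial, its gradient at z is a scalar multiple of z, so the
  term (z . i) (grad bump z . j) is symmetric in i and j.\<close>

lemma bump2_sym: "bump2 i j z = bump2 j i z"
  by (simp add: bump2_eq grad_bump inner_commute)

text \<open>The trace is the divergence of z bump(z). Up to sign and powers of the scale this is
  also the derivative of the dilated bump in the scale, as \<open>bump_dilation_deriv\<close> shows;
  the scale derivative is thus a divergence.\<close>

lemma sum_bump2: "(\<Sum>j\<in>Basis. bump2 j j z) = real DIM('a) * bump (z::'a::euclidean_space) + grad bump z \<bullet> z"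
  by (simp add: bump2_eq sum.distrib euclidean_inner[of "grad bump z" z] mult.commute)

lemma bump1_zero: "1 \<le> norm z \<Longrightarrow> bump1 i z = 0"
  by (simp add: bump1_def bump_zero)

lemma bump2_zero: "1 < norm z \<Longrightarrow> bump2 i j z = 0"
  unfolding bump2_def using grad_eq_0_outside[of 1 "bump1 i" z, OF bump1_zero[OF less_imp_le]] by simp

lemma smooth_Cc_grad:
  assumes "smooth_Cc f" "i \<in> Basis" shows "smooth_Cc (\<lambda>x. grad f x \<bullet> i)"
proof -
  have "Cc (\<lambda>x. grad f x \<bullet> i)"
    by (intro Cc_inner Cc_grad smooth_Cc_C1c assms continuous_intros)
  moreover have "Ck k (\<lambda>x. grad f x \<bullet> i)" for k
    using assms Ck_SucD(2)[of k f i] by (simp add: smooth_Cc_iff del: Ck.simps)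
  ultimately show ?thesis by (simp add: smooth_Cc_iff Cc_def)
qed

section \<open>Convolution with dilated kernels\<close>

definition kern :: "real \<Rightarrow> ('a::euclidean_space \<Rightarrow> real) \<Rightarrow> bool" where
  "kern L k \<longleftrightarrow> L \<ge> 0 \<and> continuous_on UNIV k \<and> (\<forall>z. \<bar>k z\<bar> \<le> L) \<and>
     (\<forall>z z'. \<bar>k z - k z'\<bar> \<le> L * norm (z - z')) \<and> (\<forall>z. 1 < norm z \<longrightarrow> k z = 0)"

lemma kern_mono: assumes "kern L k" "L \<le> L'" shows "kern L' k"
  unfolding kern_def
proof (intro conjI allI)
  show "\<bar>k z\<bar> \<le> L'" for z using assms unfolding kern_def by (meson order_trans)
  show "\<bar>k z - k z'\<bar> \<le> L' * norm (z - z')" for z z'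
    using assms mult_right_mono[OF assms(2), of "norm (z - z')"] unfolding kern_def by (meson norm_ge_zero order_trans)
qed (use assms in \<open>auto simp: kern_def\<close>)

lemma kern_exists:
  assumes "smooth_Cc k" "\<And>z. 1 < norm z \<Longrightarrow> k z = 0" shows "\<exists>L. kern L k"
proof -
  have c: "C1c k" using assms(1) by (rule smooth_Cc_C1c)
  obtain B where B: "B > 0" "\<And>x y. \<bar>k x - k y\<bar> \<le> B * norm (x - y)"
    using C1c_lipschitz[OF c] by metis
  obtain D where D: "D > 0" "\<And>x. norm (k x) \<le> D" using Cc_bounded[OF C1c_Cc[OF c]] by metis
  have "kern (max B D) k" unfolding kern_def
  proof (intro conjI allI)
    show "\<bar>k z\<bar> \<le> max B D" for z using D(2)[of z] by simp
    show "\<bar>k z - k z'\<bar> \<le> max B D * norm (z - z')" for z z'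
      using B(2)[of z z'] mult_right_mono[of B "max B D" "norm (z - z')"] by simp
  qed (use B assms c in \<open>auto intro: Cc_cont C1c_Cc\<close>)
  then show ?thesis by blast
qed

text \<open>There are finitely many kernels, so one constant can serve as bound and as Lipschitz
  constant for all of them; the maximum with 1 makes it positive.\<close>

lemma kern_bumps:
  "\<exists>L>0. kern L (bump::'a::euclidean_space \<Rightarrow> real) \<and> (\<forall>i\<in>Basis. kern L (bump1 i :: 'a \<Rightarrow> real)) \<and>
     (\<forall>i\<in>Basis. \<forall>j\<in>Basis. kern L (bump2 i j :: 'a \<Rightarrow> real))"
proof -
  define K where "K = insert bump (bump1 ` Basis \<union> (\<lambda>(i,j). bump2 i j :: 'a \<Rightarrow> real) ` (Basis \<times> Basis))"
  have "finite K" by (simp add: K_def)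
  moreover have "\<forall>k\<in>K. \<exists>L. kern L k"
    unfolding K_def bump2_def[abs_def]
    using bump1_zero[OF less_imp_le] bump_zero[OF less_imp_le] bump2_zero[unfolded bump2_def]
    by (auto intro!: kern_exists smooth_Cc_bump smooth_Cc_bump1 smooth_Cc_grad)
  ultimately have "\<exists>L. \<forall>k\<in>K. kern L k"
  proof (induction K rule: finite_induct)
    case (insert k K)
    then obtain L L' where "\<forall>k\<in>K. kern L k" "kern L' k" by auto
    then have "\<forall>k\<in>insert k K. kern (max L L') k" by (auto intro: kern_mono)
    then show ?case by blast
  qed auto
  then obtain L where "\<forall>k\<in>K. kern L k" by blast
  then have "\<forall>k\<in>K. kern (max L 1) k" by (auto intro: kern_mono)
  then show ?thesis unfolding K_def by (intro exI[of _ "max L 1"]) auto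
qed

text \<open>The value at x of the convolution of f with the dilate s^(-N) k(z/s). The kernel is not
  normalised, so \<open>W bump s x f\<close> approaches \<open>mass\<close> times f x as s tends to
  0.\<close>

definition W :: "('a::euclidean_space \<Rightarrow> real) \<Rightarrow> real \<Rightarrow> 'a \<Rightarrow> ('a \<Rightarrow> real) \<Rightarrow> real" where
  "W k s x f = (\<integral>y. k ((x - y) /\<^sub>R s) * f y \<partial>lebesgue) / s ^ DIM('a)"

text \<open>The kernel estimates use f only through its L^1 norm on a ball. For the datum this norm
  comes from L^q, for the vector field from its oscillation.\<close>

definition loc_int :: "('a::euclidean_space \<Rightarrow> real) \<Rightarrow> 'a \<Rightarrow> real \<Rightarrow> real \<Rightarrow> bool" where
  "loc_int f x r A \<longleftrightarrow> f \<in> borel_measurable lebesgue \<and> integrable lebesgue (\<lambda>y. indicator (cball x r) y * f y) \<and>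
     (\<integral>y. indicator (cball x r) y * \<bar>f y\<bar> \<partial>lebesgue) \<le> A"

lemma kern_cont: "kern L k \<Longrightarrow> continuous_on UNIV (\<lambda>y. k ((x - y) /\<^sub>R s))"
  unfolding kern_def
  by (rule continuous_on_compose2[of UNIV k UNIV "\<lambda>y. (x - y) /\<^sub>R s"]) (auto intro!: continuous_intros)

lemma kern_zero: "kern L k \<Longrightarrow> s > 0 \<Longrightarrow> s < norm (x - y) \<Longrightarrow> k ((x - y) /\<^sub>R s) = 0"
  unfolding kern_def by (simp add: divide_inverse[symmetric] less_divide_eq mult.commute[of "inverse s"])

lemma loc_int_bound:
  fixes f :: "'a::euclidean_space \<Rightarrow> real"
  assumes f: "loc_int f x r A" and g: "g \<in> borel_measurable lebesgue" "\<And>y. \<bar>g y\<bar> \<le> D" "\<And>y. r < norm (x - y) \<Longrightarrow> g y = 0" "D \<ge> 0"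
  shows "integrable lebesgue (\<lambda>y. g y * f y)" "\<bar>\<integral>y. g y * f y \<partial>lebesgue\<bar> \<le> D * A"
proof -
  have b: "\<bar>g y * f y\<bar> \<le> D * (indicator (cball x r) y * \<bar>f y\<bar>)" for y
    using g(2)[of y] g(3)[of y] by (auto simp: indicator_def abs_mult dist_norm not_le intro: mult_right_mono)
  have a: "integrable lebesgue (\<lambda>y. D * (indicator (cball x r) y * \<bar>f y\<bar>))"
    using f integrable_abs[of lebesgue "\<lambda>y. indicator (cball x r) y * f y"]
    by (simp add: loc_int_def abs_mult)
  have f': "f \<in> borel_measurable lebesgue" using f by (simp add: loc_int_def)
  show i: "integrable lebesgue (\<lambda>y. g y * f y)"
  proof (rule Bochner_Integration.integrable_bound[OF a])
    show "(\<lambda>y. g y * f y) \<in> borel_measurable lebesgue" using f' g(1) by simp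
    show "AE y in lebesgue. norm (g y * f y) \<le> norm (D * (indicator (cball x r) y * \<bar>f y\<bar>))"
      using b g(4) by (intro AE_I2) (simp add: abs_mult)
  qed
  have "\<bar>\<integral>y. g y * f y \<partial>lebesgue\<bar> \<le> (\<integral>y. \<bar>g y * f y\<bar> \<partial>lebesgue)" by (rule integral_abs_bound)
  also have "\<dots> \<le> (\<integral>y. D * (indicator (cball x r) y * \<bar>f y\<bar>) \<partial>lebesgue)"
    using i a b by (intro integral_mono) auto
  also have "\<dots> = D * (\<integral>y. indicator (cball x r) y * \<bar>f y\<bar> \<partial>lebesgue)" by simp
  also have "\<dots> \<le> D * A" using f g(4) by (intro mult_left_mono) (auto simp: loc_int_def)
  finally show "\<bar>\<integral>y. g y * f y \<partial>lebesgue\<bar> \<le> D * A" .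
qed

text \<open>For x' within distance s of x, the kernel centred at x' lives in the ball of radius 2 s
  around x. One local bound therefore controls both values and their difference, and the Lipschitz
  bound on k gains the factor |x - x'| / s.\<close>

lemma W_bound:
  fixes f :: "'a::euclidean_space \<Rightarrow> real"
  assumes k: "kern L k" and s: "s > 0" and f: "loc_int f x (2 * s) A" and x': "norm (x - x') \<le> s"
  shows "integrable lebesgue (\<lambda>y. k ((x' - y) /\<^sub>R s) * f y)"
    and "\<bar>W k s x' f\<bar> \<le> L * A / s ^ DIM('a)"
    and "\<bar>W k s x f - W k s x' f\<bar> \<le> L * (norm (x - x') / s) * A / s ^ DIM('a)"
proof -
  have L: "L \<ge> 0" using k by (simp add: kern_def)
  have m: "(\<lambda>y. k ((z - y) /\<^sub>R s)) \<in> borel_measurable lebesgue" for z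
    by (rule lebesgue_cont[OF kern_cont[OF k]])
  have b: "\<bar>k ((z - y) /\<^sub>R s)\<bar> \<le> L" for y z using k by (simp add: kern_def)
  have z: "k ((z - y) /\<^sub>R s) = 0" if "norm (x - z) \<le> s" "2 * s < norm (x - y)" for y z
    using that norm_triangle_ineq[of "x - z" "z - y"] by (intro kern_zero[OF k s]) auto
  have i: "integrable lebesgue (\<lambda>y. k ((z - y) /\<^sub>R s) * f y)" if "norm (x - z) \<le> s" for z
    by (rule loc_int_bound[OF f m b z[OF that] L])
  show "integrable lebesgue (\<lambda>y. k ((x' - y) /\<^sub>R s) * f y)" using i[OF x'] .
  have "\<bar>\<integral>y. k ((x' - y) /\<^sub>R s) * f y \<partial>lebesgue\<bar> \<le> L * A"
    by (rule loc_int_bound[OF f m b z[OF x'] L])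
  then show "\<bar>W k s x' f\<bar> \<le> L * A / s ^ DIM('a)"
    using s by (simp add: W_def abs_divide divide_right_mono)
  have "\<bar>\<integral>y. (k ((x - y) /\<^sub>R s) - k ((x' - y) /\<^sub>R s)) * f y \<partial>lebesgue\<bar> \<le> (L * (norm (x - x') / s)) * A"
  proof (rule loc_int_bound(2)[OF f])
    show "(\<lambda>y. k ((x - y) /\<^sub>R s) - k ((x' - y) /\<^sub>R s)) \<in> borel_measurable lebesgue" using m by simp
    fix y
    have "\<bar>k ((x - y) /\<^sub>R s) - k ((x' - y) /\<^sub>R s)\<bar> \<le> L * norm ((x - y) /\<^sub>R s - (x' - y) /\<^sub>R s)"
      using k by (auto simp: kern_def)
    also have "(x - y) /\<^sub>R s - (x' - y) /\<^sub>R s = (x - x') /\<^sub>R s" by (simp add: algebra_simps)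
    finally show "\<bar>k ((x - y) /\<^sub>R s) - k ((x' - y) /\<^sub>R s)\<bar> \<le> L * (norm (x - x') / s)"
      using s by (simp add: divide_inverse mult.commute)
    show "k ((x - y) /\<^sub>R s) - k ((x' - y) /\<^sub>R s) = 0" if "2 * s < norm (x - y)"
      using z[of x y] z[of x' y] that x' s by simp
  qed (use L s in auto)
  moreover have "W k s x f - W k s x' f = (\<integral>y. (k ((x - y) /\<^sub>R s) - k ((x' - y) /\<^sub>R s)) * f y \<partial>lebesgue) / s ^ DIM('a)"
    using i[of x] i[of x'] x' s by (simp add: W_def left_diff_distrib diff_divide_distrib)
  ultimately show "\<bar>W k s x f - W k s x' f\<bar> \<le> L * (norm (x - x') / s) * A / s ^ DIM('a)"
    using s by (simp only: abs_divide power_abs abs_of_pos) (intro divide_right_mono, auto)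
qed

lemma loc_int_Lp:
  fixes f :: "'a::euclidean_space \<Rightarrow> real"
  assumes p: "p > 1" and f: "in_Lp p f" and r: "r \<ge> 0"
  shows "loc_int f x r ((unit_ball_vol DIM('a) * r ^ DIM('a)) powr (1 - 1 / p) * Lnorm p f)"
proof -
  define q where "q = p / (p - 1)"
  have q: "q > 1" "1 / q + 1 / p = 1" "1 / q = 1 - 1 / p"
    using p by (auto simp: q_def field_simps)
  define g where "g y = (indicator (cball x r) y :: real)" for y
  have gq: "(\<lambda>y. \<bar>g y\<bar> powr q) = indicator (cball x r)"
    using q by (auto simp: g_def indicator_def fun_eq_iff)
  have fm: "f \<in> borel_measurable lebesgue" "integrable lebesgue (\<lambda>y. \<bar>f y\<bar> powr p)"
    using f by (auto simp: in_Lp_def)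
  have g: "g \<in> borel_measurable lebesgue" "integrable lebesgue (\<lambda>y. \<bar>g y\<bar> powr q)"
    using integrable_indicator_cball[of 1 x r] unfolding gq by (auto simp: g_def[abs_def])
  have "(\<integral>y. \<bar>g y\<bar> powr q \<partial>lebesgue) = unit_ball_vol DIM('a) * r ^ DIM('a)"
    unfolding gq using r by (simp add: content_cball)
  then have "(\<integral>y. \<bar>g y * f y\<bar> \<partial>lebesgue) \<le> (unit_ball_vol DIM('a) * r ^ DIM('a)) powr (1 - 1 / p) * Lnorm p f"
    using holder_ineq(2)[OF q(1) p q(2) g(1) fm(1) g(2) fm(2)] by (simp add: q(3) Lnorm_def)
  then show ?thesis
    using holder_ineq(1)[OF q(1) p q(2) g(1) fm(1) g(2) fm(2)] fm(1)
    by (simp add: loc_int_def g_def abs_mult)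
qed

text \<open>The factor left over from Hoelder's inequality on a ball of radius 2 s once the power
  s^(N - N/p) is split off; in \<open>W\<close> the part s^N cancels against the
  normalisation.\<close>

definition vol2 :: "'a::euclidean_space itself \<Rightarrow> real \<Rightarrow> real" where
  "vol2 _ p = (unit_ball_vol (real DIM('a)) * 2 ^ DIM('a)) powr (1 - 1 / p)"

lemma loc_int_Lp_double:
  fixes f :: "'a::euclidean_space \<Rightarrow> real"
  assumes p: "p > 1" and f: "in_Lp p f" and s: "s > 0"
  shows "loc_int f x (2 * s) (vol2 TYPE('a) p * Lnorm p f * (s ^ DIM('a) * s powr (- DIM('a) / p)))"
proof -
  have "(unit_ball_vol DIM('a) * (2 * s) ^ DIM('a)) powr (1 - 1 / p)
      = vol2 TYPE('a) p * (s powr DIM('a)) powr (1 - 1 / p)"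
    using s by (simp add: vol2_def power_mult_distrib powr_mult powr_realpow mult.assoc[symmetric])
  also have "(s powr DIM('a)) powr (1 - 1 / p) = s ^ DIM('a) * s powr (- DIM('a) / p)"
    using s by (simp add: powr_powr right_diff_distrib powr_diff powr_minus divide_inverse powr_realpow[symmetric] del: powr_realpow)
  finally show ?thesis using loc_int_Lp[OF p f, of "2 * s" x] s by (simp add: mult_ac)
qed

lemma W_bound_Lp:
  fixes f :: "'a::euclidean_space \<Rightarrow> real"
  assumes k: "kern L k" and s: "s > 0" and p: "p > 1" and f: "in_Lp p f"
  shows "integrable lebesgue (\<lambda>y. k ((x - y) /\<^sub>R s) * f y)"
    and "\<bar>W k s x f\<bar> \<le> L * vol2 TYPE('a) p * Lnorm p f * s powr (- DIM('a) / p)"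
    and "norm (x - x') \<le> s \<Longrightarrow>
      \<bar>W k s x f - W k s x' f\<bar> \<le> L * vol2 TYPE('a) p * Lnorm p f * s powr (- DIM('a) / p) * (norm (x - x') / s)"
  using W_bound[OF k s loc_int_Lp_double[OF p f s], of x] W_bound[OF k s loc_int_Lp_double[OF p f s], of x x'] s
  by (auto simp: field_simps)

section \<open>Mollification\<close>

lemma Cc_bump: "Cc bump"
  by (intro C1c_Cc smooth_Cc_C1c smooth_Cc_bump)

lemma continuous_bump_scaled:
  "continuous_on UNIV (\<lambda>y::'a::euclidean_space. bump (y /\<^sub>R s))"
  "continuous_on UNIV (\<lambda>y::'a::euclidean_space. bump ((x - y) /\<^sub>R s))"
  by (rule continuous_on_compose2[OF Cc_cont[OF Cc_bump], of UNIV "\<lambda>y. y /\<^sub>R s"]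
        continuous_on_compose2[OF Cc_cont[OF Cc_bump], of UNIV "\<lambda>y. (x - y) /\<^sub>R s"];
      auto intro!: continuous_intros)+

lemma kern_Cc_integrable:
  assumes "kern L k" "Cc f" shows "integrable lebesgue (\<lambda>y. k ((x - y) /\<^sub>R s) * f y)"
  by (intro Cc_integrable Cc_times2 kern_cont[OF assms(1)] assms(2))

section \<open>Derivatives of mollifications in the scale\<close>

lemma bump_dilation_deriv:
  fixes v :: "'a::euclidean_space"
  assumes s: "s > 0"
  shows "((\<lambda>s. bump (v /\<^sub>R s) / s ^ DIM('a)) has_real_derivative
    - (\<Sum>j\<in>Basis. bump2 j j (v /\<^sub>R s)) / s ^ DIM('a) / s) (at s)"
proof -
  define w where "w = v /\<^sub>R s"
  have "((\<lambda>s. v /\<^sub>R s) has_derivative (\<lambda>h. (- (inverse s * h * inverse s)) *\<^sub>R v)) (at s)"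
    using s by (auto intro!: derivative_eq_intros)
  from has_derivative_compose[OF this grad_has_derivative[OF Ck_SucD(1)[OF Ck_bump[of "Suc 0"]]]]
  have "((\<lambda>s. bump (v /\<^sub>R s)) has_derivative (\<lambda>h. grad bump w \<bullet> ((- (inverse s * h * inverse s)) *\<^sub>R v))) (at s)"
    by (simp add: w_def)
  then have D: "((\<lambda>s. bump (v /\<^sub>R s)) has_real_derivative - (grad bump w \<bullet> w) / s) (at s)"
    unfolding has_field_derivative_def
    by (rule has_derivative_eq_rhs) (auto simp: w_def fun_eq_iff field_simps)
  have P: "((\<lambda>s. s ^ DIM('a)) has_real_derivative real DIM('a) * s ^ (DIM('a) - 1)) (at s)"
    by (auto intro!: derivative_eq_intros)
  have "real DIM('a) * s ^ (DIM('a) - 1) = real DIM('a) * s ^ DIM('a) / s"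
    using s DIM_positive[where 'a='a] by (simp add: power_diff)
  then have "(- (grad bump w \<bullet> w) / s * s ^ DIM('a) - bump w * (real DIM('a) * s ^ (DIM('a) - 1))) / (s ^ DIM('a) * s ^ DIM('a))
    = (- (grad bump w \<bullet> w) * (s ^ DIM('a) / s) - bump w * real DIM('a) * (s ^ DIM('a) / s)) / (s ^ DIM('a) * s ^ DIM('a))"
    by (simp add: mult_ac)
  also have "\<dots> = - (real DIM('a) * bump w + grad bump w \<bullet> w) * (s ^ DIM('a) / s) / (s ^ DIM('a) * s ^ DIM('a))"
    by (simp add: algebra_simps)
  also have "\<dots> = - (\<Sum>j\<in>Basis. bump2 j j w) / s ^ DIM('a) / s"
    using s by (simp add: sum_bump2)
  finally show ?thesis
    using DERIV_divide[OF D P] s by (simp add: w_def)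
qed

lemma W_bump_deriv:
  fixes f :: "'a::euclidean_space \<Rightarrow> real"
  assumes f: "Cc f" and s: "s > 0"
  shows "((\<lambda>s. W bump s x f) has_real_derivative - (\<Sum>j\<in>Basis. W (bump2 j j) s x f) / s) (at s)"
proof -
  obtain L where L: "L > 0" "kern L (bump::'a\<Rightarrow>real)" "\<And>i j. i \<in> Basis \<Longrightarrow> j \<in> Basis \<Longrightarrow> kern L (bump2 i j :: 'a\<Rightarrow>real)"
    using kern_bumps by blast
  define g where "g s y = bump ((x - y) /\<^sub>R s) / s ^ DIM('a) * f y" for s y
  define g' where "g' s y = - (\<Sum>j\<in>Basis. bump2 j j ((x - y) /\<^sub>R s)) / s ^ DIM('a) / s * f y" for s y
  have ig: "integrable lebesgue (g t)" for t
  proof -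
    have "g t = (\<lambda>y. (bump ((x - y) /\<^sub>R t) * f y) / t ^ DIM('a))"
      by (auto simp: g_def)
    then show ?thesis using kern_Cc_integrable[OF L(2) f, where x=x and s=t] by simp
  qed
  define D where "D = real DIM('a) * L / (s/2) ^ DIM('a) / (s/2)"
  have "((\<lambda>s. \<integral>y. g s y \<partial>lebesgue) has_real_derivative (\<integral>y. g' s y \<partial>lebesgue)) (at s)"
  \<comment> \<open>Between s/2 and 2 s the scale stays away from 0, so a constant multiple of |f|
    dominates; D bounds the kernel at the smallest scale s/2.\<close>
  proof (rule deriv_under_integral[where a="s/2" and b="2 * s" and w="\<lambda>y. D * \<bar>f y\<bar>"])
    fix t y assume t: "s / 2 < t" "t < 2 * s"
    then have t0: "t > 0" using s by linarith
    show "integrable lebesgue (g t)" by (rule ig)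
    show "((\<lambda>s. g s y) has_real_derivative g' t y) (at t)"
      unfolding g_def g'_def by (intro DERIV_cmult_right bump_dilation_deriv t0)
    have "\<bar>\<Sum>j\<in>Basis. bump2 j j ((x - y) /\<^sub>R t)\<bar> \<le> (\<Sum>j\<in>(Basis::'a set). L)"
      using L(3) by (intro order_trans[OF sum_abs] sum_mono) (auto simp: kern_def)
    then have B: "\<bar>\<Sum>j\<in>Basis. bump2 j j ((x - y) /\<^sub>R t)\<bar> \<le> real DIM('a) * L" by simp
    have "\<bar>g' t y\<bar> = \<bar>\<Sum>j\<in>Basis. bump2 j j ((x - y) /\<^sub>R t)\<bar> / t ^ DIM('a) / t * \<bar>f y\<bar>"
      using t0 by (simp add: g'_def abs_mult abs_divide)
    also have "\<dots> \<le> D * \<bar>f y\<bar>"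
      unfolding D_def using t t0 s B L(1) by (intro mult_right_mono frac_le power_mono divide_nonneg_nonneg) auto
    finally show "\<bar>g' t y\<bar> \<le> D * \<bar>f y\<bar>" .
  qed (use s Cc_integrable[OF f] in auto)
  moreover have "(\<integral>y. g t y \<partial>lebesgue) = W bump t x f" for t
    unfolding g_def W_def by (subst integral_divide_zero[symmetric]) simp
  moreover have "(\<integral>y. g' s y \<partial>lebesgue) = - (\<Sum>j\<in>Basis. W (bump2 j j) s x f) / s"
  proof -
    have "g' s = (\<lambda>y. (\<Sum>j\<in>Basis. bump2 j j ((x - y) /\<^sub>R s) * f y) * (- 1 / s ^ DIM('a) / s))"
      by (simp add: g'_def fun_eq_iff sum_distrib_right[symmetric])
    then have "(\<integral>y. g' s y \<partial>lebesgue) = (\<Sum>j\<in>Basis. \<integral>y. bump2 j j ((x - y) /\<^sub>R s) * f y \<partial>lebesgue) * (- 1 / s ^ DIM('a) / s)"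
      using kern_Cc_integrable[OF L(3) f] by (simp add: Bochner_Integration.integral_sum)
    then show ?thesis by (simp add: W_def sum_divide_distrib)
  qed
  ultimately show ?thesis by simp
qed

text \<open>The extra factor s compensates for differentiating the dilation: the components of the
  gradient are, up to sign, the \<open>bump2\<close> kernels with exactly the normalisation of
  \<open>W\<close>. Thus the kernels of the scale derivative are gradients of admissible test
  functions.\<close>

definition psi :: "'a \<Rightarrow> real \<Rightarrow> 'a \<Rightarrow> 'a::euclidean_space \<Rightarrow> real" where
  "psi i s x y = s / s ^ DIM('a) * bump1 i ((x - y) /\<^sub>R s)"

lemma psi_affine: "psi i s x = (\<lambda>y. s / s ^ DIM('a) * bump1 i (x /\<^sub>R s + (- inverse s) *\<^sub>R (y::'a::euclidean_space)))"
  by (auto simp: psi_def algebra_simps)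

lemma smooth_Cc_psi:
  assumes "s > 0" shows "smooth_Cc (psi i s x)"
proof -
  have "Ck k (psi i s x)" for k
    unfolding psi_affine using smooth_Cc_bump1[of i]
    by (intro Ck_cmult Ck_affine) (simp add: smooth_Cc_iff)
  moreover have "psi i s x y = 0" if "norm x + s < norm y" for y
  proof -
    have "s < norm (x - y)" using that norm_triangle_ineq2[of y x] by (simp add: norm_minus_commute)
    then have "1 \<le> norm ((x - y) /\<^sub>R s)" using assms by (simp add: divide_inverse[symmetric] mult.commute[of "inverse s"])
    then show ?thesis by (simp add: psi_def bump1_zero)
  qed
  ultimately show ?thesis unfolding smooth_Cc_iff by blast
qed

lemma grad_psi:
  fixes x :: "'a::euclidean_space"
  assumes "s > 0" shows "grad (psi i s x) y \<bullet> j = - bump2 i j ((x - y) /\<^sub>R s) / s ^ DIM('a)"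
proof -
  define z where "z = x /\<^sub>R s + (- inverse s) *\<^sub>R y"
  have d: "bump1 i differentiable (at z)"
    using smooth_Cc_bump1[of i] smooth_Cc_C1c C1c_def by blast
  have dd: "(\<lambda>y. bump1 i (x /\<^sub>R s + (- inverse s) *\<^sub>R y)) differentiable (at y)"
    using has_derivative_affine_comp[OF d[unfolded z_def]] differentiable_def by blast
  have "grad (psi i s x) y = (s / s ^ DIM('a)) *\<^sub>R ((- inverse s) *\<^sub>R grad (bump1 i) z)"
    unfolding psi_affine grad_cmult(2)[OF dd] grad_unique[OF has_derivative_affine_comp[OF d[unfolded z_def]]] z_def ..
  moreover have "z = (x - y) /\<^sub>R s" by (simp add: z_def algebra_simps)
  ultimately show ?thesis using assms by (simp add: bump2_def)
qed

lemma sum_W_bump2: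
  fixes f :: "'a::euclidean_space \<Rightarrow> real"
  assumes "s > 0"
  shows "- (\<Sum>j\<in>Basis. W (bump2 j j) s x f) = (\<Sum>j\<in>Basis. \<integral>y. f y * (grad (psi j s x) y \<bullet> j) \<partial>lebesgue)"
proof -
  have "(\<integral>y. f y * (grad (psi j s x) y \<bullet> j) \<partial>lebesgue) = - W (bump2 j j) s x f" for j
    unfolding W_def grad_psi[OF assms]
    by (subst integral_divide_zero[symmetric], subst integral_minus[symmetric]) (simp add: mult.commute)
  then show ?thesis by (simp add: sum_negf)
qed

text \<open>The scale derivative first appears as a sum over j of the i-th derivative of f paired
  with the j-th derivative of \<open>psi j\<close>. The weak symmetry of mixed derivatives exchanges
  the indices, and the symmetry of \<open>bump2\<close> then replaces \<open>psi j\<close> by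
  \<open>psi i\<close>. What remains is the weak Laplacian of f tested with one function, a quantity
  controlled by the equation.\<close>

lemma W_grad_deriv:
  fixes f :: "'a::euclidean_space \<Rightarrow> real"
  assumes f: "C1c f" and s: "s > 0" and i: "i \<in> Basis"
  shows "((\<lambda>s. W bump s x (\<lambda>y. grad f y \<bullet> i)) has_real_derivative ip (grad f) (grad (psi i s x)) / s) (at s)"
proof -
  note p = smooth_Cc_C1c[OF smooth_Cc_psi[OF s]]
  have "- (\<Sum>j\<in>Basis. W (bump2 j j) s x (\<lambda>y. grad f y \<bullet> i))
      = (\<Sum>j\<in>Basis. \<integral>y. (grad f y \<bullet> i) * (grad (psi j s x) y \<bullet> j) \<partial>lebesgue)"
    by (rule sum_W_bump2[OF s])
  also have "\<dots> = (\<Sum>j\<in>Basis. \<integral>y. (grad f y \<bullet> j) * (grad (psi j s x) y \<bullet> i) \<partial>lebesgue)"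
    by (intro sum.cong refl weak_schwarz f p)
  also have "\<dots> = (\<Sum>j\<in>Basis. \<integral>y. (grad f y \<bullet> j) * (grad (psi i s x) y \<bullet> j) \<partial>lebesgue)"
    unfolding grad_psi[OF s] by (simp add: bump2_sym)
  also have "\<dots> = (\<integral>y. (\<Sum>j\<in>Basis. (grad f y \<bullet> j) * (grad (psi i s x) y \<bullet> j)) \<partial>lebesgue)"
    by (rule Bochner_Integration.integral_sum[symmetric])
      (intro Cc_integrable Cc_times Cc_inner Cc_grad f continuous_intros Cc_cont[OF Cc_grad[OF p]])
  also have "\<dots> = ip (grad f) (grad (psi i s x))"
    unfolding ip_def by (intro Bochner_Integration.integral_cong refl euclidean_inner[symmetric])
  finally show ?thesis
    using W_bump_deriv[OF Cc_inner[OF Cc_grad[OF f] continuous_on_const] s, of x i] by simp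
qed

text \<open>Integrating by parts moves the derivative from the test function to f and cancels the
  factor 1 / s, so a bounded gradient gives a bounded scale derivative.\<close>

lemma W_pot_deriv:
  fixes f :: "'a::euclidean_space \<Rightarrow> real"
  assumes f: "C1c f" and s: "s > 0"
  shows "((\<lambda>s. W bump s x f) has_real_derivative - (\<Sum>j\<in>Basis. W (bump1 j) s x (\<lambda>y. grad f y \<bullet> j))) (at s)"
proof -
  note p = smooth_Cc_C1c[OF smooth_Cc_psi[OF s]]
  have "- (\<Sum>j\<in>Basis. W (bump2 j j) s x f) = (\<Sum>j\<in>Basis. \<integral>y. f y * (grad (psi j s x) y \<bullet> j) \<partial>lebesgue)"
    by (rule sum_W_bump2[OF s])
  also have "\<dots> = (\<Sum>j\<in>Basis. - (s * W (bump1 j) s x (\<lambda>y. grad f y \<bullet> j)))"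
  proof (intro sum.cong refl)
    fix j :: 'a
    have "(\<integral>y. f y * (grad (psi j s x) y \<bullet> j) \<partial>lebesgue) = - (\<integral>y. psi j s x y * (grad f y \<bullet> j) \<partial>lebesgue)"
      by (rule integration_by_parts[OF f p])
    also have "(\<integral>y. psi j s x y * (grad f y \<bullet> j) \<partial>lebesgue) = s * W (bump1 j) s x (\<lambda>y. grad f y \<bullet> j)"
      unfolding psi_def W_def mult.assoc by simp
    finally show "(\<integral>y. f y * (grad (psi j s x) y \<bullet> j) \<partial>lebesgue) = - (s * W (bump1 j) s x (\<lambda>y. grad f y \<bullet> j))" .
  qed
  also have "\<dots> = - s * (\<Sum>j\<in>Basis. W (bump1 j) s x (\<lambda>y. grad f y \<bullet> j))"
    by (simp add: sum_distrib_left sum_negf)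
  finally show ?thesis
    using W_bump_deriv[OF C1c_Cc[OF f] s, of x] s by simp
qed

section \<open>Norm estimates for mollification\<close>

definition mass :: "'a::euclidean_space itself \<Rightarrow> real" where
  "mass _ = (\<integral>z. bump (z::'a) \<partial>lebesgue)"

lemma mass_pos: "mass TYPE('a::euclidean_space) > 0"
proof -
  have b: "exp (- 4 / 3) * indicator (cball 0 (1/2)) z \<le> bump z" for z :: 'a
  proof (cases "norm z \<le> 1/2")
    case True
    then have z: "z \<bullet> z \<le> 1/4"
      using power_mono[of "norm z" "1/2" 2] by (simp add: dot_square_norm power_divide)
    then have "- 4 / 3 \<le> - 1 / (1 - z \<bullet> z)" by (simp add: field_simps)
    then show ?thesis using z True by (simp add: bump_def expinv_def)
  qed (simp add: indicator_def bump_nonneg)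
  have "0 < exp (- 4 / 3) * (unit_ball_vol (real DIM('a)) * (1/2) ^ DIM('a) :: real)"
    by (simp add: unit_ball_vol_pos)
  also have "\<dots> = (\<integral>z. exp (- 4 / 3) * indicator (cball 0 (1/2)) (z::'a) \<partial>lebesgue)"
    by (simp add: content_cball)
  also have "\<dots> \<le> mass TYPE('a)" unfolding mass_def
    by (intro integral_mono integrable_indicator_cball Cc_integrable Cc_bump b)
  finally show ?thesis .
qed

lemma bump_scaled_integral:
  fixes x :: "'a::euclidean_space"
  assumes "s > 0"
  shows "(\<integral>z. bump (z /\<^sub>R s) \<partial>(lebesgue :: 'a measure)) = s ^ DIM('a) * mass TYPE('a)"
    and "(\<integral>y. bump ((x - y) /\<^sub>R s) \<partial>lebesgue) = s ^ DIM('a) * mass TYPE('a)"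
proof -
  have c: "continuous_on UNIV (\<lambda>z::'a. bump (z /\<^sub>R s))"
    by (rule continuous_bump_scaled)
  show 1: "(\<integral>z. bump (z /\<^sub>R s) \<partial>(lebesgue :: 'a measure)) = s ^ DIM('a) * mass TYPE('a)"
    using integral_affine[OF c, of s 0] assms by (simp add: mass_def)
  show "(\<integral>y. bump ((x - y) /\<^sub>R s) \<partial>lebesgue) = s ^ DIM('a) * mass TYPE('a)"
    using integral_reflect[OF c, of x] 1 by simp
qed

lemma W_bump_const: "s > 0 \<Longrightarrow> W bump s (x::'a::euclidean_space) (\<lambda>y. c) = mass TYPE('a) * c"
  by (simp add: W_def bump_scaled_integral)

lemma Cc_bump_scaled: 
  assumes "s > 0" shows "Cc (\<lambda>y::'a::euclidean_space. bump ((x - y) /\<^sub>R s))"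
proof -
  have "bump ((x - y) /\<^sub>R s) = 0" if "norm x + s < norm y" for y
  proof -
    have "s < norm (x - y)" using that norm_triangle_ineq2[of y x] by (simp add: norm_minus_commute)
    then have "1 \<le> norm ((x - y) /\<^sub>R s)" using assms by (simp add: divide_inverse[symmetric] mult.commute[of "inverse s"])
    then show ?thesis by (rule bump_zero)
  qed
  then show ?thesis using continuous_bump_scaled unfolding Cc_def by blast
qed

text \<open>Jensen's inequality for a measure of total mass \<open>mass\<close>, obtained from
  Hoelder's inequality by writing the kernel as b^(1/q) b^(1/p) and attaching the second factor to
  f. The power \<open>p - 1\<close> of the mass accounts for the missing normalisation.\<close>

lemma W_bump_jensen:
  fixes f :: "'a::euclidean_space \<Rightarrow> real"
  assumes f: "continuous_on UNIV f" and s: "s > 0" and p: "p > 1"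
  shows "\<bar>W bump s x f\<bar> powr p \<le> mass TYPE('a) powr (p - 1) * W bump s x (\<lambda>y. \<bar>f y\<bar> powr p)"
proof -
  define b where "b y = bump ((x - y) /\<^sub>R s)" for y
  have Cb: "Cc b" unfolding b_def[abs_def] by (rule Cc_bump_scaled[OF s])
  have b0: "b y \<ge> 0" for y by (simp add: b_def bump_nonneg)
  define q where "q = p / (p - 1)"
  have q: "q > 1" "1 / q + 1 / p = 1" "1 / q = 1 - 1 / p"
    using p by (auto simp: q_def field_simps)
  have c: "continuous_on UNIV (\<lambda>y. b y powr (1/p))" "continuous_on UNIV (\<lambda>y. b y powr (1/q))"
    using p q(1) b0 by (intro continuous_on_powr' continuous_on_const Cc_cont[OF Cb]; simp)+
  have cf: "continuous_on UNIV (\<lambda>y. \<bar>f y\<bar> powr p)"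
    using p f by (intro continuous_on_powr' continuous_intros) auto
  have e: "\<bar>b y powr (1/q)\<bar> powr q = b y" "\<bar>b y powr (1/p) * f y\<bar> powr p = b y * \<bar>f y\<bar> powr p" for y
    using p q(1) b0[of y] by (auto simp: powr_powr abs_mult powr_mult)
  have m: "b y powr (1/q) * (b y powr (1/p) * f y) = b y * f y" for y
    using q b0[of y] by (simp add: mult.assoc[symmetric] powr_add[symmetric])
  have I: "(\<integral>y. b y \<partial>lebesgue) = s ^ DIM('a) * mass TYPE('a)"
    unfolding b_def by (rule bump_scaled_integral[OF s])
  have ib: "integrable lebesgue (\<lambda>y. b y * f y)" "integrable lebesgue (\<lambda>y. b y * \<bar>f y\<bar> powr p)"
    by (intro Cc_integrable Cc_times Cb f cf)+
  have "\<bar>\<integral>y. b y * f y \<partial>lebesgue\<bar> \<le> (\<integral>y. \<bar>b y * f y\<bar> \<partial>lebesgue)" by (rule integral_abs_bound)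
  also have "\<dots> \<le> (\<integral>y. b y \<partial>lebesgue) powr (1/q) * (\<integral>y. b y * \<bar>f y\<bar> powr p \<partial>lebesgue) powr (1/p)"
    using holder_ineq(2)[OF q(1) p q(2), of "\<lambda>y. b y powr (1/q)" lebesgue "\<lambda>y. b y powr (1/p) * f y"]
      lebesgue_cont[OF c(2)] lebesgue_cont[OF continuous_on_mult[OF c(1) f]] Cc_integrable[OF Cb] ib
    unfolding e m by simp
  finally have "\<bar>\<integral>y. b y * f y \<partial>lebesgue\<bar> powr p \<le>
    ((\<integral>y. b y \<partial>lebesgue) powr (1/q) * (\<integral>y. b y * \<bar>f y\<bar> powr p \<partial>lebesgue) powr (1/p)) powr p"
    using p by (intro powr_mono2) auto
  also have "\<dots> = (s ^ DIM('a) * mass TYPE('a)) powr (p - 1) * (\<integral>y. b y * \<bar>f y\<bar> powr p \<partial>lebesgue)"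
  proof -
    have n: "0 \<le> (\<integral>y. b y * \<bar>f y\<bar> powr p \<partial>lebesgue)" using b0 by (intro integral_nonneg_AE) auto
    have "p * (1 - 1/p) = p - 1" using p by (simp add: field_simps)
    then show ?thesis using p n by (simp add: I powr_mult powr_powr q(3) mult.commute[of _ p])
  qed
  finally have B: "\<bar>\<integral>y. b y * f y \<partial>lebesgue\<bar> powr p
      \<le> (s ^ DIM('a) * mass TYPE('a)) powr (p - 1) * (\<integral>y. b y * \<bar>f y\<bar> powr p \<partial>lebesgue)" .
  have "\<bar>W bump s x f\<bar> powr p = \<bar>\<integral>y. b y * f y \<partial>lebesgue\<bar> powr p / (s ^ DIM('a)) powr p"
    using s by (simp add: W_def b_def abs_divide powr_divide)
  also have "\<dots> \<le> (s ^ DIM('a) * mass TYPE('a)) powr (p - 1) * (\<integral>y. b y * \<bar>f y\<bar> powr p \<partial>lebesgue) / (s ^ DIM('a)) powr p"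
    using B by (intro divide_right_mono) auto
  also have "\<dots> = mass TYPE('a) powr (p - 1) * W bump s x (\<lambda>y. \<bar>f y\<bar> powr p)"
    using s mass_pos[where 'a='a] by (simp add: W_def b_def powr_mult powr_diff)
  finally show ?thesis .
qed

lemma fubini_Cc:
  fixes H :: "'a::euclidean_space \<times> 'a \<Rightarrow> real"
  assumes "Cc H"
  shows "integrable lebesgue (\<lambda>x. \<integral>z. H (x, z) \<partial>lebesgue)"
    and "(\<integral>x. (\<integral>z. H (x, z) \<partial>lebesgue) \<partial>lebesgue) = (\<integral>z. (\<integral>x. H (x, z) \<partial>lebesgue) \<partial>lebesgue)"
proof -
  have c: "continuous_on UNIV H" using assms by (rule Cc_cont)
  have c1: "continuous_on UNIV (\<lambda>z. H (x, z))" "continuous_on UNIV (\<lambda>x. H (x, z))" for x z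
    by (auto intro!: continuous_on_compose2[OF c] continuous_intros)
  have I: "integrable (lborel \<Otimes>\<^sub>M lborel) H"
    using Cc_integrable_lborel[OF assms] by (simp add: lborel_prod)
  have e1: "(\<lambda>x. \<integral>z. H (x, z) \<partial>lebesgue) = (\<lambda>x. \<integral>z. H (x, z) \<partial>lborel)"
    using integral_lebesgue_cont[OF c1(1)] by auto
  have e2: "(\<lambda>z. \<integral>x. H (x, z) \<partial>lebesgue) = (\<lambda>z. \<integral>x. H (x, z) \<partial>lborel)"
    using integral_lebesgue_cont[OF c1(2)] by auto
  have i1: "integrable lborel (\<lambda>x. \<integral>z. H (x, z) \<partial>lborel)" by (rule lborel_pair.integrable_fst'[OF I])
  have i2: "integrable lborel (\<lambda>z. \<integral>x. H (x, z) \<partial>lborel)"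
    using lborel_pair.integrable_snd[of "\<lambda>x z. H (x, z)"] I by simp
  show "integrable lebesgue (\<lambda>x. \<integral>z. H (x, z) \<partial>lebesgue)"
    unfolding e1 using i1 integrable_completion[OF borel_measurable_integrable[OF i1]] by simp
  show "(\<integral>x. (\<integral>z. H (x, z) \<partial>lebesgue) \<partial>lebesgue) = (\<integral>z. (\<integral>x. H (x, z) \<partial>lebesgue) \<partial>lebesgue)"
    unfolding e1 e2 integral_completion[OF borel_measurable_integrable[OF i1]]
      integral_completion[OF borel_measurable_integrable[OF i2]]
    using lborel_pair.Fubini_integral[of "\<lambda>x z. H (x, z)"] I by simp
qed

lemma W_reflect:
  fixes f :: "'a::euclidean_space \<Rightarrow> real"
  assumes "continuous_on UNIV f"
  shows "W bump s x f = (\<integral>z. bump (z /\<^sub>R s) * f (x - z) \<partial>lebesgue) / s ^ DIM('a)"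
proof -
  have "continuous_on UNIV (\<lambda>z::'a. bump (z /\<^sub>R s))"
    by (rule continuous_bump_scaled)
  moreover have "continuous_on UNIV (\<lambda>z. f (x - z))"
    by (rule continuous_on_compose2[OF assms, of UNIV "\<lambda>z. x - z"]) (auto intro!: continuous_intros)
  ultimately have "continuous_on UNIV (\<lambda>z. bump (z /\<^sub>R s) * f (x - z))" by (rule continuous_on_mult)
  from integral_reflect[OF this, of x] show ?thesis by (simp add: W_def)
qed

text \<open>After the reflection z = x - y the kernel is independent of x, so Fubini leaves for each
  z an integral over x alone, to which translation estimates apply. The function h may depend on
  both points because the Poincare estimate averages (f x - f y)^2.\<close>

lemma W_bump_double_integral:
  fixes h :: "'a::euclidean_space \<Rightarrow> 'a \<Rightarrow> real"
  assumes s: "s > 0" and h: "continuous_on UNIV (\<lambda>(x, y). h x y)"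
    and R: "\<And>x y. R < norm x \<Longrightarrow> norm (x - y) \<le> s \<Longrightarrow> h x y = 0"
  shows "integrable lebesgue (\<lambda>x. W bump s x (h x))"
    and "(\<integral>x. W bump s x (h x) \<partial>lebesgue) = (\<integral>z. bump (z /\<^sub>R s) * (\<integral>x. h x (x - z) \<partial>lebesgue) \<partial>lebesgue) / s ^ DIM('a)"
proof -
  define H where "H = (\<lambda>(x::'a, z). bump (z /\<^sub>R s) * h x (x - z))"
  have ch: "continuous_on UNIV (h x)" for x
  proof -
    have "continuous_on UNIV (\<lambda>y. (x, y))" by (intro continuous_intros)
    from continuous_on_compose2[OF h this] show ?thesis by simp
  qed
  have "continuous_on UNIV (\<lambda>z::'a. bump (z /\<^sub>R s))"
    by (rule continuous_bump_scaled)
  then have c1: "continuous_on UNIV (\<lambda>p::'a\<times>'a. bump (snd p /\<^sub>R s))"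
    by (rule continuous_on_compose2[of UNIV _ UNIV snd]) (auto intro!: continuous_intros)
  have c2: "continuous_on UNIV (\<lambda>p::'a\<times>'a. h (fst p) (fst p - snd p))"
  proof -
    have "continuous_on UNIV (\<lambda>p::'a\<times>'a. (fst p, fst p - snd p))" by (intro continuous_intros)
    from continuous_on_compose2[OF h this] show ?thesis by simp
  qed
  have "continuous_on UNIV H"
    using continuous_on_mult[OF c1 c2] by (simp add: H_def case_prod_beta')
  moreover have "H p = 0" if "\<bar>R\<bar> + s < norm p" for p
  proof (rule ccontr)
    obtain x z where p: "p = (x, z)" by (cases p)
    assume "H p \<noteq> 0"
    then have n: "bump (z /\<^sub>R s) \<noteq> 0" "h x (x - z) \<noteq> 0" by (auto simp: H_def p)
    have z: "norm z \<le> s"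
    proof (rule ccontr)
      assume "\<not> norm z \<le> s"
      then have "1 \<le> norm (z /\<^sub>R s)" using s by (simp add: divide_inverse[symmetric] mult.commute[of "inverse s"])
      then show False using n bump_zero by blast
    qed
    then have "norm x \<le> R" using R[of x "x - z"] n by force
    then show False using that z norm_Pair_le[of x z] unfolding p by simp
  qed
  ultimately have C: "Cc H" unfolding Cc_def by blast
  have W: "W bump s x (h x) = (\<integral>z. H (x, z) \<partial>lebesgue) / s ^ DIM('a)" for x
    by (simp add: W_reflect[OF ch] H_def)
  show "integrable lebesgue (\<lambda>x. W bump s x (h x))"
    unfolding W using fubini_Cc(1)[OF C] by simp
  show "(\<integral>x. W bump s x (h x) \<partial>lebesgue) = (\<integral>z. bump (z /\<^sub>R s) * (\<integral>x. h x (x - z) \<partial>lebesgue) \<partial>lebesgue) / s ^ DIM('a)"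
    unfolding W using fubini_Cc(2)[OF C] by (simp add: H_def)
qed

lemma in_Lp_Cc: "p > 0 \<Longrightarrow> Cc f \<Longrightarrow> in_Lp p f"
  unfolding in_Lp_def using Cc_powr[of f p] by (auto intro: lebesgue_cont Cc_cont Cc_integrable)

lemma Cc_W_bump:
  fixes f :: "'a::euclidean_space \<Rightarrow> real"
  assumes "Cc f" "s > 0" shows "Cc (\<lambda>x. W bump s x f)"
proof -
  obtain L where L: "L > 0" "kern L (bump::'a\<Rightarrow>real)" using kern_bumps by blast
  obtain R where R: "\<And>x. R < norm x \<Longrightarrow> f x = 0" using assms(1) Cc_def by metis
  have l2: "in_Lp 2 f" using assms by (intro in_Lp_Cc) auto
  define C where "C = L * vol2 TYPE('a) 2 * Lnorm 2 f * s powr (- DIM('a) / 2)"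
  have "isCont (\<lambda>x. W bump s x f) x" for x
  proof -
    have "((\<lambda>y. C * (norm (x - y) / s)) \<longlongrightarrow> C * (norm (x - x) / s)) (at x)"
      using assms by (intro tendsto_intros) auto
    then have "((\<lambda>y. C * (norm (x - y) / s)) \<longlongrightarrow> 0) (at x)" by simp
    moreover have "\<forall>\<^sub>F y in at x. norm (W bump s y f - W bump s x f) \<le> C * (norm (x - y) / s)"
      unfolding eventually_at
    proof (intro exI[of _ s] conjI ballI impI)
      fix y assume "y \<noteq> x \<and> dist y x < s"
      then have "norm (x - y) \<le> s" by (simp add: dist_norm norm_minus_commute)
      from W_bound_Lp(3)[OF L(2) assms(2) _ l2 this]
      show "norm (W bump s y f - W bump s x f) \<le> C * (norm (x - y) / s)"
        by (simp add: C_def abs_minus_commute)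
    qed (rule assms(2))
    ultimately have "((\<lambda>y. W bump s y f - W bump s x f) \<longlongrightarrow> 0) (at x)"
      by (rule Lim_null_comparison[rotated])
    then show ?thesis unfolding isCont_def by (rule LIM_zero_cancel)
  qed
  moreover have "W bump s x f = 0" if "R + s < norm x" for x
  proof -
    have "bump ((x - y) /\<^sub>R s) * f y = 0" for y
    proof (cases "norm y \<le> R")
      case True
      then have "s < norm (x - y)" using that norm_triangle_ineq2[of x y] by simp
      then show ?thesis using kern_zero[OF L(2) assms(2)] by simp
    qed (use R in auto)
    then have "(\<lambda>y. bump ((x - y) /\<^sub>R s) * f y) = (\<lambda>y. 0)" by blast
    then show ?thesis by (simp add: W_def)
  qed
  ultimately show ?thesis unfolding Cc_def by (blast intro: continuous_at_imp_continuous_on)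
qed

text \<open>Young's convolution inequality for the unnormalised kernel: Jensen pointwise, then
  Fubini and translation invariance.\<close>

lemma W_bump_Lp:
  fixes f :: "'a::euclidean_space \<Rightarrow> real"
  assumes f: "Cc f" and s: "s > 0" and p: "p > 1"
  shows "(\<integral>x. \<bar>W bump s x f\<bar> powr p \<partial>lebesgue) \<le> mass TYPE('a) powr p * (\<integral>x. \<bar>f x\<bar> powr p \<partial>lebesgue)"
proof -
  have Cp: "Cc (\<lambda>y. \<bar>f y\<bar> powr p)" using Cc_powr[OF f, of p] p by simp
  obtain R where R: "\<And>x. R < norm x \<Longrightarrow> f x = 0" using f Cc_def by metis
  have cc: "continuous_on UNIV (\<lambda>(x::'a, y). \<bar>f y\<bar> powr p)"
    unfolding case_prod_beta'
    by (rule continuous_on_compose2[OF Cc_cont[OF Cp], of UNIV snd]) (simp_all add: continuous_on_snd)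
  have z: "\<bar>f y\<bar> powr p = 0" if "R + s < norm x" "norm (x - y) \<le> s" for x y
    using R[of y] that norm_triangle_ineq2[of x y] by auto
  note I = W_bump_double_integral[OF s cc z]
  have t: "(\<integral>x. \<bar>f (x - z)\<bar> powr p \<partial>lebesgue) = (\<integral>x. \<bar>f x\<bar> powr p \<partial>lebesgue)" for z
    using integral_translate[OF Cc_cont[OF Cp], of "- z"] by simp
  have "(\<integral>x. \<bar>W bump s x f\<bar> powr p \<partial>lebesgue)
      \<le> (\<integral>x. mass TYPE('a) powr (p - 1) * W bump s x (\<lambda>y. \<bar>f y\<bar> powr p) \<partial>lebesgue)"
    using Cc_integrable[OF Cc_powr[OF Cc_W_bump[OF f s], of p]] p I(1)
    by (intro integral_mono W_bump_jensen Cc_cont f s) auto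
  also have "\<dots> = mass TYPE('a) powr (p - 1) * (mass TYPE('a) * (\<integral>x. \<bar>f x\<bar> powr p \<partial>lebesgue))"
    using s by (simp add: I(2) t bump_scaled_integral)
  also have "\<dots> = mass TYPE('a) powr p * (\<integral>x. \<bar>f x\<bar> powr p \<partial>lebesgue)"
    using mass_pos[where 'a='a] by (simp add: powr_diff)
  finally show ?thesis .
qed

text \<open>Jensen reduces the left-hand side to an average, over shifts |z| \<le> s, of the squared
  L^2 norm of f x - f (x - z), and \<open>translation_estimate\<close> bounds each of these by s^2
  times the squared norm of the gradient.\<close>

lemma W_bump_poincare:
  fixes f :: "'a::euclidean_space \<Rightarrow> real"
  assumes f: "C1c f" and s: "s > 0"
  shows "n2 (\<lambda>x. mass TYPE('a) * f x - W bump s x f) \<le> mass TYPE('a) * s * n2 (grad f)"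
proof (rule power2_le_imp_le)
  let ?m = "mass TYPE('a)"
  note m = mass_pos[where 'a='a]
  have Cf: "Cc f" using f by (rule C1c_Cc)
  note cf = Cc_cont[OF Cf]
  obtain L where L: "L > 0" "kern L (bump::'a\<Rightarrow>real)" using kern_bumps by blast
  obtain R where R: "\<And>x. R < norm x \<Longrightarrow> f x = 0" using f C1c_def by metis
  have c2: "continuous_on UNIV (\<lambda>(x, y). (f x - f y)\<^sup>2)"
    unfolding case_prod_beta'
    by (intro continuous_intros continuous_on_compose2[OF cf, of UNIV fst] continuous_on_compose2[OF cf, of UNIV snd]) simp_all
  have z: "(f x - f y)\<^sup>2 = 0" if "R + s < norm x" "norm (x - y) \<le> s" for x y
    using R[of y] R[of x] that s norm_triangle_ineq2[of x y] by auto
  note I = W_bump_double_integral[OF s c2 z]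
  have d: "?m * f x - W bump s x f = W bump s x (\<lambda>y. f x - f y)" for x
  proof -
    have "integrable lebesgue (\<lambda>y. bump ((x - y) /\<^sub>R s) * f y)" "integrable lebesgue (\<lambda>y. bump ((x - y) /\<^sub>R s) * f x)"
      by (intro Cc_integrable Cc_times Cc_bump_scaled s cf continuous_intros)+
    then have "W bump s x (\<lambda>y. f x - f y) = W bump s x (\<lambda>y. f x) - W bump s x f"
      by (simp add: W_def right_diff_distrib diff_divide_distrib)
    then show ?thesis using s by (simp add: W_bump_const)
  qed
  have j: "(?m * f x - W bump s x f)\<^sup>2 \<le> ?m * W bump s x (\<lambda>y. (f x - f y)\<^sup>2)" for x
    using W_bump_jensen[of "\<lambda>y. f x - f y" s 2 x] s m cf unfolding d
    by (simp add: continuous_on_diff)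
  have T: "(\<integral>x. (f x - f (x - z))\<^sup>2 \<partial>lebesgue) \<le> (norm z * n2 (grad f))\<^sup>2" for z
  proof -
    have "(\<integral>x. (f x - f (x - z))\<^sup>2 \<partial>lebesgue) = (n2 (\<lambda>x. f (x + - z) - f x))\<^sup>2"
      unfolding n2_square by (simp add: power2_commute)
    also have "\<dots> \<le> (norm (- z) * n2 (grad f))\<^sup>2"
      by (intro power_mono translation_estimate f) simp
    finally show ?thesis by simp
  qed
  have Cz: "Cc (\<lambda>z::'a. bump (z /\<^sub>R s))"
    using Cc_bump_scaled[OF s, of 0] by (simp add: bump_def)
  \<comment> \<open>Integrability in z is deduced from continuity: expanding the square leaves a
    constant and the autocorrelation J, which is Lipschitz in z.\<close>
  have ct: "continuous_on UNIV (\<lambda>z. \<integral>x. (f x - f (x - z))\<^sup>2 \<partial>lebesgue)"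
  proof -
    define J where "J z = (\<integral>x. f x * f (x - z) \<partial>lebesgue)" for z
    have J: "J z = W (\<lambda>_. 1) 1 0 (\<lambda>x. f x * f (x - z))" for z by (simp add: J_def W_def)
    obtain B where B: "B > 0" "\<And>x y. \<bar>f x - f y\<bar> \<le> B * norm (x - y)" using C1c_lipschitz[OF f] by metis
    have iJ: "integrable lebesgue (\<lambda>x. f x * f (x - z))" for z
      using Cc_integrable[OF Cc_times[OF Cf Cc_cont[OF Cc_translate[OF Cf, of "- z"]]]] by simp
    define A where "A = (\<integral>x. \<bar>f x\<bar> \<partial>lebesgue)"
    have "dist (J z) (J z') \<le> (A * B) * dist z z'" for z z'
    proof -
      have "J z - J z' = (\<integral>x. f x * (f (x - z) - f (x - z')) \<partial>lebesgue)"
        using iJ by (simp add: J_def right_diff_distrib)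
      also have "\<bar>\<dots>\<bar> \<le> (\<integral>x. \<bar>f x * (f (x - z) - f (x - z'))\<bar> \<partial>lebesgue)" by (rule integral_abs_bound)
      also have "\<dots> \<le> (\<integral>x. \<bar>f x\<bar> * (B * norm (z - z')) \<partial>lebesgue)"
      proof (rule integral_mono)
        show "integrable lebesgue (\<lambda>x. \<bar>f x * (f (x - z) - f (x - z'))\<bar>)"
          using iJ by (simp add: right_diff_distrib)
        show "integrable lebesgue (\<lambda>x. \<bar>f x\<bar> * (B * norm (z - z')))"
          using Cc_integrable[OF Cf] by simp
        show "\<bar>f x * (f (x - z) - f (x - z'))\<bar> \<le> \<bar>f x\<bar> * (B * norm (z - z'))" for x
          unfolding abs_mult using B(2)[of "x - z" "x - z'"]
          by (intro mult_left_mono) (auto simp: norm_minus_commute)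
      qed
      finally show ?thesis by (simp add: A_def dist_norm mult_ac)
    qed
    then have cJ: "continuous_on UNIV J"
    proof -
      have "(A * B)-lipschitz_on UNIV J"
        using \<open>\<And>z z'. dist (J z) (J z') \<le> (A * B) * dist z z'\<close> B
        by (intro lipschitz_onI) (auto simp: A_def intro!: mult_nonneg_nonneg integral_nonneg_AE)
      then show ?thesis by (rule lipschitz_on_continuous_on)
    qed
    have C2: "Cc (\<lambda>x. (f x)\<^sup>2)" using Cc_norm_power2[OF Cf] by simp
    have "(\<integral>x. (f x - f (x - z))\<^sup>2 \<partial>lebesgue) = 2 * (\<integral>x. (f x)\<^sup>2 \<partial>lebesgue) - 2 * J z" for z
    proof -
      have "(\<lambda>x. (f x - f (x - z))\<^sup>2) = (\<lambda>x. (f x)\<^sup>2 + (f (x - z))\<^sup>2 - 2 * (f x * f (x - z)))"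
        by (auto simp: power2_diff)
      moreover have "(\<integral>x. (f (x - z))\<^sup>2 \<partial>lebesgue) = (\<integral>x. (f x)\<^sup>2 \<partial>lebesgue)"
        using integral_translate[OF Cc_cont[OF C2], of "- z"] by simp
      moreover have "integrable lebesgue (\<lambda>x. (f (x - z))\<^sup>2)"
        using Cc_integrable[OF Cc_translate[OF C2, of "- z"]] by simp
      ultimately show ?thesis using Cc_integrable[OF C2] iJ[of z] by (simp add: J_def)
    qed
    then show ?thesis using cJ by (simp add: continuous_intros)
  qed
  have "(n2 (\<lambda>x. ?m * f x - W bump s x f))\<^sup>2 = (\<integral>x. (?m * f x - W bump s x f)\<^sup>2 \<partial>lebesgue)"
    by (simp add: n2_square)
  also have "\<dots> \<le> (\<integral>x. ?m * W bump s x (\<lambda>y. (f x - f y)\<^sup>2) \<partial>lebesgue)"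
  proof (rule integral_mono[OF _ _ j])
    show "integrable lebesgue (\<lambda>x. (?m * f x - W bump s x f)\<^sup>2)"
      using Cc_integrable[OF Cc_norm_power2[OF Cc_diff[OF Cc_cmult[OF Cf] Cc_W_bump[OF Cf s]]]] by simp
    show "integrable lebesgue (\<lambda>x. ?m * W bump s x (\<lambda>y. (f x - f y)\<^sup>2))" using I(1) by simp
  qed
  also have "\<dots> = ?m * ((\<integral>z. bump (z /\<^sub>R s) * (\<integral>x. (f x - f (x - z))\<^sup>2 \<partial>lebesgue) \<partial>lebesgue) / s ^ DIM('a))"
    by (simp add: I(2))
  also have "\<dots> \<le> ?m * ((\<integral>z. bump ((z::'a) /\<^sub>R s) * (s * n2 (grad f))\<^sup>2 \<partial>lebesgue) / s ^ DIM('a))"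
  proof (rule mult_left_mono[OF divide_right_mono[OF integral_mono]])
    show "integrable lebesgue (\<lambda>z. bump (z /\<^sub>R s) * (\<integral>x. (f x - f (x - z))\<^sup>2 \<partial>lebesgue))"
      by (intro Cc_integrable Cc_times Cz ct)
    show "integrable lebesgue (\<lambda>z::'a. bump (z /\<^sub>R s) * (s * n2 (grad f))\<^sup>2)"
      using Cc_integrable[OF Cz] by simp
    fix z :: 'a
    show "bump (z /\<^sub>R s) * (\<integral>x. (f x - f (x - z))\<^sup>2 \<partial>lebesgue) \<le> bump (z /\<^sub>R s) * (s * n2 (grad f))\<^sup>2"
    proof (cases "norm z \<le> s")
      case True
      then have "(norm z * n2 (grad f))\<^sup>2 \<le> (s * n2 (grad f))\<^sup>2"
        by (intro power_mono mult_right_mono) auto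
      then show ?thesis using T[of z] by (intro mult_left_mono) (auto simp: bump_nonneg)
    next
      case False
      then have "1 \<le> norm (z /\<^sub>R s)" using s by (simp add: divide_inverse[symmetric] mult.commute[of "inverse s"])
      then show ?thesis by (simp add: bump_zero)
    qed
  qed (use s m in auto)
  also have "\<dots> = (?m * s * n2 (grad f))\<^sup>2"
    using s by (simp add: bump_scaled_integral power2_eq_square)
  finally show "(n2 (\<lambda>x. ?m * f x - W bump s x f))\<^sup>2 \<le> (?m * s * n2 (grad f))\<^sup>2" .
qed (use s mass_pos[where 'a='a] in auto)

lemma W_bump_approx:
  fixes f :: "'a::euclidean_space \<Rightarrow> real"
  assumes f: "continuous_on UNIV f" and s: "s > 0"
    and B: "\<And>y. norm (x - y) \<le> s \<Longrightarrow> \<bar>f x - f y\<bar> \<le> B"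
  shows "\<bar>mass TYPE('a) * f x - W bump s x f\<bar> \<le> mass TYPE('a) * B"
proof -
  obtain L where L: "L > 0" "kern L (bump::'a\<Rightarrow>real)" using kern_bumps by blast
  have i: "integrable lebesgue (\<lambda>y. bump ((x - y) /\<^sub>R s) * f y)" "integrable lebesgue (\<lambda>y. bump ((x - y) /\<^sub>R s) * f x)"
    "integrable lebesgue (\<lambda>y. bump ((x - y) /\<^sub>R s) * B)"
    by (intro Cc_integrable Cc_times Cc_bump_scaled s f continuous_intros)+
  have "mass TYPE('a) * f x - W bump s x f = (\<integral>y. bump ((x - y) /\<^sub>R s) * (f x - f y) \<partial>lebesgue) / s ^ DIM('a)"
    using i W_bump_const[OF s, of x "f x"] by (simp add: W_def right_diff_distrib diff_divide_distrib)
  also have "\<bar>\<dots>\<bar> \<le> (\<integral>y. bump ((x - y) /\<^sub>R s) * B \<partial>lebesgue) / s ^ DIM('a)"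
  proof -
    have "\<bar>\<integral>y. bump ((x - y) /\<^sub>R s) * (f x - f y) \<partial>lebesgue\<bar> \<le> (\<integral>y. \<bar>bump ((x - y) /\<^sub>R s) * (f x - f y)\<bar> \<partial>lebesgue)"
      by (rule integral_abs_bound)
    also have "\<dots> \<le> (\<integral>y. bump ((x - y) /\<^sub>R s) * B \<partial>lebesgue)"
    proof (rule integral_mono)
      fix y
      show "\<bar>bump ((x - y) /\<^sub>R s) * (f x - f y)\<bar> \<le> bump ((x - y) /\<^sub>R s) * B"
        using B[of y] kern_zero[OF L(2) s, of x y] bump_nonneg[of "(x - y) /\<^sub>R s"]
        by (cases "norm (x - y) \<le> s") (auto simp: abs_mult intro: mult_left_mono)
    qed (use i in \<open>auto simp: right_diff_distrib\<close>)
    finally show ?thesis using s by (simp add: abs_divide divide_right_mono)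
  qed
  also have "\<dots> = mass TYPE('a) * B" using W_bump_const[OF s, of x B] by (simp add: W_def)
  finally show ?thesis .
qed

text \<open>The constant comes from the Lipschitz constant and the support of f. Its dependence on f
  is harmless, since the estimate is applied to a fixed f while s tends to 0.\<close>

lemma W_bump_approx_Lp:
  fixes f :: "'a::euclidean_space \<Rightarrow> real"
  assumes f: "C1c f" and p: "p > 1"
  obtains C where "\<And>s. 0 < s \<Longrightarrow> s \<le> 1 \<Longrightarrow> (\<integral>x. \<bar>f x - W bump s x f / mass TYPE('a)\<bar> powr p \<partial>lebesgue) \<le> C * s powr p"
proof -
  let ?m = "mass TYPE('a)"
  note m = mass_pos[where 'a='a]
  have Cf: "Cc f" using f by (rule C1c_Cc)
  obtain B where B: "B > 0" "\<And>x y. \<bar>f x - f y\<bar> \<le> B * norm (x - y)" using C1c_lipschitz[OF f] by metis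
  obtain R where R: "\<And>x. R < norm x \<Longrightarrow> f x = 0" using f C1c_def by metis
  obtain L where L: "L > 0" "kern L (bump::'a\<Rightarrow>real)" using kern_bumps by blast
  define V where "V = (\<integral>x. indicator (cball (0::'a) (R + 1)) x \<partial>lebesgue :: real)"
  have "(\<integral>x. \<bar>f x - W bump s x f / ?m\<bar> powr p \<partial>lebesgue) \<le> (B powr p * V) * s powr p" if s: "0 < s" "s \<le> 1" for s
  proof -
    have a: "\<bar>f x - W bump s x f / ?m\<bar> \<le> B * s" for x
    proof -
      have "\<bar>f x - f y\<bar> \<le> B * s" if "norm (x - y) \<le> s" for y
        using B(2)[of x y] mult_left_mono[OF that, of B] B(1) by linarith
      from W_bump_approx[OF Cc_cont[OF Cf] s(1) this]
      have "\<bar>?m * f x - W bump s x f\<bar> \<le> ?m * (B * s)" by blast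
      moreover have "?m * f x - W bump s x f = ?m * (f x - W bump s x f / ?m)" using m by (simp add: field_simps)
      ultimately show ?thesis using m by (simp add: abs_mult)
    qed
    have z: "f x - W bump s x f / ?m = 0" if x: "R + 1 < norm x" for x
    proof -
      have "bump ((x - y) /\<^sub>R s) * f y = 0" for y
      proof (cases "norm y \<le> R")
        case True
        then have "s < norm (x - y)" using x s norm_triangle_ineq2[of x y] by simp
        then show ?thesis using kern_zero[OF L(2) s(1)] by simp
      qed (use R in auto)
      then have "(\<lambda>y. bump ((x - y) /\<^sub>R s) * f y) = (\<lambda>y. 0)" by blast
      moreover have "f x = 0" using x by (intro R) simp
      ultimately show ?thesis by (simp add: W_def)
    qed
    have "(\<integral>x. \<bar>f x - W bump s x f / ?m\<bar> powr p \<partial>lebesgue) \<le> (\<integral>x. (B * s) powr p * indicator (cball (0::'a) (R + 1)) x \<partial>lebesgue)"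
    proof (rule integral_mono)
      show "integrable lebesgue (\<lambda>x. \<bar>f x - W bump s x f / ?m\<bar> powr p)"
        using Cc_integrable[OF Cc_powr[OF Cc_diff[OF Cf Cc_cmult[OF Cc_W_bump[OF Cf s(1)], of "1 / ?m"]], of p]] p
        by simp
      show "\<bar>f x - W bump s x f / ?m\<bar> powr p \<le> (B * s) powr p * indicator (cball 0 (R + 1)) x" for x
        using z[of x] powr_mono2[of p "\<bar>f x - W bump s x f / ?m\<bar>" "B * s"] a[of x] p
        by (auto simp: indicator_def not_le)
    qed (rule integrable_indicator_cball)
    also have "\<dots> = (B * s) powr p * V" by (simp add: V_def)
    also have "\<dots> = (B powr p * V) * s powr p" using B s by (simp add: powr_mult)
    finally show ?thesis .
  qed
  then show ?thesis by (rule that)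
qed

section \<open>The Sobolev inequality\<close>

text \<open>A quadratic spline going from 0 to 1 on the unit interval with vanishing slope at both
  ends. It replaces the piecewise linear clamp so that truncations stay continuously
  differentiable.\<close>

definition ramp :: "real \<Rightarrow> real" where
  "ramp x = 2 * (max 0 x)\<^sup>2 - 4 * (max 0 (x - 1/2))\<^sup>2 + 2 * (max 0 (x - 1))\<^sup>2"

definition ramp' :: "real \<Rightarrow> real" where
  "ramp' x = 4 * max 0 x - 8 * max 0 (x - 1/2) + 4 * max 0 (x - 1)"

lemma max_0_power2_deriv: "((\<lambda>x::real. (max 0 x)\<^sup>2) has_real_derivative 2 * max 0 x) (at x)"
proof -
  consider "x > 0" | "x < 0" | "x = 0" by linarith
  then show ?thesis
  proof cases
    case 1
    have "((\<lambda>x::real. x\<^sup>2) has_real_derivative 2 * max 0 x) (at x)"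
      using 1 by (auto intro!: derivative_eq_intros)
    then show ?thesis
      using 1 by (elim has_field_derivative_transform_within_open[where S="{0<..}"]) auto
  next
    case 2
    have "((\<lambda>x::real. 0) has_real_derivative 2 * max 0 x) (at x)"
      using 2 by auto
    then show ?thesis
      using 2 by (elim has_field_derivative_transform_within_open[where S="{..<0}"]) auto
  next
    case 3
    have "((\<lambda>h::real. ((max 0 h)\<^sup>2 - 0) / h) \<longlongrightarrow> 0) (at 0)"
    proof (rule Lim_null_comparison[where g="\<lambda>h. \<bar>h\<bar>"])
      show "\<forall>\<^sub>F h in at 0. norm (((max 0 h)\<^sup>2 - 0) / h) \<le> \<bar>h::real\<bar>"
        by (intro always_eventually allI) (auto simp: max_def power2_eq_square)
      show "((\<lambda>h::real. \<bar>h\<bar>) \<longlongrightarrow> 0) (at 0)" by (rule tendsto_rabs_zero) (rule tendsto_ident_at)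
    qed
    then show ?thesis using 3 by (simp add: has_field_derivative_iff)
  qed
qed

lemma ramp_deriv: "(ramp has_real_derivative ramp' x) (at x)"
proof -
  have s: "((\<lambda>x. (max 0 (x - c))\<^sup>2) has_real_derivative 2 * max 0 (x - c)) (at x)" for c
  proof -
    have "((\<lambda>x. x - c) has_real_derivative 1) (at x)" by (auto intro!: derivative_eq_intros)
    from DERIV_chain2[OF max_0_power2_deriv this] show ?thesis by simp
  qed
  have "(ramp has_real_derivative 2 * (2 * max 0 x) - 4 * (2 * max 0 (x - 1/2)) + 2 * (2 * max 0 (x - 1))) (at x)"
    unfolding ramp_def[abs_def]
    by (intro DERIV_add DERIV_diff DERIV_cmult s max_0_power2_deriv)
  then show ?thesis by (simp add: ramp'_def)
qed

lemma ramp_facts: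
  "x \<le> 0 \<Longrightarrow> ramp x = 0" "x \<ge> 1 \<Longrightarrow> ramp x = 1" "0 \<le> ramp x" "ramp x \<le> 1"
  "x \<le> 0 \<or> x \<ge> 1 \<Longrightarrow> ramp' x = 0" "\<bar>ramp' x\<bar> \<le> 2"
proof -
  have "0 \<le> ramp x \<and> ramp x \<le> 1"
  proof -
    consider "x \<le> 0" | "0 \<le> x" "x \<le> 1/2" | "1/2 \<le> x" "x \<le> 1" | "1 \<le> x" by linarith
    then show ?thesis
    proof cases
      case 2
      then have "x\<^sup>2 \<le> (1/2)\<^sup>2" by (intro power_mono) auto
      moreover have "ramp x = 2 * x\<^sup>2" using 2 by (simp add: ramp_def max_def)
      ultimately show ?thesis by (simp add: power2_eq_square)
    next
      case 3
      then have "(1 - x)\<^sup>2 \<le> (1/2)\<^sup>2" by (intro power_mono) auto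
      moreover have "ramp x = 1 - 2 * (1 - x)\<^sup>2"
        using 3 by (auto simp: ramp_def max_def power2_eq_square field_simps)
      ultimately show ?thesis by (simp add: power2_eq_square)
    qed (auto simp: ramp_def max_def power2_eq_square field_simps)
  qed
  then show "0 \<le> ramp x" "ramp x \<le> 1" by auto
qed (auto simp: ramp_def ramp'_def max_def power2_eq_square field_simps abs_if split: if_splits)

text \<open>The square of f is truncated rather than its absolute value, which keeps
  differentiability at the zeros of f. The affine map inside sends |f| = l to 0 and |f| = 2 l to
  1.\<close>

definition trunc :: "real \<Rightarrow> ('a::euclidean_space \<Rightarrow> real) \<Rightarrow> 'a \<Rightarrow> real" where
  "trunc l f x = l * ramp (((f x)\<^sup>2 / l\<^sup>2 - 1) / 3)"

lemma trunc_facts: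
  assumes "l > 0"
  shows "0 \<le> trunc l f x" "trunc l f x \<le> l" "\<bar>f x\<bar> \<le> l \<Longrightarrow> trunc l f x = 0" "2 * l \<le> \<bar>f x\<bar> \<Longrightarrow> trunc l f x = l"
proof -
  show "0 \<le> trunc l f x" "trunc l f x \<le> l"
    using assms ramp_facts(3,4) by (auto simp: trunc_def mult_left_le)
  show "trunc l f x = 0" if "\<bar>f x\<bar> \<le> l"
  proof -
    have "(f x)\<^sup>2 \<le> l\<^sup>2" using that assms by (intro abs_le_square_iff[THEN iffD1]) auto
    then show ?thesis using assms by (simp add: trunc_def ramp_facts(1))
  qed
  show "trunc l f x = l" if "2 * l \<le> \<bar>f x\<bar>"
  proof -
    have "(2 * l)\<^sup>2 \<le> (f x)\<^sup>2" using that assms by (intro abs_le_square_iff[THEN iffD1]) auto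
    then have "4 \<le> (f x)\<^sup>2 / l\<^sup>2" using assms by (simp add: field_simps power_mult_distrib)
    then show ?thesis using assms by (simp add: trunc_def ramp_facts(2))
  qed
qed

lemma trunc_C1c:
  fixes f :: "'a::euclidean_space \<Rightarrow> real"
  assumes f: "C1c f" and l: "l > 0"
  shows "C1c (trunc l f)"
    and "norm (grad (trunc l f) x) \<le> 3 * (indicator {x. l < \<bar>f x\<bar> \<and> \<bar>f x\<bar> < 2 * l} x * norm (grad f x))"
proof -
  define c where "c x = 2 * f x / (3 * l) * ramp' (((f x)\<^sup>2 / l\<^sup>2 - 1) / 3)" for x
  have d: "(trunc l f has_derivative (\<lambda>h. (c x *\<^sub>R grad f x) \<bullet> h)) (at x)" for x
  proof -
    have "((\<lambda>t. l * ramp ((t\<^sup>2 / l\<^sup>2 - 1) / 3)) has_real_derivative c x) (at (f x))"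
    proof -
      have "((\<lambda>t. (t\<^sup>2 / l\<^sup>2 - 1) / 3) has_real_derivative (2 * f x / l\<^sup>2 / 3)) (at (f x))"
      proof -
        have "((\<lambda>t. t\<^sup>2) has_real_derivative 2 * f x) (at (f x))"
          using DERIV_pow[of 2 "f x" UNIV] by simp
        from DERIV_cdivide[OF DERIV_diff[OF DERIV_cdivide[OF this, of "l\<^sup>2"] DERIV_const[of 1]], of 3]
        show ?thesis by simp
      qed
      from DERIV_cmult[OF DERIV_chain2[OF ramp_deriv this], of l] show ?thesis
        using l by (simp add: c_def power2_eq_square mult_ac)
    qed
    from has_derivative_compose[OF C1c_deriv[OF f] this[unfolded has_field_derivative_def]]
    show ?thesis by (simp add: trunc_def[abs_def] mult_ac)
  qed
  have g: "grad (trunc l f) x = c x *\<^sub>R grad f x" for x by (rule grad_unique[OF d])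
  have cf: "continuous_on UNIV f" by (intro Cc_cont C1c_Cc f)
  have "continuous_on UNIV ramp'" unfolding ramp'_def[abs_def] by (intro continuous_intros)
  then have "continuous_on UNIV (\<lambda>x. ramp' (((f x)\<^sup>2 / l\<^sup>2 - 1) / 3))"
    by (rule continuous_on_compose2[of UNIV _ UNIV "\<lambda>x. ((f x)\<^sup>2 / l\<^sup>2 - 1) / 3"])
      (use l in \<open>auto intro!: continuous_intros cf\<close>)
  then have "continuous_on UNIV c"
    unfolding c_def[abs_def] using l by (intro continuous_intros cf) auto
  then have "continuous_on UNIV (\<lambda>x. c x *\<^sub>R grad f x)"
    by (intro continuous_on_scaleR Cc_cont[OF Cc_grad[OF f]])
  then have "continuous_on UNIV (grad (trunc l f))" by (simp add: g[abs_def])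
  moreover have "trunc l f differentiable (at x)" for x using d differentiable_def by blast
  moreover obtain R where "\<forall>x. R < norm x \<longrightarrow> f x = 0" using f C1c_def by metis
  then have "\<forall>x. R < norm x \<longrightarrow> trunc l f x = 0" using trunc_facts(3)[OF l, of f] l by simp
  ultimately show "C1c (trunc l f)" unfolding C1c_def by blast
  show "norm (grad (trunc l f) x) \<le> 3 * (indicator {x. l < \<bar>f x\<bar> \<and> \<bar>f x\<bar> < 2 * l} x * norm (grad f x))"
  proof (cases "l < \<bar>f x\<bar> \<and> \<bar>f x\<bar> < 2 * l")
    case True
    have "\<bar>c x\<bar> = (2 * \<bar>f x\<bar> / (3 * l)) * \<bar>ramp' (((f x)\<^sup>2 / l\<^sup>2 - 1) / 3)\<bar>"
      using l by (simp add: c_def abs_mult abs_divide)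
    \<comment> \<open>In the band |f| < 2 l the first factor is at most 4/3, and the slope of the
      ramp is at most 2; the product 8/3 is rounded up to 3.\<close>
    also have "\<dots> \<le> (4/3) * 2"
      using True l by (intro mult_mono ramp_facts) (auto simp: field_simps)
    finally have "\<bar>c x\<bar> \<le> 3" by simp
    then show ?thesis using True by (simp add: g mult_right_mono)
  next
    case False
    have "((f x)\<^sup>2 / l\<^sup>2 - 1) / 3 \<le> 0 \<or> 1 \<le> ((f x)\<^sup>2 / l\<^sup>2 - 1) / 3"
    proof (cases "\<bar>f x\<bar> \<le> l")
      case True
      then have "(f x)\<^sup>2 \<le> l\<^sup>2" using l by (intro abs_le_square_iff[THEN iffD1]) auto
      then show ?thesis using l by simp
    next
      case False
      with \<open>\<not> (l < \<bar>f x\<bar> \<and> \<bar>f x\<bar> < 2 * l)\<close> have "2 * l \<le> \<bar>f x\<bar>" by linarith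
      then have "(2 * l)\<^sup>2 \<le> (f x)\<^sup>2" using l by (intro abs_le_square_iff[THEN iffD1]) auto
      then show ?thesis using l by (simp add: field_simps power_mult_distrib)
    qed
    then have "c x = 0" using ramp_facts(5) by (simp add: c_def)
    then show ?thesis by (simp add: g)
  qed
qed

section \<open>Dyadic level sets\<close>

lemma level_set_measurable:
  fixes f :: "'a::euclidean_space \<Rightarrow> real"
  assumes "Cc f" "l > 0"
  shows "{x. l < \<bar>f x\<bar>} \<in> lmeasurable"
proof -
  have "open {x. l < \<bar>f x\<bar>}"
    using Cc_cont[OF assms(1)] by (intro open_Collect_less continuous_intros) auto
  moreover obtain R where "\<And>x. R < norm x \<Longrightarrow> f x = 0" using assms(1) Cc_def by metis
  then have "{x. l < \<bar>f x\<bar>} \<subseteq> cball 0 R" using assms(2) by (force simp: not_le[symmetric])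
  then have "bounded {x. l < \<bar>f x\<bar>}" using bounded_cball bounded_subset by blast
  ultimately show ?thesis using lmeasurable_open by blast
qed

lemma band_sets:
  fixes f :: "'a::euclidean_space \<Rightarrow> real"
  assumes "Cc f" shows "{x. l < \<bar>f x\<bar> \<and> \<bar>f x\<bar> < u} \<in> sets lebesgue"
proof -
  have "open {x. l < \<bar>f x\<bar> \<and> \<bar>f x\<bar> < u}"
    using Cc_cont[OF assms] by (intro open_Collect_conj open_Collect_less continuous_intros) auto
  then show ?thesis by simp
qed

text \<open>Mollify the truncation at a scale so large that its average drops to half of the maximal
  value l. Where |f| > 2 l the truncation equals l, so it differs from its average by at least l /
  2; Chebyshev's inequality and \<open>W_bump_poincare\<close> bound the measure of that set by the
  energy in the band between l and 2 l.\<close>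

lemma level_step:
  fixes f :: "'a::euclidean_space \<Rightarrow> real"
  assumes f: "C1c f" and l: "l > 0"
  defines "a \<equiv> measure lebesgue {x. l < \<bar>f x\<bar>}"
  shows "l\<^sup>2 * measure lebesgue {x. 2 * l < \<bar>f x\<bar>}
    \<le> 36 * (2 / mass TYPE('a)) powr (2 / DIM('a)) * a powr (2 / DIM('a)) *
      (\<integral>x. indicator {x. l < \<bar>f x\<bar> \<and> \<bar>f x\<bar> < 2 * l} x * (norm (grad f x))\<^sup>2 \<partial>lebesgue)"
proof -
  let ?m = "mass TYPE('a)" and ?A = "{x. l < \<bar>f x\<bar>}" and ?B = "{x. 2 * l < \<bar>f x\<bar>}"
  let ?E = "\<integral>x. indicator {x. l < \<bar>f x\<bar> \<and> \<bar>f x\<bar> < 2 * l} x * (norm (grad f x))\<^sup>2 \<partial>lebesgue"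
  note m = mass_pos[where 'a='a]
  have Cf: "Cc f" using f by (rule C1c_Cc)
  have mA: "?A \<in> lmeasurable" "?B \<in> lmeasurable" using level_set_measurable[OF Cf] l by auto
  have a0: "a \<ge> 0" by (simp add: a_def)
  have E0: "?E \<ge> 0" by (intro integral_nonneg_AE) auto
  have BA: "measure lebesgue ?B \<le> a"
    unfolding a_def using mA l by (intro measure_mono_fmeasurable) auto
  show ?thesis
  proof (cases "a = 0")
    case True
    then have "measure lebesgue ?B = 0" using BA measure_nonneg[of lebesgue ?B] by linarith
    then show ?thesis using E0 by (simp add: True)
  next
    case False
    then have a: "a > 0" using a0 by linarith
    \<comment> \<open>The truncation is at most l, is supported in a set of measure a, and the
      kernel is at most 1, so its convolution is at most l a / s^N. This choice makes that equal to
      \<open>?m * l / 2\<close>.\<close>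
    define s where "s = (2 * a / ?m) powr (1 / DIM('a))"
    have s: "s > 0" using a m by (simp add: s_def)
    have sN: "s ^ DIM('a) = 2 * a / ?m"
      using a m by (simp add: s_def powr_realpow[symmetric] powr_powr)
    have s2: "s\<^sup>2 = (2 / ?m) powr (2 / DIM('a)) * a powr (2 / DIM('a))"
    proof -
      have "s\<^sup>2 = (2 * a / ?m) powr (2 / DIM('a))"
        using a m by (simp add: s_def powr_realpow[symmetric] powr_powr)
      also have "2 * a / ?m = (2 / ?m) * a" by simp
      also have "\<dots> powr (2 / DIM('a)) = (2 / ?m) powr (2 / DIM('a)) * a powr (2 / DIM('a))"
        using a m by (simp only: powr_mult)
      finally show ?thesis .
    qed
    let ?c = "trunc l f"
    note C = trunc_C1c[OF f l]
    have Cct: "Cc ?c" using C(1) by (rule C1c_Cc)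
    have Wb: "W bump s x ?c \<le> ?m * l / 2" for x
    proof -
      have "(\<integral>y. bump ((x - y) /\<^sub>R s) * ?c y \<partial>lebesgue) \<le> (\<integral>y. l * indicator ?A y \<partial>lebesgue)"
      proof (rule integral_mono)
        show "integrable lebesgue (\<lambda>y. bump ((x - y) /\<^sub>R s) * ?c y)"
          by (intro Cc_integrable Cc_times Cc_bump_scaled s Cc_cont[OF Cct])
        show "integrable lebesgue (\<lambda>y. l * indicator ?A y)"
          using mA by (intro integrable_mult_right integrable_real_indicator) (auto simp: fmeasurable_def)
        show "bump ((x - y) /\<^sub>R s) * ?c y \<le> l * indicator ?A y" for y
          using trunc_facts[OF l, of f y] bump_le_1[of "(x - y) /\<^sub>R s"] bump_nonneg[of "(x - y) /\<^sub>R s"]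
            mult_mono[of "bump ((x - y) /\<^sub>R s)" 1 "?c y" l]
          by (cases "l < \<bar>f y\<bar>") auto
      qed
      also have "\<dots> = l * a" using mA by (simp add: a_def)
      finally have "W bump s x ?c \<le> l * a / s ^ DIM('a)" unfolding W_def using s by (intro divide_right_mono) auto
      also have "\<dots> = ?m * l / 2" using a m by (simp add: sN)
      finally show ?thesis .
    qed
    have L2d: "L2 (\<lambda>x. ?m * ?c x - W bump s x ?c)"
      by (intro L2_Cc Cc_diff Cc_cmult Cct Cc_W_bump s)
    have "(?m * l / 2)\<^sup>2 * measure lebesgue ?B = (\<integral>x. (?m * l / 2)\<^sup>2 * indicator ?B x \<partial>lebesgue)"
      using mA by simp
    also have "\<dots> \<le> (\<integral>x. (?m * ?c x - W bump s x ?c)\<^sup>2 \<partial>lebesgue)"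
    proof (rule integral_mono)
      show "integrable lebesgue (\<lambda>x. (?m * l / 2)\<^sup>2 * indicator ?B x)"
        using mA by (intro integrable_mult_right integrable_real_indicator) (auto simp: fmeasurable_def)
      show "integrable lebesgue (\<lambda>x. (?m * ?c x - W bump s x ?c)\<^sup>2)" using L2d by (simp add: L2_def)
      show "(?m * l / 2)\<^sup>2 * indicator ?B x \<le> (?m * ?c x - W bump s x ?c)\<^sup>2" for x
      proof (cases "2 * l < \<bar>f x\<bar>")
        case True
        then have "?c x = l" using trunc_facts(4)[OF l, of f x] by simp
        then have "?m * l / 2 \<le> ?m * ?c x - W bump s x ?c" using Wb[of x] by (simp add: mult.commute)
        then have "(?m * l / 2)\<^sup>2 \<le> (?m * ?c x - W bump s x ?c)\<^sup>2" using m l by (intro power_mono) auto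
        then show ?thesis by (simp add: indicator_def)
      qed simp
    qed
    also have "\<dots> = (n2 (\<lambda>x. ?m * ?c x - W bump s x ?c))\<^sup>2" by (simp add: n2_square)
    also have "\<dots> \<le> (?m * s * n2 (grad ?c))\<^sup>2"
      by (intro power_mono W_bump_poincare C s) simp
    also have "\<dots> = ?m\<^sup>2 * s\<^sup>2 * (n2 (grad ?c))\<^sup>2" by (simp add: power_mult_distrib)
    also have "\<dots> \<le> ?m\<^sup>2 * s\<^sup>2 * (9 * ?E)"
    proof (rule mult_left_mono)
      have "(n2 (grad ?c))\<^sup>2 \<le> (\<integral>x. 9 * (indicator {x. l < \<bar>f x\<bar> \<and> \<bar>f x\<bar> < 2 * l} x * (norm (grad f x))\<^sup>2) \<partial>lebesgue)"
        unfolding n2_square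
      proof (rule integral_mono)
        show "integrable lebesgue (\<lambda>x. (norm (grad ?c x))\<^sup>2)"
          using L2_Cc[OF Cc_grad[OF C(1)]] by (simp add: L2_def)
        show "integrable lebesgue (\<lambda>x. 9 * (indicator {x. l < \<bar>f x\<bar> \<and> \<bar>f x\<bar> < 2 * l} x * (norm (grad f x))\<^sup>2))"
          using integrable_real_mult_indicator[OF band_sets[OF Cf], of "\<lambda>x. (norm (grad f x))\<^sup>2"] L2_Cc[OF Cc_grad[OF f]]
          by (auto simp: L2_def mult.commute)
        show "(norm (grad ?c x))\<^sup>2 \<le> 9 * (indicator {x. l < \<bar>f x\<bar> \<and> \<bar>f x\<bar> < 2 * l} x * (norm (grad f x))\<^sup>2)" for x
          using power_mono[OF C(2)[of x], of 2] by (auto simp: power_mult_distrib indicator_def split: if_splits)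
      qed
      then show "(n2 (grad ?c))\<^sup>2 \<le> 9 * ?E" by simp
    qed simp
    \<comment> \<open>Here 36 = 4 * 9: the 4 comes from the half in \<open>?m * l / 2\<close>, the 9
      from the squared gradient bound of the truncation.\<close>
    finally have "?m\<^sup>2 * (l\<^sup>2 * measure lebesgue ?B) \<le> ?m\<^sup>2 * (36 * s\<^sup>2 * ?E)"
      by (simp add: power_mult_distrib power_divide field_simps)
    then have "l\<^sup>2 * measure lebesgue ?B \<le> 36 * s\<^sup>2 * ?E" using m by simp
    then show ?thesis by (simp add: s2 mult_ac)
  qed
qed

lemma two_star_facts:
  assumes "n \<ge> 3"
  shows "two_star n > 2" "two_star n - 2 = 2 * two_star n / n" "two_star n / 2 = 1 / (1 - 2 / real n)" 
    "1 / two_star n = 1 / 2 - 1 / real n"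
  using assms by (auto simp: two_star_def field_simps)

text \<open>The bands are disjoint. Bounding the sum by the indicator of t < l 2^M, and not merely
  by 1, is what carries the induction.\<close>

lemma sum_band_indicator:
  fixes l t :: real
  assumes "l > 0"
  shows "(\<Sum>n<M. if l * 2 ^ n < t \<and> t < 2 * (l * 2 ^ n) then 1 else 0) \<le> (if t < l * 2 ^ M then 1 else 0 :: real)"
proof (induction M)
  case (Suc M)
  have "l * 2 ^ M \<le> l * 2 ^ Suc M" using assms by simp
  then show ?case using Suc.IH by (auto split: if_splits)
qed simp

text \<open>A dyadic layer-cake bound. The part below the lowest level is paid for by
  \<open>l powr p\<close>, which disappears when l tends to 0.\<close>

lemma layer_bound:
  fixes l t p :: real
  assumes "l > 0" "0 \<le> t" "t \<le> l * 2 ^ Suc M" "p > 0"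
  shows "t powr p \<le> l powr p + (\<Sum>n\<le>M. (2 * (l * 2 ^ n)) powr p * (if l * 2 ^ n < t then 1 else 0))"
  using assms(3)
proof (induction M)
  case 0
  have "l powr p \<ge> 0" by simp
  with 0 show ?case using assms powr_mono2[of p t l] powr_mono2[of p t "2 * l"]
    by (cases "l < t") (auto simp: mult.commute add_increasing simp del: powr_ge_zero)
next
  case (Suc M)
  have nn: "0 \<le> (\<Sum>n\<le>M. (2 * (l * 2 ^ n)) powr p * (if l * 2 ^ n < t then 1 else 0))"
    by (intro sum_nonneg) auto
  show ?case
  proof (cases "l * 2 ^ Suc M < t")
    case True
    have "t powr p \<le> (2 * (l * 2 ^ Suc M)) powr p" using Suc.prems assms by (intro powr_mono2) auto
    then show ?thesis using True nn by (simp add: add_increasing)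
  next
    case False
    then show ?thesis using Suc.IH by simp
  qed
qed

text \<open>If S exceeds 2 a, the sublinear term accounts for at least half of S and can be divided
  out. This needs S finite in advance, hence the finitely many levels in its application.\<close>

lemma sublinear_bound:
  fixes S a K th :: real
  assumes "S \<ge> 0" "a \<ge> 0" "K \<ge> 0" "S \<le> a + K * S powr th" "0 < th" "th < 1"
  shows "S \<le> 2 * a + (2 * K) powr (1 / (1 - th))"
proof (cases "S \<le> 2 * a")
  case False
  then have S: "S > 0" "S \<le> 2 * K * S powr th" using assms by auto
  have "S powr (1 - th) = S / S powr th" using S by (simp add: powr_diff)
  also have "\<dots> \<le> 2 * K" using S by (simp add: divide_le_eq)
  finally have "(S powr (1 - th)) powr (1 / (1 - th)) \<le> (2 * K) powr (1 / (1 - th))"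
    using assms by (intro powr_mono2) auto
  then show ?thesis using S assms by (simp add: powr_powr add_increasing)
qed (simp add: add_increasing2)

text \<open>Let a n be the p-th power of the n-th level times the measure of its level set, and e n
  the energy in the n-th band. \<open>level_step\<close> becomes a (n+1) \<le> K (a n)^(2/N) e n.
  Bounding each a n inside the power by the total S and using that the bands are disjoint gives S
  \<le> a 0 + K E S^(2/N), a sublinear inequality since 2/N < 1.\<close>

lemma sobolev_integral:
  fixes f :: "'a::euclidean_space \<Rightarrow> real"
  assumes N: "DIM('a) \<ge> 3" and f: "C1c f"
  defines "p \<equiv> two_star DIM('a)"
  defines "K \<equiv> 2 powr p * (36 * (2 / mass TYPE('a)) powr (2 / DIM('a)))"
  shows "(\<integral>x. \<bar>f x\<bar> powr p \<partial>lebesgue) \<le> 2 powr p * (2 * K * (n2 (grad f))\<^sup>2) powr (p / 2)"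
proof -
  note p = two_star_facts[OF N, folded p_def]
  have Cf: "Cc f" using f by (rule C1c_Cc)
  obtain R where R: "\<And>x. R < norm x \<Longrightarrow> f x = 0" using Cf Cc_def by metis
  obtain Mx where Mx: "Mx > 0" "\<And>x. norm (f x) \<le> Mx" using Cc_bounded[OF Cf] by blast
  define V where "V = measure lebesgue (cball (0::'a) R)"
  have V: "V \<ge> 0" by (simp add: V_def)
  have K0: "K \<ge> 0" by (simp add: K_def)
  define E where "E = (n2 (grad f))\<^sup>2"
  have E0: "E \<ge> 0" by (simp add: E_def)
  have th: "0 < 2 / real DIM('a)" "2 / real DIM('a) < 1" using N by auto
  \<comment> \<open>A positive lowest level keeps every level set inside the support ball of f and
    lets V pay for the bottom layer; l is sent to 0 only at the end.\<close>
  have main: "(\<integral>x. \<bar>f x\<bar> powr p \<partial>lebesgue) \<le> (1 + 2 * 2 powr p) * V * l powr p + 2 powr p * (2 * K * E) powr (p / 2)"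
    if l: "l > 0" for l
  proof -
    define A where "A n = {x. l * 2 ^ n < \<bar>f x\<bar>}" for n :: nat
    define a where "a n = (l * 2 ^ n) powr p * measure lebesgue (A n)" for n
    define e where "e n = (\<integral>x. indicator {x. l * 2 ^ n < \<bar>f x\<bar> \<and> \<bar>f x\<bar> < 2 * (l * 2 ^ n)} x * (norm (grad f x))\<^sup>2 \<partial>lebesgue)" for n :: nat
    have An: "A n \<in> lmeasurable" for n unfolding A_def using l by (intro level_set_measurable Cf) auto
    have an: "a n \<ge> 0" for n by (simp add: a_def)
    have en: "e n \<ge> 0" for n unfolding e_def by (intro integral_nonneg_AE) auto
    have ie: "integrable lebesgue (\<lambda>x. indicator {x. l * 2 ^ n < \<bar>f x\<bar> \<and> \<bar>f x\<bar> < 2 * (l * 2 ^ n)} x * (norm (grad f x))\<^sup>2)" for n :: nat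
      using integrable_real_mult_indicator[OF band_sets[OF Cf], of "\<lambda>x. (norm (grad f x))\<^sup>2"] L2_Cc[OF Cc_grad[OF f]]
      by (auto simp: L2_def mult.commute)
    have step: "a (Suc n) \<le> K * a n powr (2 / DIM('a)) * e n" for n
    proof -
      define t where "t = l * 2 ^ n"
      have t: "t > 0" using l by (simp add: t_def)
      have "a (Suc n) = 2 powr p * t powr (p - 2) * (t\<^sup>2 * measure lebesgue {x. 2 * t < \<bar>f x\<bar>})"
        using t by (simp add: a_def A_def t_def[symmetric] powr_mult mult_ac powr_diff)
          (simp add: t_def mult_ac powr_mult)
      also have "\<dots> \<le> 2 powr p * t powr (p - 2) *
        (36 * (2 / mass TYPE('a)) powr (2 / DIM('a)) * measure lebesgue {x. t < \<bar>f x\<bar>} powr (2 / DIM('a)) * e n)"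
        using level_step[OF f t] by (intro mult_left_mono) (auto simp: e_def t_def)
      also have "\<dots> = K * (t powr (p - 2) * measure lebesgue (A n) powr (2 / DIM('a))) * e n"
        by (simp add: K_def A_def t_def mult_ac)
      \<comment> \<open>This is where the critical exponent is forced: p - 2 = p * (2/N), so the
        power of the level and the power of the measure combine to a power of
        \<open>a n\<close>.\<close>
      also have "t powr (p - 2) * measure lebesgue (A n) powr (2 / DIM('a)) = a n powr (2 / DIM('a))"
        using t by (simp add: a_def t_def[symmetric] powr_mult powr_powr p(2) mult.commute)
      finally show ?thesis .
    qed
    have sume: "(\<Sum>n<M. e n) \<le> E" for M
    proof -
      have "(\<Sum>n<M. e n) = (\<integral>x. (\<Sum>n<M. indicator {x. l * 2 ^ n < \<bar>f x\<bar> \<and> \<bar>f x\<bar> < 2 * (l * 2 ^ n)} x * (norm (grad f x))\<^sup>2) \<partial>lebesgue)"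
        unfolding e_def by (rule Bochner_Integration.integral_sum[symmetric]) (rule ie)
      also have "\<dots> \<le> (\<integral>x. (norm (grad f x))\<^sup>2 \<partial>lebesgue)"
      proof (rule integral_mono)
        fix x
        have "(\<Sum>n<M. indicator {x. l * 2 ^ n < \<bar>f x\<bar> \<and> \<bar>f x\<bar> < 2 * (l * 2 ^ n)} x) \<le> (1::real)"
          using sum_band_indicator[OF l, where M=M and t="\<bar>f x\<bar>"]
          by (simp only: indicator_def of_bool_def mem_Collect_eq) (rule order_trans, assumption, simp)
        then show "(\<Sum>n<M. indicator {x. l * 2 ^ n < \<bar>f x\<bar> \<and> \<bar>f x\<bar> < 2 * (l * 2 ^ n)} x * (norm (grad f x))\<^sup>2) \<le> (norm (grad f x))\<^sup>2"
          unfolding sum_distrib_right[symmetric] by (intro mult_left_le_one_le) (auto intro!: sum_nonneg)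
        show "integrable lebesgue (\<lambda>x. \<Sum>n<M. indicator {x. l * 2 ^ n < \<bar>f x\<bar> \<and> \<bar>f x\<bar> < 2 * (l * 2 ^ n)} x * (norm (grad f x))\<^sup>2)"
          by (rule Bochner_Integration.integrable_sum) (rule ie)
      qed (use L2_Cc[OF Cc_grad[OF f]] in \<open>simp add: L2_def\<close>)
      finally show ?thesis by (simp add: E_def n2_square)
    qed
    \<comment> \<open>f is bounded, so finitely many dyadic levels reach its maximum and S is a
      finite sum.\<close>
    obtain M where M: "Mx \<le> l * 2 ^ Suc M"
    proof -
      obtain M where "Mx / l < 2 ^ M" using real_arch_pow[of 2 "Mx / l"] by auto
      then have "Mx \<le> l * 2 ^ M" using l by (simp add: field_simps)
      also have "\<dots> \<le> l * 2 ^ Suc M" using l by simp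
      finally show ?thesis by (rule that)
    qed
    define S where "S = (\<Sum>n\<le>M. a n)"
    have S0: "S \<ge> 0" unfolding S_def by (intro sum_nonneg an)
    have "S = a 0 + (\<Sum>n<M. a (Suc n))"
      unfolding S_def lessThan_Suc_atMost[symmetric] by (rule sum.lessThan_Suc_shift)
    also have "\<dots> \<le> a 0 + (\<Sum>n<M. K * S powr (2 / DIM('a)) * e n)"
    proof (intro add_left_mono sum_mono order_trans[OF step] mult_right_mono mult_left_mono powr_mono2)
      fix n assume "n \<in> {..<M}"
      then show "a n \<le> S" unfolding S_def by (intro member_le_sum an) auto
    qed (use an en K0 in auto)
    also have "\<dots> \<le> a 0 + K * S powr (2 / DIM('a)) * E"
      unfolding sum_distrib_left[symmetric] using K0 by (intro add_left_mono mult_left_mono sume) auto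
    finally have "S \<le> a 0 + (K * E) * S powr (2 / DIM('a))" by (simp add: mult_ac)
    then have "S \<le> 2 * a 0 + (2 * (K * E)) powr (1 / (1 - 2 / DIM('a)))"
      using S0 an K0 E0 th by (intro sublinear_bound) auto
    then have S: "S \<le> 2 * a 0 + (2 * K * E) powr (p / 2)" by (simp add: p(3) mult.assoc)
    have a0: "a 0 \<le> l powr p * V"
    proof -
      have "A 0 \<subseteq> cball 0 R" using R l by (force simp: A_def not_le[symmetric])
      then have "measure lebesgue (A 0) \<le> V" unfolding V_def using An[of 0]
        by (intro measure_mono_fmeasurable) auto
      then show ?thesis by (simp add: a_def mult_left_mono)
    qed
    have "(\<integral>x. \<bar>f x\<bar> powr p \<partial>lebesgue) \<le> (\<integral>x. l powr p * indicator (cball (0::'a) R) x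
         + (\<Sum>n\<le>M. (2 * (l * 2 ^ n)) powr p * indicator (A n) x) \<partial>lebesgue)"
    proof (rule integral_mono)
      show "integrable lebesgue (\<lambda>x. \<bar>f x\<bar> powr p)" using Cc_integrable[OF Cc_powr[OF Cf, of p]] p by simp
      show "integrable lebesgue (\<lambda>x. l powr p * indicator (cball (0::'a) R) x
         + (\<Sum>n\<le>M. (2 * (l * 2 ^ n)) powr p * indicator (A n) x))"
      proof (intro Bochner_Integration.integrable_add integrable_indicator_cball Bochner_Integration.integrable_sum)
        show "integrable lebesgue (\<lambda>x. (2 * (l * 2 ^ n)) powr p * indicator (A n) x :: real)" for n
          using An[of n] by (intro integrable_mult_right integrable_real_indicator) (auto simp: fmeasurable_def)
      qed
      show "\<bar>f x\<bar> powr p \<le> l powr p * indicator (cball (0::'a) R) x + (\<Sum>n\<le>M. (2 * (l * 2 ^ n)) powr p * indicator (A n) x)" for x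
      proof (cases "norm x \<le> R")
        case True
        have "\<bar>f x\<bar> \<le> l * 2 ^ Suc M" using Mx(2)[of x] M by simp
        from layer_bound[OF l _ this, of p] show ?thesis
          using True p(1) by (simp add: indicator_def A_def of_bool_def)
      next
        case False
        then show ?thesis using R[of x] by (auto intro!: sum_nonneg add_nonneg_nonneg)
      qed
    qed
    also have "\<dots> = l powr p * V + (\<Sum>n\<le>M. (2 * (l * 2 ^ n)) powr p * measure lebesgue (A n))"
    proof -
      have i: "integrable lebesgue (\<lambda>x. (2 * (l * 2 ^ n)) powr p * indicator (A n) x :: real)" for n
        using An[of n] by (intro integrable_mult_right integrable_real_indicator) (auto simp: fmeasurable_def)
      have "(\<integral>x. (\<Sum>n\<le>M. (2 * (l * 2 ^ n)) powr p * indicator (A n) x) \<partial>lebesgue) = (\<Sum>n\<le>M. (2 * (l * 2 ^ n)) powr p * measure lebesgue (A n))"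
        by (subst Bochner_Integration.integral_sum[OF i]) (use An in simp)
      moreover have "(\<integral>x. l powr p * indicator (cball (0::'a) R) x \<partial>lebesgue) = l powr p * V"
        by (simp add: V_def)
      ultimately show ?thesis
        using Bochner_Integration.integral_add[OF integrable_indicator_cball[of "l powr p" "0::'a" R]
            Bochner_Integration.integrable_sum[where I="{..M}", OF i]] by (simp only:)
    qed
    also have "(\<Sum>n\<le>M. (2 * (l * 2 ^ n)) powr p * measure lebesgue (A n)) = 2 powr p * S"
      unfolding S_def a_def sum_distrib_left using l by (intro sum.cong) (auto simp: powr_mult)
    also have "l powr p * V + 2 powr p * S \<le> l powr p * V + 2 powr p * (2 * (l powr p * V) + (2 * K * E) powr (p / 2))"
      using S a0 by (intro add_left_mono mult_left_mono) auto
    finally show ?thesis by (simp add: algebra_simps)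
  qed
  show ?thesis
  proof (rule field_le_epsilon)
    fix d :: real assume d: "d > 0"
    define c where "c = (1 + 2 * 2 powr p) * V"
    have c: "c \<ge> 0" using V by (simp add: c_def)
    \<comment> \<open>With this level the contribution of the bottom layer is c d / (c + 1), hence
      at most d; adding 1 to c avoids a vanishing denominator.\<close>
    define l where "l = (d / (c + 1)) powr (1 / p)"
    have l: "l > 0" "l powr p = d / (c + 1)" using d c p(1) by (auto simp: l_def powr_powr)
    have "c * l powr p \<le> d" using c d unfolding l(2) by (simp add: field_simps)
    then show "(\<integral>x. \<bar>f x\<bar> powr p \<partial>lebesgue) \<le> 2 powr p * (2 * K * (n2 (grad f))\<^sup>2) powr (p / 2) + d"
      using main[OF l(1)] by (simp add: c_def E_def)
  qed
qed

lemma sobolev: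
  assumes N: "DIM('a::euclidean_space) \<ge> 3"
  obtains C where "C > 0" "\<And>f :: 'a \<Rightarrow> real. C1c f \<Longrightarrow> Lnorm (two_star DIM('a)) f \<le> C * n2 (grad f)"
proof -
  define p where "p = two_star DIM('a)"
  note p = two_star_facts[OF N, folded p_def]
  define K where "K = 2 powr p * (36 * (2 / mass TYPE('a)) powr (2 / DIM('a)))"
  have K: "K > 0" using mass_pos[where 'a='a] by (simp add: K_def)
  have p2: "two_star DIM('a) = p" by (simp add: p_def)
  have "Lnorm p f \<le> (2 * sqrt (2 * K)) * n2 (grad f)" if f: "C1c f" for f :: "'a \<Rightarrow> real"
  proof -
    have "Lnorm p f \<le> (2 powr p * (2 * K * (n2 (grad f))\<^sup>2) powr (p / 2)) powr (1 / p)"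
      unfolding Lnorm_def
    proof (rule powr_mono2)
      show "(\<integral>x. \<bar>f x\<bar> powr p \<partial>lebesgue) \<le> 2 powr p * (2 * K * (n2 (grad f))\<^sup>2) powr (p / 2)"
        using sobolev_integral[OF N f] unfolding K_def p2 .
    qed (use p(1) in \<open>auto intro!: integral_nonneg_AE\<close>)
    also have "\<dots> = 2 * (2 * K * (n2 (grad f))\<^sup>2) powr (1 / 2)"
      using p(1) by (simp add: powr_mult powr_powr)
    also have "\<dots> = (2 * sqrt (2 * K)) * n2 (grad f)"
      using K by (simp add: powr_half_sqrt real_sqrt_mult)
    finally show ?thesis .
  qed
  then show ?thesis using K that[of "2 * sqrt (2 * K)"] by (simp add: p_def)
qed

section \<open>Approximate solutions of the linear equation\<close>

lemma one_over_Suc_tendsto: "(\<lambda>n. 1 / (real n + 1)) \<longlonglongrightarrow> 0"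
  using LIMSEQ_inverse_real_of_nat by (simp add: inverse_eq_divide add.commute)

lemma two_lstar_facts:
  assumes "n \<ge> 3"
  shows "two_lstar n > 1" "1 / two_lstar n + 1 / two_star n = 1" "two_lstar n < 2"
  using assms by (auto simp: two_star_def two_lstar_def field_simps)

lemma dual_pairing:
  fixes f g :: "'a::euclidean_space \<Rightarrow> real"
  assumes N: "DIM('a) \<ge> 3" and f: "in_Lp (two_lstar DIM('a)) f" and g: "in_Lp (two_star DIM('a)) g"
  shows "integrable lebesgue (\<lambda>x. f x * g x)"
    and "\<bar>\<integral>x. f x * g x \<partial>lebesgue\<bar> \<le> Lnorm (two_lstar DIM('a)) f * Lnorm (two_star DIM('a)) g"
proof -
  have p: "two_lstar DIM('a) > 1" "two_star DIM('a) > 1" "1 / two_lstar DIM('a) + 1 / two_star DIM('a) = 1"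
    using two_lstar_facts[OF N] two_star_facts(1)[OF N] by auto
  note h = holder_ineq[OF p, of f lebesgue g] f[unfolded in_Lp_def] g[unfolded in_Lp_def]
  show "integrable lebesgue (\<lambda>x. f x * g x)" using h by blast
  have "\<bar>\<integral>x. f x * g x \<partial>lebesgue\<bar> \<le> (\<integral>x. \<bar>f x * g x\<bar> \<partial>lebesgue)" by (rule integral_abs_bound)
  also have "\<dots> \<le> Lnorm (two_lstar DIM('a)) f * Lnorm (two_star DIM('a)) g"
    unfolding Lnorm_def using h by blast
  finally show "\<bar>\<integral>x. f x * g x \<partial>lebesgue\<bar> \<le> Lnorm (two_lstar DIM('a)) f * Lnorm (two_star DIM('a)) g" .
qed

lemma Lnorm_nonneg: "Lnorm p f \<ge> 0"
  by (simp add: Lnorm_def)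

lemma L2_grad: "smooth_Cc f \<Longrightarrow> L2 (grad f)"
  by (intro L2_Cc Cc_grad smooth_Cc_C1c)

text \<open>The weak form of -Laplace \<phi>_k = \<rho> + div F, with a residual measured in the
  dual norm of D^{1,2}. Fixing its rate as 1/(k+1) makes every later limit in k
  quantitative.\<close>

definition approx_sol :: "('a::euclidean_space \<Rightarrow> real) \<Rightarrow> ('a \<Rightarrow> 'a) \<Rightarrow> (nat \<Rightarrow> 'a \<Rightarrow> real) \<Rightarrow> bool" where
  "approx_sol \<rho> F \<phi> \<longleftrightarrow> (\<forall>k. smooth_Cc (\<phi> k)) \<and> (\<forall>k \<psi>. smooth_Cc \<psi> \<longrightarrow>
     \<bar>ip (grad (\<phi> k)) (grad \<psi>) + ip F (grad \<psi>) - (\<integral>x. \<rho> x * \<psi> x \<partial>lebesgue)\<bar> \<le> n2 (grad \<psi>) / (real k + 1))"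

text \<open>A quantitative Euler equation: at a point whose value lies within d of the infimum, the
  first variation is at most sqrt(2 d) times the norm of the direction. The optimal choice is t = -
  b / n^2.\<close>

lemma quadratic_nonneg_imp:
  fixes b d n :: real
  assumes "\<And>t. 0 \<le> d + t * b + t\<^sup>2 / 2 * n\<^sup>2" "n \<ge> 0"
  shows "\<bar>b\<bar> \<le> sqrt (2 * d) * n"
proof (cases "n = 0")
  case True
  \<comment> \<open>For n = 0 the expression is affine in t and can only stay nonnegative if its
    slope vanishes.\<close>
  have "b = 0"
  proof (rule ccontr)
    assume "b \<noteq> 0"
    then show False using assms(1)[of "- (d + 1) / b"] True by simp
  qed
  then show ?thesis using True by simp
next
  case False
  then have n: "n > 0" using assms by simp
  have d: "d \<ge> 0" using assms(1)[of 0] by simp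
  have "0 \<le> d - b\<^sup>2 / (2 * n\<^sup>2)"
    using assms(1)[of "- b / n\<^sup>2"] n by (simp add: power2_eq_square field_simps)
  then have "b\<^sup>2 \<le> 2 * d * n\<^sup>2" using n by (simp add: field_simps)
  then have "sqrt (b\<^sup>2) \<le> sqrt (2 * d * n\<^sup>2)" by (rule real_sqrt_le_mono)
  then show ?thesis using n by (simp add: real_sqrt_mult)
qed

text \<open>The Sobolev inequality bounds the linear functional l by the L^2 norm of the gradient,
  so J is bounded below on test functions. Near-minimizers satisfy the equation up to a small
  residual, which avoids any appeal to completeness.\<close>

lemma approx_sol_exists:
  fixes \<rho> :: "'a::euclidean_space \<Rightarrow> real" and F :: "'a \<Rightarrow> 'a"
  assumes N: "DIM('a) \<ge> 3" and rho: "in_Lp (two_lstar DIM('a)) \<rho>" and F: "L2 F"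
  shows "\<exists>\<phi>. approx_sol \<rho> F \<phi>"
proof -
  obtain C where C: "C > 0" "\<And>f :: 'a \<Rightarrow> real. C1c f \<Longrightarrow> Lnorm (two_star DIM('a)) f \<le> C * n2 (grad f)"
    using sobolev[OF N] by blast
  have Lp: "in_Lp (two_star DIM('a)) f" if "smooth_Cc f" for f :: "'a \<Rightarrow> real"
    using that two_star_facts(1)[OF N] by (intro in_Lp_Cc C1c_Cc smooth_Cc_C1c) auto
  note ri = dual_pairing(1)[OF N rho Lp]
  define l where "l f = (\<integral>x. \<rho> x * f x \<partial>lebesgue) - ip F (grad f)" for f
  define J where "J f = (n2 (grad f))\<^sup>2 / 2 - l f" for f
  define K where "K = Lnorm (two_lstar DIM('a)) \<rho> * C + n2 F"
  have lb: "\<bar>l f\<bar> \<le> K * n2 (grad f)" if f: "smooth_Cc f" for f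
  proof -
    have "\<bar>\<integral>x. \<rho> x * f x \<partial>lebesgue\<bar> \<le> Lnorm (two_lstar DIM('a)) \<rho> * (C * n2 (grad f))"
      using dual_pairing(2)[OF N rho Lp[OF f]] C(2)[OF smooth_Cc_C1c[OF f]] Lnorm_nonneg
      by (meson mult_left_mono order_trans)
    then show ?thesis using ip_bound[OF F L2_grad[OF f]] by (simp add: l_def K_def algebra_simps)
  qed
  have ll: "J (\<lambda>x. f x + t * g x) = J f + t * (ip (grad f) (grad g) - l g) + t\<^sup>2 / 2 * (n2 (grad g))\<^sup>2"
    if f: "smooth_Cc f" and g: "smooth_Cc g" for f g t
  proof -
    have gr: "grad (\<lambda>x. f x + t * g x) = (\<lambda>x. grad f x + t *\<^sub>R grad g x)"
      using grad_lincomb(1)[OF smooth_Cc_C1c[OF f] smooth_Cc_C1c[OF g]] by auto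
    have L: "L2 (grad f)" "L2 (grad g)" "L2 (\<lambda>x. t *\<^sub>R grad g x)" using f g by (auto intro: L2_grad L2_scaleR)
    have "(n2 (\<lambda>x. grad f x + t *\<^sub>R grad g x))\<^sup>2 = (n2 (grad f))\<^sup>2 + 2 * (t * ip (grad f) (grad g)) + (t * n2 (grad g))\<^sup>2"
    proof -
      have "ip (\<lambda>x. grad f x + t *\<^sub>R grad g x) (\<lambda>x. grad f x + t *\<^sub>R grad g x)
        = ip (grad f) (\<lambda>x. grad f x + t *\<^sub>R grad g x) + t * ip (grad g) (\<lambda>x. grad f x + t *\<^sub>R grad g x)"
        using L by (simp add: ip_add_left L2_add ip_scaleR_left)
      also have "ip (grad f) (\<lambda>x. grad f x + t *\<^sub>R grad g x) = ip (grad f) (grad f) + t * ip (grad f) (grad g)"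
        using L by (subst ip_commute) (simp add: ip_add_left ip_scaleR_left ip_commute[of "grad g"])
      also have "ip (grad g) (\<lambda>x. grad f x + t *\<^sub>R grad g x) = ip (grad f) (grad g) + t * ip (grad g) (grad g)"
        using L by (subst ip_commute) (simp add: ip_add_left ip_scaleR_left)
      finally show ?thesis by (simp add: ip_self[symmetric] power_mult_distrib)
          (simp add: algebra_simps power2_eq_square ip_self)
    qed
    moreover have "ip F (\<lambda>x. grad f x + t *\<^sub>R grad g x) = ip F (grad f) + t * ip F (grad g)"
      using L F by (simp add: ip_commute[of F] ip_add_left ip_scaleR_left)
    moreover have "(\<integral>x. \<rho> x * (f x + t * g x) \<partial>lebesgue) = (\<integral>x. \<rho> x * f x \<partial>lebesgue) + t * (\<integral>x. \<rho> x * g x \<partial>lebesgue)"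
    proof -
      have "(\<lambda>x. \<rho> x * (f x + t * g x)) = (\<lambda>x. \<rho> x * f x + t * (\<rho> x * g x))" by (auto simp: algebra_simps)
      then show ?thesis using ri[OF f] ri[OF g] by simp
    qed
    ultimately show ?thesis unfolding J_def l_def gr by (simp add: power_mult_distrib algebra_simps add_divide_distrib)
  qed
  have Jb: "J f \<ge> - K\<^sup>2 / 2" if "smooth_Cc f" for f
  proof -
    have "K * n2 (grad f) \<le> K\<^sup>2 / 2 + (n2 (grad f))\<^sup>2 / 2"
      using sum_squares_bound[of K "n2 (grad f)"] by simp
    then show ?thesis using lb[OF that] by (simp add: J_def)
  qed
  let ?S = "J ` {f. smooth_Cc f}"
  have bdd: "bdd_below ?S" using Jb by (intro bdd_belowI[of _ "- K\<^sup>2 / 2"]) auto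
  have ne: "?S \<noteq> {}" using smooth_Cc_zero by blast
  define M where "M = Inf ?S"
  have MJ: "M \<le> J f" if "smooth_Cc f" for f unfolding M_def using that bdd by (intro cInf_lower) auto
  \<comment> \<open>The gap 1 / (2 (k+1)^2) is the one that \<open>quadratic_nonneg_imp\<close>
    converts into the residual 1 / (k+1).\<close>
  have "\<exists>f. smooth_Cc f \<and> J f < M + 1 / (2 * (real k + 1)\<^sup>2)" for k :: nat
  proof -
    have "Inf ?S < M + 1 / (2 * (real k + 1)\<^sup>2)" by (simp add: M_def add_pos_nonneg)
    then obtain y where "y \<in> ?S" "y < M + 1 / (2 * (real k + 1)\<^sup>2)" using cInf_less_iff[OF ne bdd] by blast
    then show ?thesis by blast
  qed
  then obtain \<phi> where \<phi>: "\<And>k. smooth_Cc (\<phi> k)" "\<And>k. J (\<phi> k) < M + 1 / (2 * (real k + 1)\<^sup>2)" by metis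
  have "\<bar>ip (grad (\<phi> k)) (grad g) + ip F (grad g) - (\<integral>x. \<rho> x * g x \<partial>lebesgue)\<bar> \<le> n2 (grad g) / (real k + 1)"
    if g: "smooth_Cc g" for k g
  proof -
    have "\<bar>ip (grad (\<phi> k)) (grad g) - l g\<bar> \<le> sqrt (2 * (J (\<phi> k) - M)) * n2 (grad g)"
    proof (rule quadratic_nonneg_imp)
      fix t
      have "smooth_Cc (\<lambda>x. \<phi> k x + t * g x)" by (intro smooth_Cc_add smooth_Cc_cmult \<phi> g)
      from MJ[OF this] show "0 \<le> J (\<phi> k) - M + t * (ip (grad (\<phi> k)) (grad g) - l g) + t\<^sup>2 / 2 * (n2 (grad g))\<^sup>2"
        unfolding ll[OF \<phi>(1) g] by simp
    qed simp
    also have "\<dots> \<le> 1 / (real k + 1) * n2 (grad g)"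
    proof (rule mult_right_mono)
      have "2 * (J (\<phi> k) - M) \<le> (1 / (real k + 1))\<^sup>2" using \<phi>(2)[of k] by (simp add: power_divide field_simps)
      then show "sqrt (2 * (J (\<phi> k) - M)) \<le> 1 / (real k + 1)" by (intro real_le_lsqrt) auto
    qed simp
    finally show ?thesis by (simp add: l_def algebra_simps)
  qed
  then show ?thesis using \<phi>(1) unfolding approx_sol_def by blast
qed

lemma le_of_square_le:
  fixes n a :: real
  assumes "n\<^sup>2 \<le> a * n" "n \<ge> 0" "a \<ge> 0" shows "n \<le> a"
  using assms by (cases "n = 0") (auto simp: power2_eq_square)

text \<open>Testing both equations with the difference cancels the datum. With F = F' this is the
  Cauchy property of one sequence; with different fields it is the estimate behind the
  contraction.\<close>

lemma approx_sol_diff: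
  fixes \<rho> :: "'a::euclidean_space \<Rightarrow> real" and F F' :: "'a \<Rightarrow> 'a"
  assumes s: "approx_sol \<rho> F \<phi>" "approx_sol \<rho> F' \<phi>'" and F: "L2 F" "L2 F'"
  shows "n2 (\<lambda>x. grad (\<phi> k) x - grad (\<phi>' l) x) \<le> n2 (\<lambda>x. F x - F' x) + 1 / (real k + 1) + 1 / (real l + 1)"
proof (rule le_of_square_le)
  define g where "g = (\<lambda>x. \<phi> k x - \<phi>' l x)"
  have sm: "smooth_Cc (\<phi> k)" "smooth_Cc (\<phi>' l)" using s by (auto simp: approx_sol_def)
  then have g: "smooth_Cc g" unfolding g_def by (rule smooth_Cc_diff)
  have gg: "grad g = (\<lambda>x. grad (\<phi> k) x - grad (\<phi>' l) x)"
    unfolding g_def using grad_lincomb(2)[OF smooth_Cc_C1c[OF sm(1)] smooth_Cc_C1c[OF sm(2)]] by auto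
  note L = L2_grad[OF sm(1)] L2_grad[OF sm(2)] L2_grad[OF g]
  have "(n2 (grad g))\<^sup>2 = ip (grad (\<phi> k)) (grad g) - ip (grad (\<phi>' l)) (grad g)"
    using L ip_diff_left[OF L] unfolding ip_self[symmetric] by (simp add: gg)
  also have "\<dots> \<le> ip F' (grad g) - ip F (grad g) + n2 (grad g) / (real k + 1) + n2 (grad g) / (real l + 1)"
  proof -
    have "\<bar>ip (grad (\<phi> k)) (grad g) + ip F (grad g) - (\<integral>x. \<rho> x * g x \<partial>lebesgue)\<bar> \<le> n2 (grad g) / (real k + 1)"
      "\<bar>ip (grad (\<phi>' l)) (grad g) + ip F' (grad g) - (\<integral>x. \<rho> x * g x \<partial>lebesgue)\<bar> \<le> n2 (grad g) / (real l + 1)"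
      using s g unfolding approx_sol_def by blast+
    then show ?thesis unfolding abs_le_iff by linarith
  qed
  also have "ip F' (grad g) - ip F (grad g) = - ip (\<lambda>x. F x - F' x) (grad g)"
    using ip_diff_left[OF F L(3)] by simp
  also have "\<dots> \<le> n2 (\<lambda>x. F x - F' x) * n2 (grad g)"
    using ip_bound[OF L2_diff[OF F] L(3)] by linarith
  finally have "(n2 (grad g))\<^sup>2 \<le> (n2 (\<lambda>x. F x - F' x) + 1 / (real k + 1) + 1 / (real l + 1)) * n2 (grad g)"
    by (simp add: algebra_simps)
  then show "(n2 (\<lambda>x. grad (\<phi> k) x - grad (\<phi>' l) x))\<^sup>2
      \<le> (n2 (\<lambda>x. F x - F' x) + 1 / (real k + 1) + 1 / (real l + 1)) * n2 (\<lambda>x. grad (\<phi> k) x - grad (\<phi>' l) x)"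
    by (simp add: gg)
qed auto

text \<open>The energy estimate: test with \<open>\<phi> k\<close> itself and control the datum by
  duality and the Sobolev constant C.\<close>

lemma approx_sol_norm:
  fixes \<rho> :: "'a::euclidean_space \<Rightarrow> real" and F :: "'a \<Rightarrow> 'a"
  assumes N: "DIM('a) \<ge> 3" and rho: "in_Lp (two_lstar DIM('a)) \<rho>" and F: "L2 F" and s: "approx_sol \<rho> F \<phi>"
    and C: "C > 0" "\<And>f :: 'a \<Rightarrow> real. C1c f \<Longrightarrow> Lnorm (two_star DIM('a)) f \<le> C * n2 (grad f)"
  shows "n2 (grad (\<phi> k)) \<le> C * Lnorm (two_lstar DIM('a)) \<rho> + n2 F + 1 / (real k + 1)"
proof (rule le_of_square_le)
  have sm: "smooth_Cc (\<phi> k)" using s by (auto simp: approx_sol_def)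
  have c: "C1c (\<phi> k)" using sm by (rule smooth_Cc_C1c)
  have Lp: "in_Lp (two_star DIM('a)) (\<phi> k)"
    using two_star_facts(1)[OF N] by (intro in_Lp_Cc C1c_Cc c) auto
  have "(\<integral>x. \<rho> x * \<phi> k x \<partial>lebesgue) \<le> Lnorm (two_lstar DIM('a)) \<rho> * Lnorm (two_star DIM('a)) (\<phi> k)"
    using dual_pairing(2)[OF N rho Lp] by linarith
  also have "\<dots> \<le> Lnorm (two_lstar DIM('a)) \<rho> * (C * n2 (grad (\<phi> k)))"
    using C(2)[OF c] Lnorm_nonneg by (intro mult_left_mono) auto
  finally have 1: "(\<integral>x. \<rho> x * \<phi> k x \<partial>lebesgue) \<le> Lnorm (two_lstar DIM('a)) \<rho> * (C * n2 (grad (\<phi> k)))" .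
  have 2: "- ip F (grad (\<phi> k)) \<le> n2 F * n2 (grad (\<phi> k))" using ip_bound[OF F L2_grad[OF sm]] by linarith
  have "\<bar>ip (grad (\<phi> k)) (grad (\<phi> k)) + ip F (grad (\<phi> k)) - (\<integral>x. \<rho> x * \<phi> k x \<partial>lebesgue)\<bar> \<le> n2 (grad (\<phi> k)) / (real k + 1)"
    using s sm by (auto simp: approx_sol_def)
  then have "(n2 (grad (\<phi> k)))\<^sup>2 \<le> Lnorm (two_lstar DIM('a)) \<rho> * (C * n2 (grad (\<phi> k))) + n2 F * n2 (grad (\<phi> k)) + n2 (grad (\<phi> k)) / (real k + 1)"
    using 1 2 unfolding ip_self by linarith
  then show "(n2 (grad (\<phi> k)))\<^sup>2 \<le> (C * Lnorm (two_lstar DIM('a)) \<rho> + n2 F + 1 / (real k + 1)) * n2 (grad (\<phi> k))"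
    by (simp add: algebra_simps)
  show "0 \<le> C * Lnorm (two_lstar DIM('a)) \<rho> + n2 F + 1 / (real k + 1)"
    using C(1) Lnorm_nonneg by (intro add_nonneg_nonneg mult_nonneg_nonneg) auto
qed simp

lemma powr_add_le:
  fixes a b p :: real
  assumes "p > 0" shows "\<bar>a + b\<bar> powr p \<le> 2 powr p * (\<bar>a\<bar> powr p + \<bar>b\<bar> powr p)"
proof -
  have "\<bar>a + b\<bar> powr p \<le> (2 * max \<bar>a\<bar> \<bar>b\<bar>) powr p" using assms by (intro powr_mono2) auto
  also have "\<dots> = 2 powr p * (max \<bar>a\<bar> \<bar>b\<bar>) powr p" by (simp add: powr_mult)
  also have "\<dots> \<le> 2 powr p * (\<bar>a\<bar> powr p + \<bar>b\<bar> powr p)"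
    by (intro mult_left_mono) (auto simp: max_def)
  finally show ?thesis .
qed

text \<open>A mollified limit of an $L^p$-Cauchy sequence is its $L^p$-limit: apply Fatou's lemma first in
  the sequence and then in the scale of the mollifier.\<close>

lemma mollified_limit_Lp:
  fixes f :: "nat \<Rightarrow> 'a::euclidean_space \<Rightarrow> real"
  assumes p: "p > 1" and f: "\<And>k. C1c (f k)"
    and cauchy: "\<And>k l. k \<le> l \<Longrightarrow> (\<integral>x. \<bar>f k x - f l x\<bar> powr p \<partial>lebesgue) \<le> d k"
    and H: "\<And>s x. 0 < s \<Longrightarrow> (\<lambda>l. W bump s x (f l)) \<longlonglongrightarrow> H s x"
    and g: "\<And>x. (\<lambda>n. H (1 / (real n + 1)) x / mass TYPE('a)) \<longlonglongrightarrow> g x"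
  shows "g \<in> borel_measurable lebesgue" "integrable lebesgue (\<lambda>x. \<bar>f k x - g x\<bar> powr p)"
    "(\<integral>x. \<bar>f k x - g x\<bar> powr p \<partial>lebesgue) \<le> 2 powr p * d k"
proof -
  let ?m = "mass TYPE('a)"
  note m = mass_pos[where 'a='a]
  have Cf: "Cc (f l)" for l using f by (rule C1c_Cc)
  have mH: "H s \<in> borel_measurable lebesgue" if "s > 0" for s
    using lebesgue_cont[OF Cc_cont[OF Cc_W_bump[OF Cf that]]] H[OF that]
    by (intro borel_measurable_LIMSEQ_real[of lebesgue "\<lambda>l x. W bump s x (f l)" "H s"]) auto
  show mg: "g \<in> borel_measurable lebesgue"
    by (rule borel_measurable_LIMSEQ_real[of _ "\<lambda>n x. H (1 / (real n + 1)) x / ?m"]) (use g mH in auto)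
  obtain C where C: "\<And>s. 0 < s \<Longrightarrow> s \<le> 1 \<Longrightarrow> (\<integral>x. \<bar>f k x - W bump s x (f k) / ?m\<bar> powr p \<partial>lebesgue) \<le> C * s powr p"
    using W_bump_approx_Lp[OF f p] by blast
  \<comment> \<open>At a fixed scale the difference splits into the mollification error of
    \<open>f k\<close>, of order s^p, and the mollification of \<open>f k - f l\<close>, bounded by
    Young's inequality and the Cauchy hypothesis. Fatou's lemma then lets l tend to
    infinity.\<close>
  have step: "integrable lebesgue (\<lambda>x. \<bar>f k x - H s x / ?m\<bar> powr p) \<and>
      (\<integral>x. \<bar>f k x - H s x / ?m\<bar> powr p \<partial>lebesgue) \<le> 2 powr p * (C * s powr p + d k)" if s: "0 < s" "s \<le> 1" for s
  proof -
    \<comment> \<open>The index is shifted by k because the Cauchy hypothesis only covers k \<le>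
      l.\<close>
    define h where "h l x = \<bar>f k x - W bump s x (f (l + k)) / ?m\<bar> powr p" for l x
    have Ch: "Cc (\<lambda>x. f k x - W bump s x (f l) / ?m)" for l
      using Cc_diff[OF Cf Cc_cmult[OF Cc_W_bump[OF Cf s(1)], of "1 / ?m"]] by simp
    have ih: "integrable lebesgue (h l)" for l
      using Cc_integrable[OF Cc_powr[OF Ch, of p]] p by (simp add: h_def[abs_def])
    have bh: "(\<integral>x. h l x \<partial>lebesgue) \<le> 2 powr p * (C * s powr p + d k)" for l
    proof -
      let ?D = "\<lambda>x. f k x - f (l + k) x"
      have CD: "Cc ?D" by (intro Cc_diff Cf)
      have WD: "W bump s x ?D = W bump s x (f k) - W bump s x (f (l + k))" for x
      proof -
        have "integrable lebesgue (\<lambda>y. bump ((x - y) /\<^sub>R s) * f j y)" for j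
          by (intro Cc_integrable Cc_times Cc_bump_scaled s Cc_cont Cf)
        then show ?thesis by (simp add: W_def right_diff_distrib diff_divide_distrib)
      qed
      have i1: "integrable lebesgue (\<lambda>x. \<bar>f k x - W bump s x (f k) / ?m\<bar> powr p)"
        using Cc_integrable[OF Cc_powr[OF Ch, of p]] p by simp
      have i2: "integrable lebesgue (\<lambda>x. \<bar>W bump s x ?D\<bar> powr p)"
        using Cc_integrable[OF Cc_powr[OF Cc_W_bump[OF CD s(1)], of p]] p by simp
      have "(\<integral>x. h l x \<partial>lebesgue) \<le> (\<integral>x. 2 powr p * (\<bar>f k x - W bump s x (f k) / ?m\<bar> powr p + \<bar>W bump s x ?D\<bar> powr p / ?m powr p) \<partial>lebesgue)"
      proof (rule integral_mono[OF ih])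
        show "integrable lebesgue (\<lambda>x. 2 powr p * (\<bar>f k x - W bump s x (f k) / ?m\<bar> powr p + \<bar>W bump s x ?D\<bar> powr p / ?m powr p))"
          using i1 i2 by simp
        fix x
        have "f k x - W bump s x (f (l + k)) / ?m = (f k x - W bump s x (f k) / ?m) + W bump s x ?D / ?m"
          unfolding WD by (simp add: diff_divide_distrib)
        then have "h l x = \<bar>(f k x - W bump s x (f k) / ?m) + W bump s x ?D / ?m\<bar> powr p"
          unfolding h_def by (simp only:)
        then show "h l x \<le> 2 powr p * (\<bar>f k x - W bump s x (f k) / ?m\<bar> powr p + \<bar>W bump s x ?D\<bar> powr p / ?m powr p)"
          using powr_add_le[of p "f k x - W bump s x (f k) / ?m" "W bump s x ?D / ?m"] p m
          by (simp add: abs_divide powr_divide)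
      qed
      also have "\<dots> = 2 powr p * ((\<integral>x. \<bar>f k x - W bump s x (f k) / ?m\<bar> powr p \<partial>lebesgue) + (\<integral>x. \<bar>W bump s x ?D\<bar> powr p \<partial>lebesgue) / ?m powr p)"
        using i1 i2 by simp
      also have "\<dots> \<le> 2 powr p * (C * s powr p + d k)"
      proof (intro mult_left_mono add_mono C s)
        have "(\<integral>x. \<bar>W bump s x ?D\<bar> powr p \<partial>lebesgue) \<le> ?m powr p * (\<integral>x. \<bar>?D x\<bar> powr p \<partial>lebesgue)"
          by (rule W_bump_Lp[OF CD s(1) p])
        also have "\<dots> \<le> ?m powr p * d k" by (intro mult_left_mono cauchy) auto
        finally show "(\<integral>x. \<bar>W bump s x ?D\<bar> powr p \<partial>lebesgue) / ?m powr p \<le> d k"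
          using m by (simp add: divide_le_eq mult.commute)
      qed auto
      finally show ?thesis .
    qed
    have lim: "(\<lambda>l. h l x) \<longlonglongrightarrow> \<bar>f k x - H s x / ?m\<bar> powr p" for x
      unfolding h_def using p m LIMSEQ_ignore_initial_segment[OF H[OF s(1)], of x k]
      by (intro tendsto_powr' tendsto_intros) auto
    note F = fatou_bound[where f=h and g="\<lambda>x. \<bar>f k x - H s x / ?m\<bar> powr p" and M=lebesgue
        and b="\<lambda>_. 2 powr p * (C * s powr p + d k)"]
    have hn: "h l x \<ge> 0" for l x by (simp add: h_def)
    have mm: "(\<lambda>x. \<bar>f k x - H s x / ?m\<bar> powr p) \<in> borel_measurable lebesgue"
      using mH[OF s(1)] lebesgue_cont[OF Cc_cont[OF Cf]] by simp
    show ?thesis using F(1,2)[OF ih hn AE_I2[OF lim] mm bh tendsto_const] by blast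
  qed
  define s where "s n = 1 / (real n + 1)" for n
  have s: "0 < s n" "s n \<le> 1" for n by (auto simp: s_def)
  have s0: "s \<longlonglongrightarrow> 0" unfolding s_def by (rule one_over_Suc_tendsto)
  have lim: "(\<lambda>n. \<bar>f k x - H (s n) x / ?m\<bar> powr p) \<longlonglongrightarrow> \<bar>f k x - g x\<bar> powr p" for x
    using p g[of x] unfolding s_def by (intro tendsto_powr' tendsto_intros) auto
  have bl: "(\<lambda>n. 2 powr p * (C * s n powr p + d k)) \<longlonglongrightarrow> 2 powr p * (C * 0 powr p + d k)"
    using p s s0 by (intro tendsto_intros tendsto_powr') (auto intro!: always_eventually less_imp_le)
  have mm: "(\<lambda>x. \<bar>f k x - g x\<bar> powr p) \<in> borel_measurable lebesgue"
    using mg lebesgue_cont[OF Cc_cont[OF Cf]] by simp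
  note F = fatou_bound[where f="\<lambda>n x. \<bar>f k x - H (s n) x / ?m\<bar> powr p" and g="\<lambda>x. \<bar>f k x - g x\<bar> powr p" and M=lebesgue
        and b="\<lambda>n. 2 powr p * (C * s n powr p + d k)" and B="2 powr p * (C * 0 powr p + d k)"]
  have i: "integrable lebesgue (\<lambda>x. \<bar>f k x - H (s n) x / ?m\<bar> powr p)"
    "(\<integral>x. \<bar>f k x - H (s n) x / ?m\<bar> powr p \<partial>lebesgue) \<le> 2 powr p * (C * s n powr p + d k)" for n
    using step[OF s] by auto
  have nn: "0 \<le> \<bar>f k x - H (s n) x / ?m\<bar> powr p" for n x by simp
  show "integrable lebesgue (\<lambda>x. \<bar>f k x - g x\<bar> powr p)"
    by (rule F(1)[OF i(1) nn AE_I2[OF lim] mm i(2) bl])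
  show "(\<integral>x. \<bar>f k x - g x\<bar> powr p \<partial>lebesgue) \<le> 2 powr p * d k"
    using F(2)[OF i(1) nn AE_I2[OF lim] mm i(2) bl] p by simp
qed

section \<open>Hoelder regularity\<close>

lemma hoelder_continuous:
  fixes f :: "'a::real_normed_vector \<Rightarrow> 'b::real_normed_vector"
  assumes "a > 0" "\<And>x y. norm (f x - f y) \<le> C * norm (x - y) powr a"
  shows "continuous_on UNIV f"
proof -
  have "isCont f x" for x
  proof -
    have "((\<lambda>y. C * norm (x - y) powr a) \<longlongrightarrow> C * norm (x - x) powr a) (at x)"
      using assms(1) by (intro tendsto_intros tendsto_powr') auto
    then have "((\<lambda>y. C * norm (x - y) powr a) \<longlongrightarrow> 0) (at x)" by simp
    moreover have "\<forall>\<^sub>F y in at x. norm (f y - f x) \<le> C * norm (x - y) powr a"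
      using assms(2) by (intro always_eventually allI) (metis norm_minus_commute)
    ultimately have "((\<lambda>y. f y - f x) \<longlongrightarrow> 0) (at x)" by (rule Lim_null_comparison[rotated])
    then show ?thesis unfolding isCont_def by (rule LIM_zero_cancel)
  qed
  then show ?thesis by (simp add: continuous_at_imp_continuous_on)
qed

lemma Lnorm_2: "Lnorm 2 f = n2 f"
  by (simp add: Lnorm_def n2_def powr_half_sqrt)

lemma L2_in_Lp: fixes f :: "'a::euclidean_space \<Rightarrow> real" shows "L2 f \<Longrightarrow> in_Lp 2 f"
  by (simp add: L2_def in_Lp_def)

lemma n2_component:
  assumes "L2 G" "i \<in> Basis"
  shows "L2 (\<lambda>x. G x \<bullet> i)" "n2 (\<lambda>x. G x \<bullet> i) \<le> n2 G"
proof -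
  have "G \<in> borel_measurable lebesgue" using assms by (simp add: L2_def)
  then have m: "(\<lambda>x. G x \<bullet> i) \<in> borel_measurable lebesgue" by measurable
  show L: "L2 (\<lambda>x. G x \<bullet> i)"
    unfolding L2_def
  proof (intro conjI m)
    show "integrable lebesgue (\<lambda>x. (norm (G x \<bullet> i))\<^sup>2)"
    proof (rule Bochner_Integration.integrable_bound)
      show "integrable lebesgue (\<lambda>x. (norm (G x))\<^sup>2)" using assms by (simp add: L2_def)
      show "(\<lambda>x. (norm (G x \<bullet> i))\<^sup>2) \<in> borel_measurable lebesgue" using m by simp
      show "AE x in lebesgue. norm ((norm (G x \<bullet> i))\<^sup>2) \<le> norm ((norm (G x))\<^sup>2)"
        using Basis_le_norm[OF assms(2)] by (intro AE_I2) (simp add: abs_le_square_iff[symmetric])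
    qed
  qed
  show "n2 (\<lambda>x. G x \<bullet> i) \<le> n2 G"
    using Basis_le_norm[OF assms(2)] by (intro n2_mono L assms) auto
qed

lemma W_bound_L2:
  fixes f :: "'a::euclidean_space \<Rightarrow> real"
  assumes "kern L k" "s > 0" "L2 f"
  shows "\<bar>W k s x f\<bar> \<le> L * vol2 TYPE('a) 2 * s powr (- DIM('a) / 2) * n2 f"
  using W_bound_Lp(2)[OF assms(1,2) _ L2_in_Lp[OF assms(3)], of x] by (simp add: Lnorm_2 mult_ac)

lemma Cc_kern_scaled:
  fixes x :: "'a::euclidean_space"
  assumes "kern L k" "s > 0" shows "Cc (\<lambda>y. k ((x - y) /\<^sub>R s))"
proof -
  have "k ((x - y) /\<^sub>R s) = 0" if "norm x + s < norm y" for y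
    using that norm_triangle_ineq2[of y x] by (intro kern_zero[OF assms]) (simp add: norm_minus_commute)
  then show ?thesis using kern_cont[OF assms(1)] unfolding Cc_def by blast
qed

lemma W_diff_cont:
  fixes f g :: "'a::euclidean_space \<Rightarrow> real"
  assumes k: "kern L k" "s > 0" and "continuous_on UNIV f" "continuous_on UNIV g"
  shows "W k s x (\<lambda>y. f y - g y) = W k s x f - W k s x g"
proof -
  have "integrable lebesgue (\<lambda>y. k ((x - y) /\<^sub>R s) * f y)" "integrable lebesgue (\<lambda>y. k ((x - y) /\<^sub>R s) * g y)"
    by (intro Cc_integrable Cc_times Cc_kern_scaled[OF k] assms)+
  then show ?thesis by (simp add: W_def right_diff_distrib diff_divide_distrib)
qed

definition ball2 :: "'a::euclidean_space itself \<Rightarrow> real" where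
  "ball2 _ = unit_ball_vol (real DIM('a)) * 2 ^ DIM('a)"

lemma ball2_nonneg: "ball2 TYPE('a::euclidean_space) \<ge> 0"
  by (simp add: ball2_def)

lemma loc_int_bounded:
  fixes f :: "'a::euclidean_space \<Rightarrow> real"
  assumes f: "continuous_on UNIV f" and s: "s > 0" and b: "\<And>y. norm (x - y) \<le> 2 * s \<Longrightarrow> \<bar>f y\<bar> \<le> b"
  shows "loc_int f x (2 * s) (b * ball2 TYPE('a) * s ^ DIM('a))"
proof -
  have m: "f \<in> borel_measurable lebesgue" by (rule lebesgue_cont[OF f])
  have ib: "integrable lebesgue (\<lambda>y. b * indicator (cball x (2 * s)) y)" by (rule integrable_indicator_cball)
  have bb: "norm (indicator (cball x (2 * s)) y * f y) \<le> norm (b * indicator (cball x (2 * s)) y)" for y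
    using b[of y] by (auto simp: indicator_def dist_norm)
  have i: "integrable lebesgue (\<lambda>y. indicator (cball x (2 * s)) y * f y)"
      proof (rule Bochner_Integration.integrable_bound[OF ib])
    show "(\<lambda>y. indicator (cball x (2 * s)) y * f y) \<in> borel_measurable lebesgue"
      using borel_measurable_integrable[OF integrable_indicator_cball[of 1 x "2 * s"]] m by simp
  qed (use bb in auto)
  have "(\<integral>y. indicator (cball x (2 * s)) y * \<bar>f y\<bar> \<partial>lebesgue) \<le> (\<integral>y. b * indicator (cball x (2 * s)) y \<partial>lebesgue)"
  proof (rule integral_mono[OF _ ib])
    show "integrable lebesgue (\<lambda>y. indicator (cball x (2 * s)) y * \<bar>f y\<bar>)"
      using integrable_abs[OF i] by (simp add: abs_mult)
    show "indicator (cball x (2 * s)) y * \<bar>f y\<bar> \<le> b * indicator (cball x (2 * s)) y" for y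
      using b[of y] by (auto simp: indicator_def dist_norm)
  qed
  also have "\<dots> = b * ball2 TYPE('a) * s ^ DIM('a)"
    using s by (simp add: content_cball ball2_def power_mult_distrib mult_ac)
  finally show ?thesis using m i by (simp add: loc_int_def)
qed

text \<open>A fixed choice attached to the type, so that all later constants, and with them the
  threshold of the theorem, are determined before the datum is.\<close>

definition kconst :: "'a::euclidean_space itself \<Rightarrow> real" where
  "kconst _ = (SOME L. L > 0 \<and> kern L (bump::'a \<Rightarrow> real) \<and> (\<forall>i\<in>Basis. kern L (bump1 i :: 'a \<Rightarrow> real)) \<and>
     (\<forall>i\<in>Basis. \<forall>j\<in>Basis. kern L (bump2 i j :: 'a \<Rightarrow> real)))"

lemma kconst:
  "kconst TYPE('a::euclidean_space) > 0" "kern (kconst TYPE('a)) (bump::'a \<Rightarrow> real)"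
  "i \<in> Basis \<Longrightarrow> kern (kconst TYPE('a)) (bump1 i :: 'a \<Rightarrow> real)"
  "i \<in> Basis \<Longrightarrow> j \<in> Basis \<Longrightarrow> kern (kconst TYPE('a)) (bump2 i j :: 'a \<Rightarrow> real)"
proof -
  have "kconst TYPE('a) > 0 \<and> kern (kconst TYPE('a)) (bump::'a \<Rightarrow> real) \<and>
     (\<forall>i\<in>Basis. kern (kconst TYPE('a)) (bump1 i :: 'a \<Rightarrow> real)) \<and>
     (\<forall>i\<in>Basis. \<forall>j\<in>Basis. kern (kconst TYPE('a)) (bump2 i j :: 'a \<Rightarrow> real))"
    unfolding kconst_def by (rule someI_ex[OF kern_bumps])
  then show "kconst TYPE('a) > 0" "kern (kconst TYPE('a)) (bump::'a \<Rightarrow> real)"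
    "i \<in> Basis \<Longrightarrow> kern (kconst TYPE('a)) (bump1 i :: 'a \<Rightarrow> real)"
    "i \<in> Basis \<Longrightarrow> j \<in> Basis \<Longrightarrow> kern (kconst TYPE('a)) (bump2 i j :: 'a \<Rightarrow> real)" by blast+
qed

lemma cauchy_rate_limit:
  fixes a :: "nat \<Rightarrow> real"
  assumes "\<And>k l. \<bar>a k - a l\<bar> \<le> c * (1 / (real k + 1) + 1 / (real l + 1))"
  shows "a \<longlonglongrightarrow> lim a" "\<bar>a k - lim a\<bar> \<le> c / (real k + 1)"
proof -
  note z = one_over_Suc_tendsto
  have "Cauchy a"
  proof (rule metric_CauchyI)
    fix e :: real assume e: "e > 0"
    have c: "c \<ge> 0" using assms[of 0 0] by simp
    have "\<forall>\<^sub>F n in sequentially. 1 / (real n + 1) < e / (2 * (c + 1))"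
      using e c by (intro order_tendstoD[OF z]) auto
    then obtain M where M: "\<And>n. n \<ge> M \<Longrightarrow> 1 / (real n + 1) < e / (2 * (c + 1))"
      unfolding eventually_sequentially by blast
    have "dist (a m) (a n) < e" if "m \<ge> M" "n \<ge> M" for m n
    proof -
      have "dist (a m) (a n) \<le> c * (1 / (real m + 1) + 1 / (real n + 1))" using assms by (simp add: dist_real_def)
      also have "\<dots> \<le> c * (e / (2 * (c + 1)) + e / (2 * (c + 1)))"
        using M[OF that(1)] M[OF that(2)] c by (intro mult_left_mono add_mono) auto
      also have "\<dots> < e"
      proof -
        define r where "r = e / (2 * (c + 1))"
        have "r > 0" "e = 2 * (c + 1) * r" using e c by (auto simp: r_def)
        then show ?thesis unfolding r_def[symmetric] by (simp add: algebra_simps)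
      qed
      finally show ?thesis .
    qed
    then show "\<exists>M. \<forall>m\<ge>M. \<forall>n\<ge>M. dist (a m) (a n) < e" by blast
  qed
  then show L: "a \<longlonglongrightarrow> lim a" by (simp add: Cauchy_convergent_iff convergent_LIMSEQ_iff)
  have "(\<lambda>l. \<bar>a k - a l\<bar>) \<longlonglongrightarrow> \<bar>a k - lim a\<bar>" by (intro tendsto_intros L)
  moreover have "(\<lambda>l. c * (1 / (real k + 1) + 1 / (real l + 1))) \<longlonglongrightarrow> c * (1 / (real k + 1) + 0)"
    by (intro tendsto_intros z)
  ultimately have "\<bar>a k - lim a\<bar> \<le> c * (1 / (real k + 1) + 0)"
    using assms by (intro LIMSEQ_le[of "\<lambda>l. \<bar>a k - a l\<bar>"]) auto
  then show "\<bar>a k - lim a\<bar> \<le> c / (real k + 1)" by simp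
qed

text \<open>Since t^b vanishes at 0, the bound makes h Cauchy as the scale tends to 0. The limit is
  taken along 1/(n+1): a countable sequence keeps limits measurable in further parameters.\<close>

lemma scale_limit:
  fixes h :: "real \<Rightarrow> real"
  assumes b: "b > 0" and h: "\<And>s t. 0 < s \<Longrightarrow> s \<le> t \<Longrightarrow> \<bar>h t - h s\<bar> \<le> c * (t powr b - s powr b)"
  shows "(\<lambda>n. h (1 / (real n + 1))) \<longlonglongrightarrow> lim (\<lambda>n. h (1 / (real n + 1)))"
    and "0 < t \<Longrightarrow> \<bar>h t - lim (\<lambda>n. h (1 / (real n + 1)))\<bar> \<le> c * t powr b"
proof -
  note z = one_over_Suc_tendsto
  have zb: "(\<lambda>l. (1 / (real l + 1)) powr b) \<longlonglongrightarrow> 0"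
    using tendsto_powr'[OF z tendsto_const[of b]] b by auto
  have c0: "c \<ge> 0"
  proof -
    have "0 \<le> c * (2 powr b - 1 powr b)" using h[of 1 2] by linarith
    moreover have "2 powr b - 1 powr b > (0::real)" using b by simp
    ultimately show ?thesis by (simp add: zero_le_mult_iff)
  qed
  have h2: "\<bar>h t - h s\<bar> \<le> c * max (t powr b) (s powr b)" if "0 < s" "0 < t" for s t
  proof (cases "s \<le> t")
    case True
    then have "\<bar>h t - h s\<bar> \<le> c * (t powr b - s powr b)" using h that by blast
    also have "\<dots> \<le> c * max (t powr b) (s powr b)"
      using c0 by (intro mult_left_mono) (auto intro: order_trans[of _ "t powr b"])
    finally show ?thesis .
  next
    case False
    then have "\<bar>h s - h t\<bar> \<le> c * (s powr b - t powr b)" using h that by force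
    also have "\<dots> \<le> c * max (t powr b) (s powr b)"
      using c0 by (intro mult_left_mono) (auto intro: order_trans[of _ "s powr b"])
    finally show ?thesis by linarith
  qed
  have "Cauchy (\<lambda>n. h (1 / (real n + 1)))"
  proof (rule metric_CauchyI)
    fix e :: real assume e: "e > 0"
    have "\<forall>\<^sub>F n in sequentially. (1 / (real n + 1)) powr b < e / (c + 1)"
      using e c0 by (intro order_tendstoD[OF zb]) auto
    then obtain M where M: "\<And>n. n \<ge> M \<Longrightarrow> (1 / (real n + 1)) powr b < e / (c + 1)"
      unfolding eventually_sequentially by blast
    have "dist (h (1 / (real m + 1))) (h (1 / (real n + 1))) < e" if "m \<ge> M" "n \<ge> M" for m n
    proof -
      have "dist (h (1 / (real m + 1))) (h (1 / (real n + 1))) \<le> c * max ((1 / (real m + 1)) powr b) ((1 / (real n + 1)) powr b)"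
        unfolding dist_real_def by (rule h2) auto
      also have "\<dots> \<le> c * (e / (c + 1))" using M[OF that(1)] M[OF that(2)] c0 by (intro mult_left_mono) auto
      also have "\<dots> < e" using e c0 by (simp add: field_simps)
      finally show ?thesis .
    qed
    then show "\<exists>M. \<forall>m\<ge>M. \<forall>n\<ge>M. dist (h (1 / (real m + 1))) (h (1 / (real n + 1))) < e" by blast
  qed
  then show L: "(\<lambda>n. h (1 / (real n + 1))) \<longlonglongrightarrow> lim (\<lambda>n. h (1 / (real n + 1)))"
    by (simp add: Cauchy_convergent_iff convergent_LIMSEQ_iff)
  show "\<bar>h t - lim (\<lambda>n. h (1 / (real n + 1)))\<bar> \<le> c * t powr b" if t: "0 < t"
  proof (rule LIMSEQ_le)
    show "(\<lambda>n. \<bar>h t - h (1 / (real n + 1))\<bar>) \<longlonglongrightarrow> \<bar>h t - lim (\<lambda>n. h (1 / (real n + 1)))\<bar>"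
      by (intro tendsto_intros L)
    have "(\<lambda>n. c * max (t powr b) ((1 / (real n + 1)) powr b)) \<longlonglongrightarrow> c * max (t powr b) 0"
      by (intro tendsto_intros tendsto_max zb)
    then show "(\<lambda>n. c * max (t powr b) ((1 / (real n + 1)) powr b)) \<longlonglongrightarrow> c * t powr b" by simp
    show "\<exists>N. \<forall>n\<ge>N. \<bar>h t - h (1 / (real n + 1))\<bar> \<le> c * max (t powr b) ((1 / (real n + 1)) powr b)"
      using h2 t by auto
  qed
qed

text \<open>Setting for the linear regularity estimate. The exponent \<open>al\<close> is dictated
  by scaling: tested at scale s, a datum in L^q contributes s s^(-N/q) and the oscillation of a
  Hoelder field contributes s^al, and these agree precisely for al = 1 - N/q.\<close>

locale approx_problem =
  fixes \<rho> :: "'a::euclidean_space \<Rightarrow> real" and F :: "'a \<Rightarrow> 'a" and \<phi> :: "nat \<Rightarrow> 'a \<Rightarrow> real" and q A al K m :: real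
  assumes dim: "DIM('a) \<ge> 3" and q: "q > DIM('a)" and rho: "in_Lp q \<rho>" and A: "A \<ge> 0"
    and hoelder: "\<And>x y. norm (F x - F y) \<le> A * norm (x - y) powr al"
    and L2F: "L2 F" and sol: "approx_sol \<rho> F \<phi>"
    and al_def: "al = 1 - real DIM('a) / q" and K_def: "K = kconst TYPE('a)" and m_def: "m = mass TYPE('a)"
begin

lemmas Kc = kconst[where 'a='a, folded K_def]
lemmas m_pos = mass_pos[where 'a='a, folded m_def]

lemma al: "0 < al" "al < 1"
  using q DIM_positive[where 'a='a] by (auto simp: field_simps al_def)

lemma smooth: "smooth_Cc (\<phi> k)"
  using sol by (simp add: approx_sol_def)

lemmas C1 = smooth_Cc_C1c[OF smooth]

lemma F_cont: "continuous_on UNIV F"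
  by (rule hoelder_continuous[OF al(1) hoelder])

lemma cauchy: "n2 (\<lambda>x. grad (\<phi> k) x - grad (\<phi> l) x) \<le> 1 / (real k + 1) + 1 / (real l + 1)"
  using approx_sol_diff[OF sol sol L2F L2F, of k l] by (simp add: n2_def)

definition g :: "nat \<Rightarrow> 'a \<Rightarrow> 'a \<Rightarrow> real" where "g k i y = grad (\<phi> k) y \<bullet> i"

lemma g_C1c: "i \<in> Basis \<Longrightarrow> C1c (g k i)"
  unfolding g_def[abs_def] by (intro smooth_Cc_C1c smooth_Cc_grad smooth)

lemma g_Cc: "i \<in> Basis \<Longrightarrow> Cc (g k i)"
  by (intro C1c_Cc g_C1c)

lemma g_diff:
  assumes "i \<in> Basis"
  shows "n2 (\<lambda>y. g k i y - g l i y) \<le> 1 / (real k + 1) + 1 / (real l + 1)"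
proof -
  have "n2 (\<lambda>y. (grad (\<phi> k) y - grad (\<phi> l) y) \<bullet> i) \<le> n2 (\<lambda>x. grad (\<phi> k) x - grad (\<phi> l) x)"
    by (intro n2_component L2_diff L2_grad smooth assms)
  then show ?thesis using cauchy[of k l] by (simp add: g_def inner_diff_left)
qed

definition cs :: "real \<Rightarrow> real" where "cs s = K * vol2 TYPE('a) 2 * s powr (- DIM('a) / 2)"

lemma cs_nonneg: "cs s \<ge> 0"
  using Kc(1) by (simp add: cs_def vol2_def)

text \<open>The mollification of the i-th component of the limit gradient at scale s, defined before
  that gradient exists: for positive s, L^2 convergence already forces pointwise
  convergence.\<close>

definition H :: "'a \<Rightarrow> real \<Rightarrow> 'a \<Rightarrow> real" where "H i s x = lim (\<lambda>k. W bump s x (g k i))"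

lemma H_rate:
  assumes "s > 0" "i \<in> Basis"
  shows "\<bar>W bump s x (g k i) - W bump s x (g l i)\<bar> \<le> cs s * (1 / (real k + 1) + 1 / (real l + 1))"
proof -
  have "W bump s x (g k i) - W bump s x (g l i) = W bump s x (\<lambda>y. g k i y - g l i y)"
    by (rule W_diff_cont[symmetric, OF Kc(2) assms(1)]) (intro Cc_cont g_Cc assms)+
  also have "\<bar>\<dots>\<bar> \<le> cs s * n2 (\<lambda>y. g k i y - g l i y)"
    unfolding cs_def by (intro W_bound_L2 Kc assms L2_Cc Cc_diff g_Cc)
  also have "\<dots> \<le> cs s * (1 / (real k + 1) + 1 / (real l + 1))"
    by (intro mult_left_mono g_diff assms cs_nonneg)
  finally show ?thesis .
qed

lemma H_lim:
  assumes "s > 0" "i \<in> Basis"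
  shows "(\<lambda>k. W bump s x (g k i)) \<longlonglongrightarrow> H i s x" "\<bar>W bump s x (g k i) - H i s x\<bar> \<le> cs s / (real k + 1)"
  unfolding H_def by (rule cauchy_rate_limit, rule H_rate[OF assms])+

definition ell :: "('a \<Rightarrow> real) \<Rightarrow> real" where
  "ell \<psi> = (\<integral>x. \<rho> x * \<psi> x \<partial>lebesgue) - ip F (grad \<psi>)"

lemma sol_ell: "smooth_Cc \<psi> \<Longrightarrow> \<bar>ip (grad (\<phi> k)) (grad \<psi>) - ell \<psi>\<bar> \<le> n2 (grad \<psi>) / (real k + 1)"
  using sol by (auto simp: approx_sol_def ell_def algebra_simps)

lemma W_bump2_const:
  assumes "s > 0" shows "(\<integral>y. bump2 i j ((x - y) /\<^sub>R s) \<partial>lebesgue) = 0"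
proof -
  have "(\<integral>y. grad (psi i s x) y \<bullet> j \<partial>lebesgue) = 0"
    by (intro integral_grad smooth_Cc_C1c smooth_Cc_psi assms)
  then show ?thesis using assms unfolding grad_psi[OF assms] by simp
qed

text \<open>Every \<open>bump2\<close> kernel integrates to 0, so an arbitrary constant may be
  subtracted from F. With c = F x only the oscillation of F near x is left.\<close>

lemma ip_F_psi:
  assumes s: "s > 0" and i: "i \<in> Basis"
  shows "ip F (grad (psi i s x)) = - (\<Sum>j\<in>Basis. W (bump2 i j) s x (\<lambda>y. (F y - c) \<bullet> j))"
proof -
  have cF: "continuous_on UNIV (\<lambda>y. F y \<bullet> j)" for j using F_cont by (intro continuous_intros)
  have I: "integrable lebesgue (\<lambda>y. bump2 i j ((x - y) /\<^sub>R s) * (F y \<bullet> j))" if "j \<in> Basis" for j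
    by (intro Cc_integrable Cc_times cF Cc_kern_scaled[OF Kc(4)[OF i that] s])
  have I1: "integrable lebesgue (\<lambda>y. bump2 i j ((x - y) /\<^sub>R s))" if "j \<in> Basis" for j
    by (intro Cc_integrable Cc_kern_scaled[OF Kc(4)[OF i that] s])
  have "ip F (grad (psi i s x)) = (\<integral>y. (\<Sum>j\<in>Basis. - (bump2 i j ((x - y) /\<^sub>R s) * (F y \<bullet> j)) / s ^ DIM('a)) \<partial>lebesgue)"
    unfolding ip_def
  proof (intro Bochner_Integration.integral_cong refl)
    fix y
    show "F y \<bullet> grad (psi i s x) y = (\<Sum>j\<in>Basis. - (bump2 i j ((x - y) /\<^sub>R s) * (F y \<bullet> j)) / s ^ DIM('a))"
      unfolding euclidean_inner[of "F y" "grad (psi i s x) y"] grad_psi[OF s] by (simp add: mult.commute)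
  qed
  also have "\<dots> = (\<Sum>j\<in>Basis. - (\<integral>y. bump2 i j ((x - y) /\<^sub>R s) * (F y \<bullet> j) \<partial>lebesgue) / s ^ DIM('a))"
    using I by (subst Bochner_Integration.integral_sum) auto
  also have "\<dots> = (\<Sum>j\<in>Basis. - W (bump2 i j) s x (\<lambda>y. (F y - c) \<bullet> j))"
  proof (intro sum.cong refl)
    fix j :: 'a assume j: "j \<in> Basis"
    have "(\<integral>y. bump2 i j ((x - y) /\<^sub>R s) * ((F y - c) \<bullet> j) \<partial>lebesgue)
        = (\<integral>y. bump2 i j ((x - y) /\<^sub>R s) * (F y \<bullet> j) - bump2 i j ((x - y) /\<^sub>R s) * (c \<bullet> j) \<partial>lebesgue)"
      by (simp add: inner_diff_left right_diff_distrib)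
    also have "\<dots> = (\<integral>y. bump2 i j ((x - y) /\<^sub>R s) * (F y \<bullet> j) \<partial>lebesgue)"
      using I[OF j] I1[OF j] W_bump2_const[OF s, of i j x] by simp
    finally show "- (\<integral>y. bump2 i j ((x - y) /\<^sub>R s) * (F y \<bullet> j) \<partial>lebesgue) / s ^ DIM('a) = - W (bump2 i j) s x (\<lambda>y. (F y - c) \<bullet> j)"
      by (simp add: W_def)
  qed
  finally show ?thesis by (simp add: sum_negf)
qed

definition c1 :: real where "c1 = K * (vol2 TYPE('a) q + 2 * DIM('a) * ball2 TYPE('a))"

text \<open>A product, larger than what the estimates produce, so that the final bound is linear in
  \<open>Lnorm q \<rho> + A\<close> with a constant independent of both; \<open>B_split\<close>
  discards the mixed terms.\<close>

definition B :: real where "B = c1 * (Lnorm q \<rho> + A)"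

lemma B_nonneg: "B \<ge> 0"
  using Kc(1) ball2_nonneg[where 'a='a] A Lnorm_nonneg[of q \<rho>]
  by (simp add: B_def c1_def vol2_def)

lemma B_split:
  "K * vol2 TYPE('a) q * Lnorm q \<rho> + DIM('a) * (K * (2 * A * ball2 TYPE('a))) \<le> B"
proof -
  have "B = K * vol2 TYPE('a) q * Lnorm q \<rho> + DIM('a) * (K * (2 * A * ball2 TYPE('a)))
      + K * vol2 TYPE('a) q * A + K * (2 * DIM('a) * ball2 TYPE('a)) * Lnorm q \<rho>"
    by (simp add: B_def c1_def algebra_simps)
  moreover have "0 \<le> K * vol2 TYPE('a) q * A" "0 \<le> K * (2 * DIM('a) * ball2 TYPE('a)) * Lnorm q \<rho>"
    using Kc(1) ball2_nonneg[where 'a='a] A Lnorm_nonneg[of q \<rho>] by (simp_all add: vol2_def)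
  ultimately show ?thesis by linarith
qed

lemma F_loc_int:
  assumes s: "s > 0" and j: "j \<in> Basis"
  shows "loc_int (\<lambda>y. (F y - F x) \<bullet> j) x (2 * s) (2 * A * s powr al * ball2 TYPE('a) * s ^ DIM('a))"
proof (rule loc_int_bounded[OF _ s])
  show "continuous_on UNIV (\<lambda>y. (F y - F x) \<bullet> j)" using F_cont by (intro continuous_intros)
  fix y assume y: "norm (x - y) \<le> 2 * s"
  have "\<bar>(F y - F x) \<bullet> j\<bar> \<le> norm (F y - F x)" by (rule Basis_le_norm[OF j])
  also have "\<dots> \<le> A * norm (y - x) powr al" by (rule hoelder)
  also have "\<dots> \<le> A * (2 * s) powr al"
    using y al A by (intro mult_left_mono powr_mono2) (auto simp: norm_minus_commute)
  also have "(2 * s) powr al \<le> 2 * s powr al"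
  proof -
    have "(2::real) powr al \<le> 2 powr 1" using al by (intro powr_mono) auto
    then show ?thesis using s by (simp add: powr_mult mult_right_mono)
  qed
  then have "A * (2 * s) powr al \<le> 2 * A * s powr al" using A mult_left_mono[of "(2 * s) powr al" "2 * s powr al" A] by simp
  finally show "\<bar>(F y - F x) \<bullet> j\<bar> \<le> 2 * A * s powr al" .
qed

lemma ell_psi:
  assumes s: "s > 0" and i: "i \<in> Basis"
  shows "ell (psi i s z) = s * W (bump1 i) s z \<rho> + (\<Sum>j\<in>Basis. W (bump2 i j) s z (\<lambda>y. (F y - c) \<bullet> j))"
proof -
  have "(\<integral>x. \<rho> x * psi i s z x \<partial>lebesgue) = s * W (bump1 i) s z \<rho>"
  proof -
    have "(\<lambda>y. \<rho> y * psi i s z y) = (\<lambda>y. s / s ^ DIM('a) * (bump1 i ((z - y) /\<^sub>R s) * \<rho> y))"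
      by (auto simp: psi_def)
    then show ?thesis by (simp add: W_def)
  qed
  then show ?thesis by (simp add: ell_def ip_F_psi[OF s i, of _ c])
qed

lemma rate_q: "s > 0 \<Longrightarrow> s powr (- DIM('a) / q) = s powr (al - 1)" by (simp add: al_def)

text \<open>The right-hand side of the equation, tested at scale s, is of order s^al; moving the
  centre by a distance d \<le> s gains the factor d / s. These two facts are all that the Hoelder
  estimate uses of the datum and of F.\<close>

lemma ell_bound:
  assumes s: "s > 0" and i: "i \<in> Basis"
  shows "\<bar>ell (psi i s x)\<bar> \<le> s * (B * s powr (al - 1))"
    and "norm (x - x') \<le> s \<Longrightarrow> \<bar>ell (psi i s x) - ell (psi i s x')\<bar> \<le> s * (B * s powr (al - 1) * (norm (x - x') / s))"
proof -
  have q1: "q > 1" using q DIM_positive[where 'a='a] by linarith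
  note F1 = F_loc_int[OF s, of _ x]
  \<comment> \<open>The same constant F x is subtracted for both centres, so the two expressions
    differ only through the centre of the kernel.\<close>
  let ?f = "\<lambda>j y. (F y - F x) \<bullet> j"
  have sal: "s * s powr (al - 1) = s powr al" using s by (simp add: powr_diff)
  have Wj: "\<bar>W (bump2 i j) s x (?f j)\<bar> \<le> K * (2 * A * ball2 TYPE('a)) * s powr al"
    if j: "j \<in> Basis" for j
    using W_bound(2)[OF Kc(4)[OF i j] s F1[OF j], of x] s by (simp add: mult_ac)
  have "\<bar>\<Sum>j\<in>Basis. W (bump2 i j) s x (?f j)\<bar> \<le> (\<Sum>j\<in>(Basis::'a set). K * (2 * A * ball2 TYPE('a)) * s powr al)"
    by (intro order_trans[OF sum_abs] sum_mono Wj)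
  then have S: "\<bar>\<Sum>j\<in>Basis. W (bump2 i j) s x (?f j)\<bar> \<le> DIM('a) * (K * (2 * A * ball2 TYPE('a))) * s powr al" by simp
  have R: "\<bar>s * W (bump1 i) s x \<rho>\<bar> \<le> K * vol2 TYPE('a) q * Lnorm q \<rho> * s powr al"
  proof -
    have "\<bar>W (bump1 i) s x \<rho>\<bar> \<le> K * vol2 TYPE('a) q * Lnorm q \<rho> * s powr (al - 1)"
      using W_bound_Lp(2)[OF Kc(3)[OF i] s q1 rho, of x] rate_q[OF s] by simp
    from mult_left_mono[OF this, of s] s show ?thesis
      by (simp add: abs_mult sal[symmetric] mult_ac)
  qed
  have "\<bar>ell (psi i s x)\<bar> \<le> (K * vol2 TYPE('a) q * Lnorm q \<rho> + DIM('a) * (K * (2 * A * ball2 TYPE('a)))) * s powr al"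
    using S R unfolding ell_psi[OF s i, of x "F x"] by (simp add: distrib_right)
  also have "\<dots> \<le> B * s powr al" by (intro mult_right_mono B_split) auto
  finally show "\<bar>ell (psi i s x)\<bar> \<le> s * (B * s powr (al - 1))" by (simp add: sal[symmetric] mult_ac)
  assume x': "norm (x - x') \<le> s"
  define d where "d = norm (x - x') / s"
  have d: "d \<ge> 0" using s by (simp add: d_def)
  have Wj: "\<bar>W (bump2 i j) s x (?f j) - W (bump2 i j) s x' (?f j)\<bar> \<le> K * (2 * A * ball2 TYPE('a)) * s powr al * d"
    if j: "j \<in> Basis" for j
    using W_bound(3)[OF Kc(4)[OF i j] s F1[OF j] x', folded d_def] s by (simp add: mult_ac)
  have "\<bar>\<Sum>j\<in>Basis. W (bump2 i j) s x (?f j) - W (bump2 i j) s x' (?f j)\<bar> \<le> (\<Sum>j\<in>(Basis::'a set). K * (2 * A * ball2 TYPE('a)) * s powr al * d)"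
    by (intro order_trans[OF sum_abs] sum_mono Wj)
  then have S: "\<bar>\<Sum>j\<in>Basis. W (bump2 i j) s x (?f j) - W (bump2 i j) s x' (?f j)\<bar> \<le> DIM('a) * (K * (2 * A * ball2 TYPE('a))) * (s powr al * d)"
    by (simp add: mult_ac)
  have R: "\<bar>s * W (bump1 i) s x \<rho> - s * W (bump1 i) s x' \<rho>\<bar> \<le> K * vol2 TYPE('a) q * Lnorm q \<rho> * (s powr al * d)"
  proof -
    have "\<bar>W (bump1 i) s x \<rho> - W (bump1 i) s x' \<rho>\<bar> \<le> K * vol2 TYPE('a) q * Lnorm q \<rho> * s powr (al - 1) * d"
      using W_bound_Lp(3)[OF Kc(3)[OF i] s q1 rho x', folded d_def] rate_q[OF s] by simp
    from mult_left_mono[OF this, of s] s show ?thesis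
      unfolding right_diff_distrib[symmetric] by (simp add: abs_mult sal[symmetric] mult_ac)
  qed
  have "\<bar>ell (psi i s x) - ell (psi i s x')\<bar>
      \<le> (K * vol2 TYPE('a) q * Lnorm q \<rho> + DIM('a) * (K * (2 * A * ball2 TYPE('a)))) * (s powr al * d)"
    using S R unfolding ell_psi[OF s i, of _ "F x"] by (simp add: distrib_right sum_subtractf)
  also have "\<dots> \<le> B * (s powr al * d)" using d by (intro mult_right_mono B_split) auto
  finally show "\<bar>ell (psi i s x) - ell (psi i s x')\<bar> \<le> s * (B * s powr (al - 1) * (norm (x - x') / s))"
    using s by (simp add: sal[symmetric] d_def mult_ac)
qed

text \<open>Q multiplies the residual 1/(k+1) of the approximate equation, which vanishes in the
  limit; hence only uniformity over a compact range of scales matters, not the size of Q.\<close>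

lemma n2_psi_bound:
  fixes x i :: 'a
  assumes "0 < s0" "i \<in> Basis"
  shows "\<exists>Q\<ge>0. \<forall>s. s0 \<le> s \<longrightarrow> s \<le> s1 \<longrightarrow> n2 (grad (psi i s x)) \<le> Q"
proof -
  define f where "f y = DIM('a) * K / s0 ^ DIM('a) * indicator (cball x s1) y" for y
  have Lf: "L2 f"
    unfolding L2_def
  proof
    show "f \<in> borel_measurable lebesgue"
      using borel_measurable_integrable[OF integrable_indicator_cball[of "DIM('a) * K / s0 ^ DIM('a)" x s1]] by (simp add: f_def[abs_def])
    have "(\<lambda>y. (norm (f y))\<^sup>2) = (\<lambda>y. (DIM('a) * K / s0 ^ DIM('a))\<^sup>2 * indicator (cball x s1) y)"
      by (rule ext) (simp add: f_def indicator_def power_divide)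
    then show "integrable lebesgue (\<lambda>y. (norm (f y))\<^sup>2)" by (simp only: integrable_indicator_cball)
  qed
  have "n2 (grad (psi i s x)) \<le> n2 f" if s: "s0 \<le> s" "s \<le> s1" for s
  proof -
    have s0: "s > 0" using s assms by linarith
    have "norm (grad (psi i s x) y) \<le> norm (f y)" for y
    proof -
      have "norm (grad (psi i s x) y) \<le> (\<Sum>j\<in>Basis. \<bar>grad (psi i s x) y \<bullet> j\<bar>)" by (rule norm_le_l1)
      also have "\<dots> \<le> (\<Sum>j\<in>(Basis::'a set). K / s0 ^ DIM('a) * indicator (cball x s1) y)"
      proof (intro sum_mono)
        fix j :: 'a assume j: "j \<in> Basis"
        have k: "kern K (bump2 i j)" by (rule Kc(4)[OF assms(2) j])
        show "\<bar>grad (psi i s x) y \<bullet> j\<bar> \<le> K / s0 ^ DIM('a) * indicator (cball x s1) y"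
        proof (cases "norm (x - y) \<le> s1")
          case True
          have "\<bar>bump2 i j ((x - y) /\<^sub>R s)\<bar> \<le> K" using k by (simp add: kern_def)
          then have "\<bar>bump2 i j ((x - y) /\<^sub>R s)\<bar> / s ^ DIM('a) \<le> K / s0 ^ DIM('a)"
            using assms s s0 Kc(1) by (intro frac_le power_mono) auto
          then show ?thesis using True s0 by (simp add: grad_psi[OF s0] dist_norm abs_divide)
        next
          case False
          then have "bump2 i j ((x - y) /\<^sub>R s) = 0" using s by (intro kern_zero[OF k s0]) auto
          then show ?thesis using Kc(1) assms(1) by (simp add: grad_psi[OF s0])
        qed
      qed
      also have "\<dots> = f y" by (simp add: f_def)
      finally show ?thesis by simp
    qed
    then show ?thesis by (intro n2_mono L2_grad smooth_Cc_psi s0 Lf)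
  qed
  then show ?thesis by (intro exI[of _ "n2 f"]) auto
qed

lemma powr_deriv:
  assumes "0 < t" shows "((\<lambda>t. c * t powr b) has_real_derivative (c * b) * t powr (b - 1)) (at t)"
  using assms by (auto intro!: derivative_eq_intros simp: powr_diff field_simps)

text \<open>By \<open>W_grad_deriv\<close> the derivative in the scale is the weak Laplacian tested
  with \<open>psi\<close>, divided by the scale. The equation replaces it by a term of order
  r^(al-1), whose primitive is r^al / al, plus a residual that disappears as k grows.\<close>

lemma H_scale:
  assumes s: "0 < s" "s \<le> t" and i: "i \<in> Basis"
  shows "\<bar>H i t x - H i s x\<bar> \<le> B / al * (t powr al - s powr al)"
proof -
  obtain Q where Q: "Q \<ge> 0" "\<And>r. s \<le> r \<Longrightarrow> r \<le> t \<Longrightarrow> n2 (grad (psi i r x)) \<le> Q"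
    using n2_psi_bound[OF s(1) i] by blast
  have k: "\<bar>W bump t x (g k i) - W bump s x (g k i)\<bar>
      \<le> (B / al * t powr al + Q / s / (real k + 1) * t) - (B / al * s powr al + Q / s / (real k + 1) * s)" for k
  proof (rule deriv_bound_diff[OF s(2)])
    fix r assume r: "s \<le> r" "r \<le> t"
    then have r0: "r > 0" using s by linarith
    show "((\<lambda>s. W bump s x (g k i)) has_real_derivative ip (grad (\<phi> k)) (grad (psi i r x)) / r) (at r)"
      unfolding g_def[abs_def] by (rule W_grad_deriv[OF C1 r0 i])
    show "((\<lambda>t. B / al * t powr al + Q / s / (real k + 1) * t) has_real_derivative
       (B / al * al) * r powr (al - 1) + Q / s / (real k + 1)) (at r)"
      using DERIV_add[OF powr_deriv[OF r0, of "B / al" al] DERIV_cmult_Id[of "Q / s / (real k + 1)" r]] .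
    have "\<bar>ip (grad (\<phi> k)) (grad (psi i r x))\<bar> \<le> r * (B * r powr (al - 1)) + Q / (real k + 1)"
      using sol_ell[OF smooth_Cc_psi[OF r0], of k i x] ell_bound(1)[OF r0 i, of x]
        divide_right_mono[OF Q(2)[OF r], of "real k + 1"] by linarith
    from divide_right_mono[OF this, of r] r0
    have "\<bar>ip (grad (\<phi> k)) (grad (psi i r x)) / r\<bar> \<le> B * r powr (al - 1) + Q / (real k + 1) / r"
      by (simp add: abs_divide add_divide_distrib)
    also have "Q / (real k + 1) / r \<le> Q / (real k + 1) / s" using r s Q(1) by (intro divide_left_mono) auto
    finally show "\<bar>ip (grad (\<phi> k)) (grad (psi i r x)) / r\<bar> \<le> (B / al * al) * r powr (al - 1) + Q / s / (real k + 1)"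
      using al by (simp add: mult.commute)
  qed
  note z = one_over_Suc_tendsto
  have zq: "(\<lambda>l. Q / s / (real l + 1)) \<longlonglongrightarrow> 0"
    using tendsto_mult_left[OF z, of "Q / s"] by simp
  have "\<bar>H i t x - H i s x\<bar> \<le> (B / al * t powr al + 0 * t) - (B / al * s powr al + 0 * s)"
  proof (rule LIMSEQ_le)
    show "(\<lambda>k. \<bar>W bump t x (g k i) - W bump s x (g k i)\<bar>) \<longlonglongrightarrow> \<bar>H i t x - H i s x\<bar>"
      using s i by (intro tendsto_intros H_lim) auto
    show "(\<lambda>k. (B / al * t powr al + Q / s / (real k + 1) * t) - (B / al * s powr al + Q / s / (real k + 1) * s))
      \<longlonglongrightarrow> (B / al * t powr al + 0 * t) - (B / al * s powr al + 0 * s)"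
      by (intro tendsto_add tendsto_diff tendsto_const tendsto_mult zq)
  qed (use k in auto)
  then show ?thesis by (simp add: right_diff_distrib)
qed

text \<open>A bound of order s^(-N/2) from the L^2 norm alone. It anchors the comparison in
  \<open>H_space\<close> at infinite scale.\<close>

lemma H_decay:
  assumes "s > 0" "i \<in> Basis" shows "\<bar>H i s x\<bar> \<le> cs s * (n2 (grad (\<phi> 0)) + 1)"
proof -
  have "\<bar>W bump s x (g 0 i)\<bar> \<le> cs s * n2 (g 0 i)"
    unfolding cs_def by (intro W_bound_L2 Kc assms L2_Cc g_Cc)
  also have "\<dots> \<le> cs s * n2 (grad (\<phi> 0))"
    unfolding g_def[abs_def] by (intro mult_left_mono n2_component L2_grad smooth assms cs_nonneg)
  finally show ?thesis using H_lim(2)[OF assms, of x 0] by (simp add: algebra_simps)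
qed

text \<open>Compare in the scale from s up to infinity, where the spatial difference vanishes by
  \<open>H_decay\<close>. Its scale derivative is of order |x - x'| r^(al-2), integrable at infinity
  because al < 1.\<close>

lemma H_space:
  assumes s: "0 < s" "norm (x - x') \<le> s" and i: "i \<in> Basis"
  shows "\<bar>H i s x - H i s x'\<bar> \<le> B * norm (x - x') / (1 - al) * s powr (al - 1)"
proof -
  define d where "d = norm (x - x')"
  have d: "d \<ge> 0" "norm (x - x') = d" by (auto simp: d_def)
  define D where "D t = H i t x - H i t x'" for t
  have step: "\<bar>D t - D s\<bar> \<le> B * d / (1 - al) * s powr (al - 1)" if t: "s \<le> t" for t
  proof -
    obtain Q where Q: "Q \<ge> 0" "\<And>r. s \<le> r \<Longrightarrow> r \<le> t \<Longrightarrow> n2 (grad (psi i r x)) \<le> Q"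
      using n2_psi_bound[OF s(1) i] by blast
    obtain Q' where Q': "Q' \<ge> 0" "\<And>r. s \<le> r \<Longrightarrow> r \<le> t \<Longrightarrow> n2 (grad (psi i r x')) \<le> Q'"
      using n2_psi_bound[OF s(1) i] by blast
    define a where "a = - (B * d / (1 - al))"
    define w where "w k r = W bump r x (g k i) - W bump r x' (g k i)" for k r
    have k: "\<bar>w k t - w k s\<bar>
      \<le> (a * t powr (al - 1) + (Q + Q') / s / (real k + 1) * t) - (a * s powr (al - 1) + (Q + Q') / s / (real k + 1) * s)" for k
    proof (rule deriv_bound_diff[OF t])
      fix r assume r: "s \<le> r" "r \<le> t"
      then have r0: "r > 0" using s by linarith
      let ?p = "ip (grad (\<phi> k)) (grad (psi i r x)) / r - ip (grad (\<phi> k)) (grad (psi i r x')) / r"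
      show "(w k has_real_derivative ?p) (at r)"
        unfolding w_def[abs_def] g_def[abs_def] by (intro DERIV_diff W_grad_deriv C1 r0 i)
      show "((\<lambda>t. a * t powr (al - 1) + (Q + Q') / s / (real k + 1) * t) has_real_derivative
         (a * (al - 1)) * r powr (al - 1 - 1) + (Q + Q') / s / (real k + 1)) (at r)"
        using DERIV_add[OF powr_deriv[OF r0, of a "al - 1"] DERIV_cmult_Id[of "(Q + Q') / s / (real k + 1)" r]] .
      have e: "\<bar>ell (psi i r x) - ell (psi i r x')\<bar> \<le> r * (B * r powr (al - 1) * (d / r))"
        using ell_bound(2)[OF r0 i, of x x'] s r by (simp add: d)
      have "\<bar>ip (grad (\<phi> k)) (grad (psi i r x)) - ip (grad (\<phi> k)) (grad (psi i r x'))\<bar>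
          \<le> r * (B * r powr (al - 1) * (d / r)) + (Q + Q') / (real k + 1)"
        using sol_ell[OF smooth_Cc_psi[OF r0], of k i x] sol_ell[OF smooth_Cc_psi[OF r0], of k i x'] e
          divide_right_mono[OF Q(2)[OF r], of "real k + 1"] divide_right_mono[OF Q'(2)[OF r], of "real k + 1"]
        unfolding add_divide_distrib by linarith
      from divide_right_mono[OF this, of r] r0
      have "\<bar>?p\<bar> \<le> B * r powr (al - 1) * (d / r) + (Q + Q') / (real k + 1) / r"
        unfolding diff_divide_distrib[symmetric] by (simp add: abs_divide add_divide_distrib)
      also have "(Q + Q') / (real k + 1) / r \<le> (Q + Q') / (real k + 1) / s" using r s Q(1) Q'(1) by (intro divide_left_mono) auto
      also have "B * r powr (al - 1) * (d / r) = (a * (al - 1)) * r powr (al - 1 - 1)"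
      proof -
        have "a * (al - 1) = B * d" using al by (simp add: a_def field_simps)
        moreover have "r powr (al - 1 - 1) = r powr (al - 1) / r" using powr_diff[of r "al - 1" 1] r0 by simp
        ultimately show ?thesis by simp
      qed
      finally show "\<bar>?p\<bar> \<le> (a * (al - 1)) * r powr (al - 1 - 1) + (Q + Q') / s / (real k + 1)"
        by (simp add: mult.commute)
    qed
  note z = one_over_Suc_tendsto
    have zq: "(\<lambda>l. (Q + Q') / s / (real l + 1)) \<longlonglongrightarrow> 0"
      using tendsto_mult_left[OF z, of "(Q + Q') / s"] by simp
    have "\<bar>D t - D s\<bar> \<le> (a * t powr (al - 1) + 0 * t) - (a * s powr (al - 1) + 0 * s)"
    proof (rule LIMSEQ_le)
      show "(\<lambda>k. \<bar>w k t - w k s\<bar>) \<longlonglongrightarrow> \<bar>D t - D s\<bar>"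
        unfolding w_def D_def using s t i by (intro tendsto_intros H_lim) auto
      show "(\<lambda>k. (a * t powr (al - 1) + (Q + Q') / s / (real k + 1) * t) - (a * s powr (al - 1) + (Q + Q') / s / (real k + 1) * s))
        \<longlonglongrightarrow> (a * t powr (al - 1) + 0 * t) - (a * s powr (al - 1) + 0 * s)"
        by (intro tendsto_add tendsto_diff tendsto_const tendsto_mult zq)
    qed (use k in auto)
    also have "\<dots> \<le> - a * s powr (al - 1)"
      using B_nonneg d al by (simp add: a_def)
    finally show ?thesis by (simp add: a_def)
  qed
  have "\<bar>D s\<bar> \<le> B * d / (1 - al) * s powr (al - 1)"
  proof -
    define S where "S n = s + real n" for n
    have St: "filterlim S at_top sequentially"
      unfolding S_def[abs_def] by (intro filterlim_tendsto_add_at_top[OF tendsto_const] filterlim_real_sequentially)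
    have "((\<lambda>t. t powr (- (DIM('a) / 2))) \<longlongrightarrow> 0) at_top"
      using DIM_positive[where 'a='a] by (intro tendsto_neg_powr filterlim_ident) auto
    from filterlim_compose[OF this St]
    have P: "(\<lambda>n. S n powr (- (DIM('a) / 2))) \<longlonglongrightarrow> 0" .
    have "(\<lambda>n. 2 * ((K * vol2 TYPE('a) 2 * S n powr (- (DIM('a) / 2))) * (n2 (grad (\<phi> 0)) + 1)))
       \<longlonglongrightarrow> 2 * ((K * vol2 TYPE('a) 2 * 0) * (n2 (grad (\<phi> 0)) + 1))"
      by (intro tendsto_mult tendsto_const P)
    then have Z: "(\<lambda>n. 2 * (cs (S n) * (n2 (grad (\<phi> 0)) + 1))) \<longlonglongrightarrow> 0" by (simp add: cs_def)
    have b: "\<bar>D s\<bar> \<le> B * d / (1 - al) * s powr (al - 1) + 2 * (cs (S n) * (n2 (grad (\<phi> 0)) + 1))" for n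
    proof -
      have "S n > 0" "s \<le> S n" using s by (auto simp: S_def)
      then show ?thesis
        using step[of "S n"] H_decay[OF _ i, of "S n" x] H_decay[OF _ i, of "S n" x'] unfolding D_def by linarith
    qed
    have "\<bar>D s\<bar> \<le> B * d / (1 - al) * s powr (al - 1) + 0"
      by (rule LIMSEQ_le_const[OF tendsto_add[OF tendsto_const Z]]) (use b in auto)
    then show ?thesis by simp
  qed
  then show ?thesis by (simp add: D_def d_def)
qed

section \<open>The limiting gradient field\<close>

definition Gc :: "'a \<Rightarrow> 'a \<Rightarrow> real" where "Gc i x = lim (\<lambda>n. H i (1 / (real n + 1)) x) / m"

definition G :: "'a \<Rightarrow> 'a" where "G x = (\<Sum>i\<in>Basis. Gc i x *\<^sub>R i)"

lemma G_inner: "i \<in> Basis \<Longrightarrow> G x \<bullet> i = Gc i x"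
  by (simp add: G_def inner_sum_left inner_Basis if_distrib sum.delta cong: if_cong)

lemma Gc_lim:
  assumes i: "i \<in> Basis"
  shows "(\<lambda>n. H i (1 / (real n + 1)) x / m) \<longlonglongrightarrow> Gc i x"
    and "0 < s \<Longrightarrow> \<bar>H i s x - m * Gc i x\<bar> \<le> B / al * s powr al"
proof -
  have h: "\<bar>H i t x - H i s x\<bar> \<le> B / al * (t powr al - s powr al)" if "0 < s" "s \<le> t" for s t
    by (rule H_scale[OF that i])
  have mG: "lim (\<lambda>n. H i (1 / (real n + 1)) x) = m * Gc i x"
    using m_pos by (simp add: Gc_def)
  show "(\<lambda>n. H i (1 / (real n + 1)) x / m) \<longlonglongrightarrow> Gc i x"
    unfolding Gc_def using m_pos by (intro tendsto_divide scale_limit(1)[OF al(1) h] tendsto_const) auto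
  show "0 < s \<Longrightarrow> \<bar>H i s x - m * Gc i x\<bar> \<le> B / al * s powr al"
    using scale_limit(2)[OF al(1) h] unfolding mG by blast
qed

definition c2 :: real where "c2 = DIM('a) * ((2 / al + 1 / (1 - al)) / m) * c1"

text \<open>Mollify at the scale d = |x - y|. Passing to scale 0 at each of the two points costs
  d^al / al, and the difference at scale d costs d^al / (1 - al); this explains the
  constant.\<close>

lemma Gc_hoelder:
  assumes i: "i \<in> Basis"
  shows "\<bar>Gc i x - Gc i y\<bar> \<le> (2 / al + 1 / (1 - al)) / m * B * norm (x - y) powr al"
proof (cases "x = y")
  case False
  define d where "d = norm (x - y)"
  have d: "d > 0" using False by (simp add: d_def)
  have m: "m > 0" by (rule m_pos)
  have "\<bar>H i d x - H i d y\<bar> \<le> B / (1 - al) * (d * d powr (al - 1))"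
    using H_space[OF d _ i, of x y] by (simp add: d_def[symmetric])
  also have "d * d powr (al - 1) = d powr al" using d by (simp add: powr_diff)
  finally have "\<bar>m * Gc i x - m * Gc i y\<bar> \<le> B / al * d powr al + B / al * d powr al + B / (1 - al) * d powr al"
    using Gc_lim(2)[OF i d, of x] Gc_lim(2)[OF i d, of y] by linarith
  also have "\<dots> = (2 / al + 1 / (1 - al)) * B * d powr al" by (simp add: algebra_simps)
  finally have "m * \<bar>Gc i x - Gc i y\<bar> \<le> (2 / al + 1 / (1 - al)) * B * d powr al"
    using m by (simp add: right_diff_distrib[symmetric] abs_mult)
  then show ?thesis using m by (simp add: d_def field_simps)
qed simp

lemma G_hoelder: "norm (G x - G y) \<le> c2 * (Lnorm q \<rho> + A) * norm (x - y) powr al"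
proof -
  have "norm (G x - G y) \<le> (\<Sum>i\<in>Basis. \<bar>(G x - G y) \<bullet> i\<bar>)" by (rule norm_le_l1)
  also have "\<dots> \<le> (\<Sum>i\<in>(Basis::'a set). (2 / al + 1 / (1 - al)) / m * B * norm (x - y) powr al)"
    by (intro sum_mono) (simp only: inner_diff_left G_inner, rule Gc_hoelder)
  also have "\<dots> = c2 * (Lnorm q \<rho> + A) * norm (x - y) powr al" by (simp add: c2_def B_def mult_ac)
  finally show ?thesis .
qed

text \<open>\<open>mollified_limit_Lp\<close> with exponent 2 identifies each pointwise limit as an
  L^2 limit. The factor 2^2 from that lemma, the 2 in d and the N components give a squared bound 16
  N / (k+1)^2.\<close>

lemma G_L2_rate: "L2 (\<lambda>x. grad (\<phi> k) x - G x)" "n2 (\<lambda>x. grad (\<phi> k) x - G x) \<le> 4 * sqrt DIM('a) / (real k + 1)"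
proof -
  define d where "d k = (2 / (real k + 1))\<^sup>2" for k :: nat
  have cau: "(\<integral>x. \<bar>g k i x - g l i x\<bar> powr 2 \<partial>lebesgue) \<le> d k" if i: "i \<in> Basis" and kl: "k \<le> l" for i k l
  proof -
    have "(\<integral>x. \<bar>g k i x - g l i x\<bar> powr 2 \<partial>lebesgue) = (n2 (\<lambda>x. g k i x - g l i x))\<^sup>2" by (simp add: n2_square)
    also have "\<dots> \<le> (1 / (real k + 1) + 1 / (real l + 1))\<^sup>2" by (intro power_mono g_diff i) simp
    also have "\<dots> \<le> (2 / (real k + 1))\<^sup>2"
    proof (rule power_mono)
      have "1 / (real l + 1) \<le> 1 / (real k + 1)" using kl by (intro frac_le) auto
      then show "1 / (real k + 1) + 1 / (real l + 1) \<le> 2 / (real k + 1)" by simp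
    qed simp
    finally show ?thesis by (simp add: d_def)
  qed
  have two: "(2::real) > 1" by simp
  note M = mollified_limit_Lp[where 'a='a, folded m_def, OF two]
  have mi: "Gc i \<in> borel_measurable lebesgue" "integrable lebesgue (\<lambda>x. (g k i x - Gc i x)\<^sup>2)"
     "(\<integral>x. (g k i x - Gc i x)\<^sup>2 \<partial>lebesgue) \<le> 4 * d k" if i: "i \<in> Basis" for i k
    using M[OF g_C1c[OF i] cau[OF i] H_lim(1)[OF _ i] Gc_lim(1)[OF i]] by auto
  have mG: "G \<in> borel_measurable lebesgue"
    unfolding G_def[abs_def] using mi(1) by (intro borel_measurable_sum borel_measurable_scaleR) auto
  have sq: "(norm (grad (\<phi> k) x - G x))\<^sup>2 = (\<Sum>i\<in>Basis. (g k i x - Gc i x)\<^sup>2)" for x k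
    unfolding power2_norm_eq_inner euclidean_inner[of "grad (\<phi> k) x - G x" "grad (\<phi> k) x - G x"]
    by (intro sum.cong refl) (simp add: g_def inner_diff_left G_inner power2_eq_square)
  show L: "L2 (\<lambda>x. grad (\<phi> k) x - G x)"
    unfolding L2_def sq
  proof
    show "(\<lambda>x. grad (\<phi> k) x - G x) \<in> borel_measurable lebesgue"
      using L2_grad[OF smooth, of k] by (intro borel_measurable_diff mG) (simp add: L2_def)
    show "integrable lebesgue (\<lambda>x. \<Sum>i\<in>Basis. (g k i x - Gc i x)\<^sup>2)"
      by (intro Bochner_Integration.integrable_sum mi)
  qed
  have "(n2 (\<lambda>x. grad (\<phi> k) x - G x))\<^sup>2 = (\<Sum>i\<in>Basis. \<integral>x. (g k i x - Gc i x)\<^sup>2 \<partial>lebesgue)"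
    unfolding n2_square sq using mi(2) by (intro Bochner_Integration.integral_sum)
  also have "\<dots> \<le> (\<Sum>i\<in>(Basis::'a set). 4 * d k)" by (intro sum_mono mi)
  also have "\<dots> = (4 * sqrt DIM('a) / (real k + 1))\<^sup>2"
    by (simp add: d_def power_divide power_mult_distrib)
  finally show "n2 (\<lambda>x. grad (\<phi> k) x - G x) \<le> 4 * sqrt DIM('a) / (real k + 1)"
    by (rule power2_le_imp_le) simp
qed

lemma G_L2: "L2 G"
  using L2_diff[OF L2_grad[OF smooth] G_L2_rate(1), of 0 0] by simp

end

definition sobconst :: "'a::euclidean_space itself \<Rightarrow> real" where
  "sobconst _ = (SOME C. C > 0 \<and> (\<forall>f :: 'a \<Rightarrow> real. C1c f \<longrightarrow> Lnorm (two_star DIM('a)) f \<le> C * n2 (grad f)))"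

lemma sobconst:
  assumes "DIM('a::euclidean_space) \<ge> 3"
  shows "sobconst TYPE('a) > 0" "C1c (f :: 'a \<Rightarrow> real) \<Longrightarrow> Lnorm (two_star DIM('a)) f \<le> sobconst TYPE('a) * n2 (grad f)"
proof -
  have "sobconst TYPE('a) > 0 \<and> (\<forall>f :: 'a \<Rightarrow> real. C1c f \<longrightarrow> Lnorm (two_star DIM('a)) f \<le> sobconst TYPE('a) * n2 (grad f))"
    unfolding sobconst_def by (rule someI_ex) (use sobolev[OF assms] in blast)
  then show "sobconst TYPE('a) > 0" "C1c (f :: 'a \<Rightarrow> real) \<Longrightarrow> Lnorm (two_star DIM('a)) f \<le> sobconst TYPE('a) * n2 (grad f)"
    by blast+
qed

text \<open>In the reflected form the point x enters through f only, so the derivative falls on f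
  and the kernel is left alone.\<close>

lemma W_line_deriv:
  fixes f :: "'a::euclidean_space \<Rightarrow> real"
  assumes f: "C1c f" and s: "s > 0"
  shows "((\<lambda>t. W bump s (x + t *\<^sub>R h) f) has_real_derivative W bump s (x + t *\<^sub>R h) (\<lambda>y. grad f y \<bullet> h)) (at t)"
proof -
  obtain B where B: "B > 0" "\<And>x. norm (grad f x) \<le> B" using C1c_lipschitz[OF f] by metis
  have Cz: "Cc (\<lambda>z::'a. bump (z /\<^sub>R s))"
    using Cc_bump_scaled[OF s, of 0] by (simp add: bump_def)
  have cf: "continuous_on UNIV f" "continuous_on UNIV (\<lambda>y. grad f y \<bullet> h)"
    by (intro Cc_cont[OF C1c_Cc[OF f]] continuous_on_inner Cc_cont[OF Cc_grad[OF f]] continuous_on_const)+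
  have ct: "continuous_on UNIV (\<lambda>z. f (y - z))" for y
    by (rule continuous_on_compose2[OF cf(1), of UNIV "\<lambda>z. y - z"]) (auto intro!: continuous_intros)
  have "((\<lambda>t. \<integral>z. bump (z /\<^sub>R s) * f (x + t *\<^sub>R h - z) \<partial>lebesgue) has_real_derivative
     (\<integral>z. bump (z /\<^sub>R s) * (grad f (x + t *\<^sub>R h - z) \<bullet> h) \<partial>lebesgue)) (at t)"
  proof (rule deriv_under_integral[where a="t - 1" and b="t + 1" and w="\<lambda>z. bump (z /\<^sub>R s) * (B * norm h)"])
    fix r :: real and z :: 'a
    show "integrable lebesgue (\<lambda>z. bump (z /\<^sub>R s) * f (x + r *\<^sub>R h - z))"
      by (intro Cc_integrable Cc_times Cz ct)
    have "((\<lambda>t. f ((x - z) + t *\<^sub>R h)) has_real_derivative grad f ((x - z) + r *\<^sub>R h) \<bullet> h) (at r)"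
      by (rule C1c_line_deriv[OF f])
    then show "((\<lambda>t. bump (z /\<^sub>R s) * f (x + t *\<^sub>R h - z)) has_real_derivative
       bump (z /\<^sub>R s) * (grad f (x + r *\<^sub>R h - z) \<bullet> h)) (at r)"
      by (intro DERIV_cmult) (simp add: algebra_simps)
    have "\<bar>grad f (x + r *\<^sub>R h - z) \<bullet> h\<bar> \<le> norm (grad f (x + r *\<^sub>R h - z)) * norm h" by (rule Cauchy_Schwarz_ineq2)
    also have "\<dots> \<le> B * norm h" by (intro mult_right_mono B) auto
    finally show "\<bar>bump (z /\<^sub>R s) * (grad f (x + r *\<^sub>R h - z) \<bullet> h)\<bar> \<le> bump (z /\<^sub>R s) * (B * norm h)"
      by (simp add: abs_mult bump_nonneg mult_left_mono)
  qed (use Cc_integrable[OF Cz] in auto)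
  from DERIV_cdivide[OF this, of "s ^ DIM('a)"] show ?thesis
    by (simp add: W_reflect[OF cf(1)] W_reflect[OF cf(2)])
qed

section \<open>The potential of the limiting field\<close>

context approx_problem
begin

lemma ps: "two_star DIM('a) > 1" using two_star_facts(1)[OF dim] by simp

lemma phi_diff_Lp:
  "Lnorm (two_star DIM('a)) (\<lambda>y. \<phi> k y - \<phi> l y) \<le> sobconst TYPE('a) * (1 / (real k + 1) + 1 / (real l + 1))"
proof -
  have "Lnorm (two_star DIM('a)) (\<lambda>y. \<phi> k y - \<phi> l y) \<le> sobconst TYPE('a) * n2 (grad (\<lambda>y. \<phi> k y - \<phi> l y))"
    by (intro sobconst(2) dim smooth_Cc_C1c smooth_Cc_diff smooth)
  also have "grad (\<lambda>y. \<phi> k y - \<phi> l y) = (\<lambda>x. grad (\<phi> k) x - grad (\<phi> l) x)"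
    using grad_lincomb(2)[OF C1 C1] by auto
  finally show ?thesis
    using mult_left_mono[OF cauchy[of k l], of "sobconst TYPE('a)"] sobconst(1)[OF dim] by linarith
qed

definition cp :: "real \<Rightarrow> real" where
  "cp s = K * vol2 TYPE('a) (two_star DIM('a)) * s powr (- DIM('a) / two_star DIM('a)) * sobconst TYPE('a)"

definition V :: "real \<Rightarrow> 'a \<Rightarrow> real" where "V s x = lim (\<lambda>k. W bump s x (\<phi> k))"

lemma V_rate:
  assumes "s > 0"
  shows "\<bar>W bump s x (\<phi> k) - W bump s x (\<phi> l)\<bar> \<le> cp s * (1 / (real k + 1) + 1 / (real l + 1))"
proof -
  have "W bump s x (\<phi> k) - W bump s x (\<phi> l) = W bump s x (\<lambda>y. \<phi> k y - \<phi> l y)"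
    by (rule W_diff_cont[symmetric, OF Kc(2) assms]) (intro Cc_cont C1c_Cc C1)+
  also have "\<bar>\<dots>\<bar> \<le> K * vol2 TYPE('a) (two_star DIM('a)) * Lnorm (two_star DIM('a)) (\<lambda>y. \<phi> k y - \<phi> l y) * s powr (- DIM('a) / two_star DIM('a))"
    using ps by (intro W_bound_Lp(2) Kc assms in_Lp_Cc Cc_diff C1c_Cc C1) auto
  also have "\<dots> \<le> K * vol2 TYPE('a) (two_star DIM('a)) * (sobconst TYPE('a) * (1 / (real k + 1) + 1 / (real l + 1))) * s powr (- DIM('a) / two_star DIM('a))"
    using Kc(1) by (intro mult_right_mono mult_left_mono phi_diff_Lp) (auto simp: vol2_def)
  finally show ?thesis by (simp add: cp_def mult_ac)
qed

lemma V_lim: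
  assumes "s > 0" shows "(\<lambda>k. W bump s x (\<phi> k)) \<longlonglongrightarrow> V s x"
  unfolding V_def by (rule cauchy_rate_limit(1), rule V_rate[OF assms])

text \<open>Compare with the mollification at scale 1: the Hoelder part bounds the difference and
  \<open>H_decay\<close> the mollification.\<close>

lemma Gc_bounded: "\<exists>b\<ge>0. \<forall>x. \<forall>i\<in>Basis. \<bar>Gc i x\<bar> \<le> b"
proof -
  define b where "b = (B / al + cs 1 * (n2 (grad (\<phi> 0)) + 1)) / m"
  have b: "b \<ge> 0" using B_nonneg al m_pos cs_nonneg by (simp add: b_def)
  moreover have "\<bar>Gc i x\<bar> \<le> b" if i: "i \<in> Basis" for i x
  proof -
    have "\<bar>m * Gc i x\<bar> \<le> B / al + cs 1 * (n2 (grad (\<phi> 0)) + 1)"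
      using Gc_lim(2)[OF i, of 1 x] H_decay[OF _ i, of 1 x] by simp
    then show ?thesis using m_pos by (simp add: b_def abs_mult field_simps)
  qed
  ultimately show ?thesis by blast
qed

lemma G_cont: "continuous_on UNIV G"
  by (rule hoelder_continuous[OF al(1) G_hoelder])

lemma g_G_rate:
  assumes "i \<in> Basis"
  shows "L2 (\<lambda>y. g k i y - Gc i y)" "n2 (\<lambda>y. g k i y - Gc i y) \<le> 4 * sqrt DIM('a) / (real k + 1)"
proof -
  have e: "(\<lambda>y. g k i y - Gc i y) = (\<lambda>y. (grad (\<phi> k) y - G y) \<bullet> i)"
    using assms by (simp add: g_def inner_diff_left G_inner)
  show "L2 (\<lambda>y. g k i y - Gc i y)" unfolding e by (intro n2_component G_L2_rate assms)
  have "n2 (\<lambda>y. g k i y - Gc i y) \<le> n2 (\<lambda>y. grad (\<phi> k) y - G y)" unfolding e by (intro n2_component G_L2_rate assms)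
  then show "n2 (\<lambda>y. g k i y - Gc i y) \<le> 4 * sqrt DIM('a) / (real k + 1)" using G_L2_rate(2)[of k] by linarith
qed

text \<open>The scale derivative is a convolution of the gradient of \<phi>_k, which splits into the
  bounded field G and a remainder of order 1/(k+1) in L^2. Letting k tend to infinity leaves a
  Lipschitz bound in the scale.\<close>

lemma V_scale: "\<exists>c. \<forall>x s t. 0 < s \<longrightarrow> s \<le> t \<longrightarrow> \<bar>V t x - V s x\<bar> \<le> c * (t - s)"
proof -
  obtain b where b: "b \<ge> 0" "\<And>x i. i \<in> Basis \<Longrightarrow> \<bar>Gc i x\<bar> \<le> b" using Gc_bounded by blast
  define c where "c = DIM('a) * (K * b * ball2 TYPE('a))"
  have "\<bar>V t x - V s x\<bar> \<le> c * (t - s)" if s: "0 < s" "s \<le> t" for x s t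
  proof -
    define e where "e k = DIM('a) * (cs s * (4 * sqrt DIM('a) / (real k + 1)))" for k :: nat
    have k: "\<bar>W bump t x (\<phi> k) - W bump s x (\<phi> k)\<bar> \<le> (c + e k) * t - (c + e k) * s" for k
    proof (rule deriv_bound_diff[OF s(2)])
      fix r assume r: "s \<le> r" "r \<le> t"
      then have r0: "r > 0" using s by linarith
      have D: "((\<lambda>s. W bump s x (\<phi> k)) has_real_derivative - (\<Sum>j\<in>Basis. W (bump1 j) r x (g k j))) (at r)"
        unfolding g_def[abs_def] by (rule W_pot_deriv[OF C1 r0])
      then show "((\<lambda>s. W bump s x (\<phi> k)) has_real_derivative - (\<Sum>j\<in>Basis. W (bump1 j) r x (g k j))) (at r)" .
      show "((*) (c + e k) has_real_derivative c + e k) (at r)" by (rule DERIV_cmult_Id)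
      have csr: "cs r \<le> cs s"
      proof -
        have "r powr (- DIM('a) / 2) \<le> s powr (- DIM('a) / 2)" using r s by (intro powr_mono2') auto
        then show ?thesis unfolding cs_def using Kc(1) by (intro mult_left_mono) (auto simp: vol2_def)
      qed
      have "\<bar>W (bump1 j) r x (g k j)\<bar> \<le> K * b * ball2 TYPE('a) + cs s * (4 * sqrt DIM('a) / (real k + 1))"
        if j: "j \<in> Basis" for j
      proof -
        have cG: "continuous_on UNIV (Gc j)"
        proof -
          have "continuous_on UNIV (\<lambda>x. G x \<bullet> j)" using G_cont by (intro continuous_intros)
          then show ?thesis using j by (simp add: G_inner)
        qed
        have "W (bump1 j) r x (\<lambda>y. g k j y - Gc j y) = W (bump1 j) r x (g k j) - W (bump1 j) r x (Gc j)"
          by (intro W_diff_cont[OF Kc(3)[OF j] r0] cG Cc_cont[OF g_Cc[OF j]])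
        moreover have "\<bar>W (bump1 j) r x (\<lambda>y. g k j y - Gc j y)\<bar> \<le> cs s * (4 * sqrt DIM('a) / (real k + 1))"
        proof -
          have "\<bar>W (bump1 j) r x (\<lambda>y. g k j y - Gc j y)\<bar> \<le> cs r * n2 (\<lambda>y. g k j y - Gc j y)"
            unfolding cs_def by (intro W_bound_L2 Kc j r0 g_G_rate)
          also have "\<dots> \<le> cs s * (4 * sqrt DIM('a) / (real k + 1))"
            by (intro mult_mono csr g_G_rate j cs_nonneg) simp
          finally show ?thesis .
        qed
        moreover have "\<bar>W (bump1 j) r x (Gc j)\<bar> \<le> K * b * ball2 TYPE('a)"
          using W_bound(2)[OF Kc(3)[OF j] r0 loc_int_bounded[OF cG r0, of x b], of x] b(2)[OF j] r0
          by (simp add: mult_ac)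
        ultimately show ?thesis by linarith
      qed
      then have "(\<Sum>j\<in>Basis. \<bar>W (bump1 j) r x (g k j)\<bar>)
        \<le> (\<Sum>j\<in>(Basis::'a set). K * b * ball2 TYPE('a) + cs s * (4 * sqrt DIM('a) / (real k + 1)))"
        by (intro sum_mono)
      also have "\<dots> = c + e k" by (simp add: c_def e_def distrib_left)
      finally show "\<bar>- (\<Sum>j\<in>Basis. W (bump1 j) r x (g k j))\<bar> \<le> c + e k"
        using sum_abs[of "\<lambda>j. W (bump1 j) r x (g k j)" Basis] by linarith
    qed
  note z = one_over_Suc_tendsto
    have e0: "e \<longlonglongrightarrow> 0"
    proof -
      have "(\<lambda>k. DIM('a) * (cs s * (4 * sqrt DIM('a))) * (1 / (real k + 1))) \<longlonglongrightarrow> DIM('a) * (cs s * (4 * sqrt DIM('a))) * 0"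
        by (intro tendsto_mult tendsto_const z)
      then show ?thesis by (simp add: e_def[abs_def] mult_ac)
    qed
    have "\<bar>V t x - V s x\<bar> \<le> (c + 0) * t - (c + 0) * s"
    proof (rule LIMSEQ_le)
      show "(\<lambda>k. \<bar>W bump t x (\<phi> k) - W bump s x (\<phi> k)\<bar>) \<longlonglongrightarrow> \<bar>V t x - V s x\<bar>"
        using s by (intro tendsto_intros V_lim) auto
      show "(\<lambda>k. (c + e k) * t - (c + e k) * s) \<longlonglongrightarrow> (c + 0) * t - (c + 0) * s"
        by (intro tendsto_intros e0)
    qed (use k in auto)
    then show ?thesis by (simp add: right_diff_distrib)
  qed
  then show ?thesis by blast
qed

definition v :: "'a \<Rightarrow> real" where "v x = lim (\<lambda>n. V (1 / (real n + 1)) x) / m"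

lemma v_lim: "(\<lambda>n. V (1 / (real n + 1)) x / m) \<longlonglongrightarrow> v x"
proof -
  obtain c where c: "\<And>x s t. 0 < s \<Longrightarrow> s \<le> t \<Longrightarrow> \<bar>V t x - V s x\<bar> \<le> c * (t - s)" using V_scale by blast
  have "\<bar>V t x - V s x\<bar> \<le> c * (t powr 1 - s powr 1)" if "0 < s" "s \<le> t" for s t
    using c[OF that] that by simp
  from scale_limit(1)[OF zero_less_one this] show ?thesis
    unfolding v_def using m_pos by (intro tendsto_divide tendsto_const) auto
qed

lemma W_grad_inner:
  assumes "s > 0"
  shows "W bump s x (\<lambda>y. grad (\<phi> k) y \<bullet> h) = (\<Sum>i\<in>Basis. (h \<bullet> i) * W bump s x (g k i))"
proof -
  have "(\<lambda>y. bump ((x - y) /\<^sub>R s) * (grad (\<phi> k) y \<bullet> h)) = (\<lambda>y. \<Sum>i\<in>Basis. (h \<bullet> i) * (bump ((x - y) /\<^sub>R s) * g k i y))"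
    by (auto simp: g_def euclidean_inner[of "grad (\<phi> k) _" h] sum_distrib_left mult_ac)
  moreover have "integrable lebesgue (\<lambda>y. (h \<bullet> i) * (bump ((x - y) /\<^sub>R s) * g k i y))" if "i \<in> Basis" for i
    by (intro integrable_mult_right Cc_integrable Cc_times Cc_bump_scaled assms Cc_cont g_Cc that)
  ultimately show ?thesis by (simp add: W_def Bochner_Integration.integral_sum sum_divide_distrib)
qed

text \<open>Taylor expansion along the segment from x to x + h at a fixed scale. The derivative
  there is a mollified gradient; exchanging its value at the moving point for that at x costs the
  oscillation of Gc and twice the distance between H and m Gc.\<close>

lemma V_expansion:
  assumes s: "s > 0"
  defines "C \<equiv> (2 / al + 1 / (1 - al)) / m * B"
  shows "\<bar>V s (x + h) - V s x - (\<Sum>i\<in>Basis. (h \<bullet> i) * H i s x)\<bar>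
    \<le> DIM('a) * (norm h * (2 * (B / al * s powr al) + m * (C * norm h powr al)))"
proof -
  have C0: "C \<ge> 0" using al m_pos B_nonneg by (simp add: C_def)
  define e where "e k = DIM('a) * (norm h * (2 * (cs s / (real k + 1)) + (2 * (B / al * s powr al) + m * (C * norm h powr al))))" for k :: nat
  define w where "w k t = W bump s (x + t *\<^sub>R h) (\<phi> k) - t * W bump s x (\<lambda>y. grad (\<phi> k) y \<bullet> h)" for k t
  have k: "\<bar>w k 1 - w k 0\<bar> \<le> e k * 1 - e k * 0" for k
  proof (rule deriv_bound_diff)
    fix t :: real assume t: "0 \<le> t" "t \<le> 1"
    let ?y = "x + t *\<^sub>R h"
    show "(w k has_real_derivative W bump s ?y (\<lambda>y. grad (\<phi> k) y \<bullet> h) - W bump s x (\<lambda>y. grad (\<phi> k) y \<bullet> h)) (at t)"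
      using DERIV_diff[OF W_line_deriv[OF C1 s, where x=x and h=h and t=t] DERIV_cmult_right[OF DERIV_ident], of k "W bump s x (\<lambda>y. grad (\<phi> k) y \<bullet> h)"]
      by (simp add: w_def[abs_def])
    show "((*) (e k) has_real_derivative e k) (at t)" by (rule DERIV_cmult_Id)
    have "\<bar>(h \<bullet> i) * W bump s ?y (g k i) - (h \<bullet> i) * W bump s x (g k i)\<bar>
        \<le> norm h * (2 * (cs s / (real k + 1)) + (2 * (B / al * s powr al) + m * (C * norm h powr al)))"
      if i: "i \<in> Basis" for i
    proof -
      have "norm (?y - x) \<le> norm h" using t by (simp add: mult_left_le_one_le)
      then have "norm (?y - x) powr al \<le> norm h powr al" using al by (intro powr_mono2) auto
      then have "C * norm (?y - x) powr al \<le> C * norm h powr al" using C0 by (intro mult_left_mono)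
      then have "\<bar>Gc i ?y - Gc i x\<bar> \<le> C * norm h powr al"
        using Gc_hoelder[OF i, of ?y x] unfolding C_def by linarith
      from mult_left_mono[OF this, of m] m_pos
      have "\<bar>m * Gc i ?y - m * Gc i x\<bar> \<le> m * (C * norm h powr al)"
        by (simp add: right_diff_distrib[symmetric] abs_mult)
      then have "\<bar>W bump s ?y (g k i) - W bump s x (g k i)\<bar>
        \<le> 2 * (cs s / (real k + 1)) + (2 * (B / al * s powr al) + m * (C * norm h powr al))"
        using H_lim(2)[OF s i, of ?y k] H_lim(2)[OF s i, of x k] Gc_lim(2)[OF i s, of ?y] Gc_lim(2)[OF i s, of x]
        by linarith
      then have "\<bar>h \<bullet> i\<bar> * \<bar>W bump s ?y (g k i) - W bump s x (g k i)\<bar>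
        \<le> norm h * (2 * (cs s / (real k + 1)) + (2 * (B / al * s powr al) + m * (C * norm h powr al)))"
        by (intro mult_mono Basis_le_norm i) auto
      then show ?thesis by (simp add: right_diff_distrib[symmetric] abs_mult)
    qed
    then have "(\<Sum>i\<in>Basis. \<bar>(h \<bullet> i) * W bump s ?y (g k i) - (h \<bullet> i) * W bump s x (g k i)\<bar>)
      \<le> (\<Sum>i\<in>(Basis::'a set). norm h * (2 * (cs s / (real k + 1)) + (2 * (B / al * s powr al) + m * (C * norm h powr al))))"
      by (intro sum_mono)
    also have "\<dots> = e k" by (simp add: e_def)
    finally show "\<bar>W bump s ?y (\<lambda>y. grad (\<phi> k) y \<bullet> h) - W bump s x (\<lambda>y. grad (\<phi> k) y \<bullet> h)\<bar> \<le> e k"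
      unfolding W_grad_inner[OF s] sum_subtractf[symmetric] by (rule order_trans[OF sum_abs])
  qed simp
  note z = one_over_Suc_tendsto
  have "(\<lambda>k. cs s * (1 / (real k + 1))) \<longlonglongrightarrow> cs s * 0" by (intro tendsto_mult tendsto_const z)
  then have zc: "(\<lambda>k. cs s / (real k + 1)) \<longlonglongrightarrow> 0" by simp
  have "\<bar>V s (x + h) - V s x - (\<Sum>i\<in>Basis. (h \<bullet> i) * H i s x)\<bar>
    \<le> DIM('a) * (norm h * (2 * 0 + (2 * (B / al * s powr al) + m * (C * norm h powr al))))"
  proof (rule LIMSEQ_le)
    have "(\<lambda>k. \<bar>W bump s (x + h) (\<phi> k) - W bump s x (\<phi> k) - (\<Sum>i\<in>Basis. (h \<bullet> i) * W bump s x (g k i))\<bar>)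
      \<longlonglongrightarrow> \<bar>V s (x + h) - V s x - (\<Sum>i\<in>Basis. (h \<bullet> i) * H i s x)\<bar>"
      using s by (intro tendsto_intros V_lim H_lim) auto
    moreover have "w k 1 - w k 0 = W bump s (x + h) (\<phi> k) - W bump s x (\<phi> k) - (\<Sum>i\<in>Basis. (h \<bullet> i) * W bump s x (g k i))" for k
      by (simp add: w_def W_grad_inner[OF s])
    ultimately show "(\<lambda>k. \<bar>w k 1 - w k 0\<bar>) \<longlonglongrightarrow> \<bar>V s (x + h) - V s x - (\<Sum>i\<in>Basis. (h \<bullet> i) * H i s x)\<bar>" by simp
    show "e \<longlonglongrightarrow> DIM('a) * (norm h * (2 * 0 + (2 * (B / al * s powr al) + m * (C * norm h powr al))))"
      unfolding e_def[abs_def] by (intro tendsto_mult tendsto_add tendsto_const zc)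
  qed (use k in auto)
  then show ?thesis by simp
qed

text \<open>Sending the scale to 0 removes the terms in s^al and leaves a remainder of order |h|^(1
  + al), so G is the classical gradient of v.\<close>

lemma v_expansion:
  defines "C \<equiv> (2 / al + 1 / (1 - al)) / m * B"
  shows "\<bar>v (x + h) - v x - G x \<bullet> h\<bar> \<le> DIM('a) * (norm h * (C * norm h powr al))"
proof -
  define s where "s n = 1 / (real n + 1)" for n
  have z: "s \<longlonglongrightarrow> 0"
    unfolding s_def by (rule one_over_Suc_tendsto)
  have zb: "(\<lambda>l. s l powr al) \<longlonglongrightarrow> 0"
    using tendsto_powr'[OF z tendsto_const[of al]] al by (auto simp: s_def)
  have "\<bar>v (x + h) - v x - (\<Sum>i\<in>Basis. (h \<bullet> i) * Gc i x)\<bar>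
      \<le> DIM('a) * (norm h * (2 * (B / al * 0) + m * (C * norm h powr al))) / m"
  proof (rule LIMSEQ_le)
    show "(\<lambda>n. \<bar>V (s n) (x + h) / m - V (s n) x / m - (\<Sum>i\<in>Basis. (h \<bullet> i) * (H i (s n) x / m))\<bar>)
      \<longlonglongrightarrow> \<bar>v (x + h) - v x - (\<Sum>i\<in>Basis. (h \<bullet> i) * Gc i x)\<bar>"
      unfolding s_def by (intro tendsto_intros v_lim Gc_lim)
    show "(\<lambda>n. DIM('a) * (norm h * (2 * (B / al * s n powr al) + m * (C * norm h powr al))) / m)
      \<longlonglongrightarrow> DIM('a) * (norm h * (2 * (B / al * 0) + m * (C * norm h powr al))) / m"
      using m_pos by (intro tendsto_divide tendsto_mult tendsto_add tendsto_const zb) auto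
    have "\<bar>V (s n) (x + h) / m - V (s n) x / m - (\<Sum>i\<in>Basis. (h \<bullet> i) * (H i (s n) x / m))\<bar>
      \<le> DIM('a) * (norm h * (2 * (B / al * s n powr al) + m * (C * norm h powr al))) / m" for n
    proof -
      have "V (s n) (x + h) / m - V (s n) x / m - (\<Sum>i\<in>Basis. (h \<bullet> i) * (H i (s n) x / m))
        = (V (s n) (x + h) - V (s n) x - (\<Sum>i\<in>Basis. (h \<bullet> i) * H i (s n) x)) / m"
        by (simp add: diff_divide_distrib sum_divide_distrib)
      moreover have "s n > 0" by (simp add: s_def)
      ultimately show ?thesis
        using divide_right_mono[OF V_expansion[of "s n" x h], of m] m_pos by (simp only: C_def abs_divide) simp
    qed
    then show "\<exists>N. \<forall>n\<ge>N. \<bar>V (s n) (x + h) / m - V (s n) x / m - (\<Sum>i\<in>Basis. (h \<bullet> i) * (H i (s n) x / m))\<bar>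
      \<le> DIM('a) * (norm h * (2 * (B / al * s n powr al) + m * (C * norm h powr al))) / m" by blast
  qed
  moreover have "G x \<bullet> h = (\<Sum>i\<in>Basis. (h \<bullet> i) * Gc i x)"
    unfolding euclidean_inner[of "G x" h] by (intro sum.cong refl) (simp add: G_inner)
  ultimately show ?thesis using m_pos by simp
qed

lemma v_deriv: "(v has_derivative (\<lambda>h. G x \<bullet> h)) (at x)"
proof -
  define C where "C = (2 / al + 1 / (1 - al)) / m * B"
  have "((\<lambda>y. norm (v y - v x - G x \<bullet> (y - x)) / norm (y - x)) \<longlongrightarrow> 0) (at x)"
  proof (rule Lim_null_comparison)
    show "\<forall>\<^sub>F y in at x. norm (norm (v y - v x - G x \<bullet> (y - x)) / norm (y - x)) \<le> DIM('a) * (C * norm (y - x) powr al)"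
    proof (intro always_eventually allI)
      fix y
      have "\<bar>v y - v x - G x \<bullet> (y - x)\<bar> \<le> DIM('a) * (norm (y - x) * (C * norm (y - x) powr al))"
        using v_expansion[of x "y - x"] by (simp add: C_def)
      then have "\<bar>v y - v x - G x \<bullet> (y - x)\<bar> \<le> DIM('a) * (C * norm (y - x) powr al) * norm (y - x)"
        by (simp add: mult_ac)
      moreover have "0 \<le> DIM('a) * (C * norm (y - x) powr al)"
        using al m_pos B_nonneg by (simp add: C_def)
      ultimately show "norm (norm (v y - v x - G x \<bullet> (y - x)) / norm (y - x)) \<le> DIM('a) * (C * norm (y - x) powr al)"
        by (cases "y = x") (auto simp: divide_le_eq)
    qed
    have "((\<lambda>y. DIM('a) * (C * norm (y - x) powr al)) \<longlongrightarrow> DIM('a) * (C * norm (x - x) powr al)) (at x)"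
      using al by (intro tendsto_intros tendsto_powr') auto
    then show "((\<lambda>y. DIM('a) * (C * norm (y - x) powr al)) \<longlongrightarrow> 0) (at x)" by simp
  qed
  then show ?thesis unfolding has_derivative_iff_norm by (simp add: bounded_linear_inner_right)
qed

lemma v_Lp:
  "v \<in> borel_measurable lebesgue" "integrable lebesgue (\<lambda>x. \<bar>\<phi> k x - v x\<bar> powr two_star DIM('a))"
  "(\<lambda>k. \<integral>x. \<bar>\<phi> k x - v x\<bar> powr two_star DIM('a) \<partial>lebesgue) \<longlonglongrightarrow> 0"
proof -
  let ?p = "two_star DIM('a)" and ?S = "sobconst TYPE('a)"
  define d where "d k = (?S * (2 / (real k + 1))) powr ?p" for k :: nat
  have S: "?S > 0" by (rule sobconst[OF dim])
  have cau: "(\<integral>x. \<bar>\<phi> k x - \<phi> l x\<bar> powr ?p \<partial>lebesgue) \<le> d k" if kl: "k \<le> l" for k l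
  proof -
    have n: "0 \<le> (\<integral>x. \<bar>\<phi> k x - \<phi> l x\<bar> powr ?p \<partial>lebesgue)" by (intro integral_nonneg_AE) auto
    have "1 / (real l + 1) \<le> 1 / (real k + 1)" using kl by (intro frac_le) auto
    then have "1 / (real k + 1) + 1 / (real l + 1) \<le> 2 / (real k + 1)" by simp
    then have "?S * (1 / (real k + 1) + 1 / (real l + 1)) \<le> ?S * (2 / (real k + 1))" using S by (intro mult_left_mono) auto
    then have "Lnorm ?p (\<lambda>x. \<phi> k x - \<phi> l x) \<le> ?S * (2 / (real k + 1))"
      using phi_diff_Lp[of k l] by linarith
    then have "Lnorm ?p (\<lambda>x. \<phi> k x - \<phi> l x) powr ?p \<le> d k"
      unfolding d_def using ps Lnorm_nonneg by (intro powr_mono2) auto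
    then show ?thesis using n ps by (simp add: Lnorm_def powr_powr)
  qed
  note M = mollified_limit_Lp[where 'a='a, folded m_def, OF ps C1 cau V_lim v_lim]
  show "v \<in> borel_measurable lebesgue" "integrable lebesgue (\<lambda>x. \<bar>\<phi> k x - v x\<bar> powr two_star DIM('a))"
    by (rule M, assumption+)+
  note z = one_over_Suc_tendsto
  have "(\<lambda>k. ?S * 2 * (1 / (real k + 1))) \<longlonglongrightarrow> ?S * 2 * 0" by (intro tendsto_mult tendsto_const z)
  then have zz: "(\<lambda>k. ?S * (2 / (real k + 1))) \<longlonglongrightarrow> 0" by (simp add: mult_ac)
  have "(\<lambda>k. 2 powr ?p * (?S * (2 / (real k + 1))) powr ?p) \<longlonglongrightarrow> 2 powr ?p * 0 powr ?p"
    using S ps by (intro tendsto_mult tendsto_const tendsto_powr' zz) (auto intro!: always_eventually)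
  then have u: "(\<lambda>k. 2 powr ?p * d k) \<longlonglongrightarrow> 0" by (simp add: d_def)
  show "(\<lambda>k. \<integral>x. \<bar>\<phi> k x - v x\<bar> powr two_star DIM('a) \<partial>lebesgue) \<longlonglongrightarrow> 0"
    by (rule tendsto_sandwich[OF _ _ tendsto_const u])
      (use M(3) in \<open>auto intro!: always_eventually integral_nonneg_AE\<close>)
qed

end

text \<open>The constant \<open>c2\<close> of the locale written out as a function of the type and
  q; neither the datum nor the field enters it.\<close>

definition regconst :: "'a::euclidean_space itself \<Rightarrow> real \<Rightarrow> real" where
  "regconst _ q = (let al = 1 - real DIM('a) / q in
     DIM('a) * ((2 / al + 1 / (1 - al)) / mass TYPE('a)) * (kconst TYPE('a) * (vol2 TYPE('a) q + 2 * DIM('a) * ball2 TYPE('a))))"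

lemma regconst_nonneg:
  fixes q :: real
  assumes "q > DIM('a::euclidean_space)" shows "regconst TYPE('a) q \<ge> 0"
proof -
  have "0 < 1 - real DIM('a) / q" "real DIM('a) / q > 0" using assms DIM_positive[where 'a='a] by (auto simp: field_simps)
  then show ?thesis
    using mass_pos[where 'a='a] kconst(1)[where 'a='a] ball2_nonneg[where 'a='a]
    unfolding regconst_def Let_def by (intro mult_nonneg_nonneg divide_nonneg_nonneg add_nonneg_nonneg) (auto simp: vol2_def)
qed

lemma approx_sol_regularity:
  fixes \<rho> :: "'a::euclidean_space \<Rightarrow> real" and F :: "'a \<Rightarrow> 'a" and q A :: real
  assumes "DIM('a) \<ge> 3" "q > DIM('a)" "in_Lp q \<rho>" "A \<ge> 0"
    and "\<And>x y. norm (F x - F y) \<le> A * norm (x - y) powr (1 - DIM('a) / q)"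
    and "L2 F" "approx_sol \<rho> F \<phi>"
  obtains G v where
    "\<And>x y. norm (G x - G y) \<le> regconst TYPE('a) q * (Lnorm q \<rho> + A) * norm (x - y) powr (1 - DIM('a) / q)"
    "L2 G" "\<And>k. L2 (\<lambda>x. grad (\<phi> k) x - G x)" "(\<lambda>k. n2 (\<lambda>x. grad (\<phi> k) x - G x)) \<longlonglongrightarrow> 0"
    "\<And>x. (v has_derivative (\<lambda>h. G x \<bullet> h)) (at x)" "v \<in> borel_measurable lebesgue"
    "\<And>k. integrable lebesgue (\<lambda>x. \<bar>\<phi> k x - v x\<bar> powr two_star DIM('a))"
    "(\<lambda>k. \<integral>x. \<bar>\<phi> k x - v x\<bar> powr two_star DIM('a) \<partial>lebesgue) \<longlonglongrightarrow> 0"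
proof -
  interpret approx_problem \<rho> F \<phi> q A "1 - real DIM('a) / q" "kconst TYPE('a)" "mass TYPE('a)"
    using assms by unfold_locales auto
  have c2: "c2 = regconst TYPE('a) q" by (simp add: c2_def c1_def regconst_def Let_def)
  note z = one_over_Suc_tendsto
  have "(\<lambda>k. 4 * sqrt DIM('a) * (1 / (real k + 1))) \<longlonglongrightarrow> 4 * sqrt DIM('a) * 0" by (intro tendsto_mult tendsto_const z)
  then have u: "(\<lambda>k. 4 * sqrt DIM('a) / (real k + 1)) \<longlonglongrightarrow> 0" by simp
  have "(\<lambda>k. n2 (\<lambda>x. grad (\<phi> k) x - G x)) \<longlonglongrightarrow> 0"
    by (rule tendsto_sandwich[OF _ _ tendsto_const u]) (use G_L2_rate(2) in auto)
  then show ?thesis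
    by (rule that[OF G_hoelder[unfolded c2] G_L2 G_L2_rate(1) _ v_deriv v_Lp])
qed

section \<open>The nonlinear fixed point\<close>

text \<open>The Hoelder bound controls the distance to a mollification at scale s, the L^2 norm
  controls the mollification itself. The free scale is 1 for the bound on a single field and small
  when two nearby fields are compared.\<close>

lemma holder_sup_bound:
  fixes g :: "'a::euclidean_space \<Rightarrow> 'a"
  assumes g: "L2 g" and h: "\<And>x y. norm (g x - g y) \<le> A * norm (x - y) powr al" and al: "al > 0" and A: "A \<ge> 0" and s: "s > 0"
  shows "norm (g x) \<le> DIM('a) * (A * s powr al + kconst TYPE('a) * vol2 TYPE('a) 2 / mass TYPE('a) * s powr (- DIM('a) / 2) * n2 g)"
    and "continuous_on UNIV g"
proof -
  show c: "continuous_on UNIV g" by (rule hoelder_continuous[OF al h])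
  let ?m = "mass TYPE('a)"
  note m = mass_pos[where 'a='a]
  have "\<bar>g x \<bullet> i\<bar> \<le> A * s powr al + kconst TYPE('a) * vol2 TYPE('a) 2 / ?m * s powr (- DIM('a) / 2) * n2 g"
    if i: "i \<in> Basis" for i
  proof -
    let ?f = "\<lambda>y. g y \<bullet> i"
    have b: "\<bar>?f x - ?f y\<bar> \<le> A * s powr al" if "norm (x - y) \<le> s" for y
    proof -
      have "\<bar>?f x - ?f y\<bar> \<le> norm (g x - g y)" using Basis_le_norm[OF i, of "g x - g y"] by (simp add: inner_diff_left)
      also have "\<dots> \<le> A * norm (x - y) powr al" by (rule h)
      also have "\<dots> \<le> A * s powr al" using that al A by (intro mult_left_mono powr_mono2) auto
      finally show ?thesis .
    qed
    have "\<bar>?m * ?f x - W bump s x ?f\<bar> \<le> ?m * (A * s powr al)"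
      using c b by (intro W_bump_approx s continuous_intros) auto
    moreover have "\<bar>W bump s x ?f\<bar> \<le> kconst TYPE('a) * vol2 TYPE('a) 2 * s powr (- DIM('a) / 2) * n2 g"
    proof -
      have "\<bar>W bump s x ?f\<bar> \<le> kconst TYPE('a) * vol2 TYPE('a) 2 * s powr (- DIM('a) / 2) * n2 ?f"
        by (intro W_bound_L2 kconst s n2_component g i)
      also have "\<dots> \<le> kconst TYPE('a) * vol2 TYPE('a) 2 * s powr (- DIM('a) / 2) * n2 g"
        using kconst(1)[where 'a='a] by (intro mult_left_mono n2_component g i) (auto simp: vol2_def)
      finally show ?thesis .
    qed
    ultimately have "\<bar>?m * ?f x\<bar> \<le> ?m * (A * s powr al) + kconst TYPE('a) * vol2 TYPE('a) 2 * s powr (- DIM('a) / 2) * n2 g"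
      by linarith
    then show ?thesis using m by (simp add: abs_mult field_simps)
  qed
  then have "(\<Sum>i\<in>Basis. \<bar>g x \<bullet> i\<bar>)
    \<le> (\<Sum>i\<in>(Basis::'a set). A * s powr al + kconst TYPE('a) * vol2 TYPE('a) 2 / ?m * s powr (- DIM('a) / 2) * n2 g)"
    by (rule sum_mono)
  then show "norm (g x) \<le> DIM('a) * (A * s powr al + kconst TYPE('a) * vol2 TYPE('a) 2 / ?m * s powr (- DIM('a) / 2) * n2 g)"
    using norm_le_l1[of "g x"] by simp
qed

section \<open>The cubic excess and the iteration map\<close>

definition excess :: "'a::euclidean_space \<Rightarrow> 'a" where
  "excess p = (1 / sqrt (1 - (norm p)\<^sup>2) - 1) *\<^sub>R p"

lemma excess_0: "excess 0 = 0" by (simp add: excess_def)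

text \<open>Write the excess as a scalar multiplier times p. The multiplier is at most r^2, and it
  varies by at most 2 r |p - p'|, which meets a vector of length at most r: the sum is 3
  r^2.\<close>

lemma excess_lipschitz:
  fixes p p' :: "'a::euclidean_space"
  assumes "norm p \<le> r" "norm p' \<le> r" "r \<le> 1/2"
  shows "norm (excess p - excess p') \<le> 3 * r\<^sup>2 * norm (p - p')"
proof -
  define w where "w x = sqrt (1 - (norm x)\<^sup>2)" for x :: 'a
  \<comment> \<open>For norms up to 1/2 the root is at least sqrt(3/4), and 4/5 is a rational lower
    bound still large enough to make both denominators below at least 1.\<close>
  have w: "4/5 \<le> w x" "(w x)\<^sup>2 = 1 - (norm x)\<^sup>2" if "norm x \<le> r" for x
  proof -
    have "(norm x)\<^sup>2 \<le> (1/2)\<^sup>2" using that assms(3) by (intro power_mono) auto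
    then have x: "(norm x)\<^sup>2 \<le> 1/4" by (simp add: power2_eq_square)
    then show "(w x)\<^sup>2 = 1 - (norm x)\<^sup>2" by (simp add: w_def)
    show "4/5 \<le> w x" unfolding w_def using x by (intro real_le_rsqrt) (simp add: power2_eq_square)
  qed
  have r0: "0 \<le> r" using assms(1) norm_ge_zero order_trans by blast
  note wp = w[OF assms(1)] and wp' = w[OF assms(2)]
  have "\<bar>1 / w p - 1\<bar> \<le> r\<^sup>2"
  proof -
    have "w p \<le> 1" unfolding w_def by simp
    then have "\<bar>1 / w p - 1\<bar> = (1 - w p) / w p" using wp by (simp add: field_simps)
    also have "\<dots> = (norm p)\<^sup>2 / (w p * (1 + w p))"
    proof -
      have "(1 - w p) * (1 + w p) = (norm p)\<^sup>2" using wp(2) by (simp add: algebra_simps power2_eq_square)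
      then show ?thesis using wp(1) by (simp flip: \<open>(1 - w p) * (1 + w p) = (norm p)\<^sup>2\<close>)
    qed
    also have "\<dots> \<le> (norm p)\<^sup>2 / 1"
    proof (rule divide_left_mono)
      have "(4/5) * (1 + 4/5) \<le> w p * (1 + w p)" using wp(1) by (intro mult_mono) auto
      then show "1 \<le> w p * (1 + w p)" by simp
    qed (use wp(1) in auto)
    also have "\<dots> \<le> r\<^sup>2" using assms(1) by (simp add: power_mono)
    finally show ?thesis .
  qed
  moreover have "\<bar>1 / w p - 1 / w p'\<bar> \<le> 2 * r * norm (p - p')"
  proof -
    have "1 / w p - 1 / w p' = (w p' - w p) / (w p * w p')" using wp(1) wp'(1) by (simp add: field_simps)
    also have "\<dots> = ((norm p)\<^sup>2 - (norm p')\<^sup>2) / (w p * w p' * (w p + w p'))"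
    proof -
      have "(w p' - w p) * (w p + w p') = (norm p)\<^sup>2 - (norm p')\<^sup>2"
        using wp(2) wp'(2) by (simp add: algebra_simps power2_eq_square)
      moreover have "w p + w p' \<noteq> 0" using wp(1) wp'(1) by simp
      ultimately show ?thesis by (simp flip: \<open>(w p' - w p) * (w p + w p') = (norm p)\<^sup>2 - (norm p')\<^sup>2\<close>)
    qed
    also have "\<bar>\<dots>\<bar> \<le> \<bar>(norm p)\<^sup>2 - (norm p')\<^sup>2\<bar> / 1"
    proof -
      have "(4/5) * (4/5) * (4/5 + 4/5) \<le> w p * w p' * (w p + w p')" using wp(1) wp'(1) by (intro mult_mono) auto
      then have "1 \<le> w p * w p' * (w p + w p')" by simp
      then show ?thesis using wp(1) wp'(1) unfolding abs_divide by (intro divide_left_mono) auto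
    qed
    also have "\<dots> = \<bar>norm p - norm p'\<bar> * (norm p + norm p')"
      by (simp add: power2_eq_square square_diff_square_factored abs_mult mult.commute)
    also have "\<dots> \<le> norm (p - p') * (2 * r)"
      using assms norm_triangle_ineq3[of p p'] by (intro mult_mono) auto
    finally show ?thesis by (simp add: mult_ac)
  qed
  moreover have "excess p - excess p' = (1 / w p - 1) *\<^sub>R (p - p') + (1 / w p - 1 / w p') *\<^sub>R p'"
    by (simp add: excess_def w_def algebra_simps)
  ultimately have "norm (excess p - excess p') \<le> r\<^sup>2 * norm (p - p') + 2 * r * norm (p - p') * r"
    using assms(2) r0
    by (auto intro!: order_trans[OF norm_triangle_ineq] add_mono mult_mono)
  then show ?thesis by (simp add: power2_eq_square algebra_simps)
qed

text \<open>r is the bound of \<open>holder_sup_bound\<close> at scale 1 for a field with both norms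
  at most R. The remaining conditions make the ball invariant: the new Hoelder constant is at most
  R/2 from the datum plus R/2 from the excess, and the new L^2 norm at most R/4 from the datum plus
  3R/4 from the excess.\<close>

locale small_problem =
  fixes \<rho> :: "'a::euclidean_space \<Rightarrow> real" and q R r al :: real
  assumes dim: "DIM('a) \<ge> 3" and q: "q > DIM('a)" and rho_q: "in_Lp q \<rho>" and rho_l: "in_Lp (two_lstar DIM('a)) \<rho>"
    and al_def: "al = 1 - DIM('a) / q"
    and R: "R > 0" and r_def: "r = DIM('a) * (R + kconst TYPE('a) * vol2 TYPE('a) 2 / mass TYPE('a) * R)"
    and r_half: "r \<le> 1/2" and reg_r: "regconst TYPE('a) q * (3 * r\<^sup>2) \<le> 1/2"
    and small_q: "regconst TYPE('a) q * Lnorm q \<rho> \<le> R / 2"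
    and small_l: "sobconst TYPE('a) * Lnorm (two_lstar DIM('a)) \<rho> \<le> R / 4"
begin

lemma al: "0 < al" "al < 1"
  using q DIM_positive[where 'a='a] by (auto simp: al_def field_simps)

definition good :: "('a \<Rightarrow> 'a) \<Rightarrow> bool" where
  "good G \<longleftrightarrow> (\<forall>x y. norm (G x - G y) \<le> R * norm (x - y) powr al) \<and> L2 G \<and> n2 G \<le> R"

text \<open>One step of the iteration together with its witnesses. The approximating test functions
  and the potential are recorded because membership of the potential in \<open>D12\<close> is read
  off from them for the fixed point.\<close>

definition solves :: "('a \<Rightarrow> 'a) \<Rightarrow> ('a \<Rightarrow> 'a) \<Rightarrow> (nat \<Rightarrow> 'a \<Rightarrow> real) \<Rightarrow> ('a \<Rightarrow> real) \<Rightarrow> bool" where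
  "solves G G' \<phi> v \<longleftrightarrow> approx_sol \<rho> (\<lambda>x. excess (G x)) \<phi> \<and>
     (\<forall>k. L2 (\<lambda>x. grad (\<phi> k) x - G' x)) \<and> (\<lambda>k. n2 (\<lambda>x. grad (\<phi> k) x - G' x)) \<longlonglongrightarrow> 0 \<and>
     (\<forall>x. (v has_derivative (\<lambda>h. G' x \<bullet> h)) (at x)) \<and> v \<in> borel_measurable lebesgue \<and>
     (\<forall>k. integrable lebesgue (\<lambda>x. \<bar>\<phi> k x - v x\<bar> powr two_star DIM('a))) \<and>
     (\<lambda>k. \<integral>x. \<bar>\<phi> k x - v x\<bar> powr two_star DIM('a) \<partial>lebesgue) \<longlonglongrightarrow> 0"

lemma good_cont: "good G \<Longrightarrow> continuous_on UNIV G"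
  using holder_sup_bound(2)[where g=G and A=R and al=al and s=1] al R by (auto simp: good_def)

lemma good_sup:
  assumes "good G" shows "norm (G x) \<le> r"
proof -
  have "norm (G x) \<le> DIM('a) * (R * 1 powr al + kconst TYPE('a) * vol2 TYPE('a) 2 / mass TYPE('a) * 1 powr (- DIM('a) / 2) * n2 G)"
    using assms al R by (intro holder_sup_bound) (auto simp: good_def)
  also have "\<dots> \<le> r"
    unfolding r_def using assms mass_pos[where 'a='a] kconst(1)[where 'a='a]
    by (auto simp: good_def vol2_def intro!: mult_left_mono divide_right_mono)
  finally show ?thesis .
qed

lemma r_nonneg: "r \<ge> 0"
  unfolding r_def using R mass_pos[where 'a='a] kconst(1)[where 'a='a]
  by (auto simp: vol2_def intro!: mult_nonneg_nonneg add_nonneg_nonneg)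

lemma del_le: "3 * r\<^sup>2 \<le> 3/4"
proof -
  have "r\<^sup>2 \<le> (1/2)\<^sup>2" using r_half r_nonneg by (intro power_mono) auto
  then show ?thesis by (simp add: power2_eq_square)
qed

lemma excess_diff:
  assumes "good G" "good G'"
  shows "norm (excess (G x) - excess (G' y)) \<le> 3 * r\<^sup>2 * norm (G x - G' y)"
  by (intro excess_lipschitz good_sup assms r_half)

lemma zero_good: "good (\<lambda>x. 0)"
  using R by (simp add: good_def L2_def n2_def)

text \<open>Comparison with the zero field turns the Lipschitz bound for the excess into a bound on
  its size; 3/4 is the bound on 3 r^2 that r \<le> 1/2 provides.\<close>

lemma good_excess:
  assumes "good G"
  shows "L2 (\<lambda>x. excess (G x))" "n2 (\<lambda>x. excess (G x)) \<le> 3/4 * R"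
    "continuous_on UNIV (\<lambda>x. excess (G x))"
    "norm (excess (G x) - excess (G y)) \<le> 3 * r\<^sup>2 * R * norm (x - y) powr al"
proof -
  show h: "norm (excess (G x) - excess (G y)) \<le> 3 * r\<^sup>2 * R * norm (x - y) powr al" for x y
  proof -
    have "norm (excess (G x) - excess (G y)) \<le> 3 * r\<^sup>2 * norm (G x - G y)" by (rule excess_diff[OF assms assms])
    also have "\<dots> \<le> 3 * r\<^sup>2 * (R * norm (x - y) powr al)"
      using assms by (intro mult_left_mono) (auto simp: good_def)
    finally show ?thesis by (simp add: mult.assoc)
  qed
  have b: "norm (excess (G x)) \<le> norm ((3/4) *\<^sub>R G x)" for x
  proof -
    have "norm (excess (G x)) \<le> 3 * r\<^sup>2 * norm (G x)" using excess_diff[OF assms zero_good, of x] by (simp add: excess_0)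
    also have "\<dots> \<le> 3/4 * norm (G x)" by (intro mult_right_mono del_le) auto
    finally show ?thesis by simp
  qed
  have "continuous_on UNIV (\<lambda>x. 1 / sqrt (1 - (norm (G x))\<^sup>2))"
  proof -
    have "1 - (norm (G x))\<^sup>2 > 0" for x
    proof -
      have "(norm (G x))\<^sup>2 \<le> (1/2)\<^sup>2" using good_sup[OF assms, of x] r_half by (intro power_mono) auto
      then show ?thesis by (simp add: power2_eq_square)
    qed
    then have "sqrt (1 - (norm (G x))\<^sup>2) \<noteq> 0" for x by (metis less_irrefl real_sqrt_eq_zero_cancel_iff)
    then show ?thesis by (intro continuous_intros good_cont assms) auto
  qed
  then show c: "continuous_on UNIV (\<lambda>x. excess (G x))"
    unfolding excess_def by (intro continuous_on_scaleR continuous_on_diff continuous_on_const good_cont assms)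
  have LG: "L2 (\<lambda>x. (3/4) *\<^sub>R G x)" using assms by (intro L2_scaleR) (simp add: good_def)
  show L: "L2 (\<lambda>x. excess (G x))"
    unfolding L2_def
  proof
    show m: "(\<lambda>x. excess (G x)) \<in> borel_measurable lebesgue" by (rule lebesgue_cont[OF c])
    show "integrable lebesgue (\<lambda>x. (norm (excess (G x)))\<^sup>2)"
    proof (rule Bochner_Integration.integrable_bound)
      show "integrable lebesgue (\<lambda>x. (norm ((3/4) *\<^sub>R G x))\<^sup>2)" using LG by (simp only: L2_def)
      show "(\<lambda>x. (norm (excess (G x)))\<^sup>2) \<in> borel_measurable lebesgue"
        by (intro lebesgue_cont continuous_intros c)
      show "AE x in lebesgue. norm ((norm (excess (G x)))\<^sup>2) \<le> norm ((norm ((3/4) *\<^sub>R G x))\<^sup>2)"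
        using b by (intro AE_I2) (auto intro!: power_mono simp: power_mult_distrib[symmetric] power_divide[symmetric] simp del: norm_scaleR)
    qed
  qed
  have "n2 (\<lambda>x. excess (G x)) \<le> n2 (\<lambda>x. (3/4) *\<^sub>R G x)" by (rule n2_mono[OF L LG b])
  also have "\<dots> \<le> 3/4 * R" using assms by (simp add: n2_scaleR good_def)
  finally show "n2 (\<lambda>x. excess (G x)) \<le> 3/4 * R" .
qed

lemma L2_limit_norm:
  assumes "L2 G'" "\<And>k. L2 (f k)" "(\<lambda>k. n2 (\<lambda>x. f k x - G' x)) \<longlonglongrightarrow> 0" "\<And>k. n2 (f k) \<le> b k" "b \<longlonglongrightarrow> c"
  shows "n2 G' \<le> c"
proof (rule LIMSEQ_le_const)
  show "(\<lambda>k. b k + n2 (\<lambda>x. f k x - G' x)) \<longlonglongrightarrow> c"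
    using tendsto_add[OF assms(5,3)] by simp
  have "n2 G' \<le> b k + n2 (\<lambda>x. f k x - G' x)" for k
  proof -
    have "n2 (\<lambda>x. G' x - f k x + f k x) \<le> n2 (\<lambda>x. G' x - f k x) + n2 (f k)"
      by (intro n2_triangle L2_diff assms)
    then show ?thesis using assms(4)[of k] n2_commute[of G' "f k"] by simp
  qed
  then show "\<exists>N. \<forall>k\<ge>N. n2 G' \<le> b k + n2 (\<lambda>x. f k x - G' x)" by blast
qed

lemma solve_step:
  assumes G: "good G" shows "\<exists>G' \<phi> v. good G' \<and> solves G G' \<phi> v"
proof -
  note E = good_excess[OF G]
  obtain \<phi> where \<phi>: "approx_sol \<rho> (\<lambda>x. excess (G x)) \<phi>"
    using approx_sol_exists[OF dim rho_l E(1)] by blast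
  have A0: "0 \<le> 3 * r\<^sup>2 * R" using R by simp
  obtain G' v where s:
    "\<And>x y. norm (G' x - G' y) \<le> regconst TYPE('a) q * (Lnorm q \<rho> + 3 * r\<^sup>2 * R) * norm (x - y) powr (1 - DIM('a) / q)"
    "L2 G'" "\<And>k. L2 (\<lambda>x. grad (\<phi> k) x - G' x)" "(\<lambda>k. n2 (\<lambda>x. grad (\<phi> k) x - G' x)) \<longlonglongrightarrow> 0"
    "\<And>x. (v has_derivative (\<lambda>h. G' x \<bullet> h)) (at x)" "v \<in> borel_measurable lebesgue"
    "\<And>k. integrable lebesgue (\<lambda>x. \<bar>\<phi> k x - v x\<bar> powr two_star DIM('a))"
    "(\<lambda>k. \<integral>x. \<bar>\<phi> k x - v x\<bar> powr two_star DIM('a) \<partial>lebesgue) \<longlonglongrightarrow> 0"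
    using approx_sol_regularity[OF dim q rho_q A0 E(4)[unfolded al_def] E(1) \<phi>] by blast
  have "norm (G' x - G' y) \<le> R * norm (x - y) powr al" for x y
  proof -
    have "regconst TYPE('a) q * (Lnorm q \<rho> + 3 * r\<^sup>2 * R) \<le> R / 2 + 1/2 * R"
    proof -
      have "regconst TYPE('a) q * (3 * r\<^sup>2) * R \<le> 1/2 * R" using reg_r R by (intro mult_right_mono) auto
      then show ?thesis using small_q by (simp only: distrib_left mult.assoc)
    qed
    then have "regconst TYPE('a) q * (Lnorm q \<rho> + 3 * r\<^sup>2 * R) * norm (x - y) powr al \<le> R * norm (x - y) powr al"
      by (intro mult_right_mono) auto
    then show ?thesis using s(1)[of x y] unfolding al_def by linarith
  qed
  moreover have "n2 G' \<le> R"
  proof (rule L2_limit_norm[OF s(2) _ s(4)])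
    show "L2 (grad (\<phi> k))" for k using \<phi> by (auto simp: approx_sol_def intro: L2_grad)
    show "n2 (grad (\<phi> k)) \<le> R / 4 + 3/4 * R + 1 / (real k + 1)" for k
      using approx_sol_norm[OF dim rho_l E(1) \<phi> sobconst[OF dim], of k] small_l E(2) by linarith
    show "(\<lambda>k. R / 4 + 3/4 * R + 1 / (real k + 1)) \<longlonglongrightarrow> R"
      using tendsto_add[OF tendsto_const[of "R / 4 + 3/4 * R"] one_over_Suc_tendsto] by simp
  qed
  ultimately have "good G'" using s(2) by (simp add: good_def)
  moreover have "solves G G' \<phi> v" unfolding solves_def using \<phi> s by blast
  ultimately show ?thesis by blast
qed

text \<open>Both steps share the datum, so \<open>approx_sol_diff\<close> leaves only the difference
  of the excesses, which is at most 3 r^2 \<le> 3/4 times the difference of the fields.\<close>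

lemma solves_contraction:
  assumes g: "good G1" "good G2" "good G1'" "good G2'" and s: "solves G1 G1' \<phi>1 v1" "solves G2 G2' \<phi>2 v2"
  shows "n2 (\<lambda>x. G1' x - G2' x) \<le> 3/4 * n2 (\<lambda>x. G1 x - G2 x)"
proof -
  have L: "L2 (\<lambda>x. grad (\<phi>1 k) x)" "L2 (\<lambda>x. grad (\<phi>2 k) x)" "L2 G1'" "L2 G2'" "L2 (\<lambda>x. G1 x - G2 x)" for k
    using g s by (auto simp: good_def solves_def approx_sol_def intro: L2_grad L2_diff)
  have e: "n2 (\<lambda>x. excess (G1 x) - excess (G2 x)) \<le> 3/4 * n2 (\<lambda>x. G1 x - G2 x)"
  proof -
    have "n2 (\<lambda>x. excess (G1 x) - excess (G2 x)) \<le> n2 (\<lambda>x. (3/4) *\<^sub>R (G1 x - G2 x))"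
    proof (rule n2_mono)
      show "L2 (\<lambda>x. excess (G1 x) - excess (G2 x))" by (intro L2_diff good_excess g)
      show "L2 (\<lambda>x. (3/4) *\<^sub>R (G1 x - G2 x))" by (intro L2_scaleR L)
      fix x
      have "norm (excess (G1 x) - excess (G2 x)) \<le> 3 * r\<^sup>2 * norm (G1 x - G2 x)" by (rule excess_diff[OF g(1,2)])
      also have "\<dots> \<le> 3/4 * norm (G1 x - G2 x)" by (intro mult_right_mono del_le) auto
      finally show "norm (excess (G1 x) - excess (G2 x)) \<le> norm ((3/4) *\<^sub>R (G1 x - G2 x))" by simp
    qed
    then show ?thesis unfolding n2_scaleR by simp
  qed
  have "n2 (\<lambda>x. G1' x - G2' x) \<le> n2 (\<lambda>x. grad (\<phi>1 k) x - G1' x) + (3/4 * n2 (\<lambda>x. G1 x - G2 x) + 1 / (real k + 1) + 1 / (real k + 1))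
      + n2 (\<lambda>x. grad (\<phi>2 k) x - G2' x)" for k
  proof -
    have "n2 (\<lambda>x. grad (\<phi>1 k) x - grad (\<phi>2 k) x) \<le> n2 (\<lambda>x. excess (G1 x) - excess (G2 x)) + 1 / (real k + 1) + 1 / (real k + 1)"
      using s by (intro approx_sol_diff good_excess g) (auto simp: solves_def)
    moreover have "n2 (\<lambda>x. G1' x - G2' x) \<le> n2 (\<lambda>x. G1' x - grad (\<phi>1 k) x) + n2 (\<lambda>x. grad (\<phi>1 k) x - G2' x)"
      by (intro n2_diff_triangle L)
    moreover have "n2 (\<lambda>x. grad (\<phi>1 k) x - G2' x) \<le> n2 (\<lambda>x. grad (\<phi>1 k) x - grad (\<phi>2 k) x) + n2 (\<lambda>x. grad (\<phi>2 k) x - G2' x)"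
      by (intro n2_diff_triangle L)
    ultimately show ?thesis using e n2_commute[of G1' "grad (\<phi>1 k)"] by simp
  qed
  moreover have "(\<lambda>k. n2 (\<lambda>x. grad (\<phi>1 k) x - G1' x) + (3/4 * n2 (\<lambda>x. G1 x - G2 x) + 1 / (real k + 1) + 1 / (real k + 1))
      + n2 (\<lambda>x. grad (\<phi>2 k) x - G2' x)) \<longlonglongrightarrow> 0 + (3/4 * n2 (\<lambda>x. G1 x - G2 x) + 0 + 0) + 0"
    using s by (intro tendsto_add tendsto_const one_over_Suc_tendsto) (auto simp: solves_def)
  ultimately have "n2 (\<lambda>x. G1' x - G2' x) \<le> 0 + (3/4 * n2 (\<lambda>x. G1 x - G2 x) + 0 + 0) + 0"
    by (intro LIMSEQ_le_const) auto
  then show ?thesis by simp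
qed

section \<open>Convergence of the iteration\<close>

definition c3 :: real where "c3 = kconst TYPE('a) * vol2 TYPE('a) 2 / mass TYPE('a)"

lemma good_diff_sup:
  assumes "good G" "good G'" "s > 0"
  shows "norm (G x - G' x) \<le> DIM('a) * (2 * R * s powr al + c3 * s powr (- DIM('a) / 2) * n2 (\<lambda>x. G x - G' x))"
  unfolding c3_def
proof (rule holder_sup_bound[OF _ _ al(1) _ assms(3)])
  show "L2 (\<lambda>x. G x - G' x)" using assms by (intro L2_diff) (auto simp: good_def)
  fix x y
  have "norm (G x - G' x - (G y - G' y)) = norm ((G x - G y) - (G' x - G' y))" by (simp add: algebra_simps)
  also have "\<dots> \<le> norm (G x - G y) + norm (G' x - G' y)" by (rule norm_triangle_ineq4)
  also have "\<dots> \<le> R * norm (x - y) powr al + R * norm (x - y) powr al"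
    using assms by (intro add_mono) (auto simp: good_def)
  finally show "norm (G x - G' x - (G y - G' y)) \<le> 2 * R * norm (x - y) powr al" by simp
qed (use R in auto)

text \<open>The contraction holds in L^2 only, whereas limits are taken pointwise. Within the
  Hoelder ball the two are reconciled by interpolation: L^2 closeness implies uniform
  closeness.\<close>

lemma sup_small:
  assumes "e > 0"
  obtains d where "d > 0" "\<And>G G' x. good G \<Longrightarrow> good G' \<Longrightarrow> n2 (\<lambda>x. G x - G' x) < d \<Longrightarrow> norm (G x - G' x) < e"
proof -
  define a where "a = real DIM('a)"
  have a: "a > 0" by (simp add: a_def)
  have c3: "c3 \<ge> 0" unfolding c3_def using mass_pos[where 'a='a] kconst(1)[where 'a='a] by (simp add: vol2_def)
  \<comment> \<open>At this scale the Hoelder term of \<open>good_diff_sup\<close> is exactly e / 2;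
    the scale being fixed, a small L^2 distance handles the other term.\<close>
  define s where "s = (e / (4 * R * a)) powr (1 / al)"
  have s: "s > 0" "s powr al = e / (4 * R * a)" using assms R a al by (auto simp: s_def powr_powr)
  define t where "t = c3 * s powr (- DIM('a) / 2)"
  have t: "t \<ge> 0" using c3 by (simp add: t_def)
  show ?thesis
  proof (rule that)
    show "e / (2 * a * (t + 1)) > 0" using assms a t by simp
    fix G G' x assume g: "good G" "good G'" and n: "n2 (\<lambda>x. G x - G' x) < e / (2 * a * (t + 1))"
    have "norm (G x - G' x) \<le> a * (2 * R * s powr al + t * n2 (\<lambda>x. G x - G' x))"
      using good_diff_sup[OF g s(1), of x] by (simp add: a_def t_def)
    also have "a * (2 * R * s powr al) = e / 2" using R a by (simp add: s(2))
    then have "a * (2 * R * s powr al + t * n2 (\<lambda>x. G x - G' x)) = e / 2 + a * (t * n2 (\<lambda>x. G x - G' x))"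
      by (simp add: distrib_left)
    also have "\<dots> \<le> e / 2 + a * (t * (e / (2 * a * (t + 1))))"
      using n a t by (intro add_left_mono mult_left_mono) auto
    also have "\<dots> < e"
    proof -
      have "a * (t * (e / (2 * a * u))) = (e / 2) * (t / u)" if "u > 0" for u
        using a that by (simp add: field_simps)
      then have "a * (t * (e / (2 * a * (t + 1)))) = (e / 2) * (t / (t + 1))" using t by simp
      also have "\<dots> < (e / 2) * 1" using assms t by (intro mult_strict_left_mono) auto
      finally show ?thesis by simp
    qed
    finally show "norm (G x - G' x) < e" .
  qed
qed

lemma fixpoint_exists: "\<exists>G \<phi> v. good G \<and> solves G G \<phi> v"
proof -
  have "\<exists>f. \<forall>n. good (f n) \<and> (\<exists>\<phi> v. solves (f n) (f (Suc n)) \<phi> v)"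
  proof (rule dependent_nat_choice)
    show "\<exists>x. good x" using zero_good by blast
    show "\<exists>y. good y \<and> (\<exists>\<phi> v. solves x y \<phi> v)" if "good x" for x and n :: nat
      using solve_step[OF that] by blast
  qed
  then obtain f where f: "\<And>n. good (f n)" and st: "\<And>n. \<exists>\<phi> v. solves (f n) (f (Suc n)) \<phi> v" by blast
  have L: "L2 (f n)" "n2 (f n) \<le> R" for n using f by (auto simp: good_def)
  define k :: real where "k = 3/4"
  have one: "n2 (\<lambda>x. f (Suc n) x - f n x) \<le> 2 * R * k ^ n" for n
  proof (induction n)
    case 0
    have "n2 (\<lambda>x. f (Suc 0) x - f 0 x) \<le> n2 (f (Suc 0)) + n2 (\<lambda>x. (-1) *\<^sub>R f 0 x)"
      using n2_triangle[OF L(1) L2_scaleR[OF L(1)], of "Suc 0" "-1" 0] by simp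
    then show ?case using L(2)[of 0] L(2)[of "Suc 0"] by (simp only: n2_scaleR) simp
  next
    case (Suc n)
    obtain \<phi>1 v1 \<phi>2 v2 where "solves (f (Suc n)) (f (Suc (Suc n))) \<phi>1 v1" "solves (f n) (f (Suc n)) \<phi>2 v2"
      using st by metis
    from solves_contraction[OF f f f f this] Suc.IH show ?case by (simp add: k_def)
  qed
  \<comment> \<open>A geometric sum: 8 R = 2 R / (1 - k) for k = 3/4, in a telescoped form that
    suits the induction.\<close>
  have tail: "n2 (\<lambda>x. f (n + j) x - f n x) \<le> 8 * R * k ^ n * (1 - k ^ j)" for n j
  proof (induction j)
    case 0 then show ?case by (simp add: n2_def)
  next
    case (Suc j)
    have "n2 (\<lambda>x. f (n + Suc j) x - f n x) \<le> n2 (\<lambda>x. f (Suc (n + j)) x - f (n + j) x) + n2 (\<lambda>x. f (n + j) x - f n x)"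
      using n2_diff_triangle[OF L(1)[of "Suc (n + j)"] L(1)[of "n + j"] L(1)[of n]] by simp
    also have "\<dots> \<le> 2 * R * k ^ (n + j) + 8 * R * k ^ n * (1 - k ^ j)" by (intro add_mono one Suc.IH)
    also have "\<dots> = 8 * R * k ^ n * (1 - k ^ Suc j)" by (simp add: k_def power_add algebra_simps)
    finally show ?case .
  qed
  have tail2: "n2 (\<lambda>x. f i x - f n x) \<le> 8 * R * k ^ n" if "n \<le> i" for n i
  proof -
    have "8 * R * k ^ n * (1 - k ^ (i - n)) \<le> 8 * R * k ^ n * 1"
      using R by (intro mult_left_mono) (auto simp: k_def)
    then show ?thesis using tail[of n "i - n"] that by simp
  qed
  have k0: "(\<lambda>n. 8 * R * k ^ n) \<longlonglongrightarrow> 0"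
    using tendsto_mult_left[OF LIMSEQ_power_zero[of k], of "8 * R"] by (simp add: k_def)
  have conv: "convergent (\<lambda>n. f n x)" for x
    unfolding Cauchy_convergent_iff[symmetric]
  proof (rule metric_CauchyI)
    fix e :: real assume "e > 0"
    then obtain d where d: "d > 0" "\<And>G G' x. good G \<Longrightarrow> good G' \<Longrightarrow> n2 (\<lambda>x. G x - G' x) < d \<Longrightarrow> norm (G x - G' x) < e"
      using sup_small by blast
    have "\<forall>\<^sub>F n in sequentially. 8 * R * k ^ n < d" by (rule order_tendstoD(2)[OF k0 d(1)])
    then obtain M where M: "\<And>n. n \<ge> M \<Longrightarrow> 8 * R * k ^ n < d" unfolding eventually_sequentially by blast
    have "dist (f i x) (f j x) < e" if ij: "i \<ge> M" "j \<ge> M" for i j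
    proof (cases "j \<le> i")
      case True
      have "n2 (\<lambda>x. f i x - f j x) < d" using tail2[OF True] M[OF ij(2)] by linarith
      then show ?thesis using d(2)[OF f f] by (simp add: dist_norm)
    next
      case False
      then have "n2 (\<lambda>x. f j x - f i x) < d" using tail2[of i j] M[OF ij(1)] by linarith
      from d(2)[OF f f this, of x] show ?thesis by (simp add: dist_norm norm_minus_commute)
    qed
    then show "\<exists>M. \<forall>m\<ge>M. \<forall>n\<ge>M. dist (f m x) (f n x) < e" by blast
  qed
  define g where "g x = lim (\<lambda>n. f n x)" for x
  have lim: "(\<lambda>n. f n x) \<longlonglongrightarrow> g x" for x
    using conv[of x] unfolding g_def by (simp add: convergent_LIMSEQ_iff)
  have gh: "norm (g x - g y) \<le> R * norm (x - y) powr al" for x y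
    by (rule LIMSEQ_le_const2[of "\<lambda>n. norm (f n x - f n y)"])
      (use f in \<open>auto intro!: tendsto_intros lim simp: good_def\<close>)
  have mg: "g \<in> borel_measurable lebesgue"
    by (rule borel_measurable_LIMSEQ_metric[of f]) (use L lim in \<open>auto simp: L2_def\<close>)
  \<comment> \<open>The pointwise limit inherits the L^2 tail bound by Fatou's lemma, so it is also
    the L^2 limit.\<close>
  have fat: "integrable lebesgue (\<lambda>x. (norm (g x - f n x))\<^sup>2) \<and> (\<integral>x. (norm (g x - f n x))\<^sup>2 \<partial>lebesgue) \<le> (8 * R * k ^ n)\<^sup>2" for n
  proof -
    have i: "integrable lebesgue (\<lambda>x. (norm (f (j + n) x - f n x))\<^sup>2)" for j
      using L2_diff[OF L(1) L(1), of "j + n" n] by (simp add: L2_def)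
    have b: "(\<integral>x. (norm (f (j + n) x - f n x))\<^sup>2 \<partial>lebesgue) \<le> (8 * R * k ^ n)\<^sup>2" for j
      using power_mono[OF tail2[of n "j + n"], of 2] by (simp add: n2_square)
    have l: "(\<lambda>j. (norm (f (j + n) x - f n x))\<^sup>2) \<longlonglongrightarrow> (norm (g x - f n x))\<^sup>2" for x
      by (intro tendsto_intros LIMSEQ_ignore_initial_segment[OF lim])
    have mm: "(\<lambda>x. (norm (g x - f n x))\<^sup>2) \<in> borel_measurable lebesgue"
    proof -
      have "(\<lambda>x. g x - f n x) \<in> borel_measurable lebesgue"
        using mg L(1)[of n] by (intro borel_measurable_diff) (simp_all add: L2_def)
      then show ?thesis by measurable
    qed
    show ?thesis
      using fatou_bound(1,2)[OF i _ AE_I2[OF l] mm b tendsto_const] by simp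
  qed
  have Lgf: "L2 (\<lambda>x. g x - f n x)" for n
    unfolding L2_def using fat[of n] mg L(1)[of n] by (intro conjI borel_measurable_diff) (simp_all add: L2_def)
  have ngf: "n2 (\<lambda>x. g x - f n x) \<le> 8 * R * k ^ n" for n
    unfolding n2_def using fat[of n] R by (intro real_le_lsqrt) (auto simp: k_def)
  have Lg: "L2 g" using L2_add[OF Lgf[of 0] L(1)[of 0]] by simp
  have gf0: "(\<lambda>n. n2 (\<lambda>x. g x - f n x)) \<longlonglongrightarrow> 0"
    by (rule tendsto_sandwich[OF _ _ tendsto_const k0]) (use ngf in auto)
  have "n2 g \<le> R"
    by (rule L2_limit_norm[OF Lg L(1) _ L(2) tendsto_const]) (use gf0 in \<open>simp add: n2_commute[of g]\<close>)
  then have gg: "good g" using gh Lg by (simp add: good_def)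
  \<comment> \<open>No continuity of the iteration map is invoked: one more step from the limit g
    gives g', and contraction compares g' with \<open>f (Suc n)\<close>, which converges to g. The
    L^2 distance of g' and g is thus 0, and \<open>sup_small\<close> makes them equal
    everywhere.\<close>
  obtain g' \<phi> v where g': "good g'" "solves g g' \<phi> v" using solve_step[OF gg] by blast
  have "g' x = g x" for x
  proof (rule ccontr)
    assume "g' x \<noteq> g x"
    then have "norm (g' x - g x) > 0" by simp
    then obtain d where d: "d > 0" "\<And>G G' y. good G \<Longrightarrow> good G' \<Longrightarrow> n2 (\<lambda>x. G x - G' x) < d \<Longrightarrow> norm (G y - G' y) < norm (g' x - g x)"
      using sup_small by blast
    have b: "n2 (\<lambda>x. g' x - g x) \<le> 3/4 * n2 (\<lambda>x. g x - f n x) + n2 (\<lambda>x. g x - f (Suc n) x)" for n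
    proof -
      obtain \<phi>1 v1 where "solves (f n) (f (Suc n)) \<phi>1 v1" using st by blast
      from solves_contraction[OF gg f g'(1) f g'(2) this]
      have "n2 (\<lambda>x. g' x - f (Suc n) x) \<le> 3/4 * n2 (\<lambda>x. g x - f n x)" .
      moreover have "n2 (\<lambda>x. g' x - g x) \<le> n2 (\<lambda>x. g' x - f (Suc n) x) + n2 (\<lambda>x. f (Suc n) x - g x)"
        using g'(1) by (intro n2_diff_triangle L Lg) (simp add: good_def)
      ultimately show ?thesis using n2_commute[of g "f (Suc n)"] by simp
    qed
    have "n2 (\<lambda>x. g' x - g x) \<le> 3/4 * 0 + 0"
      by (rule LIMSEQ_le_const[OF tendsto_add[OF tendsto_mult[OF tendsto_const gf0] LIMSEQ_Suc[OF gf0]]]) (use b in auto)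
    then have "n2 (\<lambda>x. g' x - g x) < d" using d(1) by simp
    from d(2)[OF g'(1) gg this, of x] show False by simp
  qed
  then have "g' = g" by auto
  then show ?thesis using g' by blast
qed

end

section \<open>Energy and minimizers\<close>

lemma powr_le_add_powr:
  fixes t m r q :: real
  assumes "m \<le> r" "r \<le> q" "t \<ge> 0" "m > 0"
  shows "t powr r \<le> t powr m + t powr q"
proof (cases "t \<le> 1")
  case True
  then have "t powr r \<le> t powr m" using assms by (intro powr_mono') auto
  then show ?thesis by (simp add: add_increasing2)
next
  case False
  then have "t powr r \<le> t powr q" using assms by (intro powr_mono) auto
  then show ?thesis by (simp add: add_increasing)
qed

text \<open>Pointwise, t^r is at most t^m for t \<le> 1 and at most t^q beyond. The estimate is kept
  at the level of integrals, which are then compared with the norms.\<close>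

lemma in_Lp_interpolate:
  fixes f :: "'a::euclidean_space \<Rightarrow> real"
  assumes "in_Lp m f" "in_Lp q f" "m \<le> r" "r \<le> q" "m > 0"
  shows "in_Lp r f"
    and "(\<integral>x. \<bar>f x\<bar> powr r \<partial>lebesgue) \<le> (\<integral>x. \<bar>f x\<bar> powr m \<partial>lebesgue) + (\<integral>x. \<bar>f x\<bar> powr q \<partial>lebesgue)"
proof -
  have m: "f \<in> borel_measurable lebesgue" and i: "integrable lebesgue (\<lambda>x. \<bar>f x\<bar> powr m)" "integrable lebesgue (\<lambda>x. \<bar>f x\<bar> powr q)"
    using assms by (auto simp: in_Lp_def)
  have b: "\<bar>f x\<bar> powr r \<le> \<bar>f x\<bar> powr m + \<bar>f x\<bar> powr q" for x
    using assms by (intro powr_le_add_powr) auto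
  have I: "integrable lebesgue (\<lambda>x. \<bar>f x\<bar> powr r)"
    by (rule Bochner_Integration.integrable_bound[OF Bochner_Integration.integrable_add[OF i]])
      (use m b in \<open>auto intro!: AE_I2 order_trans[OF b abs_ge_self]\<close>)
  then show "in_Lp r f" using m by (simp add: in_Lp_def)
  have "(\<integral>x. \<bar>f x\<bar> powr r \<partial>lebesgue) \<le> (\<integral>x. \<bar>f x\<bar> powr m + \<bar>f x\<bar> powr q \<partial>lebesgue)"
    using I i b by (intro integral_mono) auto
  then show "(\<integral>x. \<bar>f x\<bar> powr r \<partial>lebesgue) \<le> (\<integral>x. \<bar>f x\<bar> powr m \<partial>lebesgue) + (\<integral>x. \<bar>f x\<bar> powr q \<partial>lebesgue)"
    using i by simp
qed

text \<open>For c \<le> 1 and p \<ge> 1 one has c^p \<le> c, which makes the bound independent of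
  the exponent.\<close>

lemma integral_powr_le_of_Lnorm:
  assumes "Lnorm p f \<le> c" "c \<le> 1" "p \<ge> 1"
  shows "(\<integral>x. \<bar>f x\<bar> powr p \<partial>lebesgue) \<le> c"
proof -
  have n: "0 \<le> (\<integral>x. \<bar>f x\<bar> powr p \<partial>lebesgue)" by (intro integral_nonneg_AE) auto
  have c: "0 \<le> c" using assms(1) Lnorm_nonneg order_trans by blast
  have "(\<integral>x. \<bar>f x\<bar> powr p \<partial>lebesgue) = Lnorm p f powr p"
    using n assms by (simp add: Lnorm_def powr_powr)
  also have "\<dots> \<le> c powr p" using assms Lnorm_nonneg by (intro powr_mono2) auto
  also have "\<dots> \<le> c" using powr_mono'[of 1 p c] assms c by simp
  finally show ?thesis .
qed

section \<open>Density in D^{1,2} and consequences\<close>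

lemma D12_L2_grad: "u \<in> D12 \<Longrightarrow> L2 (grad u)"
  by (simp add: D12_def L2_def)

lemma D12_in_Lp:
  fixes u :: "'a::euclidean_space \<Rightarrow> real"
  shows "u \<in> D12 \<Longrightarrow> in_Lp (two_star DIM('a)) u"
  by (simp add: D12_def)

lemma in_Lp_diff:
  fixes f g :: "'a::euclidean_space \<Rightarrow> real"
  assumes "in_Lp p f" "in_Lp p g" "p > 0"
  shows "in_Lp p (\<lambda>x. f x - g x)"
  unfolding in_Lp_def
proof
  show m: "(\<lambda>x. f x - g x) \<in> borel_measurable lebesgue" using assms by (auto simp: in_Lp_def)
  show "integrable lebesgue (\<lambda>x. \<bar>f x - g x\<bar> powr p)"
  proof (rule Bochner_Integration.integrable_bound)
    show "integrable lebesgue (\<lambda>x. 2 powr p * (\<bar>f x\<bar> powr p + \<bar>g x\<bar> powr p))"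
      using assms by (auto simp: in_Lp_def)
    show "(\<lambda>x. \<bar>f x - g x\<bar> powr p) \<in> borel_measurable lebesgue" using m by simp
    show "AE x in lebesgue. norm (\<bar>f x - g x\<bar> powr p) \<le> norm (2 powr p * (\<bar>f x\<bar> powr p + \<bar>g x\<bar> powr p))"
      using powr_add_le[OF assms(3), of "f _" "- g _"] by (intro AE_I2) simp
  qed
qed

lemma D12_approx:
  fixes u :: "'a::euclidean_space \<Rightarrow> real"
  assumes "u \<in> D12" and N: "DIM('a) \<ge> 3"
  obtains w where "\<And>k. smooth_Cc (w k)" "\<And>k. in_Lp (two_star DIM('a)) (\<lambda>x. w k x - u x)"
    "(\<lambda>k. Lnorm (two_star DIM('a)) (\<lambda>x. w k x - u x)) \<longlonglongrightarrow> 0"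
    "\<And>k. L2 (\<lambda>x. grad (w k) x - grad u x)" "(\<lambda>k. n2 (\<lambda>x. grad (w k) x - grad u x)) \<longlonglongrightarrow> 0"
proof -
  have p: "two_star DIM('a) > 0" using two_star_facts(1)[OF N] by simp
  obtain w where c: "\<And>k. smooth_Cc (w k)"
    "(\<lambda>k. \<integral>x. \<bar>w k x - u x\<bar> powr two_star DIM('a) \<partial>lebesgue) \<longlonglongrightarrow> 0"
    "(\<lambda>k. \<integral>x. (norm (grad (w k) x - grad u x))\<^sup>2 \<partial>lebesgue) \<longlonglongrightarrow> 0"
    using assms(1) unfolding D12_def by blast
  have L: "in_Lp (two_star DIM('a)) (\<lambda>x. w k x - u x)" for k
    by (intro in_Lp_diff D12_in_Lp assms p in_Lp_Cc C1c_Cc smooth_Cc_C1c c)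
  have G: "L2 (\<lambda>x. grad (w k) x - grad u x)" for k
    by (intro L2_diff L2_grad c D12_L2_grad assms)
  have "(\<lambda>k. Lnorm (two_star DIM('a)) (\<lambda>x. w k x - u x)) \<longlonglongrightarrow> 0 powr (1 / two_star DIM('a))"
    unfolding Lnorm_def using p
    by (intro tendsto_powr' tendsto_const c(2)) (auto intro!: always_eventually integral_nonneg_AE)
  moreover have "(\<lambda>k. n2 (\<lambda>x. grad (w k) x - grad u x)) \<longlonglongrightarrow> sqrt 0"
    unfolding n2_def by (intro tendsto_real_sqrt c(3))
  ultimately show ?thesis using that[OF c(1) L _ G] by simp
qed

text \<open>Both sides are continuous for the convergence built into \<open>D12\<close>: the flux
  pairs with gradients in L^2, and the datum pairs with functions in L^{2^*}.\<close>

lemma weak_equation_extend: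
  fixes \<rho> :: "'a::euclidean_space \<Rightarrow> real" and P :: "'a \<Rightarrow> 'a"
  assumes N: "DIM('a) \<ge> 3" and rho: "in_Lp (two_lstar DIM('a)) \<rho>" and P: "L2 P"
    and eq: "\<And>\<psi>. smooth_Cc \<psi> \<Longrightarrow> ip P (grad \<psi>) = (\<integral>x. \<rho> x * \<psi> x \<partial>lebesgue)" and u: "u \<in> D12"
  shows "ip P (grad u) = (\<integral>x. \<rho> x * u x \<partial>lebesgue)"
proof -
  obtain w where c: "\<And>k. smooth_Cc (w k)" "\<And>k. in_Lp (two_star DIM('a)) (\<lambda>x. w k x - u x)"
    "(\<lambda>k. Lnorm (two_star DIM('a)) (\<lambda>x. w k x - u x)) \<longlonglongrightarrow> 0"
    "\<And>k. L2 (\<lambda>x. grad (w k) x - grad u x)" "(\<lambda>k. n2 (\<lambda>x. grad (w k) x - grad u x)) \<longlonglongrightarrow> 0"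
    using D12_approx[OF u N] by blast
  have p: "two_star DIM('a) > 0" using two_star_facts(1)[OF N] by simp
  have b: "\<bar>ip P (grad u) - (\<integral>x. \<rho> x * u x \<partial>lebesgue)\<bar> \<le> n2 P * n2 (\<lambda>x. grad (w k) x - grad u x)
      + Lnorm (two_lstar DIM('a)) \<rho> * Lnorm (two_star DIM('a)) (\<lambda>x. w k x - u x)" for k
  proof -
    have "ip P (grad (w k)) - ip P (grad u) = ip P (\<lambda>x. grad (w k) x - grad u x)"
      using P D12_L2_grad[OF u] L2_grad[OF c(1)]
      by (simp add: ip_commute[of P] ip_diff_left)
    moreover have "\<bar>ip P (\<lambda>x. grad (w k) x - grad u x)\<bar> \<le> n2 P * n2 (\<lambda>x. grad (w k) x - grad u x)"
      by (intro ip_bound P c)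
    moreover have "(\<integral>x. \<rho> x * w k x \<partial>lebesgue) - (\<integral>x. \<rho> x * u x \<partial>lebesgue) = (\<integral>x. \<rho> x * (w k x - u x) \<partial>lebesgue)"
      using dual_pairing(1)[OF N rho D12_in_Lp[OF u]]
        dual_pairing(1)[OF N rho in_Lp_Cc[OF p C1c_Cc[OF smooth_Cc_C1c[OF c(1)]]], of k]
      by (simp add: right_diff_distrib)
    moreover have "\<bar>\<integral>x. \<rho> x * (w k x - u x) \<partial>lebesgue\<bar> \<le> Lnorm (two_lstar DIM('a)) \<rho> * Lnorm (two_star DIM('a)) (\<lambda>x. w k x - u x)"
      by (intro dual_pairing(2) N rho c)
    ultimately show ?thesis using eq[OF c(1), of k] by linarith
  qed
  have "\<bar>ip P (grad u) - (\<integral>x. \<rho> x * u x \<partial>lebesgue)\<bar> \<le> n2 P * 0 + Lnorm (two_lstar DIM('a)) \<rho> * 0"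
    by (rule LIMSEQ_le_const[OF tendsto_add[OF tendsto_mult[OF tendsto_const c(5)] tendsto_mult[OF tendsto_const c(3)]]])
      (use b in auto)
  then show ?thesis by simp
qed

text \<open>The Sobolev inequality is available for differences of approximating test functions,
  whose gradients merge in L^2; in the limit the L^{2^*} norm of u - v vanishes. Continuity upgrades
  equality almost everywhere to equality, since a nonempty open set is not negligible.\<close>

lemma D12_eq_of_grad_eq:
  fixes u v :: "'a::euclidean_space \<Rightarrow> real"
  assumes N: "DIM('a) \<ge> 3" and u: "u \<in> D12" "v \<in> D12" and c: "continuous_on UNIV u" "continuous_on UNIV v"
    and g: "n2 (\<lambda>x. grad u x - grad v x) = 0"
  shows "u = v"
proof -
  let ?p = "two_star DIM('a)"
  have p: "?p > 1" using two_star_facts(1)[OF N] by simp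
  have Lpow: "(\<integral>x. \<bar>f x\<bar> powr ?p \<partial>lebesgue) = Lnorm ?p f powr ?p" for f :: "'a \<Rightarrow> real"
    using p by (simp add: Lnorm_def powr_powr integral_nonneg_AE)
  obtain a where a: "\<And>k. smooth_Cc (a k)" "\<And>k. in_Lp ?p (\<lambda>x. a k x - u x)"
    "(\<lambda>k. Lnorm ?p (\<lambda>x. a k x - u x)) \<longlonglongrightarrow> 0"
    "\<And>k. L2 (\<lambda>x. grad (a k) x - grad u x)" "(\<lambda>k. n2 (\<lambda>x. grad (a k) x - grad u x)) \<longlonglongrightarrow> 0"
    using D12_approx[OF u(1) N] by blast
  obtain b where b: "\<And>k. smooth_Cc (b k)" "\<And>k. in_Lp ?p (\<lambda>x. b k x - v x)"
    "(\<lambda>k. Lnorm ?p (\<lambda>x. b k x - v x)) \<longlonglongrightarrow> 0"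
    "\<And>k. L2 (\<lambda>x. grad (b k) x - grad v x)" "(\<lambda>k. n2 (\<lambda>x. grad (b k) x - grad v x)) \<longlonglongrightarrow> 0"
    using D12_approx[OF u(2) N] by blast
  define S where "S = sobconst TYPE('a)"
  have S: "S > 0" unfolding S_def by (rule sobconst[OF N])
  have ab: "Lnorm ?p (\<lambda>x. a k x - b k x) \<le> S * (n2 (\<lambda>x. grad (a k) x - grad u x) + n2 (\<lambda>x. grad (b k) x - grad v x))" for k
  proof -
    have L: "L2 (grad (a k))" "L2 (grad u)" "L2 (grad v)" "L2 (grad (b k))"
      using a b u by (auto intro: L2_grad D12_L2_grad)
    have "Lnorm ?p (\<lambda>x. a k x - b k x) \<le> S * n2 (grad (\<lambda>x. a k x - b k x))"
      unfolding S_def by (intro sobconst(2) N smooth_Cc_C1c smooth_Cc_diff a b)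
    also have "grad (\<lambda>x. a k x - b k x) = (\<lambda>x. grad (a k) x - grad (b k) x)"
      using grad_lincomb(2)[OF smooth_Cc_C1c[OF a(1)] smooth_Cc_C1c[OF b(1)]] by auto
    also have "n2 \<dots> \<le> n2 (\<lambda>x. grad (a k) x - grad u x) + n2 (\<lambda>x. grad (b k) x - grad v x)"
      using n2_diff_triangle[OF L(1) L(2) L(4)] n2_diff_triangle[OF L(2) L(3) L(4)] g n2_commute[of "grad v" "grad (b k)"]
      by linarith
    finally show ?thesis using S by simp
  qed
  have ab0: "(\<lambda>k. Lnorm ?p (\<lambda>x. a k x - b k x)) \<longlonglongrightarrow> 0"
  proof (rule tendsto_sandwich[OF _ _ tendsto_const])
    show "(\<lambda>k. S * (n2 (\<lambda>x. grad (a k) x - grad u x) + n2 (\<lambda>x. grad (b k) x - grad v x))) \<longlonglongrightarrow> 0"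
      using tendsto_mult[OF tendsto_const[of S] tendsto_add[OF a(5) b(5)]] by simp
  qed (intro always_eventually allI Lnorm_nonneg ab)+
  have Lab: "in_Lp ?p (\<lambda>x. a k x - b k x)" for k
    using p by (intro in_Lp_Cc Cc_diff C1c_Cc smooth_Cc_C1c a b) auto
  have Luv: "in_Lp ?p (\<lambda>x. u x - v x)" using p by (intro in_Lp_diff D12_in_Lp u) auto
  have bd: "(\<integral>x. \<bar>u x - v x\<bar> powr ?p \<partial>lebesgue) \<le> 2 powr ?p * (Lnorm ?p (\<lambda>x. a k x - u x) powr ?p
     + 2 powr ?p * (Lnorm ?p (\<lambda>x. a k x - b k x) powr ?p + Lnorm ?p (\<lambda>x. b k x - v x) powr ?p))" for k
  proof -
    have i: "integrable lebesgue (\<lambda>x. \<bar>u x - v x\<bar> powr ?p)" "integrable lebesgue (\<lambda>x. \<bar>a k x - u x\<bar> powr ?p)"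
      "integrable lebesgue (\<lambda>x. \<bar>a k x - b k x\<bar> powr ?p)" "integrable lebesgue (\<lambda>x. \<bar>b k x - v x\<bar> powr ?p)"
      using Luv a(2)[of k] b(2)[of k] Lab[of k] by (auto simp: in_Lp_def)
    have "(\<integral>x. \<bar>u x - v x\<bar> powr ?p \<partial>lebesgue) \<le> (\<integral>x. 2 powr ?p * (\<bar>a k x - u x\<bar> powr ?p
      + 2 powr ?p * (\<bar>a k x - b k x\<bar> powr ?p + \<bar>b k x - v x\<bar> powr ?p)) \<partial>lebesgue)"
    proof (rule integral_mono)
      fix x
      have "\<bar>u x - v x\<bar> powr ?p \<le> 2 powr ?p * (\<bar>u x - a k x\<bar> powr ?p + \<bar>a k x - v x\<bar> powr ?p)"
        using powr_add_le[of ?p "u x - a k x" "a k x - v x"] p by simp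
      moreover have "\<bar>a k x - v x\<bar> powr ?p \<le> 2 powr ?p * (\<bar>a k x - b k x\<bar> powr ?p + \<bar>b k x - v x\<bar> powr ?p)"
        using powr_add_le[of ?p "a k x - b k x" "b k x - v x"] p by simp
      ultimately show "\<bar>u x - v x\<bar> powr ?p \<le> 2 powr ?p * (\<bar>a k x - u x\<bar> powr ?p
          + 2 powr ?p * (\<bar>a k x - b k x\<bar> powr ?p + \<bar>b k x - v x\<bar> powr ?p))"
        unfolding abs_minus_commute[of "u x" "a k x"]
        by (rule order_trans[OF _ mult_left_mono[OF add_left_mono]]) auto
    qed (use i in auto)
    also have "\<dots> = 2 powr ?p * ((\<integral>x. \<bar>a k x - u x\<bar> powr ?p \<partial>lebesgue)
      + 2 powr ?p * ((\<integral>x. \<bar>a k x - b k x\<bar> powr ?p \<partial>lebesgue) + (\<integral>x. \<bar>b k x - v x\<bar> powr ?p \<partial>lebesgue)))"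
      using i by simp
    finally show ?thesis by (simp only: Lpow)
  qed
  have z: "(\<lambda>k. f k powr ?p) \<longlonglongrightarrow> 0" if "f \<longlonglongrightarrow> 0" "\<And>k. f k \<ge> 0" for f :: "nat \<Rightarrow> real"
  proof -
    have "(\<lambda>k. f k powr ?p) \<longlonglongrightarrow> 0 powr ?p" using that p by (intro tendsto_powr' tendsto_const) auto
    then show ?thesis by simp
  qed
  have "(\<integral>x. \<bar>u x - v x\<bar> powr ?p \<partial>lebesgue) \<le> 2 powr ?p * (0 + 2 powr ?p * (0 + 0))"
    by (rule LIMSEQ_le_const[OF tendsto_mult[OF tendsto_const tendsto_add[OF z[OF a(3)]
        tendsto_mult[OF tendsto_const tendsto_add[OF z[OF ab0] z[OF b(3)]]]]]])
      (use bd Lnorm_nonneg in auto)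
  moreover have "0 \<le> (\<integral>x. \<bar>u x - v x\<bar> powr ?p \<partial>lebesgue)" by (intro integral_nonneg_AE) auto
  ultimately have "(\<integral>x. \<bar>u x - v x\<bar> powr ?p \<partial>lebesgue) = 0" by simp
  then have "AE x in lebesgue. \<bar>u x - v x\<bar> powr ?p = 0"
    using integral_nonneg_eq_0_iff_AE[of lebesgue "\<lambda>x. \<bar>u x - v x\<bar> powr ?p"] Luv by (simp add: in_Lp_def)
  then have ae: "AE x in lebesgue. u x = v x" by eventually_elim auto
  have o: "open {x. u x \<noteq> v x}" by (intro open_Collect_neq c)
  have "{x. u x \<noteq> v x} \<in> null_sets lebesgue"
    using ae o by (subst (asm) AE_iff_null) auto
  then have "negligible {x. u x \<noteq> v x}" by (simp add: negligible_iff_null_sets)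
  then have "{x. u x \<noteq> v x} = {}" using open_not_negligible[OF o] by blast
  then show "u = v" by auto
qed

text \<open>With P and Q the two square roots, 2 P times the convexity gap equals (P - Q)^2 + |w -
  p|^2, and P \<le> 1. Only the base point p has to stay inside the unit ball: w may lie on the
  sphere, where the integrand is not differentiable, and competitors are allowed to reach
  it.\<close>

lemma sqrt_energy_convex:
  fixes p w :: "'a::real_inner"
  assumes "norm p < 1" "norm w \<le> 1"
  shows "(p \<bullet> w) / sqrt (1 - (norm p)\<^sup>2) - (p \<bullet> p) / sqrt (1 - (norm p)\<^sup>2) + (norm (w - p))\<^sup>2 / 2
    \<le> (1 - sqrt (1 - (norm w)\<^sup>2)) - (1 - sqrt (1 - (norm p)\<^sup>2))"
proof -
  define P Q where "P = sqrt (1 - (norm p)\<^sup>2)" and "Q = sqrt (1 - (norm w)\<^sup>2)"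
  have pw: "(norm p)\<^sup>2 < 1" "(norm w)\<^sup>2 \<le> 1" using assms by (auto simp: abs_square_less_1 abs_square_le_1)
  have P: "P > 0" "P \<le> 1" "P\<^sup>2 = 1 - p \<bullet> p" using pw by (auto simp: P_def power2_norm_eq_inner)
  have Q: "Q\<^sup>2 = 1 - w \<bullet> w" using pw by (simp add: Q_def power2_norm_eq_inner)
  have "2 * P * ((P - Q) - ((p \<bullet> w) / P - (p \<bullet> p) / P)) = (P - Q)\<^sup>2 + (norm (w - p))\<^sup>2"
  proof -
    have "2 * P * ((P - Q) - ((p \<bullet> w) / P - (p \<bullet> p) / P)) = 2 * P\<^sup>2 - 2 * P * Q - 2 * (p \<bullet> w) + 2 * (p \<bullet> p)"
      using P(1) by (simp add: field_simps power2_eq_square)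
    also have "\<dots> = (P - Q)\<^sup>2 + (norm (w - p))\<^sup>2"
      using P(3) Q unfolding power2_norm_eq_inner
      by (simp add: power2_diff inner_diff_left inner_diff_right inner_commute[of w p])
    finally show ?thesis .
  qed
  then have "(norm (w - p))\<^sup>2 \<le> 2 * P * ((P - Q) - ((p \<bullet> w) / P - (p \<bullet> p) / P))" by simp
  moreover have "0 \<le> (P - Q) - ((p \<bullet> w) / P - (p \<bullet> p) / P)"
  proof -
    have "0 \<le> 2 * P * ((P - Q) - ((p \<bullet> w) / P - (p \<bullet> p) / P))"
      using calculation zero_le_power2[of "norm (w - p)"] by linarith
    then show ?thesis using P(1) by (simp add: zero_le_mult_iff)
  qed
  then have "2 * P * ((P - Q) - ((p \<bullet> w) / P - (p \<bullet> p) / P)) \<le> 2 * ((P - Q) - ((p \<bullet> w) / P - (p \<bullet> p) / P))"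
    using P(2) by (intro mult_right_mono) auto
  ultimately show ?thesis by (simp add: P_def[symmetric] Q_def[symmetric])
qed

text \<open>A Bochner integral defaults to 0 on integrands that are not integrable, so energies can
  be compared only after this. The majorant |grad u|^2 comes from 1 - t \<le> sqrt(1 - t) on the
  unit interval.\<close>

lemma energy_integrable:
  fixes u :: "'a::euclidean_space \<Rightarrow> real"
  assumes "u \<in> Xsp"
  shows "integrable lebesgue (\<lambda>x. 1 - sqrt (1 - (norm (grad u x))\<^sup>2))"
proof (rule Bochner_Integration.integrable_bound)
  have L: "L2 (grad u)" and ae: "AE x in lebesgue. norm (grad u x) \<le> 1" using assms by (auto simp: Xsp_def intro: D12_L2_grad)
  show "integrable lebesgue (\<lambda>x. (norm (grad u x))\<^sup>2)" using L by (simp add: L2_def)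
  have m: "grad u \<in> borel_measurable lebesgue" using L by (simp add: L2_def)
  show "(\<lambda>x. 1 - sqrt (1 - (norm (grad u x))\<^sup>2)) \<in> borel_measurable lebesgue"
    using m by measurable
  show "AE x in lebesgue. norm (1 - sqrt (1 - (norm (grad u x))\<^sup>2)) \<le> norm ((norm (grad u x))\<^sup>2)"
    using ae
  proof eventually_elim
    case (elim x)
    define t where "t = (norm (grad u x))\<^sup>2"
    have t: "0 \<le> t" "t \<le> 1" using elim by (auto simp: t_def abs_square_le_1)
    have "(1 - t)\<^sup>2 \<le> 1 - t" using t by (simp add: power2_eq_square mult_left_le_one_le)
    then have "1 - t \<le> sqrt (1 - t)" by (rule real_le_rsqrt)
    moreover have "sqrt (1 - t) \<le> 1" using t by simp
    ultimately show ?case using t by (simp add: t_def[symmetric])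
  qed
qed

text \<open>Integrate \<open>sqrt_energy_convex\<close> with base point grad v. The weak equation,
  tested with u and with v, turns the linear terms into the two work terms, so the energy of u
  exceeds that of v by at least half the squared L^2 distance of the gradients. The bound 1/2 on
  grad v keeps the weight bounded and the pairings integrable.\<close>

lemma minimizer_unique:
  fixes \<rho> :: "'a::euclidean_space \<Rightarrow> real"
  assumes N: "DIM('a) \<ge> 3" and rho: "in_Lp (two_lstar DIM('a)) \<rho>" and v: "weak_solution \<rho> v"
    and b: "\<And>x. norm (grad v x) \<le> 1/2" and u: "is_minimizer \<rho> u"
  shows "u = v"
proof -
  have X: "u \<in> Xsp" "v \<in> Xsp" and E: "BI_energy \<rho> u \<le> BI_energy \<rho> v"
    using v u by (auto simp: weak_solution_def is_minimizer_def)
  then have D: "u \<in> D12" "v \<in> D12" and ae: "AE x in lebesgue. norm (grad u x) \<le> 1" by (auto simp: Xsp_def)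
  have Xc: "continuous_on UNIV w" if "w \<in> Xsp" for w :: "'a \<Rightarrow> real"
    using that unfolding Xsp_def by (auto intro: lipschitz_on_continuous_on)
  note L = D12_L2_grad[OF D(1)] D12_L2_grad[OF D(2)]
  let ?P = "\<lambda>x. sqrt (1 - (norm (grad v x))\<^sup>2)"
  have P: "(norm (grad v x))\<^sup>2 < 1" "1/2 \<le> ?P x" for x
  proof -
    have "(norm (grad v x))\<^sup>2 \<le> (1/2)\<^sup>2" using b by (intro power_mono) auto
    then show "(norm (grad v x))\<^sup>2 < 1" "1/2 \<le> ?P x"
      by (simp add: power2_eq_square, intro real_le_rsqrt) (simp add: power2_eq_square)
  qed
  have iP: "integrable lebesgue (\<lambda>x. (grad v x \<bullet> grad w x) / ?P x)" if w: "L2 (grad w)" for w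
  proof (rule Bochner_Integration.integrable_bound)
    show "integrable lebesgue (\<lambda>x. 2 * (grad v x \<bullet> grad w x))" using L2_integrable_inner[OF L(2) w] by simp
    have m: "grad v \<in> borel_measurable lebesgue" "grad w \<in> borel_measurable lebesgue" using L w by (auto simp: L2_def)
    show "(\<lambda>x. (grad v x \<bullet> grad w x) / ?P x) \<in> borel_measurable lebesgue" using m by measurable
    show "AE x in lebesgue. norm ((grad v x \<bullet> grad w x) / ?P x) \<le> norm (2 * (grad v x \<bullet> grad w x))"
    proof (rule AE_I2)
      fix x
      have "\<bar>grad v x \<bullet> grad w x\<bar> / ?P x \<le> \<bar>grad v x \<bullet> grad w x\<bar> / (1/2)"
      proof (rule divide_left_mono[OF P(2) abs_ge_zero])
        have "0 < ?P x" using P(2)[of x] by linarith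
        then show "0 < ?P x * (1 / 2)" by (rule mult_pos_pos) simp
      qed
      moreover have "\<bar>grad v x \<bullet> grad w x\<bar> / (1/2) = 2 * \<bar>grad v x \<bullet> grad w x\<bar>" by simp
      moreover have e: "\<bar>?P x\<bar> = ?P x" using P(2)[of x] by linarith
      ultimately show "norm ((grad v x \<bullet> grad w x) / ?P x) \<le> norm (2 * (grad v x \<bullet> grad w x))"
        unfolding real_norm_def abs_divide abs_mult e abs_numeral by (simp only:)
    qed
  qed
  have W: "(\<integral>x. (grad v x \<bullet> grad u x) / ?P x \<partial>lebesgue) = (\<integral>x. \<rho> x * u x \<partial>lebesgue)"
    "(\<integral>x. (grad v x \<bullet> grad v x) / ?P x \<partial>lebesgue) = (\<integral>x. \<rho> x * v x \<partial>lebesgue)"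
    using v X by (auto simp: weak_solution_def)
  have id: "integrable lebesgue (\<lambda>x. (norm (grad u x - grad v x))\<^sup>2)" using L2_diff[OF L] by (simp add: L2_def)
  have "(\<integral>x. (grad v x \<bullet> grad u x) / ?P x - (grad v x \<bullet> grad v x) / ?P x + (norm (grad u x - grad v x))\<^sup>2 / 2 \<partial>lebesgue)
    \<le> (\<integral>x. (1 - sqrt (1 - (norm (grad u x))\<^sup>2)) - (1 - ?P x) \<partial>lebesgue)"
  proof (rule integral_mono_AE)
    show "integrable lebesgue (\<lambda>x. (grad v x \<bullet> grad u x) / ?P x - (grad v x \<bullet> grad v x) / ?P x + (norm (grad u x - grad v x))\<^sup>2 / 2)"
      using iP[OF L(1)] iP[OF L(2)] id by simp
    show "integrable lebesgue (\<lambda>x. (1 - sqrt (1 - (norm (grad u x))\<^sup>2)) - (1 - ?P x))"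
      by (intro Bochner_Integration.integrable_diff energy_integrable X)
    show "AE x in lebesgue. (grad v x \<bullet> grad u x) / ?P x - (grad v x \<bullet> grad v x) / ?P x + (norm (grad u x - grad v x))\<^sup>2 / 2
      \<le> (1 - sqrt (1 - (norm (grad u x))\<^sup>2)) - (1 - ?P x)"
      using ae
    proof eventually_elim
      case (elim x)
      have "norm (grad v x) < 1" using b[of x] by linarith
      from sqrt_energy_convex[OF this elim] show ?case .
    qed
  qed
  then have "(\<integral>x. \<rho> x * u x \<partial>lebesgue) - (\<integral>x. \<rho> x * v x \<partial>lebesgue) + (n2 (\<lambda>x. grad u x - grad v x))\<^sup>2 / 2
    \<le> (\<integral>x. 1 - sqrt (1 - (norm (grad u x))\<^sup>2) \<partial>lebesgue) - (\<integral>x. 1 - ?P x \<partial>lebesgue)"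
    using iP[OF L(1)] iP[OF L(2)] id
    by (simp only: Bochner_Integration.integral_diff[OF energy_integrable[OF X(1)] energy_integrable[OF X(2)]]
        Bochner_Integration.integral_add Bochner_Integration.integral_diff Bochner_Integration.integrable_diff
        W n2_square integral_divide_zero integrable_divide_zero simp_thms if_True) 
  then have "(n2 (\<lambda>x. grad u x - grad v x))\<^sup>2 \<le> 0"
    using E unfolding BI_energy_def by linarith
  then have "n2 (\<lambda>x. grad u x - grad v x) = 0" by simp
  then show ?thesis by (rule D12_eq_of_grad_eq[OF N D Xc[OF X(1)] Xc[OF X(2)]])
qed

text \<open>A value of size e at a far point forces |v| \<ge> e/2 on the ball of radius e around it,
  by the Lipschitz constant 1/2. That ball then carries a fixed amount of the integral, which a
  small tail excludes.\<close>

lemma lipschitz_Lp_tendsto_0: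
  fixes v :: "'a::euclidean_space \<Rightarrow> real"
  assumes p: "p > 0" and v: "in_Lp p v" and lip: "\<And>x y. \<bar>v x - v y\<bar> \<le> 1/2 * norm (x - y)"
  shows "(v \<longlongrightarrow> 0) at_infinity"
proof -
  define I where "I n = (\<integral>y. indicator {y. real n \<le> norm y} y * \<bar>v y\<bar> powr p \<partial>lebesgue)" for n
  have m: "v \<in> borel_measurable lebesgue" and i: "integrable lebesgue (\<lambda>y. \<bar>v y\<bar> powr p)" using v by (auto simp: in_Lp_def)
  have cl: "{y::'a. c \<le> norm y} \<in> sets lebesgue" for c
  proof -
    have "closed {y::'a. c \<le> norm y}" by (intro closed_Collect_le continuous_intros)
    then show ?thesis by simp
  qed
  have iI: "integrable lebesgue (\<lambda>y. indicator {y. real n \<le> norm y} y * \<bar>v y\<bar> powr p)" for n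
    using integrable_real_mult_indicator[OF cl i] by (simp add: mult.commute)
  have I0: "I \<longlonglongrightarrow> 0"
  proof -
    have "I \<longlonglongrightarrow> integral\<^sup>L (lebesgue :: 'a measure) (\<lambda>y. 0)"
      unfolding I_def
    proof (rule integral_dominated_convergence[where w="\<lambda>y. \<bar>v y\<bar> powr p"])
      show "AE y in lebesgue. (\<lambda>n. indicator {y. real n \<le> norm y} y * \<bar>v y\<bar> powr p) \<longlonglongrightarrow> 0"
      proof (rule AE_I2)
        fix y :: 'a
        obtain n0 :: nat where "norm y < real n0" using reals_Archimedean2 by blast
        then have "\<forall>\<^sub>F n in sequentially. indicator {y. real n \<le> norm y} y * \<bar>v y\<bar> powr p = 0"
          unfolding eventually_sequentially by (intro exI[of _ n0]) (auto simp: indicator_def)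
        then show "(\<lambda>n. indicator {y. real n \<le> norm y} y * \<bar>v y\<bar> powr p) \<longlonglongrightarrow> 0" by (rule tendsto_eventually)
      qed
    qed (use i iI in \<open>auto simp: indicator_def intro: borel_measurable_integrable\<close>)
    then show ?thesis by simp
  qed
  show ?thesis
    unfolding tendsto_iff
  proof (intro allI impI)
    fix e :: real assume e: "e > 0"
    \<comment> \<open>The least contribution of one such ball to the tail integral: (e/2)^p times
      the volume of a ball of radius e.\<close>
    define c where "c = (e/2) powr p * (unit_ball_vol (real DIM('a)) * e ^ DIM('a))"
    have c: "c > 0" using e by (simp add: c_def unit_ball_vol_pos)
    have "\<forall>\<^sub>F n in sequentially. I n < c" by (rule order_tendstoD(2)[OF I0 c])
    then obtain n where n: "I n < c" unfolding eventually_sequentially by blast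
    have "\<bar>v x\<bar> < e" if x: "real n + e \<le> norm x" for x
    proof (rule ccontr)
      assume "\<not> \<bar>v x\<bar> < e"
      then have vx: "e \<le> \<bar>v x\<bar>" by simp
      have "c = (\<integral>y. (e/2) powr p * indicator (cball x e) y \<partial>lebesgue)"
        using e by (simp add: c_def content_cball)
      also have "\<dots> \<le> I n"
        unfolding I_def
      proof (rule integral_mono[OF integrable_indicator_cball iI])
        fix y
        show "(e/2) powr p * indicator (cball x e) y \<le> indicator {y. real n \<le> norm y} y * \<bar>v y\<bar> powr p"
        proof (cases "norm (x - y) \<le> e")
          case True
          then have "\<bar>v x - v y\<bar> \<le> e / 2" using lip[of x y] by linarith
          then have "e / 2 \<le> \<bar>v y\<bar>" using vx by linarith
          then have "(e/2) powr p \<le> \<bar>v y\<bar> powr p" using e p by (intro powr_mono2) auto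
          moreover have "real n \<le> norm y" using x True norm_triangle_ineq2[of x y] by linarith
          ultimately show ?thesis using True by (simp add: indicator_def dist_norm)
        qed (simp add: indicator_def dist_norm)
      qed
      finally show False using n by simp
    qed
    then show "\<forall>\<^sub>F x in at_infinity. dist (v x) 0 < e"
      unfolding eventually_at_infinity by (intro exI[of _ "real n + e"]) auto
  qed
qed

section \<open>From the fixed point to the minimizer\<close>

context small_problem
begin

lemma solution_exists:
  "\<exists>v G. weak_solution \<rho> v \<and> (\<forall>x. (v has_derivative (\<lambda>h. G x \<bullet> h)) (at x)) \<and>
     (\<forall>x. norm (G x) \<le> 1/2) \<and> (\<forall>x y. norm (G x - G y) \<le> R * norm (x - y) powr al)"
proof -
  obtain G \<phi> v where G: "good G" and s: "solves G G \<phi> v" using fixpoint_exists by blast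
  let ?p = "two_star DIM('a)"
  have p: "?p > 0" using two_star_facts(1)[OF dim] by simp
  note S = s[unfolded solves_def]
  have d: "(v has_derivative (\<lambda>h. G x \<bullet> h)) (at x)" for x using S by blast
  have gv: "grad v = G" using grad_unique[OF d] by auto
  have b: "norm (G x) \<le> 1/2" for x using good_sup[OF G, of x] r_half by linarith
  have LG: "L2 G" using G by (simp add: good_def)
  have sm: "smooth_Cc (\<phi> k)" for k using S by (simp add: approx_sol_def)
  have "in_Lp ?p v"
  proof -
    have 1: "in_Lp ?p (\<lambda>x. \<phi> 0 x - v x)"
      unfolding in_Lp_def using S lebesgue_cont[OF Cc_cont[OF C1c_Cc[OF smooth_Cc_C1c[OF sm]]], of 0]
      by (intro conjI borel_measurable_diff) auto
    have 2: "in_Lp ?p (\<phi> 0)" by (intro in_Lp_Cc C1c_Cc smooth_Cc_C1c sm p)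
    from in_Lp_diff[OF 2 1 p] show ?thesis by simp
  qed
  moreover have "(\<lambda>k. \<integral>x. (norm (grad (\<phi> k) x - G x))\<^sup>2 \<partial>lebesgue) \<longlonglongrightarrow> 0"
  proof -
    have "(\<lambda>k. (n2 (\<lambda>x. grad (\<phi> k) x - G x))\<^sup>2) \<longlonglongrightarrow> 0\<^sup>2" using S by (intro tendsto_power) blast
    then show ?thesis by (simp add: n2_square)
  qed
  ultimately have D: "v \<in> D12"
    unfolding D12_def mem_Collect_eq gv using LG S sm by (auto simp: L2_def intro!: exI[of _ \<phi>])
  have lip: "\<bar>v x - v y\<bar> \<le> 1/2 * norm (x - y)" for x y
    by (rule lipschitz_of_grad_bound[OF d b])
  have "(1/2)-lipschitz_on UNIV v" using lip by (intro lipschitz_onI) (auto simp: dist_norm)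
  moreover have "AE x in lebesgue. norm (grad v x) \<le> 1" unfolding gv
  proof (rule AE_I2)
    show "norm (G x) \<le> 1" for x using b[of x] by linarith
  qed
  ultimately have X: "v \<in> Xsp" using D unfolding Xsp_def by blast
  \<comment> \<open>P is the full flux G / sqrt(1 - |G|^2), so the fixed point equation, with the
    excess moved back to the left, is the weak form of the original equation for test
    functions.\<close>
  define P where "P x = G x + excess (G x)" for x
  note Lex = good_excess(1)[OF G]
  have LP: "L2 P" unfolding P_def[abs_def] by (intro L2_add LG Lex)
  have "ip P (grad \<psi>) = (\<integral>x. \<rho> x * \<psi> x \<partial>lebesgue)" if psi: "smooth_Cc \<psi>" for \<psi>
  proof -
    note Lp = L2_grad[OF psi]
    have eP: "ip P (grad \<psi>) = ip G (grad \<psi>) + ip (\<lambda>x. excess (G x)) (grad \<psi>)"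
      unfolding P_def[abs_def] by (rule ip_add_left[OF LG Lex Lp])
    have "\<bar>ip P (grad \<psi>) - (\<integral>x. \<rho> x * \<psi> x \<partial>lebesgue)\<bar> \<le> n2 (grad \<psi>) * (1 / (real k + 1)) + n2 (\<lambda>x. grad (\<phi> k) x - G x) * n2 (grad \<psi>)" for k
    proof -
      have "\<bar>ip (grad (\<phi> k)) (grad \<psi>) + ip (\<lambda>x. excess (G x)) (grad \<psi>) - (\<integral>x. \<rho> x * \<psi> x \<partial>lebesgue)\<bar> \<le> n2 (grad \<psi>) / (real k + 1)"
        using S psi by (auto simp: approx_sol_def)
      moreover have "ip (\<lambda>x. grad (\<phi> k) x - G x) (grad \<psi>) = ip (grad (\<phi> k)) (grad \<psi>) - ip G (grad \<psi>)"
        by (rule ip_diff_left[OF L2_grad[OF sm] LG Lp])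
      moreover have "\<bar>ip (\<lambda>x. grad (\<phi> k) x - G x) (grad \<psi>)\<bar> \<le> n2 (\<lambda>x. grad (\<phi> k) x - G x) * n2 (grad \<psi>)"
        using S by (intro ip_bound Lp) blast
      ultimately show ?thesis unfolding eP by simp
    qed
    then have "\<bar>ip P (grad \<psi>) - (\<integral>x. \<rho> x * \<psi> x \<partial>lebesgue)\<bar> \<le> n2 (grad \<psi>) * 0 + 0 * n2 (grad \<psi>)"
      using S by (intro LIMSEQ_le_const[OF tendsto_add[OF tendsto_mult[OF tendsto_const one_over_Suc_tendsto] tendsto_mult[OF _ tendsto_const]]]) auto
    then show ?thesis by simp
  qed
  note W = weak_equation_extend[OF dim rho_l LP this]
  have "weak_solution \<rho> v"
    unfolding weak_solution_def
  proof (intro conjI X ballI)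
    fix \<psi> :: "'a \<Rightarrow> real" assume "\<psi> \<in> Xsp"
    then have "ip P (grad \<psi>) = (\<integral>x. \<rho> x * \<psi> x \<partial>lebesgue)" using W by (simp add: Xsp_def)
    moreover have "P x \<bullet> grad \<psi> x = (grad v x \<bullet> grad \<psi> x) / sqrt (1 - (norm (grad v x))\<^sup>2)" for x
      by (simp add: P_def excess_def gv algebra_simps)
    ultimately show "(\<integral>x. (grad v x \<bullet> grad \<psi> x) / sqrt (1 - (norm (grad v x))\<^sup>2) \<partial>lebesgue) = (\<integral>x. \<rho> x * \<psi> x \<partial>lebesgue)"
      by (simp add: ip_def)
  qed
  moreover have "\<forall>x y. norm (G x - G y) \<le> R * norm (x - y) powr al" using G by (simp add: good_def)
  ultimately show ?thesis using d b by blast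
qed

lemma minimizer_regular:
  assumes "is_minimizer \<rho> u"
  shows "weak_solution \<rho> u \<and> (u \<longlongrightarrow> 0) at_infinity \<and> strictly_spacelike u \<and> C1alpha_loc al u"
proof -
  obtain v G where v: "weak_solution \<rho> v" "\<And>x. (v has_derivative (\<lambda>h. G x \<bullet> h)) (at x)"
    "\<And>x. norm (G x) \<le> 1/2" "\<And>x y. norm (G x - G y) \<le> R * norm (x - y) powr al"
    using solution_exists by blast
  have gv: "grad v = G" using grad_unique[OF v(2)] by auto
  have u: "u = v" by (rule minimizer_unique[OF dim rho_l v(1) _ assms]) (simp only: gv, rule v(3))
  have lip: "\<bar>v x - v y\<bar> \<le> 1/2 * norm (x - y)" for x y
    by (rule lipschitz_of_grad_bound[OF v(2,3)])
  have "v \<in> D12" using v(1) by (auto simp: weak_solution_def Xsp_def)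
  then have "(v \<longlongrightarrow> 0) at_infinity"
    using two_star_facts(1)[OF dim] lip by (intro lipschitz_Lp_tendsto_0[of "two_star DIM('a)"] D12_in_Lp) auto
  moreover have C1: "Ck 1 v"
  proof -
    have "continuous_on UNIV G" by (rule hoelder_continuous[OF al(1) v(4)])
    then have "Ck (Suc 0) v" by (intro Ck_SucI[OF v(2)]) (simp add: continuous_intros)
    then show ?thesis by (simp only: One_nat_def)
  qed
  moreover have "strictly_spacelike v"
    unfolding strictly_spacelike_def
  proof (intro conjI C1 allI impI)
    show "\<bar>v x - v y\<bar> < dist x y" if "x \<noteq> y" for x y
    proof -
      have "norm (x - y) > 0" using that by simp
      then show ?thesis using lip[of x y] unfolding dist_norm by linarith
    qed
    show "norm (grad v x) < 1" for x using v(3)[of x] by (simp add: gv)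
  qed
  moreover have "C1alpha_loc al v"
    unfolding C1alpha_loc_def gv using C1 v(4) by (auto simp: dist_norm simp del: Ck.simps)
  ultimately show ?thesis using v(1) u by simp
qed

end

theorem theorem1p6:
  fixes q m :: real
  assumes "DIM('a::euclidean_space) \<ge> 3"
    and "q > 2 * DIM('a)"
    and "1 \<le> m" and "m \<le> two_lstar DIM('a)"
  shows "\<exists>c>0. \<forall>\<rho>::'a \<Rightarrow> real.
           in_Lp q \<rho> \<and> in_Lp m \<rho> \<and> Lnorm q \<rho> + Lnorm m \<rho> \<le> c \<longrightarrow>
           (\<forall>u. is_minimizer \<rho> u \<longrightarrow>
              weak_solution \<rho> u \<and> (u \<longlongrightarrow> 0) at_infinity \<and>
              strictly_spacelike u \<and> (\<exists>\<alpha>. 0 < \<alpha> \<and> \<alpha> < 1 \<and> C1alpha_loc \<alpha> u))"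
proof -
  have N: "real DIM('a) \<ge> 3" using assms(1) by simp
  have qN: "q > DIM('a)" using assms(2) N by linarith
  define C where "C = regconst TYPE('a) q"
  have C: "C \<ge> 0" unfolding C_def by (rule regconst_nonneg[OF qN])
  define S where "S = sobconst TYPE('a)"
  have S: "S > 0" unfolding S_def by (rule sobconst[OF assms(1)])
  \<comment> \<open>The ratio r / R prescribed by \<open>small_problem\<close>: r is chosen for the
    contraction and R is then r / a.\<close>
  define a where "a = real DIM('a) * (1 + kconst TYPE('a) * vol2 TYPE('a) 2 / mass TYPE('a))"
  have a: "a > 0" unfolding a_def
    using N kconst(1)[where 'a='a] mass_pos[where 'a='a] by (intro mult_pos_pos add_pos_nonneg) (auto simp: vol2_def)
  \<comment> \<open>r \<le> 1/2 gives r^2 \<le> r, so the second entry yields 3 C r^2 \<le> C / (2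
    (C + 1)) \<le> 1/2. Adding 1 to C covers the case C = 0.\<close>
  define r where "r = min (1/2) (1 / (6 * (C + 1)))"
  have r: "r > 0" "r \<le> 1/2" "C * (3 * r\<^sup>2) \<le> 1/2"
  proof -
    show r: "r > 0" "r \<le> 1/2" using C by (auto simp: r_def)
    have "r\<^sup>2 \<le> r" using r by (simp add: power2_eq_square mult_left_le_one_le)
    also have "\<dots> \<le> 1 / (6 * (C + 1))" by (simp add: r_def)
    finally have "C * (3 * r\<^sup>2) \<le> C * (3 * (1 / (6 * (C + 1))))" using C by (intro mult_left_mono) auto
    also have "\<dots> \<le> 1/2" using C by (simp add: field_simps)
    finally show "C * (3 * r\<^sup>2) \<le> 1/2" .
  qed
  define R where "R = r / a"
  have R: "R > 0" using r a by (simp add: R_def)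
  define l where "l = two_lstar DIM('a)"
  have l: "l > 1" "l < 2" using two_lstar_facts[OF assms(1)] by (auto simp: l_def)
  \<comment> \<open>The entries serve in turn: c \<le> 1 lets norms bound integrals of powers; C c
    \<le> R/2 is the Hoelder condition; and 2 c bounds the integrals of |\<rho>|^m and |\<rho>|^q
    together, which dominate that of |\<rho>|^l, so the last entry gives
    \<open>S * Lnorm l \<rho> \<le> R / 4\<close>.\<close>
  define c where "c = min 1 (min (R / (2 * (C + 1))) ((R / (4 * S)) powr l / 2))"
  have c: "c > 0" "c \<le> 1" "C * c \<le> R / 2" "2 * c \<le> (R / (4 * S)) powr l"
  proof -
    show "c > 0" "c \<le> 1" using R C S by (auto simp: c_def)
    have "C * c \<le> C * (R / (2 * (C + 1)))" using C by (intro mult_left_mono) (auto simp: c_def)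
    also have "\<dots> \<le> R / 2" using C R by (simp add: field_simps)
    finally show "C * c \<le> R / 2" .
    show "2 * c \<le> (R / (4 * S)) powr l" by (simp add: c_def)
  qed
  show ?thesis
  proof (rule exI[of _ c], rule conjI[OF c(1)], intro allI impI)
    fix \<rho> u :: "'a \<Rightarrow> real"
    assume h: "in_Lp q \<rho> \<and> in_Lp m \<rho> \<and> Lnorm q \<rho> + Lnorm m \<rho> \<le> c" and u: "is_minimizer \<rho> u"
    have n: "Lnorm q \<rho> \<le> c" "Lnorm m \<rho> \<le> c" using h Lnorm_nonneg[of q \<rho>] Lnorm_nonneg[of m \<rho>] by linarith+
    have ml: "m \<le> l" "l \<le> q" "m > 0" "q \<ge> 1" using assms l N by (auto simp: l_def)
    have Ll: "in_Lp l \<rho>" by (rule in_Lp_interpolate(1)[OF _ _ ml(1-3)]) (use h in auto)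
    have "(\<integral>x. \<bar>\<rho> x\<bar> powr l \<partial>lebesgue) \<le> (\<integral>x. \<bar>\<rho> x\<bar> powr m \<partial>lebesgue) + (\<integral>x. \<bar>\<rho> x\<bar> powr q \<partial>lebesgue)"
      by (rule in_Lp_interpolate(2)[OF _ _ ml(1-3)]) (use h in auto)
    also have "\<dots> \<le> c + c"
      using integral_powr_le_of_Lnorm[OF n(1) c(2) ml(4)] integral_powr_le_of_Lnorm[OF n(2) c(2) assms(3)] by linarith
    finally have "(\<integral>x. \<bar>\<rho> x\<bar> powr l \<partial>lebesgue) \<le> (R / (4 * S)) powr l" using c(4) by linarith
    then have "Lnorm l \<rho> \<le> ((R / (4 * S)) powr l) powr (1 / l)"
      unfolding Lnorm_def using l by (intro powr_mono2) (auto intro!: integral_nonneg_AE)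
    also have "\<dots> = R / (4 * S)" using R S l by (simp add: powr_powr)
    finally have sl: "S * Lnorm l \<rho> \<le> R / 4" using S by (simp add: field_simps)
    have "C * Lnorm q \<rho> \<le> C * c" using C n by (intro mult_left_mono)
    then have sq: "C * Lnorm q \<rho> \<le> R / 2" using c(3) by linarith
    have rR: "r = real DIM('a) * (R + kconst TYPE('a) * vol2 TYPE('a) 2 / mass TYPE('a) * R)"
    proof -
      have "r = a * R" using a by (simp add: R_def)
      then show ?thesis by (simp add: a_def algebra_simps)
    qed
    interpret small_problem \<rho> q R r "1 - DIM('a) / q"
      using assms(1) qN h Ll R rR r sq sl by unfold_locales (auto simp: l_def C_def S_def)
    show "weak_solution \<rho> u \<and> (u \<longlongrightarrow> 0) at_infinity \<and> strictly_spacelike u \<and> (\<exists>\<alpha>. 0 < \<alpha> \<and> \<alpha> < 1 \<and> C1alpha_loc \<alpha> u)"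
      using minimizer_regular[OF u] al by blast
  qed
qed

end
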